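(* Let $s_0>\tfrac12$, let $p\ge 1$ be an integer, and let $\beta$ be a kernel satisfying the standing assumption $0\le\widehat\beta(\xi)\le C$ for all $\xi\in\mathbb{R}$. Let $D>3$, $P>P_{\min}$ where $$P_{\min}=3+\frac{D}{D-3}\big(\sqrt3+\sqrt{2D}\big)^2,$$ and let $s\ge s_0+3$. Let $(\mathbf{u}_0^\epsilon)=(u_0^\epsilon,v_0^\epsilon)$ be a family, indexed by the small parameter $\epsilon>0$, that is bounded in $X^{s+P}$. Then there exist some $\epsilon_0>0$, $T>0$ and a unique family $(\mathbf{u}^\epsilon)_{0<\epsilon<\epsilon_0}$, $\mathbf{u}^\epsilon=(u^\epsilon,v^\epsilon)$, bounded in $C\big([0,\tfrac{T}{\epsilon^p}];X^{s+D}\big)$ and such that for each $\epsilon\in(0,\epsilon_0)$ the pair $(u,v)=(u^\epsilon,v^\epsilon)$ satisfies $$u_t=Kv_x,\qquad v_t=Ku_x+\epsilon^pK\big(u^{p+1}\big)_x,\qquad x\in\mathbb{R},\ t\in[0,\tfrac{T}{\epsilon^p}],$$ with initial values $u(x,0)=u_0^\epsilon(x)$, $v(x,0)=v_0^\epsilon(x)$.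
   Context: $H^s=H^s(\mathbb{R})$ is the $L^2$-based Sobolev space with norm $\|u\|_{H^s}=\big(\int_{\mathbb{R}}(1+\xi^2)^s|\widehat u(\xi)|^2d\xi\big)^{1/2}$, where $\widehat u(\xi)=\int_{\mathbb{R}}u(x)e^{-i\xi x}dx$; functions are real-valued. $X^s=H^s\times H^s$ with norm $\|(u,v)\|_{X^s}=\|u\|_{H^s}+\|v\|_{H^s}$. Standing assumption on the kernel: $\beta$ is an integrable function on $\mathbb{R}$ (or more generally a finite measure on $\mathbb{R}$) whose Fourier transform satisfies $0\le\widehat\beta(\xi)\le C$ for some constant $C$. The operator $K$ is the Fourier multiplier $Kw=\mathcal{F}^{-1}\big(\sqrt{\widehat\beta(\xi)}\,\widehat w(\xi)\big)$, so that $K^2w=\beta*w$; it is bounded on every $H^s$. A family $(\mathbf{u}_0^\epsilon)$ is bounded in $X^{s+P}$ if $\sup_\epsilon\|\mathbf{u}_0^\epsilon\|_{X^{s+P}}<\infty$ (the index $\epsilon$ ranging over some interval of positive numbers with left endpoint $0$). A family $(\mathbf{u}^\epsilon)_{0<\epsilon<\epsilon_0}$ is bounded in $C([0,T/\epsilon^p];X^{s+D})$ if $\mathbf{u}^\epsilon$ lies in this space for every $\epsilon$ and $\sup_{0<\epsilon<\epsilon_0}\sup_{t\in[0,T/\epsilon^p]}\|\mathbf{u}^\epsilon(t)\|_{X^{s+D}}<\infty$. The time $T$ does not depend on $\epsilon$. *)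

theory Defs
  imports "HOL-Probability.Probability"
begin

section \<open>Fourier transform\<close>

text \<open>Convention: \<open>\<int> f(x) e\<^sup>-\<^sup>i\<^sup>\<xi>\<^sup>x dx\<close>, without normalising factor.\<close>

definition fourier :: "(real \<Rightarrow> complex) \<Rightarrow> real \<Rightarrow> complex" where
  "fourier f \<xi> = (CLINT x|lborel. f x * iexp (- (\<xi> * x)))"

text \<open>
  Square integrable functions are kept as functions, not as classes modulo null sets; everything
  below depends only on the classes.
\<close>

definition square_integrable :: "(real \<Rightarrow> 'a::{real_normed_vector, second_countable_topology}) \<Rightarrow> bool" where
  "square_integrable f \<longleftrightarrow>
     f \<in> borel_measurable lborel \<and> integrable lborel (\<lambda>x. (norm (f x))\<^sup>2)"

text \<open>
  Plancherel's extension to \<open>L\<^sup>2\<close>: the transform of \<open>f\<close> is the \<open>L\<^sup>2\<close> limit, as \<open>R \<rightarrow> \<infinity>\<close>, of the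
  transforms of the truncations of \<open>f\<close> to \<open>[-R, R]\<close>. The choice operators below pick
  representatives of classes that exist and are unique modulo null sets.
\<close>

definition is_fourier_L2 :: "(real \<Rightarrow> complex) \<Rightarrow> (real \<Rightarrow> complex) \<Rightarrow> bool" where
  "is_fourier_L2 f F \<longleftrightarrow> square_integrable f \<and> square_integrable F \<and>
     ((\<lambda>R. \<integral>\<^sup>+\<xi>. ennreal ((norm (F \<xi> - fourier (\<lambda>x. indicator {-R..R} x * f x) \<xi>))\<^sup>2) \<partial>lborel)
        \<longlongrightarrow> 0) at_top"

definition fourier_L2 :: "(real \<Rightarrow> complex) \<Rightarrow> real \<Rightarrow> complex" where
  "fourier_L2 f = (SOME F. is_fourier_L2 f F)"

definition inv_fourier_L2 :: "(real \<Rightarrow> complex) \<Rightarrow> real \<Rightarrow> complex" where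
  "inv_fourier_L2 F = (SOME f. is_fourier_L2 f F)"

abbreviation fourier_real :: "(real \<Rightarrow> real) \<Rightarrow> real \<Rightarrow> complex" where
  "fourier_real u \<equiv> fourier_L2 (\<lambda>x. complex_of_real (u x))"

section \<open>Sobolev spaces\<close>

text \<open>
  Only for \<open>s \<ge> 0\<close>, where \<open>H\<^sup>s\<close> is contained in \<open>L\<^sup>2\<close>.
\<close>

definition sobolev :: "real \<Rightarrow> (real \<Rightarrow> real) set" where
  "sobolev s = {u. square_integrable u \<and>
     integrable lborel (\<lambda>\<xi>. (1 + \<xi>\<^sup>2) powr s * (norm (fourier_real u \<xi>))\<^sup>2)}"

definition sobolev_norm :: "real \<Rightarrow> (real \<Rightarrow> real) \<Rightarrow> real" where
  "sobolev_norm s u = sqrt (LINT \<xi>|lborel. (1 + \<xi>\<^sup>2) powr s * (norm (fourier_real u \<xi>))\<^sup>2)"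

type_synonym state = "(real \<Rightarrow> real) \<times> (real \<Rightarrow> real)"

definition X_space :: "real \<Rightarrow> state set" where
  "X_space s = sobolev s \<times> sobolev s"

definition X_norm :: "real \<Rightarrow> state \<Rightarrow> real" where
  "X_norm s w = sobolev_norm s (fst w) + sobolev_norm s (snd w)"

text \<open>Equality of elements of \<open>X\<^sup>s\<close>, that is, equality of classes modulo null sets.\<close>

definition state_eq :: "state \<Rightarrow> state \<Rightarrow> bool" where
  "state_eq w z \<longleftrightarrow> (AE x in lborel. fst w x = fst z x \<and> snd w x = snd z x)"

definition state_diff :: "state \<Rightarrow> state \<Rightarrow> state" where
  "state_diff w z = (\<lambda>x. fst w x - fst z x, \<lambda>x. snd w x - snd z x)"

definition X_continuous_on :: "real \<Rightarrow> real set \<Rightarrow> (real \<Rightarrow> state) \<Rightarrow> bool" where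
  "X_continuous_on s S U \<longleftrightarrow> (\<forall>t\<in>S. U t \<in> X_space s) \<and>
     (\<forall>t\<in>S. ((\<lambda>\<tau>. X_norm s (state_diff (U \<tau>) (U t))) \<longlongrightarrow> 0) (at t within S))"

section \<open>Derivatives\<close>

text \<open>
  Weak derivative in \<open>L\<^sup>2\<close>, tested against continuously differentiable functions with compact
  support.
\<close>

definition is_weak_deriv :: "(real \<Rightarrow> real) \<Rightarrow> (real \<Rightarrow> real) \<Rightarrow> bool" where
  "is_weak_deriv f g \<longleftrightarrow> square_integrable f \<and> square_integrable g \<and>
     (\<forall>\<phi> \<phi>'. (\<forall>x. (\<phi> has_real_derivative \<phi>' x) (at x)) \<and> continuous_on UNIV \<phi>' \<and>
             (\<exists>R. \<forall>x. \<bar>x\<bar> > R \<longrightarrow> \<phi> x = 0) \<longrightarrow>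
        (LINT x|lborel. f x * \<phi>' x) = - (LINT x|lborel. g x * \<phi> x))"

definition weak_deriv :: "(real \<Rightarrow> real) \<Rightarrow> real \<Rightarrow> real" where
  "weak_deriv f = (SOME g. is_weak_deriv f g)"

text \<open>Derivative in time of a curve in \<open>H\<^sup>r\<close>: the difference quotients converge in \<open>H\<^sup>r\<close>.\<close>

definition has_sobolev_derivative ::
    "real \<Rightarrow> (real \<Rightarrow> real \<Rightarrow> real) \<Rightarrow> (real \<Rightarrow> real) \<Rightarrow> real \<Rightarrow> real set \<Rightarrow> bool" where
  "has_sobolev_derivative r u f t S \<longleftrightarrow> (\<forall>\<tau>\<in>S. u \<tau> \<in> sobolev r) \<and> f \<in> sobolev r \<and>
     ((\<lambda>\<tau>. sobolev_norm r (\<lambda>x. (u \<tau> x - u t x) / (\<tau> - t) - f x)) \<longlongrightarrow> 0) (at t within S)"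

section \<open>The kernel and the operator \<open>K\<close>\<close>

text \<open>
  A finite real (signed) measure \<open>\<beta>\<close> is given as a difference \<open>\<mu> - \<nu>\<close> of finite Borel measures
  (Jordan decomposition). Note that \<open>char \<mu> \<xi>\<close> is \<open>\<int> e\<^sup>i\<^sup>\<xi>\<^sup>x d\<mu>\<close>, whence the change of sign.
\<close>

definition kernel_fourier :: "real measure \<Rightarrow> real measure \<Rightarrow> real \<Rightarrow> complex" where
  "kernel_fourier \<mu> \<nu> \<xi> = char \<mu> (- \<xi>) - char \<nu> (- \<xi>)"

text \<open>Integrable kernels are the case where \<open>\<mu>\<close> and \<open>\<nu>\<close> have densities \<open>\<beta>\<^sup>+\<close> and \<open>\<beta>\<^sup>-\<close>.\<close>

lemma integrable_kernel:
  fixes \<beta> :: "real \<Rightarrow> real"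
  assumes "integrable lborel \<beta>"
  defines "\<mu> \<equiv> density lborel (\<lambda>x. ennreal (max 0 (\<beta> x)))"
    and "\<nu> \<equiv> density lborel (\<lambda>x. ennreal (max 0 (- \<beta> x)))"
  shows "finite_borel_measure \<mu>" "finite_borel_measure \<nu>"
    and "kernel_fourier \<mu> \<nu> \<xi> = fourier (\<lambda>x. complex_of_real (\<beta> x)) \<xi>"
proof -
  have [measurable]: "\<beta> \<in> borel_measurable borel"
    using borel_measurable_integrable[OF assms(1)] by simp
  have fin: "finite_borel_measure (density lborel (\<lambda>x. ennreal (max 0 (g x))))"
    if g: "integrable lborel g" for g :: "real \<Rightarrow> real"
  proof -
    have [measurable]: "g \<in> borel_measurable borel"
      using borel_measurable_integrable[OF g] by simp
    have "integrable lborel (\<lambda>x. max 0 (g x))" using g by simp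
    then have "(\<integral>\<^sup>+x. ennreal (max 0 (g x)) \<partial>lborel) < \<infinity>"
      by (subst nn_integral_eq_integral) auto
    then show ?thesis
      by (auto simp: emeasure_density intro!: finite_borel_measure.intro finite_measureI
          finite_borel_measure_axioms.intro)
  qed
  show "finite_borel_measure \<mu>" "finite_borel_measure \<nu>"
    unfolding \<mu>_def \<nu>_def using fin[of \<beta>] fin[of "\<lambda>x. - \<beta> x"] assms(1) by auto
  have int: "integrable lborel (\<lambda>x. max 0 (g x) *\<^sub>R iexp (- \<xi> * x))"
    if g: "integrable lborel g" for g :: "real \<Rightarrow> real"
  proof (rule Bochner_Integration.integrable_bound[OF g])
    have [measurable]: "g \<in> borel_measurable borel"
      using borel_measurable_integrable[OF g] by simp
    show "(\<lambda>x. max 0 (g x) *\<^sub>R iexp (- \<xi> * x)) \<in> borel_measurable lborel" by measurable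
    have "norm (iexp (- \<xi> * x)) = 1" for x by (rule norm_exp_i_times)
    then show "AE x in lborel. norm (max 0 (g x) *\<^sub>R iexp (- \<xi> * x)) \<le> norm (g x)"
      by (simp only: norm_scaleR) auto
  qed
  have "kernel_fourier \<mu> \<nu> \<xi> =
      (CLINT x|lborel. max 0 (\<beta> x) *\<^sub>R iexp (- \<xi> * x)) -
      (CLINT x|lborel. max 0 (- \<beta> x) *\<^sub>R iexp (- \<xi> * x))"
    unfolding kernel_fourier_def char_def \<mu>_def \<nu>_def
    by (subst (1 2) integral_density) auto
  also have "\<dots> = (CLINT x|lborel. max 0 (\<beta> x) *\<^sub>R iexp (- \<xi> * x) - max 0 (- \<beta> x) *\<^sub>R iexp (- \<xi> * x))"
    using int[of \<beta>] int[of "\<lambda>x. - \<beta> x"] assms(1)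
    by (intro Bochner_Integration.integral_diff[symmetric]) auto
  also have "\<dots> = fourier (\<lambda>x. complex_of_real (\<beta> x)) \<xi>"
    unfolding fourier_def
    by (intro Bochner_Integration.integral_cong) (auto simp: max_def scaleR_conv_of_real)
  finally show "kernel_fourier \<mu> \<nu> \<xi> = fourier (\<lambda>x. complex_of_real (\<beta> x)) \<xi>" .
qed

definition nonneg_bounded_symbol :: "(real \<Rightarrow> complex) \<Rightarrow> real \<Rightarrow> bool" where
  "nonneg_bounded_symbol b C \<longleftrightarrow> (\<forall>\<xi>. b \<xi> \<in> \<real> \<and> 0 \<le> Re (b \<xi>) \<and> Re (b \<xi>) \<le> C)"

text \<open>
  The first argument is \<open>b = \<beta>\<close>-hat. As \<open>\<beta>\<close> is real and \<open>b\<close> is real valued, \<open>b\<close> is even, so the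
  inverse transform is already real almost everywhere for real \<open>w\<close>; \<open>Re\<close> only changes the type.
\<close>

definition K_op :: "(real \<Rightarrow> complex) \<Rightarrow> (real \<Rightarrow> real) \<Rightarrow> real \<Rightarrow> real" where
  "K_op b w = (\<lambda>x. Re (inv_fourier_L2 (\<lambda>\<xi>. complex_of_real (sqrt (Re (b \<xi>))) * fourier_real w \<xi>) x))"

section \<open>The Cauchy problem\<close>

text \<open>
  For \<open>U\<close> continuous with values in \<open>X\<^sup>r\<close>, \<open>r \<ge> 1\<close>, both right hand sides are curves in
  \<open>H\<^sup>r\<^sup>-\<^sup>1\<close>, which is where the time derivatives are taken (one-sided at the end points).
\<close>

definition solves_system ::
    "(real \<Rightarrow> complex) \<Rightarrow> nat \<Rightarrow> real \<Rightarrow> real \<Rightarrow> real set \<Rightarrow> (real \<Rightarrow> state) \<Rightarrow> bool" where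
  "solves_system b p \<epsilon> r S U \<longleftrightarrow>
     (let u = (\<lambda>t. fst (U t)); v = (\<lambda>t. snd (U t)); K = K_op b in
      \<forall>t\<in>S.
        has_sobolev_derivative (r - 1) u (K (weak_deriv (v t))) t S \<and>
        has_sobolev_derivative (r - 1) v
          (\<lambda>x. K (weak_deriv (u t)) x + \<epsilon> ^ p * K (weak_deriv (\<lambda>y. u t y ^ (p + 1))) x) t S)"

definition bounded_data_family :: "real \<Rightarrow> real \<Rightarrow> (real \<Rightarrow> state) \<Rightarrow> bool" where
  "bounded_data_family r E U0 \<longleftrightarrow>
     (\<exists>M. \<forall>\<epsilon>\<in>{0<..<E}. U0 \<epsilon> \<in> X_space r \<and> X_norm r (U0 \<epsilon>) \<le> M)"

definition bounded_curve_family ::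
    "real \<Rightarrow> nat \<Rightarrow> real \<Rightarrow> real \<Rightarrow> (real \<Rightarrow> real \<Rightarrow> state) \<Rightarrow> bool" where
  "bounded_curve_family r p \<epsilon>\<^sub>0 T U \<longleftrightarrow>
     (\<forall>\<epsilon>\<in>{0<..<\<epsilon>\<^sub>0}. X_continuous_on r {0..T / \<epsilon> ^ p} (U \<epsilon>)) \<and>
     (\<exists>M. \<forall>\<epsilon>\<in>{0<..<\<epsilon>\<^sub>0}. \<forall>t\<in>{0..T / \<epsilon> ^ p}. X_norm r (U \<epsilon> t) \<le> M)"

definition solution_family ::
    "(real \<Rightarrow> complex) \<Rightarrow> nat \<Rightarrow> real \<Rightarrow> (real \<Rightarrow> state) \<Rightarrow> real \<Rightarrow> real \<Rightarrow> (real \<Rightarrow> real \<Rightarrow> state) \<Rightarrow> bool" where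
  "solution_family b p r U0 \<epsilon>\<^sub>0 T U \<longleftrightarrow>
     bounded_curve_family r p \<epsilon>\<^sub>0 T U \<and>
     (\<forall>\<epsilon>\<in>{0<..<\<epsilon>\<^sub>0}. solves_system b p \<epsilon> r {0..T / \<epsilon> ^ p} (U \<epsilon>) \<and> state_eq (U \<epsilon> 0) (U0 \<epsilon>))"

end

theory Submission
  imports Defs
begin

text \<open>
  The system is symmetrizable, so no derivatives are lost. Put \<open>c = \<epsilon>\<^sup>p\<close>. The operator \<open>K \<partial>\<^sub>x\<close> is skew
  adjoint, hence for a system \<open>d\<^sub>t = K e\<^sub>x\<close>, \<open>e\<^sub>t = K (d + c q d)\<^sub>x\<close> the energy
  \<open>\<parallel>d\<parallel>\<^sup>2 + c \<langle>q d, d\<rangle> + \<parallel>e\<parallel>\<^sup>2\<close> only varies through \<open>q\<^sub>t\<close>, at a rate proportional to \<open>c\<close>, and it is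
  coercive as long as \<open>c |q| \<le> 1/2\<close>. Derivatives of a solution of order \<open>N\<close> satisfy such a system up to
  remainders of size \<open>c\<close>, which bounds them on \<open>[0, T/c]\<close> uniformly in \<open>\<epsilon>\<close>; so do differences of two
  solutions, with a divided difference of powers as \<open>q\<close>, which gives uniqueness. Solutions are limits of those of
  the ordinary differential equations obtained by cutting the symbol of \<open>K \<partial>\<^sub>x\<close> off at \<open>|\<xi>| \<le> n\<close>: they are
  bounded in \<open>H\<^sup>N\<close> for an integer \<open>N > s + D\<close>, two of them differ by \<open>O(1/n)\<close> in \<open>L\<^sup>2\<close>, and
  interpolation yields convergence in \<open>H\<^sup>s\<^sup>+\<^sup>D\<close>.
\<close>

section \<open>Square integrable functions\<close>

text \<open>In a naive estimate of order N the nonlinearity costs one derivative. It does not here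
  because all terms of order N + 1 in the derivatives of \<open>u^(p+1)\<close> combine into
  \<open>((p+1) u^p w)_x\<close>, with \<open>w\<close> the derivative of \<open>u\<close> of order
  N, so that the coefficient is the very multiplier \<open>q\<close> of the energy. The cutoff is
  put on the symbol of \<open>K \<partial>\<^sub>x\<close> and not on products: the truncated
  operator stays skew adjoint, and the energy identity holds verbatim for the approximations. Growth
  rates carry the factor \<open>c\<close> and the time is \<open>T/c\<close>, so \<open>T\<close>
  alone limits the total growth. Passing from the norm to the energy and back costs a factor 3; with
  initial size X0 the bound 3 X0 + 1 stays below \<open>R^2 = 3 X0 + 2\<close>, which closes a
  continuity argument. The threshold for \<epsilon> keeps \<open>c |q| \<le> 1/2\<close>, with the
  sup bound enlarged by 1 so that it also covers a competitor near the solution. The estimate for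
  differences contains a factor growing like \<open>exp (2 T/c)\<close>; this is harmless, as it
  serves for fixed \<epsilon> only to let n tend to infinity, or with zero initial
  difference.\<close>

definition l2n :: "(real \<Rightarrow> 'a::{real_normed_vector, second_countable_topology}) \<Rightarrow> real" where
  "l2n f = sqrt (LINT x|lborel. (norm (f x))\<^sup>2)"

lemma square_integrable_measurable [dest]:
  "square_integrable f \<Longrightarrow> f \<in> borel_measurable borel"
  by (simp add: square_integrable_def)

lemma square_integrable_norm2:
  "square_integrable f \<Longrightarrow> integrable lborel (\<lambda>x. (norm (f x))\<^sup>2)"
  by (simp add: square_integrable_def)

lemma square_integrableI:
  assumes "f \<in> borel_measurable borel" "integrable lborel g" "\<And>x. (norm (f x))\<^sup>2 \<le> g x"
  shows "square_integrable f"
proof -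
  have [measurable]: "f \<in> borel_measurable borel" by fact
  have "norm ((norm (f x))\<^sup>2) \<le> norm (g x)" for x
    using assms(3)[of x] by (simp add: order_trans[OF _ abs_ge_self])
  then show ?thesis
    using assms(1,2) unfolding square_integrable_def
    by (auto intro!: Bochner_Integration.integrable_bound[OF assms(2)])
qed

lemma square_integrable_bound:
  fixes f :: "real \<Rightarrow> 'a::{real_normed_vector, second_countable_topology}"
    and g :: "real \<Rightarrow> 'b::{real_normed_vector, second_countable_topology}"
  assumes "f \<in> borel_measurable borel" "square_integrable g" "\<And>x. norm (f x) \<le> c * norm (g x)"
  shows "square_integrable f"
proof (rule square_integrableI)
  show "integrable lborel (\<lambda>x. c\<^sup>2 * (norm (g x))\<^sup>2)"
    using square_integrable_norm2[OF assms(2)] by simp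
  show "(norm (f x))\<^sup>2 \<le> c\<^sup>2 * (norm (g x))\<^sup>2" for x
    using power_mono[OF assms(3)[of x], of 2] by (simp add: power_mult_distrib)
qed fact

lemma square_integrable_norm:
  "square_integrable f \<Longrightarrow> square_integrable (\<lambda>x. norm (f x))"
  by (rule square_integrable_bound[where c = 1]) auto

lemma square_integrable_add:
  assumes "square_integrable f" "square_integrable g"
  shows "square_integrable (\<lambda>x. f x + g x)"
proof (rule square_integrableI)
  have [measurable]: "f \<in> borel_measurable borel" "g \<in> borel_measurable borel" using assms by auto
  show "(\<lambda>x. f x + g x) \<in> borel_measurable borel" by simp
  show "integrable lborel (\<lambda>x. 2 * (norm (f x))\<^sup>2 + 2 * (norm (g x))\<^sup>2)"
    using assms[THEN square_integrable_norm2] by simp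
  fix x
  have "(norm (f x + g x))\<^sup>2 \<le> (norm (f x) + norm (g x))\<^sup>2"
    by (intro power_mono norm_triangle_ineq) auto
  also have "\<dots> \<le> 2 * (norm (f x))\<^sup>2 + 2 * (norm (g x))\<^sup>2"
    using sum_squares_bound[of "norm (f x)" "norm (g x)"] by (simp add: power2_sum)
  finally show "(norm (f x + g x))\<^sup>2 \<le> 2 * (norm (f x))\<^sup>2 + 2 * (norm (g x))\<^sup>2" .
qed

lemma square_integrable_scaleR:
  assumes "square_integrable f"
  shows "square_integrable (\<lambda>x. c *\<^sub>R f x)"
proof (rule square_integrable_bound[OF _ assms, of _ "\<bar>c\<bar>"])
  have [measurable]: "f \<in> borel_measurable borel" using assms by auto
  show "(\<lambda>x. c *\<^sub>R f x) \<in> borel_measurable borel" by simp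
qed auto

lemma square_integrable_mult_left:
  fixes f :: "real \<Rightarrow> 'a::{real_normed_field, second_countable_topology}"
  assumes "square_integrable f"
  shows "square_integrable (\<lambda>x. c * f x)"
proof (rule square_integrable_bound[OF _ assms, of _ "norm c"])
  have [measurable]: "f \<in> borel_measurable borel" using assms by auto
  show "(\<lambda>x. c * f x) \<in> borel_measurable borel" by simp
qed (auto simp: norm_mult)

lemma square_integrable_minus:
  "square_integrable f \<Longrightarrow> square_integrable (\<lambda>x. - f x)"
  using square_integrable_scaleR[of f "-1"] by simp

lemma square_integrable_diff:
  "square_integrable f \<Longrightarrow> square_integrable g \<Longrightarrow> square_integrable (\<lambda>x. f x - g x)"
  using square_integrable_add[OF _ square_integrable_minus, of f g] by simp

lemma square_integrable_zero: "square_integrable (\<lambda>x. 0)"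
  by (simp add: square_integrable_def)

lemma square_integrable_bounded_mult:
  fixes f g :: "real \<Rightarrow> 'a::{real_normed_field, second_countable_topology}"
  assumes "f \<in> borel_measurable borel" "\<And>x. norm (f x) \<le> c" "square_integrable g"
  shows "square_integrable (\<lambda>x. f x * g x)"
proof (rule square_integrable_bound[OF _ assms(3), of _ c])
  have [measurable]: "f \<in> borel_measurable borel" "g \<in> borel_measurable borel" using assms by auto
  show "(\<lambda>x. f x * g x) \<in> borel_measurable borel" by simp
qed (auto simp: norm_mult intro!: mult_right_mono assms)

lemma square_integrable_of_real_iff [simp]:
  "square_integrable (\<lambda>x. complex_of_real (u x)) \<longleftrightarrow> square_integrable u"
proof -
  have "(\<lambda>x. complex_of_real (u x)) \<in> borel_measurable borel \<longleftrightarrow> u \<in> borel_measurable borel"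
  proof
    assume [measurable]: "(\<lambda>x. complex_of_real (u x)) \<in> borel_measurable borel"
    have "(\<lambda>x. Re (complex_of_real (u x))) \<in> borel_measurable borel" by measurable
    then show "u \<in> borel_measurable borel" by simp
  qed simp
  then show ?thesis by (simp add: square_integrable_def)
qed

lemma integrable_prod_square_integrable:
  fixes f g :: "real \<Rightarrow> 'a::{real_normed_field, second_countable_topology, banach}"
  assumes "square_integrable f" "square_integrable g"
  shows "integrable lborel (\<lambda>x. f x * g x)"
proof -
  have [measurable]: "f \<in> borel_measurable borel" "g \<in> borel_measurable borel" using assms by auto
  have "integrable lborel (\<lambda>x. (norm (f x))\<^sup>2 + (norm (g x))\<^sup>2)"
    using assms[THEN square_integrable_norm2] by simp
  then show ?thesis
  proof (rule Bochner_Integration.integrable_bound)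
    have "norm (f x * g x) \<le> (norm (f x))\<^sup>2 + (norm (g x))\<^sup>2" for x
    proof -
      have "2 * (norm (f x) * norm (g x)) \<le> (norm (f x))\<^sup>2 + (norm (g x))\<^sup>2"
        using sum_squares_bound[of "norm (f x)" "norm (g x)"] by (simp add: mult.assoc)
      moreover have "0 \<le> norm (f x) * norm (g x)" by simp
      ultimately show ?thesis unfolding norm_mult by linarith
    qed
    then show "AE x in lborel. norm (f x * g x) \<le> norm ((norm (f x))\<^sup>2 + (norm (g x))\<^sup>2)"
      by (auto intro: order_trans)
  qed simp
qed

lemma l2n_nonneg [simp]: "0 \<le> l2n f"
  by (simp add: l2n_def)

lemma l2n_square: "(l2n f)\<^sup>2 = (LINT x|lborel. (norm (f x))\<^sup>2)"
  by (simp add: l2n_def)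

lemma nn_integral_square_integrable:
  "square_integrable f \<Longrightarrow> (\<integral>\<^sup>+x. ennreal ((norm (f x))\<^sup>2) \<partial>lborel) = ennreal ((l2n f)\<^sup>2)"
  by (simp add: l2n_square nn_integral_eq_integral square_integrable_norm2)

text \<open>Fatou's lemma delivers bounds on extended integrals; this converts them back to
  integrability and a bound on \<open>l2n\<close>.\<close>

lemma square_integrable_nn_integral:
  assumes "f \<in> borel_measurable borel" "(\<integral>\<^sup>+x. ennreal ((norm (f x))\<^sup>2) \<partial>lborel) \<le> ennreal (c\<^sup>2)" "0 \<le> c"
  shows "square_integrable f" "l2n f \<le> c"
proof -
  have [measurable]: "f \<in> borel_measurable borel" by fact
  show si: "square_integrable f"
    unfolding square_integrable_def using assms
    by (auto intro!: integrableI_bounded simp: order_le_less_trans[OF _ ennreal_less_top])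
  show "l2n f \<le> c"
    using assms(2,3) nn_integral_square_integrable[OF si] by (simp add: power_mono_iff)
qed

lemma l2n_norm [simp]: "l2n (\<lambda>x. norm (f x)) = l2n f"
  by (simp add: l2n_def)

lemma l2n_of_real [simp]: "l2n (\<lambda>x. complex_of_real (u x)) = l2n u"
  by (simp add: l2n_def)

lemma l2n_cong_AE:
  assumes "AE x in lborel. f x = g x" "f \<in> borel_measurable borel" "g \<in> borel_measurable borel"
  shows "l2n f = l2n g"
  unfolding l2n_def
  by (rule arg_cong[where f = sqrt], rule integral_cong_AE) (use assms in \<open>auto elim: eventually_mono\<close>)

lemma square_integrable_cong_AE:
  assumes "AE x in lborel. f x = g x" "square_integrable f" "g \<in> borel_measurable borel"
  shows "square_integrable g"
proof -
  have [measurable]: "f \<in> borel_measurable borel" "g \<in> borel_measurable borel" using assms by auto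
  have "integrable lborel (\<lambda>x. (norm (f x))\<^sup>2) \<longleftrightarrow> integrable lborel (\<lambda>x. (norm (g x))\<^sup>2)"
    by (rule integrable_cong_AE) (use assms(1) in \<open>auto elim: eventually_mono\<close>)
  then show ?thesis using assms by (simp add: square_integrable_def)
qed

lemma l2n_scaleR: "l2n (\<lambda>x. c *\<^sub>R f x) = \<bar>c\<bar> * l2n f"
  by (simp add: l2n_def power_mult_distrib real_sqrt_mult)

lemma l2n_mult_left:
  fixes f :: "real \<Rightarrow> 'a::{real_normed_field, second_countable_topology}"
  shows "l2n (\<lambda>x. c * f x) = norm c * l2n f"
  by (simp add: l2n_def norm_mult power_mult_distrib real_sqrt_mult)

lemma l2n_minus: "l2n (\<lambda>x. - f x) = l2n f"
  using l2n_scaleR[of "-1" f] by simp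

lemma l2n_minus_commute: "l2n (\<lambda>x. f x - g x) = l2n (\<lambda>x. g x - f x)"
  by (simp add: l2n_def norm_minus_commute)

lemma l2n_mono:
  assumes "square_integrable g" "f \<in> borel_measurable borel" "\<And>x. norm (f x) \<le> c * norm (g x)" "0 \<le> c"
  shows "l2n f \<le> c * l2n g"
proof -
  have "square_integrable f" using assms by (intro square_integrable_bound[of f g c])
  moreover have "(norm (f x))\<^sup>2 \<le> (norm (c *\<^sub>R g x))\<^sup>2" for x
    using assms(3)[of x] assms(4) by (intro power_mono) auto
  ultimately have "l2n f \<le> l2n (\<lambda>x. c *\<^sub>R g x)"
    unfolding l2n_def using square_integrable_scaleR[OF assms(1), of c]
    by (intro real_sqrt_le_mono integral_mono) (auto dest: square_integrable_norm2)
  then show ?thesis using assms(4) by (simp add: l2n_scaleR)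
qed

lemma Cauchy_Schwarz_l2n:
  fixes f :: "real \<Rightarrow> 'a::{real_normed_vector, second_countable_topology}"
    and g :: "real \<Rightarrow> 'b::{real_normed_vector, second_countable_topology}"
  assumes "square_integrable f" "square_integrable g"
  shows "(LINT x|lborel. norm (f x) * norm (g x)) \<le> l2n f * l2n g"
proof -
  have [measurable]: "f \<in> borel_measurable borel" "g \<in> borel_measurable borel" using assms by auto
  have fg: "integrable lborel (\<lambda>x. norm (f x) * norm (g x))"
    by (rule integrable_prod_square_integrable; rule square_integrable_norm) fact+
  have nn: "0 \<le> (LINT x|lborel. norm (f x) * norm (g x))"
    by (rule integral_nonneg_AE) auto
  have "(\<integral>\<^sup>+x. ennreal (norm (f x)) * ennreal (norm (g x)) \<partial>lborel)\<^sup>2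
      \<le> (\<integral>\<^sup>+x. (ennreal (norm (f x)))\<^sup>2 \<partial>lborel) * (\<integral>\<^sup>+x. (ennreal (norm (g x)))\<^sup>2 \<partial>lborel)"
    by (rule Cauchy_Schwarz_nn_integral) auto
  then have "(ennreal (LINT x|lborel. norm (f x) * norm (g x)))\<^sup>2 \<le> ennreal ((l2n f)\<^sup>2) * ennreal ((l2n g)\<^sup>2)"
    using fg assms
    by (simp add: nn_integral_eq_integral ennreal_power nn_integral_square_integrable flip: ennreal_mult)
  then have "(LINT x|lborel. norm (f x) * norm (g x))\<^sup>2 \<le> (l2n f * l2n g)\<^sup>2"
    using nn by (simp add: ennreal_power power_mult_distrib flip: ennreal_mult)
  then show ?thesis by (simp add: power2_le_iff_abs_le nn)
qed

lemma norm_integral_prod_le: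
  fixes f g :: "real \<Rightarrow> 'a::{real_normed_field, second_countable_topology, banach}"
  assumes "square_integrable f" "square_integrable g"
  shows "norm (LINT x|lborel. f x * g x) \<le> l2n f * l2n g"
  using integral_norm_bound[of lborel "\<lambda>x. f x * g x"] Cauchy_Schwarz_l2n[OF assms]
  by (simp add: norm_mult)

lemma l2n_triangle:
  assumes "square_integrable f" "square_integrable g"
  shows "l2n (\<lambda>x. f x + g x) \<le> l2n f + l2n g"
proof -
  have [measurable]: "f \<in> borel_measurable borel" "g \<in> borel_measurable borel" using assms by auto
  have fg: "integrable lborel (\<lambda>x. norm (f x) * norm (g x))"
    by (rule integrable_prod_square_integrable; rule square_integrable_norm) fact+
  note ints = assms[THEN square_integrable_norm2]
  have "(l2n (\<lambda>x. f x + g x))\<^sup>2 \<le> (LINT x|lborel. (norm (f x))\<^sup>2 + (norm (g x))\<^sup>2 + 2 * (norm (f x) * norm (g x)))"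
    unfolding l2n_square
  proof (rule integral_mono)
    show "integrable lborel (\<lambda>x. (norm (f x + g x))\<^sup>2)"
      using square_integrable_add[OF assms] by (rule square_integrable_norm2)
    show "(norm (f x + g x))\<^sup>2 \<le> (norm (f x))\<^sup>2 + (norm (g x))\<^sup>2 + 2 * (norm (f x) * norm (g x))" for x
      using power_mono[OF norm_triangle_ineq[of "f x" "g x"], of 2] by (simp add: power2_sum mult.assoc)
  qed (use fg ints in simp)
  also have "\<dots> = (l2n f)\<^sup>2 + (l2n g)\<^sup>2 + 2 * (LINT x|lborel. norm (f x) * norm (g x))"
    using fg ints by (simp add: l2n_square)
  also have "\<dots> \<le> (l2n f + l2n g)\<^sup>2"
    using Cauchy_Schwarz_l2n[OF assms] by (simp add: power2_sum)
  finally show ?thesis by (rule power2_le_imp_le) simp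
qed

lemma l2n_triangle_diff:
  assumes "square_integrable f" "square_integrable g" "square_integrable h"
  shows "l2n (\<lambda>x. f x - h x) \<le> l2n (\<lambda>x. f x - g x) + l2n (\<lambda>x. g x - h x)"
  using l2n_triangle[OF square_integrable_diff[OF assms(1,2)] square_integrable_diff[OF assms(2,3)]] by simp

lemma l2n_eq_0_AE:
  assumes "square_integrable f" "l2n f = 0"
  shows "AE x in lborel. f x = 0"
proof -
  have "(LINT x|lborel. (norm (f x))\<^sup>2) = 0" using assms(2) by (simp add: l2n_def)
  then have "AE x in lborel. (norm (f x))\<^sup>2 = 0"
    using integral_nonneg_eq_0_iff_AE[OF square_integrable_norm2[OF assms(1)]] by auto
  then show ?thesis by simp
qed

lemma square_integrable_indicator_mult:
  fixes f :: "real \<Rightarrow> 'a::{real_normed_field, second_countable_topology}"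
  assumes "square_integrable f" "A \<in> sets borel"
  shows "square_integrable (\<lambda>x. indicator A x * f x)"
  by (rule square_integrable_bounded_mult[of _ 1]) (use assms in \<open>auto simp: indicator_def\<close>)

lemma square_integrable_indicator:
  assumes "A \<in> sets borel" "emeasure lborel A < \<infinity>"
  shows "square_integrable (indicator A :: real \<Rightarrow> 'a::{real_normed_field, second_countable_topology})"
proof (rule square_integrableI)
  show "integrable lborel (indicator A :: real \<Rightarrow> real)" using assms by (simp add: integrable_indicator_iff)
qed (use assms in \<open>auto simp: indicator_def\<close>)

lemma integrable_indicator_mult_square_integrable:
  fixes f :: "real \<Rightarrow> 'a::{real_normed_field, second_countable_topology, banach}"
  assumes "square_integrable f" "A \<in> sets borel" "emeasure lborel A < \<infinity>"
  shows "integrable lborel (\<lambda>x. indicator A x * f x)"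
  using assms by (intro integrable_prod_square_integrable square_integrable_indicator)

text \<open>Dominated convergence for the squares, with majorant
  \<open>c\<^sup>2 * (norm (g x))\<^sup>2\<close>.\<close>

lemma l2n_tendsto_0_dominated:
  fixes f :: "nat \<Rightarrow> real \<Rightarrow> 'a::{real_normed_vector, second_countable_topology}"
  assumes "\<And>n. f n \<in> borel_measurable borel" "square_integrable g"
    "\<And>n x. norm (f n x) \<le> c * norm (g x)" "AE x in lborel. (\<lambda>n. f n x) \<longlonglongrightarrow> 0"
  shows "(\<lambda>n. l2n (f n)) \<longlonglongrightarrow> 0"
proof -
  have [measurable]: "f n \<in> borel_measurable borel" for n by fact
  have "(\<lambda>n. LINT x|lborel. (norm (f n x))\<^sup>2) \<longlonglongrightarrow> (LINT x::real|lborel. (0::real))"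
  proof (rule integral_dominated_convergence[where w = "\<lambda>x. c\<^sup>2 * (norm (g x))\<^sup>2" and f = "\<lambda>x. 0::real"
        and s = "\<lambda>n x. (norm (f n x))\<^sup>2"])
    show "integrable lborel (\<lambda>x. c\<^sup>2 * (norm (g x))\<^sup>2)" using square_integrable_norm2[OF assms(2)] by simp
    show "AE x in lborel. (\<lambda>n. (norm (f n x))\<^sup>2) \<longlonglongrightarrow> 0"
      using assms(4) by (auto elim!: eventually_mono intro!: tendsto_eq_intros simp: tendsto_norm_zero_iff)
    show "AE x in lborel. norm ((norm (f n x))\<^sup>2) \<le> c\<^sup>2 * (norm (g x))\<^sup>2" for n
      using power_mono[OF assms(3)[of n] norm_ge_zero, of _ 2] by (simp add: power_mult_distrib)
  qed auto
  then show ?thesis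
    unfolding l2n_def using tendsto_real_sqrt[of _ 0] by fastforce
qed

text \<open>
  Multiplication by a fixed positive square integrable weight turns an \<open>L\<^sup>2\<close>-Cauchy sequence into an
  \<open>L\<^sup>1\<close>-Cauchy one, for which the library provides an almost everywhere convergent subsequence.
\<close>

theorem square_integrable_complete:
  fixes f :: "nat \<Rightarrow> real \<Rightarrow> complex"
  assumes si: "\<And>n. square_integrable (f n)"
    and cauchy: "\<And>e. e > 0 \<Longrightarrow> \<exists>N. \<forall>m\<ge>N. \<forall>n\<ge>N. l2n (\<lambda>x. f m x - f n x) < e"
  obtains g where "square_integrable g" "(\<lambda>n. l2n (\<lambda>x. f n x - g x)) \<longlonglongrightarrow> 0"
proof -
  have [measurable]: "f n \<in> borel_measurable borel" for n using si by auto
  \<comment> \<open>The weight must be nowhere zero, so that convergence of \<open>w * f\<close>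
    gives back convergence of \<open>f\<close>, and square integrable. The normal density is both:
    it is at most 1, so its square is at most itself.\<close>
  define w where "w x = complex_of_real (std_normal_density x)" for x
  have [measurable]: "w \<in> borel_measurable borel" unfolding w_def by measurable
  have w_pos: "w x \<noteq> 0" for x by (simp add: w_def normal_density_def)
  have "(norm (w x))\<^sup>2 \<le> std_normal_density x" for x
  proof -
    have "0 \<le> std_normal_density x" by simp
    moreover have "std_normal_density x \<le> 1"
    proof -
      have "1 \<le> sqrt (2 * pi)" using pi_ge_two by (simp add: real_le_rsqrt)
      moreover have "exp (- x\<^sup>2 / 2) \<le> 1" by simp
      ultimately show ?thesis unfolding std_normal_density_def
        by (smt (verit) divide_le_eq_1 mult_le_one exp_ge_zero zero_le_divide_1_iff)
    qed
    ultimately show ?thesis by (simp add: w_def power2_eq_square mult_left_le)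
  qed
  then have w: "square_integrable w"
    by (intro square_integrableI[where g = std_normal_density]) (auto simp: w_def)
  have wf: "\<exists>N. \<forall>i\<ge>N. \<forall>j\<ge>N. (LINT x|lborel. norm (w x * f i x - w x * f j x)) < e" if "e > 0" for e
  proof -
    define e' where "e' = e / (l2n w + 1)"
    have "l2n w + 1 > 0" using l2n_nonneg[of w] by linarith
    then have "e' > 0" unfolding e'_def using that by simp
    then obtain N where N: "\<And>m n. m \<ge> N \<Longrightarrow> n \<ge> N \<Longrightarrow> l2n (\<lambda>x. f m x - f n x) < e'" using cauchy by blast
    have "(LINT x|lborel. norm (w x * f i x - w x * f j x)) < e" if "i \<ge> N" "j \<ge> N" for i j
    proof -
      have "(LINT x|lborel. norm (w x * f i x - w x * f j x)) \<le> l2n w * l2n (\<lambda>x. f i x - f j x)"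
        using Cauchy_Schwarz_l2n[OF w square_integrable_diff[OF si si, of i j]]
        by (simp add: norm_mult flip: right_diff_distrib)
      also have "\<dots> \<le> l2n w * e'" using N[OF that] by (intro mult_left_mono) auto
      also have "\<dots> < e" using \<open>e > 0\<close> \<open>l2n w + 1 > 0\<close> unfolding e'_def by (simp add: field_simps)
      finally show ?thesis .
    qed
    then show ?thesis by blast
  qed
  obtain r where r: "strict_mono r" "AE x in lborel. Cauchy (\<lambda>i. w x * f (r i) x)"
    using cauchy_L1_AE_cauchy_subseq[OF integrable_prod_square_integrable[OF w si] wf] by metis
  define g where "g x = lim (\<lambda>i. f (r i) x)" for x
  have [measurable]: "g \<in> borel_measurable borel"
    unfolding g_def by measurable
  have lim: "AE x in lborel. (\<lambda>i. f (r i) x) \<longlonglongrightarrow> g x"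
    using r(2)
  proof (rule eventually_mono)
    fix x assume "Cauchy (\<lambda>i. w x * f (r i) x)"
    then have "convergent (\<lambda>i. inverse (w x) * (w x * f (r i) x))"
      by (intro convergent_mult convergent_const Cauchy_convergent)
    then show "(\<lambda>i. f (r i) x) \<longlonglongrightarrow> g x"
      using w_pos[of x] by (simp add: g_def convergent_LIMSEQ_iff flip: mult.assoc)
  qed
  \<comment> \<open>Fatou along the subsequence replaces \<open>f (r i)\<close> by its limit
    \<open>g\<close> in the Cauchy estimate. It applies to every index \<open>n\<close>, so the
    whole sequence converges and not just the subsequence.\<close>
  have close: "square_integrable (\<lambda>x. f n x - g x) \<and> l2n (\<lambda>x. f n x - g x) \<le> e"
    if "\<And>m. m \<ge> N \<Longrightarrow> l2n (\<lambda>x. f n x - f m x) \<le> e" "e > 0" for n N e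
  proof -
    have "(\<integral>\<^sup>+x. ennreal ((norm (f n x - g x))\<^sup>2) \<partial>lborel)
        = (\<integral>\<^sup>+x. liminf (\<lambda>i. ennreal ((norm (f n x - f (r i) x))\<^sup>2)) \<partial>lborel)"
    proof (rule nn_integral_cong_AE, use lim in \<open>rule eventually_mono\<close>)
      fix x assume "(\<lambda>i. f (r i) x) \<longlonglongrightarrow> g x"
      then have "(\<lambda>i. ennreal ((norm (f n x - f (r i) x))\<^sup>2)) \<longlonglongrightarrow> ennreal ((norm (f n x - g x))\<^sup>2)"
        by (intro tendsto_intros tendsto_ennrealI)
      then show "ennreal ((norm (f n x - g x))\<^sup>2) = liminf (\<lambda>i. ennreal ((norm (f n x - f (r i) x))\<^sup>2))"
        by (intro lim_imp_Liminf[symmetric]) auto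
    qed
    also have "\<dots> \<le> liminf (\<lambda>i. \<integral>\<^sup>+x. ennreal ((norm (f n x - f (r i) x))\<^sup>2) \<partial>lborel)"
      by (rule nn_integral_liminf) auto
    also have "\<dots> \<le> ennreal (e\<^sup>2)"
    proof (rule Liminf_le)
      show "\<forall>\<^sub>F i in sequentially. (\<integral>\<^sup>+x. ennreal ((norm (f n x - f (r i) x))\<^sup>2) \<partial>lborel) \<le> ennreal (e\<^sup>2)"
        using eventually_ge_at_top[of N]
      proof (rule eventually_mono)
        fix i assume "N \<le> i"
        then have "r i \<ge> N" using seq_suble[OF r(1), of i] by linarith
        then have "l2n (\<lambda>x. f n x - f (r i) x) \<le> e" by (rule that)
        then show "(\<integral>\<^sup>+x. ennreal ((norm (f n x - f (r i) x))\<^sup>2) \<partial>lborel) \<le> ennreal (e\<^sup>2)"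
          using square_integrable_diff[OF si si, of n "r i"]
          by (subst nn_integral_square_integrable) (auto intro!: ennreal_leI power_mono)
      qed
    qed simp
    finally show ?thesis
      using square_integrable_nn_integral[of "\<lambda>x. f n x - g x" e] that(2) by simp
  qed
  obtain N where N: "\<And>m n. m \<ge> N \<Longrightarrow> n \<ge> N \<Longrightarrow> l2n (\<lambda>x. f m x - f n x) < 1" using cauchy[of 1] by auto
  have "square_integrable (\<lambda>x. f N x - g x)"
    using close[of N N 1] N[THEN less_imp_le] by simp
  from square_integrable_diff[OF si[of N] this] have g: "square_integrable g" by simp
  have "(\<lambda>n. l2n (\<lambda>x. f n x - g x)) \<longlonglongrightarrow> 0"
  proof (rule LIMSEQ_I)
    fix e :: real assume "e > 0"
    then obtain N where N: "\<And>m n. m \<ge> N \<Longrightarrow> n \<ge> N \<Longrightarrow> l2n (\<lambda>x. f m x - f n x) < e/2"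
      using cauchy[of "e/2"] by auto
    have "l2n (\<lambda>x. f n x - g x) \<le> e/2" if "n \<ge> N" for n
    proof -
      have "l2n (\<lambda>x. f n x - f m x) \<le> e/2" if "m \<ge> N" for m
        using N[OF \<open>n \<ge> N\<close> that] by (rule less_imp_le)
      then show ?thesis using close[of N n "e/2"] \<open>e > 0\<close> by auto
    qed
    then have "norm (l2n (\<lambda>x. f n x - g x) - 0) < e" if "n \<ge> N" for n
      using that \<open>e > 0\<close> by fastforce
    then show "\<exists>N. \<forall>n\<ge>N. norm (l2n (\<lambda>x. f n x - g x) - 0) < e" by blast
  qed
  with g show ?thesis by (rule that)
qed

text \<open>Density principle: intervals form an intersection-stable generator of the Borel sets, so
  a property that survives linear combinations and \<open>L^2\<close> limits passes from intervals
  to bounded Borel sets, to simple functions and to all of \<open>L^2\<close>. Parseval's identity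
  and the uniqueness of weak derivatives are reduced to intervals by it.\<close>

lemma square_integrable_induct [consumes 1, case_names interval add scale lim]:
  fixes f :: "real \<Rightarrow> complex"
  assumes f: "square_integrable f"
    and interval: "\<And>a b. Q (indicator {a..b})"
    and add: "\<And>f g. square_integrable f \<Longrightarrow> square_integrable g \<Longrightarrow> Q f \<Longrightarrow> Q g \<Longrightarrow> Q (\<lambda>x. f x + g x)"
    and scale: "\<And>f c. square_integrable f \<Longrightarrow> Q f \<Longrightarrow> Q (\<lambda>x. c * f x)"
    and lim: "\<And>F f. (\<And>n::nat. square_integrable (F n)) \<Longrightarrow> (\<And>n. Q (F n)) \<Longrightarrow> square_integrable f \<Longrightarrow>
      (\<lambda>n. l2n (\<lambda>x. F n x - f x)) \<longlonglongrightarrow> 0 \<Longrightarrow> Q f"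
  shows "Q f"
proof -
  have zero: "Q (\<lambda>x. 0)"
    using scale[OF square_integrable_indicator interval, of 0 0 0] by simp
  have sum: "square_integrable (\<lambda>x. \<Sum>i\<in>I. h i x) \<and> Q (\<lambda>x. \<Sum>i\<in>I. h i x)"
    if "finite I" "\<And>i. i \<in> I \<Longrightarrow> square_integrable (h i) \<and> Q (h i)"
    for I :: "'i set" and h :: "'i \<Rightarrow> real \<Rightarrow> complex"
    using that
  proof (induction I rule: finite_induct)
    case empty then show ?case by (simp add: zero square_integrable_zero)
  next
    case (insert i I)
    then show ?case
      using add[of "h i" "\<lambda>x. \<Sum>i\<in>I. h i x"] by (simp add: square_integrable_add)
  qed
  have si_ind: "square_integrable (indicator (A \<inter> {a..b}) :: real \<Rightarrow> complex)" if "A \<in> sets borel" for A and a b :: real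
  proof (rule square_integrable_indicator)
    have "emeasure lborel (A \<inter> {a..b}) \<le> emeasure lborel {a..b}" using that by (intro emeasure_mono) auto
    also have "\<dots> < \<infinity>" by (rule emeasure_lborel_Icc_eq[THEN ord_eq_less_trans]) simp
    finally show "emeasure lborel (A \<inter> {a..b}) < \<infinity>" .
  qed (use that in auto)
  \<comment> \<open>Everything is intersected with one fixed interval: complements then keep finite
    measure, and the indicators in the Dynkin induction stay square integrable.\<close>
  have Q_set: "Q (indicator (A \<inter> {a..b}))" if "A \<in> sets borel" for A and a b :: real
  proof -
    have eq: "sets borel = sigma_sets UNIV (range (\<lambda>(a, b). {a..b::real}))"
      by (simp add: borel_eq_atLeastAtMost)
    show ?thesis
    proof (rule sigma_sets_induct_disjoint[of "range (\<lambda>(a, b). {a..b::real})" UNIV A "\<lambda>A. Q (indicator (A \<inter> {a..b}))"])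
      show "Int_stable (range (\<lambda>(a, b). {a..b::real}))"
        by (auto simp: Int_stable_def Int_atLeastAtMost)
      show "A \<in> sigma_sets UNIV (range (\<lambda>(a, b). {a..b::real}))" using that eq by simp
    next
      fix B assume "B \<in> range (\<lambda>(a, b). {a..b::real})"
      then show "Q (indicator (B \<inter> {a..b}))" by (auto simp: Int_atLeastAtMost interval)
    next
      have "indicator ({} \<inter> {a..b}) = (\<lambda>x. 0::complex)" by auto
      then show "Q (indicator ({} \<inter> {a..b}))" using zero by simp
    next
      fix B assume B: "B \<in> sigma_sets UNIV (range (\<lambda>(a, b). {a..b::real}))" "Q (indicator (B \<inter> {a..b}))"
      then have Bm: "B \<in> sets borel" using eq by simp
      have "Q (\<lambda>x. indicator (UNIV \<inter> {a..b}) x + (-1) * indicator (B \<inter> {a..b}) x)"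
        by (intro add scale B square_integrable_mult_left si_ind Bm) (auto simp: interval)
      moreover have "(\<lambda>x. indicator (UNIV \<inter> {a..b}) x + (-1) * indicator (B \<inter> {a..b}) x)
          = (indicator ((UNIV - B) \<inter> {a..b}) :: real \<Rightarrow> complex)"
        by (auto simp: indicator_def fun_eq_iff)
      ultimately show "Q (indicator ((UNIV - B) \<inter> {a..b}))" by simp
    next
      fix B :: "nat \<Rightarrow> real set"
      assume disj: "disjoint_family B" and B: "range B \<subseteq> sigma_sets UNIV (range (\<lambda>(a, b). {a..b::real}))"
        "\<And>i. Q (indicator (B i \<inter> {a..b}))"
      then have Bm [measurable]: "B i \<in> sets borel" for i using eq by auto
      define F where "F n x = (\<Sum>i<n. indicator (B i \<inter> {a..b}) x :: complex)" for n x
      have F: "square_integrable (F n) \<and> Q (F n)" for n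
        unfolding F_def by (rule sum) (auto intro: si_ind B)
      have F_eq: "F n x = indicator ((\<Union>i<n. B i) \<inter> {a..b}) x" for n x
      proof (induction n)
        case (Suc n)
        have "x \<in> B n \<Longrightarrow> i < n \<Longrightarrow> x \<notin> B i" for i
          using disjoint_family_onD[OF disj, of n i] by auto
        then have "indicator ((\<Union>i<n. B i) \<inter> {a..b}) x + indicator (B n \<inter> {a..b}) x
            = (indicator ((\<Union>i<Suc n. B i) \<inter> {a..b}) x :: complex)"
          by (auto simp: indicator_def lessThan_Suc)
        then show ?case using Suc by (simp add: F_def)
      qed (simp add: F_def)
      show "Q (indicator ((\<Union>i. B i) \<inter> {a..b}))"
      proof (rule lim[of F])
        show "square_integrable (indicator ((\<Union>i. B i) \<inter> {a..b}) :: real \<Rightarrow> complex)" by (rule si_ind) auto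
        show "(\<lambda>n. l2n (\<lambda>x. F n x - indicator ((\<Union>i. B i) \<inter> {a..b}) x)) \<longlonglongrightarrow> 0"
        proof (rule l2n_tendsto_0_dominated[where c = 1 and g = "indicator (UNIV \<inter> {a..b}) :: real \<Rightarrow> complex"])
          show "AE x in lborel. (\<lambda>n. F n x - indicator ((\<Union>i. B i) \<inter> {a..b}) x) \<longlonglongrightarrow> 0"
          proof (rule AE_I2)
            fix x
            have "\<forall>\<^sub>F n in sequentially. F n x - indicator ((\<Union>i. B i) \<inter> {a..b}) x = 0"
            proof (cases "x \<in> (\<Union>i. B i)")
              case True
              then obtain i where i: "x \<in> B i" by auto
              show ?thesis
                using eventually_gt_at_top[of i] by (rule eventually_mono) (use i in \<open>auto simp: F_eq indicator_def\<close>)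
            qed (auto simp: F_eq indicator_def)
            then show "(\<lambda>n. F n x - indicator ((\<Union>i. B i) \<inter> {a..b}) x) \<longlonglongrightarrow> 0"
              by (rule tendsto_eventually)
          qed
          show "square_integrable (indicator (UNIV \<inter> {a..b}) :: real \<Rightarrow> complex)" by (rule si_ind) simp
        qed (auto simp: F_eq indicator_def)
      qed (use F in auto)
    qed auto
  qed
  have fm: "f \<in> borel_measurable borel" using f by auto
  obtain s where s: "\<And>i. simple_function borel (s i)" "\<And>x. (\<lambda>i. s i x) \<longlonglongrightarrow> f x"
    "\<And>i x. norm (s i x) \<le> 2 * norm (f x)"
    using borel_measurable_implies_sequence_metric[OF fm, of 0] by (auto simp: dist_norm)
  have sm [measurable]: "s i \<in> borel_measurable borel" for i by (rule borel_measurable_simple_function[OF s(1)])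
  \<comment> \<open>Restricting the simple approximations to \<open>{- real n..real n}\<close> makes
    each of them a finite combination of indicators of bounded sets. The factor 2 in
    \<open>bound\<close> comes from the approximation theorem.\<close>
  define F where "F n x = indicator {- real n..real n} x * s n x" for n x
  have bound: "norm (F n x) \<le> 2 * norm (f x)" for n x
    using s(3)[of n x] by (auto simp: F_def indicator_def)
  have Fm [measurable]: "F n \<in> borel_measurable borel" for n unfolding F_def by measurable
  have Q_F: "Q (F n)" for n
  proof -
    have fin: "finite (range (s n))" using simple_functionD(1)[OF s(1), of n] by simp
    have "F n = (\<lambda>x. \<Sum>y\<in>range (s n). y * indicator (s n -` {y} \<inter> {- real n..real n}) x)"
    proof
      fix x
      have "(\<Sum>y\<in>range (s n). y * indicator (s n -` {y} \<inter> {- real n..real n}) x)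
          = (\<Sum>y\<in>range (s n). if y = s n x then indicator {- real n..real n} x * y else 0)"
        by (rule sum.cong) (auto simp: indicator_def)
      then show "F n x = (\<Sum>y\<in>range (s n). y * indicator (s n -` {y} \<inter> {- real n..real n}) x)"
        using fin by (simp add: F_def)
    qed
    moreover have "s n -` {y} \<in> sets borel" for y
      using measurable_sets[OF sm, of "{y}" n] by simp
    then have "square_integrable (\<lambda>x. \<Sum>y\<in>range (s n). y * indicator (s n -` {y} \<inter> {- real n..real n}) x) \<and>
        Q (\<lambda>x. \<Sum>y\<in>range (s n). y * indicator (s n -` {y} \<inter> {- real n..real n}) x)"
      by (intro sum fin conjI square_integrable_mult_left scale si_ind Q_set)
    ultimately show ?thesis by simp
  qed
  show "Q f"
  proof (rule lim[OF _ Q_F f])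
    show "square_integrable (F n)" for n
      by (rule square_integrable_bound[OF Fm f bound])
    show "(\<lambda>n. l2n (\<lambda>x. F n x - f x)) \<longlonglongrightarrow> 0"
    proof (rule l2n_tendsto_0_dominated[OF _ f])
      show "(\<lambda>x. F n x - f x) \<in> borel_measurable borel" for n using fm by measurable
      show "norm (F n x - f x) \<le> 3 * norm (f x)" for n x
        using norm_triangle_ineq4[of "F n x" "f x"] bound[of n x] by simp
      show "AE x in lborel. (\<lambda>n. F n x - f x) \<longlonglongrightarrow> 0"
      proof (rule AE_I2)
        fix x
        obtain k :: nat where k: "\<bar>x\<bar> < real k" using reals_Archimedean2 by blast
        have "\<forall>\<^sub>F n in sequentially. s n x - f x = F n x - f x"
          using eventually_ge_at_top[of k] by (rule eventually_mono) (use k in \<open>auto simp: F_def indicator_def\<close>)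
        moreover have "(\<lambda>n. s n x - f x) \<longlonglongrightarrow> 0" using s(2)[of x] by (simp add: LIM_zero_iff)
        ultimately show "(\<lambda>n. F n x - f x) \<longlonglongrightarrow> 0" by (rule Lim_transform_eventually[rotated])
      qed
    qed
  qed
qed

section \<open>Plancherel's theorem\<close>

lemma cnj_measurable [measurable]: "cnj \<in> borel_measurable borel"
  by (intro borel_measurable_continuous_onI continuous_intros)

lemma fourier_measurable [measurable]:
  assumes [measurable]: "f \<in> borel_measurable borel"
  shows "fourier f \<in> borel_measurable borel"
  unfolding fourier_def by measurable

lemma norm_fourier_le:
  assumes "integrable lborel f"
  shows "norm (fourier f \<xi>) \<le> (LINT x|lborel. norm (f x))"
  unfolding fourier_def
  using integral_norm_bound[of lborel "\<lambda>x. f x * iexp (- (\<xi> * x))"] by (simp add: norm_mult)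

lemma integrable_fourier_integrand:
  assumes "integrable lborel f"
  shows "integrable lborel (\<lambda>x. f x * iexp (- (\<xi> * x)))"
proof (rule Bochner_Integration.integrable_bound[OF assms])
  have [measurable]: "f \<in> borel_measurable borel" using assms by auto
  show "(\<lambda>x. f x * iexp (- (\<xi> * x))) \<in> borel_measurable lborel" by measurable
qed (simp add: norm_mult)

lemma fourier_add:
  "integrable lborel f \<Longrightarrow> integrable lborel g \<Longrightarrow> fourier (\<lambda>x. f x + g x) \<xi> = fourier f \<xi> + fourier g \<xi>"
  unfolding fourier_def using integrable_fourier_integrand[of f \<xi>] integrable_fourier_integrand[of g \<xi>]
  by (simp add: distrib_right)

lemma fourier_diff:
  "integrable lborel f \<Longrightarrow> integrable lborel g \<Longrightarrow> fourier (\<lambda>x. f x - g x) \<xi> = fourier f \<xi> - fourier g \<xi>"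
  unfolding fourier_def using integrable_fourier_integrand[of f \<xi>] integrable_fourier_integrand[of g \<xi>]
  by (simp add: left_diff_distrib)

lemma fourier_cmult: "fourier (\<lambda>x. c * f x) \<xi> = c * fourier f \<xi>"
  unfolding fourier_def by (simp add: mult.assoc)

lemma fourier_cnj: "fourier (\<lambda>x. cnj (f x)) \<xi> = cnj (fourier f (- \<xi>))"
proof -
  have "fourier (\<lambda>x. cnj (f x)) \<xi> = (CLINT x|lborel. cnj (f x * iexp (- (- \<xi> * x))))"
    unfolding fourier_def by (simp add: exp_cnj)
  also have "\<dots> = cnj (fourier f (- \<xi>))"
    unfolding fourier_def by (rule Bochner_Integration.integral_cnj)
  finally show ?thesis .
qed

lemma fourier_cong_AE:
  assumes "AE x in lborel. f x = g x" "f \<in> borel_measurable borel" "g \<in> borel_measurable borel"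
  shows "fourier f = fourier g"
proof
  fix \<xi>
  have [measurable]: "f \<in> borel_measurable borel" "g \<in> borel_measurable borel" by fact+
  show "fourier f \<xi> = fourier g \<xi>"
    unfolding fourier_def
    by (rule integral_cong_AE) (use assms(1) in \<open>auto elim: eventually_mono\<close>)
qed

text \<open>Fubini: both sides iterate the absolutely integrable kernel
  \<open>f x * h \<xi> * iexp (- (\<xi> * x))\<close>.\<close>

lemma fourier_multiplication_formula:
  assumes f: "integrable lborel f" and h: "integrable lborel h"
  shows "(CLINT \<xi>|lborel. fourier f \<xi> * h \<xi>) = (CLINT x|lborel. f x * fourier h x)"
proof -
  have [measurable]: "f \<in> borel_measurable borel" "h \<in> borel_measurable borel" using f h by auto
  define k where "k x \<xi> = f x * h \<xi> * iexp (- (\<xi> * x))" for x \<xi>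
  have km: "case_prod k \<in> borel_measurable (lborel \<Otimes>\<^sub>M lborel)"
    unfolding k_def by measurable
  have k_int: "integrable (lborel \<Otimes>\<^sub>M lborel) (case_prod k)"
  proof (rule lborel_pair.Fubini_integrable[OF km])
    show "integrable lborel (\<lambda>x. LINT \<xi>|lborel. norm (case_prod k (x, \<xi>)))"
      using f by (simp add: k_def norm_mult)
    show "AE x in lborel. integrable lborel (\<lambda>\<xi>. case_prod k (x, \<xi>))"
    proof (rule AE_I2)
      fix x
      have "integrable lborel (\<lambda>\<xi>. f x * (h \<xi> * iexp (- (x * \<xi>))))"
        using integrable_fourier_integrand[OF h, of x] by simp
      then show "integrable lborel (\<lambda>\<xi>. case_prod k (x, \<xi>))"
        by (simp add: k_def mult_ac)
    qed
  qed
  have "fourier f \<xi> * h \<xi> = (CLINT x|lborel. k x \<xi>)" for \<xi>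
  proof -
    have "fourier f \<xi> * h \<xi> = (CLINT x|lborel. f x * iexp (- (\<xi> * x)) * h \<xi>)"
      unfolding fourier_def by simp
    then show ?thesis by (simp add: k_def mult_ac)
  qed
  then have "(CLINT \<xi>|lborel. fourier f \<xi> * h \<xi>) = (CLINT \<xi>|lborel. CLINT x|lborel. k x \<xi>)"
    by simp
  also have "\<dots> = (CLINT x|lborel. CLINT \<xi>|lborel. k x \<xi>)"
    by (rule lborel_pair.Fubini_integral[OF k_int])
  also have "\<dots> = (CLINT x|lborel. f x * fourier h x)"
  proof (rule Bochner_Integration.integral_cong[OF refl])
    fix x
    have "f x * fourier h x = (CLINT \<xi>|lborel. f x * (h \<xi> * iexp (- (x * \<xi>))))"
      unfolding fourier_def by simp
    also have "\<dots> = (CLINT \<xi>|lborel. k x \<xi>)"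
      unfolding k_def by (rule Bochner_Integration.integral_cong) (auto simp: mult_ac)
    finally show "(CLINT \<xi>|lborel. k x \<xi>) = f x * fourier h x" ..
  qed
  finally show ?thesis .
qed

section \<open>Gaussian damping and the \<open>L^2\<close> bound for the transform\<close>

abbreviation gauss :: "real \<Rightarrow> real \<Rightarrow> real" where
  "gauss \<delta> \<xi> \<equiv> exp (- ((\<delta> * \<xi>)\<^sup>2) / 2)"

lemma gauss_normal_density:
  assumes "\<delta> > 0"
  shows "gauss \<delta> \<xi> = sqrt (2 * pi) / \<delta> * normal_density 0 (1 / \<delta>) \<xi>"
  using assms by (simp add: normal_density_def power_mult_distrib real_sqrt_mult real_sqrt_divide field_simps)

lemma integrable_gauss: "\<delta> > 0 \<Longrightarrow> integrable lborel (gauss \<delta>)"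
  using integrable_normal_density[of "1 / \<delta>" 0] by (subst gauss_normal_density) auto

text \<open>After rescaling the variable by \<open>1 / \<delta>\<close> this is the characteristic
  function of the standard normal distribution. The Gaussian is thus, up to \<open>2 * pi\<close>,
  dual to a normal density of deviation \<delta>, which concentrates at 0 as \<delta> tends to
  0.\<close>

lemma fourier_gauss:
  assumes "\<delta> > 0"
  shows "(CLINT \<xi>|lborel. gauss \<delta> \<xi> * iexp (\<xi> * t)) = 2 * pi * normal_density 0 \<delta> t"
proof -
  have "(CLINT \<xi>|lborel. gauss \<delta> \<xi> * iexp (\<xi> * t)) =
      (1 / \<delta>) *\<^sub>R (CLINT x|lborel. complex_of_real (exp (- x\<^sup>2 / 2)) * iexp (t / \<delta> * x))"
    using assms by (subst lborel_integral_real_affine[of "1 / \<delta>" _ 0]) (auto simp: mult_ac)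
  also have "(CLINT x|lborel. complex_of_real (exp (- x\<^sup>2 / 2)) * iexp (t / \<delta> * x))
      = sqrt (2 * pi) * (CLINT x|lborel. std_normal_density x *\<^sub>R iexp (t / \<delta> * x))"
    unfolding std_normal_density_def
    by (subst integral_mult_right_zero[symmetric]) (simp add: scaleR_conv_of_real flip: of_real_mult)
  also have "(CLINT x|lborel. std_normal_density x *\<^sub>R iexp (t / \<delta> * x)) = char std_normal_distribution (t / \<delta>)"
    unfolding char_def by (subst integral_density) auto
  also have "\<dots> = complex_of_real (exp (- (t / \<delta>)\<^sup>2 / 2))"
    by (simp add: char_std_normal_distribution flip: exp_of_real)
  also have "(1 / \<delta>) *\<^sub>R (sqrt (2 * pi) * complex_of_real (exp (- (t / \<delta>)\<^sup>2 / 2))) = 2 * pi * normal_density 0 \<delta> t"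
  proof -
    have "sqrt (2 * pi * \<delta>\<^sup>2) = sqrt (2 * pi) * \<delta>" using assms by (simp add: real_sqrt_mult)
    moreover have "1 / \<delta> * a = a * a * (1 / (a * \<delta>))" if "a > 0" for a
      using that assms by (simp add: field_simps)
    from this[of "sqrt (2 * pi)"]
    have "1 / \<delta> * sqrt (2 * pi) = 2 * pi * (1 / (sqrt (2 * pi) * \<delta>))" by simp
    ultimately have "1 / \<delta> * sqrt (2 * pi) = 2 * pi * (1 / sqrt (2 * pi * \<delta>\<^sup>2))" by simp
    then have "1 / \<delta> * sqrt (2 * pi) * e = 2 * pi * (1 / sqrt (2 * pi * \<delta>\<^sup>2)) * e" for e by simp
    then have "(1 / \<delta>) * (sqrt (2 * pi) * exp (- (t / \<delta>)\<^sup>2 / 2)) = 2 * pi * normal_density 0 \<delta> t"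
      unfolding normal_density_def mult.assoc[symmetric] by (simp add: power_divide del: real_sqrt_mult)
    from arg_cong[OF this, of complex_of_real] show ?thesis
      by (simp only: scaleR_conv_of_real of_real_mult)
  qed
  finally show ?thesis .
qed

text \<open>The Gaussian makes the transform side absolutely integrable, so that the multiplication
  formula applies; its price is that \<open>g\<close> is averaged against a normal density. Letting
  \<delta> tend to 0 turns this into Parseval's identity.\<close>

lemma gauss_parseval:
  assumes f: "integrable lborel f" and g: "integrable lborel g" and \<delta>: "\<delta> > 0"
  shows "(CLINT \<xi>|lborel. fourier f \<xi> * (cnj (fourier g \<xi>) * gauss \<delta> \<xi>)) =
    2 * pi * (CLINT x|lborel. f x * (CLINT y|lborel. cnj (g y) * normal_density x \<delta> y))"
proof -
  have [measurable]: "f \<in> borel_measurable borel" "g \<in> borel_measurable borel" using f g by auto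
  have gi: "integrable lborel (\<lambda>\<xi>. complex_of_real (gauss \<delta> \<xi>))" using integrable_gauss[OF \<delta>] by simp
  have h: "integrable lborel (\<lambda>\<xi>. cnj (fourier g \<xi>) * gauss \<delta> \<xi>)"
  proof (rule Bochner_Integration.integrable_bound)
    show "integrable lborel (\<lambda>\<xi>. (LINT x|lborel. norm (g x)) * gauss \<delta> \<xi>)" using integrable_gauss[OF \<delta>] by simp
    show "AE \<xi> in lborel. norm (cnj (fourier g \<xi>) * gauss \<delta> \<xi>) \<le> norm ((LINT x|lborel. norm (g x)) * gauss \<delta> \<xi>)"
      using norm_fourier_le[OF g] by (auto simp: norm_mult intro!: mult_right_mono order_trans[OF _ abs_ge_self])
  qed measurable
  have "fourier (\<lambda>\<xi>. cnj (fourier g \<xi>) * gauss \<delta> \<xi>) x =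
      2 * pi * (CLINT y|lborel. cnj (g y) * normal_density x \<delta> y)" for x
  proof -
    define k where "k \<xi> = gauss \<delta> \<xi> * iexp (\<xi> * x)" for \<xi>
    have k: "integrable lborel k"
      unfolding k_def using integrable_fourier_integrand[OF gi, of "- x"] by (simp add: mult.commute[of x])
    have "fourier k y = 2 * pi * normal_density x \<delta> y" for y
    proof -
      have "fourier k y = (CLINT \<xi>|lborel. gauss \<delta> \<xi> * iexp (\<xi> * (x - y)))"
        unfolding fourier_def k_def
        by (rule Bochner_Integration.integral_cong)
          (auto simp: algebra_simps simp flip: exp_add of_real_mult)
      then show ?thesis
        using fourier_gauss[OF \<delta>, of "x - y"] by (simp add: normal_density_def power2_commute)
    qed
    then have "(CLINT y|lborel. g y * fourier k y) = (CLINT y|lborel. 2 * pi * (g y * normal_density x \<delta> y))"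
      by (intro Bochner_Integration.integral_cong) (simp_all add: mult_ac)
    then have gk: "(CLINT y|lborel. g y * fourier k y) = 2 * pi * (CLINT y|lborel. g y * normal_density x \<delta> y)"
      by simp
    have "fourier (\<lambda>\<xi>. cnj (fourier g \<xi>) * gauss \<delta> \<xi>) x = (CLINT \<xi>|lborel. cnj (fourier g \<xi> * k \<xi>))"
      unfolding fourier_def[of _ x]
      by (intro Bochner_Integration.integral_cong) (simp_all add: k_def exp_cnj mult_ac)
    also have "\<dots> = cnj (CLINT \<xi>|lborel. fourier g \<xi> * k \<xi>)"
      by (rule Bochner_Integration.integral_cnj)
    also have "\<dots> = 2 * pi * cnj (CLINT y|lborel. g y * normal_density x \<delta> y)"
      unfolding fourier_multiplication_formula[OF g k] gk by simp
    also have "cnj (CLINT y|lborel. g y * normal_density x \<delta> y) = (CLINT y|lborel. cnj (g y * normal_density x \<delta> y))"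
      by (rule Bochner_Integration.integral_cnj[symmetric])
    finally show ?thesis by simp
  qed
  then have "(CLINT x|lborel. f x * fourier (\<lambda>\<xi>. cnj (fourier g \<xi>) * gauss \<delta> \<xi>) x) =
      (CLINT x|lborel. 2 * pi * (f x * (CLINT y|lborel. cnj (g y) * normal_density x \<delta> y)))"
    by (intro Bochner_Integration.integral_cong) (simp_all add: mult_ac)
  then show ?thesis
    unfolding fourier_multiplication_formula[OF f h] by simp
qed

lemma ennreal_norm_integral_le:
  fixes f :: "'a \<Rightarrow> 'b::{banach, second_countable_topology}"
  shows "ennreal (norm (integral\<^sup>L M f)) \<le> (\<integral>\<^sup>+x. ennreal (norm (f x)) \<partial>M)"
  by (cases "integrable M f") (auto simp: integral_norm_bound_ennreal not_integrable_integral_eq)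

lemma emeasure_lborel_interval_finite: "emeasure lborel {a..b::real} < \<infinity>"
  by (rule emeasure_lborel_Icc_eq[THEN ord_eq_less_trans]) simp

lemma integrable_interval_indicator: "integrable lborel (indicator {a..b::real} :: real \<Rightarrow> complex)"
proof -
  have "integrable lborel (\<lambda>x. complex_of_real (indicator {a..b} x))"
    using emeasure_lborel_interval_finite[of a b]
    by (intro integrable_of_real) (simp add: integrable_indicator_iff)
  then show ?thesis by (simp add: of_real_indicator)
qed

lemma square_integrable_interval_indicator:
  "square_integrable (indicator {a..b} :: real \<Rightarrow> 'a::{real_normed_field, second_countable_topology})"
  by (rule square_integrable_indicator[OF _ emeasure_lborel_interval_finite]) simp

lemma nn_integral_normal_density:
  assumes "\<delta> > 0"
  shows "(\<integral>\<^sup>+x. ennreal (normal_density \<mu> \<delta> x) \<partial>lborel) = 1"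
  using assms by (simp add: nn_integral_eq_integral integral_normal_density integrable_normal_density)

lemma normal_density_commute: "normal_density x \<delta> y = normal_density y \<delta> x"
  by (simp add: normal_density_def power2_commute)

text \<open>The damped identity with \<open>g = f\<close> bounds the damped transform, because
  averaging against a symmetric probability density does not increase the quadratic form; Fatou then
  removes the damping.\<close>

lemma fourier_l2n_le:
  assumes f: "integrable lborel f" and f2: "square_integrable f"
  shows "square_integrable (fourier f)" "l2n (fourier f) \<le> sqrt (2 * pi) * l2n f"
proof -
  have [measurable]: "f \<in> borel_measurable borel" using f by auto
  define d where "d n = 1 / real (Suc n)" for n
  have d_pos: "d n > 0" for n by (simp add: d_def)
  have d_lim: "d \<longlonglongrightarrow> 0" unfolding d_def using LIMSEQ_inverse_real_of_nat by (simp add: inverse_eq_divide)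
  have bound: "(\<integral>\<^sup>+\<xi>. ennreal ((norm (fourier f \<xi>))\<^sup>2 * gauss \<delta> \<xi>) \<partial>lborel) \<le> ennreal (2 * pi * (l2n f)\<^sup>2)"
    if \<delta>: "\<delta> > 0" for \<delta>
  proof -
    let ?N = "\<lambda>x y. normal_density x \<delta> y"
    define I where "I = (CLINT x|lborel. f x * (CLINT y|lborel. cnj (f y) * ?N x y))"
    have "integrable lborel (\<lambda>\<xi>. (norm (fourier f \<xi>))\<^sup>2 * gauss \<delta> \<xi>)"
    proof (rule Bochner_Integration.integrable_bound)
      show "integrable lborel (\<lambda>\<xi>. (LINT x|lborel. norm (f x))\<^sup>2 * gauss \<delta> \<xi>)" using integrable_gauss[OF \<delta>] by simp
      show "AE \<xi> in lborel. norm ((norm (fourier f \<xi>))\<^sup>2 * gauss \<delta> \<xi>) \<le> norm ((LINT x|lborel. norm (f x))\<^sup>2 * gauss \<delta> \<xi>)"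
        using norm_fourier_le[OF f] by (auto simp: norm_mult intro!: mult_right_mono power_mono)
    qed measurable
    then have "(\<integral>\<^sup>+\<xi>. ennreal ((norm (fourier f \<xi>))\<^sup>2 * gauss \<delta> \<xi>) \<partial>lborel)
        = ennreal (LINT \<xi>|lborel. (norm (fourier f \<xi>))\<^sup>2 * gauss \<delta> \<xi>)"
      by (intro nn_integral_eq_integral) auto
    also have "\<dots> = ennreal (norm (complex_of_real (LINT \<xi>|lborel. (norm (fourier f \<xi>))\<^sup>2 * gauss \<delta> \<xi>)))"
      by (simp add: norm_of_real integral_nonneg_AE)
    also have "complex_of_real (LINT \<xi>|lborel. (norm (fourier f \<xi>))\<^sup>2 * gauss \<delta> \<xi>)
        = (CLINT \<xi>|lborel. fourier f \<xi> * (cnj (fourier f \<xi>) * gauss \<delta> \<xi>))"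
      by (subst integral_complex_of_real[symmetric], intro Bochner_Integration.integral_cong)
        (simp_all add: complex_norm_square[symmetric] mult.assoc[symmetric])
    also have "\<dots> = complex_of_real (2 * pi) * I"
      unfolding gauss_parseval[OF f f \<delta>] I_def by simp
    also have "ennreal (norm (complex_of_real (2 * pi) * I)) = ennreal (2 * pi) * ennreal (norm I)"
      by (simp add: norm_mult ennreal_mult)
    also have "ennreal (norm I) \<le> (\<integral>\<^sup>+x. \<integral>\<^sup>+y. ennreal (norm (f x) * norm (f y) * ?N x y) \<partial>lborel \<partial>lborel)"
      unfolding I_def
    proof (rule order_trans[OF ennreal_norm_integral_le], rule nn_integral_mono)
      fix x
      have "ennreal (norm (f x * (CLINT y|lborel. cnj (f y) * ?N x y)))
          = ennreal (norm (f x)) * ennreal (norm (CLINT y|lborel. cnj (f y) * ?N x y))"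
        by (simp add: norm_mult ennreal_mult)
      also have "\<dots> \<le> ennreal (norm (f x)) * (\<integral>\<^sup>+y. ennreal (norm (cnj (f y) * ?N x y)) \<partial>lborel)"
        by (intro mult_left_mono ennreal_norm_integral_le) auto
      also have "\<dots> = (\<integral>\<^sup>+y. ennreal (norm (f x)) * ennreal (norm (cnj (f y) * ?N x y)) \<partial>lborel)"
        by (rule nn_integral_cmult[symmetric]) measurable
      also have "\<dots> = (\<integral>\<^sup>+y. ennreal (norm (f x) * norm (f y) * ?N x y) \<partial>lborel)"
        by (intro nn_integral_cong) (simp add: norm_mult mult.assoc ennreal_mult)
      finally show "ennreal (norm (f x * (CLINT y|lborel. cnj (f y) * ?N x y)))
          \<le> (\<integral>\<^sup>+y. ennreal (norm (f x) * norm (f y) * ?N x y) \<partial>lborel)" .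
    qed
    \<comment> \<open>\<open>ab \<le> (a\<^sup>2 + b\<^sup>2) / 2\<close> splits the double integral
      into two terms; in each, the symmetric normal density can be integrated out and contributes
      1.\<close>
    also have "\<dots> \<le> (\<integral>\<^sup>+x. \<integral>\<^sup>+y. ennreal ((norm (f x))\<^sup>2 / 2) * ennreal (?N x y) + ennreal ((norm (f y))\<^sup>2 / 2) * ennreal (?N y x) \<partial>lborel \<partial>lborel)"
    proof (intro nn_integral_mono)
      fix x y
      have "norm (f x) * norm (f y) \<le> (norm (f x))\<^sup>2 / 2 + (norm (f y))\<^sup>2 / 2"
        using sum_squares_bound[of "norm (f x)" "norm (f y)"] by simp
      then have "norm (f x) * norm (f y) * ?N x y \<le> ((norm (f x))\<^sup>2 / 2 + (norm (f y))\<^sup>2 / 2) * ?N x y"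
        by (rule mult_right_mono) simp
      also have "\<dots> = (norm (f x))\<^sup>2 / 2 * ?N x y + (norm (f y))\<^sup>2 / 2 * ?N y x"
        by (simp add: distrib_right normal_density_commute[of y])
      finally show "ennreal (norm (f x) * norm (f y) * ?N x y)
          \<le> ennreal ((norm (f x))\<^sup>2 / 2) * ennreal (?N x y) + ennreal ((norm (f y))\<^sup>2 / 2) * ennreal (?N y x)"
        by (simp add: ennreal_leI flip: ennreal_mult ennreal_plus)
    qed
    also have "\<dots> = (\<integral>\<^sup>+x. \<integral>\<^sup>+y. ennreal ((norm (f x))\<^sup>2 / 2) * ennreal (?N x y) \<partial>lborel \<partial>lborel)
        + (\<integral>\<^sup>+x. \<integral>\<^sup>+y. ennreal ((norm (f y))\<^sup>2 / 2) * ennreal (?N y x) \<partial>lborel \<partial>lborel)"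
      by (simp add: nn_integral_add normal_density_def)
    also have "(\<integral>\<^sup>+x. \<integral>\<^sup>+y. ennreal ((norm (f y))\<^sup>2 / 2) * ennreal (?N y x) \<partial>lborel \<partial>lborel)
        = (\<integral>\<^sup>+y. \<integral>\<^sup>+x. ennreal ((norm (f y))\<^sup>2 / 2) * ennreal (?N y x) \<partial>lborel \<partial>lborel)"
      by (rule lborel_pair.Fubini') (simp add: normal_density_def)
    also have "(\<integral>\<^sup>+x. \<integral>\<^sup>+y. ennreal ((norm (f x))\<^sup>2 / 2) * ennreal (?N x y) \<partial>lborel \<partial>lborel)
        = (\<integral>\<^sup>+x. ennreal ((norm (f x))\<^sup>2 / 2) \<partial>lborel)"
      by (simp add: nn_integral_cmult nn_integral_normal_density[OF \<delta>])
    also have "(\<integral>\<^sup>+x. ennreal ((norm (f x))\<^sup>2 / 2) \<partial>lborel) + (\<integral>\<^sup>+x. ennreal ((norm (f x))\<^sup>2 / 2) \<partial>lborel)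
        = (\<integral>\<^sup>+x. ennreal ((norm (f x))\<^sup>2) \<partial>lborel)"
      by (subst nn_integral_add[symmetric]) (auto simp flip: ennreal_plus)
    also have "\<dots> = ennreal ((l2n f)\<^sup>2)" by (rule nn_integral_square_integrable[OF f2])
    also have "ennreal (2 * pi) * ennreal ((l2n f)\<^sup>2) = ennreal (2 * pi * (l2n f)\<^sup>2)"
      by (simp add: ennreal_mult)
    finally show ?thesis by (simp add: mult_left_mono)
  qed
  have "(\<integral>\<^sup>+\<xi>. ennreal ((norm (fourier f \<xi>))\<^sup>2) \<partial>lborel)
      = (\<integral>\<^sup>+\<xi>. liminf (\<lambda>n. ennreal ((norm (fourier f \<xi>))\<^sup>2 * gauss (d n) \<xi>)) \<partial>lborel)"
  proof (rule nn_integral_cong)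
    fix \<xi>
    have "(\<lambda>n. (norm (fourier f \<xi>))\<^sup>2 * gauss (d n) \<xi>) \<longlonglongrightarrow> (norm (fourier f \<xi>))\<^sup>2 * exp (- ((0 * \<xi>)\<^sup>2) / 2)"
      by (intro tendsto_intros d_lim) simp
    then have "(\<lambda>n. ennreal ((norm (fourier f \<xi>))\<^sup>2 * gauss (d n) \<xi>)) \<longlonglongrightarrow> ennreal ((norm (fourier f \<xi>))\<^sup>2)"
      by (intro tendsto_ennrealI) simp
    then show "ennreal ((norm (fourier f \<xi>))\<^sup>2) = liminf (\<lambda>n. ennreal ((norm (fourier f \<xi>))\<^sup>2 * gauss (d n) \<xi>))"
      by (intro lim_imp_Liminf[symmetric]) auto
  qed
  also have "\<dots> \<le> liminf (\<lambda>n. \<integral>\<^sup>+\<xi>. ennreal ((norm (fourier f \<xi>))\<^sup>2 * gauss (d n) \<xi>) \<partial>lborel)"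
    by (rule nn_integral_liminf) measurable
  also have "\<dots> \<le> ennreal (2 * pi * (l2n f)\<^sup>2)"
  proof (rule Liminf_le)
    show "\<forall>\<^sub>F n in sequentially. (\<integral>\<^sup>+\<xi>. ennreal ((norm (fourier f \<xi>))\<^sup>2 * gauss (d n) \<xi>) \<partial>lborel) \<le> ennreal (2 * pi * (l2n f)\<^sup>2)"
      by (intro always_eventually allI bound d_pos)
  qed simp
  also have "2 * pi * (l2n f)\<^sup>2 = (sqrt (2 * pi) * l2n f)\<^sup>2" by (simp add: power_mult_distrib)
  finally have *: "(\<integral>\<^sup>+\<xi>. ennreal ((norm (fourier f \<xi>))\<^sup>2) \<partial>lborel) \<le> ennreal ((sqrt (2 * pi) * l2n f)\<^sup>2)" .
  show "square_integrable (fourier f)" "l2n (fourier f) \<le> sqrt (2 * pi) * l2n f"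
    by (rule square_integrable_nn_integral[OF _ *]; simp)+
qed

text \<open>Both sides of the damped identity converge: on the transform side the majorant is the
  product of two square integrable transforms; on the other the averages of an indicator are bounded
  by 1 and converge away from the end points \<open>a\<close> and \<open>b\<close>. Indicators
  suffice, since the general case follows by density.\<close>

lemma fourier_parseval_interval:
  fixes a b :: real
  assumes f: "integrable lborel f" and f2: "square_integrable f"
  defines "g \<equiv> indicator {a..b} :: real \<Rightarrow> complex"
  shows "(CLINT \<xi>|lborel. fourier f \<xi> * cnj (fourier g \<xi>)) = 2 * pi * (CLINT x|lborel. f x * cnj (g x))"
proof -
  have [measurable]: "f \<in> borel_measurable borel" using f by auto
  have gm [measurable]: "g \<in> borel_measurable borel" unfolding g_def by simp
  have g2: "square_integrable g" unfolding g_def by (rule square_integrable_interval_indicator)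
  have g1: "integrable lborel g"
    unfolding g_def by (rule integrable_interval_indicator)
  have g_le: "norm (g x) \<le> 1" for x by (simp add: g_def indicator_def)
  define d where "d n = 1 / real (Suc n)" for n
  have d_pos: "d n > 0" for n by (simp add: d_def)
  have d_lim: "d \<longlonglongrightarrow> 0" unfolding d_def using LIMSEQ_inverse_real_of_nat by (simp add: inverse_eq_divide)
  have int: "integrable lborel (\<lambda>\<xi>. fourier f \<xi> * cnj (fourier g \<xi>))"
    using integrable_prod_square_integrable[OF fourier_l2n_le(1)[OF f f2], of "\<lambda>\<xi>. cnj (fourier g \<xi>)"]
      square_integrable_bound[OF _ fourier_l2n_le(1)[OF g1 g2], of "\<lambda>\<xi>. cnj (fourier g \<xi>)" 1] by simp
  have L: "(\<lambda>n. CLINT \<xi>|lborel. fourier f \<xi> * (cnj (fourier g \<xi>) * gauss (d n) \<xi>)) \<longlonglongrightarrow>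
      (CLINT \<xi>|lborel. fourier f \<xi> * cnj (fourier g \<xi>))"
  proof (rule integral_dominated_convergence[where w = "\<lambda>\<xi>. norm (fourier f \<xi> * cnj (fourier g \<xi>))"])
    show "integrable lborel (\<lambda>\<xi>. norm (fourier f \<xi> * cnj (fourier g \<xi>)))" using int by simp
    show "AE \<xi> in lborel. (\<lambda>n. fourier f \<xi> * (cnj (fourier g \<xi>) * gauss (d n) \<xi>)) \<longlonglongrightarrow> fourier f \<xi> * cnj (fourier g \<xi>)"
    proof (rule AE_I2)
      fix \<xi>
      have "(\<lambda>n. fourier f \<xi> * (cnj (fourier g \<xi>) * gauss (d n) \<xi>))
          \<longlonglongrightarrow> fourier f \<xi> * (cnj (fourier g \<xi>) * of_real (exp (- ((0 * \<xi>)\<^sup>2) / 2)))"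
        by (intro tendsto_intros d_lim) simp
      then show "(\<lambda>n. fourier f \<xi> * (cnj (fourier g \<xi>) * gauss (d n) \<xi>)) \<longlonglongrightarrow> fourier f \<xi> * cnj (fourier g \<xi>)" by simp
    qed
    show "AE \<xi> in lborel. norm (fourier f \<xi> * (cnj (fourier g \<xi>) * gauss (d n) \<xi>)) \<le> norm (fourier f \<xi> * cnj (fourier g \<xi>))" for n
    proof (rule AE_I2)
      fix \<xi>
      have "norm (complex_of_real (gauss (d n) \<xi>)) \<le> 1" by simp
      from mult_left_mono[OF this, of "norm (fourier f \<xi>) * norm (fourier g \<xi>)"]
      show "norm (fourier f \<xi> * (cnj (fourier g \<xi>) * gauss (d n) \<xi>)) \<le> norm (fourier f \<xi> * cnj (fourier g \<xi>))"
        by (simp add: norm_mult mult.assoc)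
    qed
  qed measurable
  define G where "G n x = (CLINT y|lborel. cnj (g y) * normal_density x (d n) y)" for n x
  \<comment> \<open>The substitution \<open>y = x + d n * z\<close> moves all dependence on
    \<open>n\<close> into the argument of \<open>g\<close>, so that one standard normal density
    dominates all integrands.\<close>
  have G_eq: "G n x = (CLINT z|lborel. cnj (g (x + d n * z)) * std_normal_density z)" for n x
  proof -
    have "G n x = \<bar>d n\<bar> *\<^sub>R (CLINT z|lborel. cnj (g (x + d n * z)) * normal_density x (d n) (x + d n * z))"
      unfolding G_def using d_pos[of n] by (subst lborel_integral_real_affine[of "d n" _ x]) auto
    also have "\<dots> = (CLINT z|lborel. d n *\<^sub>R (cnj (g (x + d n * z)) * normal_density x (d n) (x + d n * z)))"
      using d_pos[of n] by simp
    also have "\<dots> = (CLINT z|lborel. cnj (g (x + d n * z)) * std_normal_density z)"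
    proof (rule Bochner_Integration.integral_cong[OF refl])
      fix z
      have "d n * normal_density x (d n) (x + d n * z) = std_normal_density z"
        using d_pos[of n] by (simp add: normal_density_def real_sqrt_mult power_mult_distrib)
      from arg_cong[OF this, of complex_of_real]
      show "d n *\<^sub>R (cnj (g (x + d n * z)) * normal_density x (d n) (x + d n * z)) = cnj (g (x + d n * z)) * std_normal_density z"
        by (simp add: scaleR_conv_of_real mult_ac)
    qed
    finally show ?thesis .
  qed
  have ni: "integrable lborel (\<lambda>z. complex_of_real (std_normal_density z))"
    using integrable_normal_density[of 1 0] by simp
  have n1: "(LINT z|lborel. std_normal_density z) = 1"
    using integral_normal_density[of 1 0] by simp
  have G_le: "norm (G n x) \<le> 1" for n x
  proof -
    have "norm (G n x) \<le> (LINT z|lborel. norm (cnj (g (x + d n * z)) * std_normal_density z))"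
      unfolding G_eq by (rule integral_norm_bound)
    also have "\<dots> \<le> (LINT z|lborel. std_normal_density z)"
    proof (rule integral_mono)
      show "integrable lborel (\<lambda>z. norm (cnj (g (x + d n * z)) * std_normal_density z))"
        by (rule integrable_norm, rule Bochner_Integration.integrable_bound[OF ni])
          (auto simp: norm_mult intro!: mult_left_le_one_le g_le)
      show "integrable lborel (\<lambda>z. std_normal_density z)" using integrable_normal_density[of 1 0] by simp
      show "norm (cnj (g (x + d n * z)) * std_normal_density z) \<le> std_normal_density z" for z
        by (auto simp: norm_mult intro!: mult_left_le_one_le g_le)
    qed
    finally show ?thesis by (simp add: n1)
  qed
  have G_lim: "(\<lambda>n. G n x) \<longlonglongrightarrow> cnj (g x)" if xab: "x \<noteq> a" "x \<noteq> b" for x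
  proof -
    have "(\<lambda>n. G n x) \<longlonglongrightarrow> (CLINT z|lborel. cnj (g x) * std_normal_density z)"
      unfolding G_eq
    proof (rule integral_dominated_convergence[where w = std_normal_density])
      show "AE z in lborel. (\<lambda>n. cnj (g (x + d n * z)) * std_normal_density z) \<longlonglongrightarrow> cnj (g x) * std_normal_density z"
      proof (rule AE_I2)
        fix z
        have lim: "(\<lambda>n. x + d n * z) \<longlonglongrightarrow> x + 0 * z" by (intro tendsto_intros d_lim)
        have "\<forall>\<^sub>F n in sequentially. g (x + d n * z) = g x"
        proof -
          consider "x < a" | "a < x \<and> x < b" | "x > b" using xab by linarith
          then show ?thesis
          proof cases
            case 1
            then have "\<forall>\<^sub>F n in sequentially. x + d n * z < a" using order_tendstoD(2)[OF lim] by simp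
            then show ?thesis by (rule eventually_mono) (use 1 in \<open>auto simp: g_def\<close>)
          next
            case 2
            then have "\<forall>\<^sub>F n in sequentially. a < x + d n * z" "\<forall>\<^sub>F n in sequentially. x + d n * z < b"
              using order_tendstoD[OF lim] by simp_all
            then show ?thesis by eventually_elim (use 2 in \<open>auto simp: g_def indicator_def\<close>)
          next
            case 3
            then have "\<forall>\<^sub>F n in sequentially. b < x + d n * z" using order_tendstoD(1)[OF lim] by simp
            then show ?thesis by (rule eventually_mono) (use 3 in \<open>auto simp: g_def\<close>)
          qed
        qed
        then have "\<forall>\<^sub>F n in sequentially. cnj (g x) * std_normal_density z = cnj (g (x + d n * z)) * std_normal_density z"
          by (rule eventually_mono) simp
        then show "(\<lambda>n. cnj (g (x + d n * z)) * std_normal_density z) \<longlonglongrightarrow> cnj (g x) * std_normal_density z"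
          by (rule Lim_transform_eventually[OF tendsto_const])
      qed
      show "AE z in lborel. norm (cnj (g (x + d n * z)) * std_normal_density z) \<le> std_normal_density z" for n
        by (auto simp: norm_mult intro!: mult_left_le_one_le g_le)
      show "integrable lborel std_normal_density" using integrable_normal_density[of 1 0] by simp
    qed measurable
    also have "(CLINT z|lborel. cnj (g x) * std_normal_density z) = cnj (g x)"
      by (simp add: n1)
    finally show ?thesis .
  qed
  have Gm [measurable]: "G n \<in> borel_measurable borel" for n
    unfolding G_def normal_density_def by measurable
  have R: "(\<lambda>n. CLINT x|lborel. f x * G n x) \<longlonglongrightarrow> (CLINT x|lborel. f x * cnj (g x))"
  proof (rule integral_dominated_convergence[where w = "\<lambda>x. norm (f x)"])
    have "AE x in lborel. x \<noteq> a" "AE x in lborel. x \<noteq> b" by (rule AE_lborel_singleton)+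
    then show "AE x in lborel. (\<lambda>n. f x * G n x) \<longlonglongrightarrow> f x * cnj (g x)"
      by eventually_elim (intro tendsto_intros G_lim)
    show "AE x in lborel. norm (f x * G n x) \<le> norm (f x)" for n
      by (auto simp: norm_mult intro!: mult_left_le G_le)
    show "integrable lborel (\<lambda>x. norm (f x))" using f by simp
  qed measurable
  have R': "(\<lambda>n. 2 * pi * (CLINT x|lborel. f x * G n x)) \<longlonglongrightarrow> 2 * pi * (CLINT x|lborel. f x * cnj (g x))"
    by (intro tendsto_intros R)
  have eq: "(CLINT \<xi>|lborel. fourier f \<xi> * (cnj (fourier g \<xi>) * gauss (d n) \<xi>)) = 2 * pi * (CLINT x|lborel. f x * G n x)" for n
    unfolding G_def by (rule gauss_parseval[OF f g1 d_pos])
  show ?thesis by (rule LIMSEQ_unique[OF L[unfolded eq] R'])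
qed

section \<open>Extension of the transform to \<open>L^2\<close>\<close>

definition cut :: "real \<Rightarrow> (real \<Rightarrow> complex) \<Rightarrow> real \<Rightarrow> complex" where
  "cut R f x = indicator {-R..R} x * f x"

lemma cut_measurable [measurable]: "f \<in> borel_measurable borel \<Longrightarrow> cut R f \<in> borel_measurable borel"
  unfolding cut_def by measurable

lemma square_integrable_cut: "square_integrable f \<Longrightarrow> square_integrable (cut R f)"
  using square_integrable_indicator_mult[of f "{-R..R}"] by (simp add: cut_def[abs_def])

lemma integrable_cut: "square_integrable f \<Longrightarrow> integrable lborel (cut R f)"
  using integrable_indicator_mult_square_integrable[of f "{-R..R}"] emeasure_lborel_interval_finite[of "-R" R]
  by (simp add: cut_def[abs_def])

lemma norm_cut_le: "norm (cut R f x) \<le> norm (f x)"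
  by (simp add: cut_def indicator_def)

lemma cut_tendsto:
  assumes f: "square_integrable f"
  shows "((\<lambda>R. l2n (\<lambda>x. cut R f x - f x)) \<longlongrightarrow> 0) at_top"
proof (rule tendsto_at_topI_sequentially)
  fix X :: "nat \<Rightarrow> real" assume X: "filterlim X at_top sequentially"
  have [measurable]: "f \<in> borel_measurable borel" using f by auto
  show "(\<lambda>n. l2n (\<lambda>x. cut (X n) f x - f x)) \<longlonglongrightarrow> 0"
  proof (rule l2n_tendsto_0_dominated[where c = 1, OF _ f])
    show "norm (cut (X n) f x - f x) \<le> 1 * norm (f x)" for n x by (simp add: cut_def indicator_def)
    show "AE x in lborel. (\<lambda>n. cut (X n) f x - f x) \<longlonglongrightarrow> 0"
    proof (rule AE_I2)
      fix x
      have "\<forall>\<^sub>F n in sequentially. X n \<ge> \<bar>x\<bar>" using X by (simp add: filterlim_at_top)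
      then have "\<forall>\<^sub>F n in sequentially. cut (X n) f x - f x = 0"
        by (rule eventually_mono) (auto simp: cut_def indicator_def)
      then show "(\<lambda>n. cut (X n) f x - f x) \<longlonglongrightarrow> 0" by (rule tendsto_eventually)
    qed
  qed simp
qed

text \<open>Real form of the defining limit: for square integrable \<open>f\<close> and
  \<open>F\<close> each difference has finite norm, so the extended integrals are squares of
  \<open>l2n\<close>.\<close>

lemma is_fourier_L2_iff:
  "is_fourier_L2 f F \<longleftrightarrow> square_integrable f \<and> square_integrable F \<and>
    ((\<lambda>R. l2n (\<lambda>\<xi>. F \<xi> - fourier (cut R f) \<xi>)) \<longlongrightarrow> 0) at_top"
proof (cases "square_integrable f \<and> square_integrable F")
  case True
  then have "square_integrable (\<lambda>\<xi>. F \<xi> - fourier (cut R f) \<xi>)" for R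
    by (intro square_integrable_diff fourier_l2n_le integrable_cut square_integrable_cut) auto
  then have eq: "(\<integral>\<^sup>+\<xi>. ennreal ((norm (F \<xi> - fourier (\<lambda>x. indicator {-R..R} x * f x) \<xi>))\<^sup>2) \<partial>lborel)
      = ennreal ((l2n (\<lambda>\<xi>. F \<xi> - fourier (cut R f) \<xi>))\<^sup>2)" for R
    using nn_integral_square_integrable[of "\<lambda>\<xi>. F \<xi> - fourier (cut R f) \<xi>"] by (simp add: cut_def[abs_def])
  have "((\<lambda>R. ennreal ((l2n (\<lambda>\<xi>. F \<xi> - fourier (cut R f) \<xi>))\<^sup>2)) \<longlongrightarrow> ennreal 0) at_top
      \<longleftrightarrow> ((\<lambda>R. (l2n (\<lambda>\<xi>. F \<xi> - fourier (cut R f) \<xi>))\<^sup>2) \<longlongrightarrow> 0) at_top"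
    by (rule tendsto_ennreal_iff) auto
  also have "\<dots> \<longleftrightarrow> ((\<lambda>R. l2n (\<lambda>\<xi>. F \<xi> - fourier (cut R f) \<xi>)) \<longlongrightarrow> 0) at_top"
    using tendsto_real_sqrt[of "\<lambda>R. (l2n (\<lambda>\<xi>. F \<xi> - fourier (cut R f) \<xi>))\<^sup>2" 0 at_top]
      tendsto_power[of "\<lambda>R. l2n (\<lambda>\<xi>. F \<xi> - fourier (cut R f) \<xi>)" 0 at_top 2] by auto
  finally show ?thesis using True unfolding is_fourier_L2_def eq by simp
qed (auto simp: is_fourier_L2_def)

lemma is_fourier_L2_D:
  "is_fourier_L2 f F \<Longrightarrow> square_integrable f" "is_fourier_L2 f F \<Longrightarrow> square_integrable F"
  by (auto simp: is_fourier_L2_def)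

lemma fourier_diff_fun:
  "integrable lborel f \<Longrightarrow> integrable lborel g \<Longrightarrow> fourier (\<lambda>x. f x - g x) = (\<lambda>\<xi>. fourier f \<xi> - fourier g \<xi>)"
  by (rule ext) (rule fourier_diff)

lemma fourier_cut_diff_le:
  assumes "square_integrable f"
  shows "l2n (\<lambda>\<xi>. fourier (cut R f) \<xi> - fourier (cut S f) \<xi>) \<le> sqrt (2 * pi) * l2n (\<lambda>x. cut R f x - cut S f x)"
  using fourier_l2n_le(2)[of "\<lambda>x. cut R f x - cut S f x"] assms
  by (simp add: fourier_diff_fun integrable_cut square_integrable_cut square_integrable_diff)

text \<open>The \<open>L^2\<close> bound makes the transforms of the truncations a Cauchy
  family.\<close>

lemma is_fourier_L2_exists:
  assumes f: "square_integrable f"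
  shows "\<exists>F. is_fourier_L2 f F"
proof -
  define h where "h R = fourier (cut R f)" for R
  define c where "c R = l2n (\<lambda>x. cut R f x - f x)" for R
  have h: "square_integrable (h R)" for R
    unfolding h_def by (intro fourier_l2n_le integrable_cut square_integrable_cut f)
  have hd: "l2n (\<lambda>\<xi>. h R \<xi> - h S \<xi>) \<le> sqrt (2 * pi) * (c R + c S)" for R S
  proof -
    have "l2n (\<lambda>x. cut R f x - cut S f x) \<le> c R + c S"
      using l2n_triangle_diff[OF square_integrable_cut[OF f, of R] f square_integrable_cut[OF f, of S]]
      unfolding c_def l2n_minus_commute[of f] .
    then show ?thesis
      unfolding h_def by (intro order_trans[OF fourier_cut_diff_le[OF f]] mult_left_mono) auto
  qed
  have c: "(c \<longlongrightarrow> 0) at_top" unfolding c_def by (rule cut_tendsto[OF f])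
  have small: "\<forall>\<^sub>F R in at_top. sqrt (2 * pi) * c R < e" if "e > 0" for e
  proof -
    have "((\<lambda>R. sqrt (2 * pi) * c R) \<longlongrightarrow> sqrt (2 * pi) * 0) at_top" by (intro tendsto_intros c)
    then show ?thesis using that by (intro order_tendstoD) simp_all
  qed
  have "\<exists>N. \<forall>m\<ge>N. \<forall>n\<ge>N. l2n (\<lambda>x. h (real m) x - h (real n) x) < e" if e: "e > 0" for e
  proof -
    have "\<forall>\<^sub>F R in at_top. sqrt (2 * pi) * c R < e / 2" using small[of "e / 2"] e by simp
    then obtain N where N: "\<And>R. R \<ge> N \<Longrightarrow> sqrt (2 * pi) * c R < e / 2"
      unfolding eventually_at_top_linorder by blast
    have "l2n (\<lambda>x. h (real m) x - h (real n) x) < e" if "m \<ge> nat \<lceil>N\<rceil>" "n \<ge> nat \<lceil>N\<rceil>" for m n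
      using hd[of "real m" "real n"] N[of "real m"] N[of "real n"] that by (simp add: distrib_left)
    then show ?thesis by blast
  qed
  then obtain F where F: "square_integrable F" "(\<lambda>n. l2n (\<lambda>x. h (real n) x - F x)) \<longlonglongrightarrow> 0"
    using square_integrable_complete[of "\<lambda>n. h (real n)"] h by blast
  \<comment> \<open>\<open>F\<close> is built along integer radii only; letting \<open>n\<close>
    tend to infinity with \<open>R\<close> fixed gives a bound for every real \<open>R\<close>, as
    the limit along \<open>at_top\<close> requires.\<close>
  have le: "l2n (\<lambda>x. F x - h R x) \<le> sqrt (2 * pi) * c R" for R
  proof (rule tendsto_lowerbound[of "\<lambda>n. l2n (\<lambda>x. h (real n) x - F x) + sqrt (2 * pi) * (c (real n) + c R)"])
    have "(\<lambda>n. c (real n)) \<longlonglongrightarrow> 0" by (rule filterlim_compose[OF c filterlim_real_sequentially])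
    then have "(\<lambda>n. l2n (\<lambda>x. h (real n) x - F x) + sqrt (2 * pi) * (c (real n) + c R)) \<longlonglongrightarrow> 0 + sqrt (2 * pi) * (0 + c R)"
      by (intro tendsto_intros F)
    then show "(\<lambda>n. l2n (\<lambda>x. h (real n) x - F x) + sqrt (2 * pi) * (c (real n) + c R)) \<longlonglongrightarrow> sqrt (2 * pi) * c R"
      by simp
    show "\<forall>\<^sub>F n in sequentially. l2n (\<lambda>x. F x - h R x) \<le> l2n (\<lambda>x. h (real n) x - F x) + sqrt (2 * pi) * (c (real n) + c R)"
    proof (rule always_eventually, rule allI)
      fix n
      show "l2n (\<lambda>x. F x - h R x) \<le> l2n (\<lambda>x. h (real n) x - F x) + sqrt (2 * pi) * (c (real n) + c R)"
        using l2n_triangle_diff[OF F(1) h[of "real n"] h[of R]] hd[of "real n" R] l2n_minus_commute[of F "h (real n)"]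
        by simp
    qed
  qed simp
  have "((\<lambda>R. l2n (\<lambda>\<xi>. F \<xi> - fourier (cut R f) \<xi>)) \<longlongrightarrow> 0) at_top"
  proof (rule tendsto_sandwich[OF _ _ tendsto_const])
    have "((\<lambda>R. sqrt (2 * pi) * c R) \<longlongrightarrow> sqrt (2 * pi) * 0) at_top" by (intro tendsto_intros c)
    then show "((\<lambda>R. sqrt (2 * pi) * c R) \<longlongrightarrow> 0) at_top" by simp
    show "\<forall>\<^sub>F R in at_top. l2n (\<lambda>\<xi>. F \<xi> - fourier (cut R f) \<xi>) \<le> sqrt (2 * pi) * c R"
      using le unfolding h_def by simp
  qed simp
  then show ?thesis using f F(1) by (auto simp: is_fourier_L2_iff)
qed

lemma is_fourier_L2_unique:
  assumes "is_fourier_L2 f F" "is_fourier_L2 g G" "AE x in lborel. f x = g x"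
  shows "AE x in lborel. F x = G x"
proof -
  note si = is_fourier_L2_D[OF assms(1)] is_fourier_L2_D[OF assms(2)]
  have "fourier (cut R f) = fourier (cut R g)" for R
    by (rule fourier_cong_AE) (use assms(3) si in \<open>auto simp: cut_def elim: eventually_mono\<close>)
  moreover have fh: "square_integrable (fourier (cut R f))" for R
    by (intro fourier_l2n_le integrable_cut square_integrable_cut si)
  ultimately have "l2n (\<lambda>x. F x - G x) \<le> l2n (\<lambda>\<xi>. F \<xi> - fourier (cut R f) \<xi>) + l2n (\<lambda>\<xi>. G \<xi> - fourier (cut R g) \<xi>)" for R
    using l2n_triangle_diff[OF si(2) fh si(4), of R] l2n_minus_commute[of G] by metis
  moreover have "((\<lambda>R. l2n (\<lambda>\<xi>. F \<xi> - fourier (cut R f) \<xi>) + l2n (\<lambda>\<xi>. G \<xi> - fourier (cut R g) \<xi>)) \<longlongrightarrow> 0 + 0) at_top"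
    using assms(1,2) by (intro tendsto_add) (auto simp: is_fourier_L2_iff)
  ultimately have "l2n (\<lambda>x. F x - G x) \<le> 0 + 0"
    by (intro tendsto_lowerbound[where F = "at_top :: real filter"]) auto
  then have "l2n (\<lambda>x. F x - G x) = 0" using l2n_nonneg[of "\<lambda>x. F x - G x"] by simp
  from l2n_eq_0_AE[OF square_integrable_diff[OF si(2,4)] this] show ?thesis by simp
qed

lemma is_fourier_L2_cong_AE:
  assumes "is_fourier_L2 f F" "AE x in lborel. f x = g x" "g \<in> borel_measurable borel"
    "AE x in lborel. F x = G x" "G \<in> borel_measurable borel"
  shows "is_fourier_L2 g G"
proof -
  note si = is_fourier_L2_D[OF assms(1)]
  have g: "square_integrable g" using square_integrable_cong_AE[OF assms(2) si(1) assms(3)] .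
  have G: "square_integrable G" using square_integrable_cong_AE[OF assms(4) si(2) assms(5)] .
  have [measurable]: "f \<in> borel_measurable borel" "g \<in> borel_measurable borel"
    "F \<in> borel_measurable borel" "G \<in> borel_measurable borel" using si g G by auto
  have "fourier (cut R f) = fourier (cut R g)" for R
    by (rule fourier_cong_AE) (use assms(2) in \<open>auto simp: cut_def elim: eventually_mono\<close>)
  moreover have "l2n (\<lambda>\<xi>. F \<xi> - fourier (cut R g) \<xi>) = l2n (\<lambda>\<xi>. G \<xi> - fourier (cut R g) \<xi>)" for R
    by (rule l2n_cong_AE) (use assms(4) in \<open>auto elim: eventually_mono\<close>)
  ultimately show ?thesis using assms(1) g G by (simp add: is_fourier_L2_iff)
qed

lemma is_fourier_L2_add:
  assumes "is_fourier_L2 f F" "is_fourier_L2 g G"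
  shows "is_fourier_L2 (\<lambda>x. f x + g x) (\<lambda>x. F x + G x)"
proof -
  note si = is_fourier_L2_D[OF assms(1)] is_fourier_L2_D[OF assms(2)]
  have fc: "fourier (cut R (\<lambda>x. f x + g x)) \<xi> = fourier (cut R f) \<xi> + fourier (cut R g) \<xi>" for R \<xi>
    using fourier_add[OF integrable_cut[OF si(1), of R] integrable_cut[OF si(3), of R], of \<xi>]
    by (simp add: cut_def[abs_def] distrib_left)
  have fh: "square_integrable (\<lambda>\<xi>. F \<xi> - fourier (cut R f) \<xi>)" "square_integrable (\<lambda>\<xi>. G \<xi> - fourier (cut R g) \<xi>)" for R
    by (intro square_integrable_diff fourier_l2n_le integrable_cut square_integrable_cut si)+
  have le: "l2n (\<lambda>\<xi>. F \<xi> + G \<xi> - fourier (cut R (\<lambda>x. f x + g x)) \<xi>)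
      \<le> l2n (\<lambda>\<xi>. F \<xi> - fourier (cut R f) \<xi>) + l2n (\<lambda>\<xi>. G \<xi> - fourier (cut R g) \<xi>)" for R
    using l2n_triangle[OF fh, of R R] by (simp add: fc algebra_simps)
  have lim: "((\<lambda>R. l2n (\<lambda>\<xi>. F \<xi> - fourier (cut R f) \<xi>) + l2n (\<lambda>\<xi>. G \<xi> - fourier (cut R g) \<xi>)) \<longlongrightarrow> 0 + 0) at_top"
    using assms by (intro tendsto_add) (auto simp: is_fourier_L2_iff)
  have "((\<lambda>R. l2n (\<lambda>\<xi>. F \<xi> + G \<xi> - fourier (cut R (\<lambda>x. f x + g x)) \<xi>)) \<longlongrightarrow> 0) at_top"
    using lim by (intro tendsto_sandwich[OF _ always_eventually[OF allI[OF le]] tendsto_const]) auto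
  then show ?thesis using si by (simp add: is_fourier_L2_iff square_integrable_add)
qed

lemma is_fourier_L2_cmult:
  assumes "is_fourier_L2 f F"
  shows "is_fourier_L2 (\<lambda>x. c * f x) (\<lambda>x. c * F x)"
proof -
  note si = is_fourier_L2_D[OF assms(1)]
  have fc: "fourier (cut R (\<lambda>x. c * f x)) \<xi> = c * fourier (cut R f) \<xi>" for R \<xi>
    using fourier_cmult[of c "cut R f" \<xi>] by (simp add: cut_def[abs_def] mult_ac)
  have eq: "l2n (\<lambda>\<xi>. c * F \<xi> - fourier (cut R (\<lambda>x. c * f x)) \<xi>) = norm c * l2n (\<lambda>\<xi>. F \<xi> - fourier (cut R f) \<xi>)" for R
    using l2n_mult_left[of c "\<lambda>\<xi>. F \<xi> - fourier (cut R f) \<xi>"] by (simp add: fc algebra_simps)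
  have "((\<lambda>R. norm c * l2n (\<lambda>\<xi>. F \<xi> - fourier (cut R f) \<xi>)) \<longlongrightarrow> norm c * 0) at_top"
    using assms by (intro tendsto_intros) (auto simp: is_fourier_L2_iff)
  then show ?thesis using si by (simp add: is_fourier_L2_iff square_integrable_mult_left eq)
qed

lemma is_fourier_L2_diff:
  assumes "is_fourier_L2 f F" "is_fourier_L2 g G"
  shows "is_fourier_L2 (\<lambda>x. f x - g x) (\<lambda>x. F x - G x)"
  using is_fourier_L2_add[OF assms(1) is_fourier_L2_cmult[OF assms(2), of "-1"]] by simp

lemma l2n_reflect: "l2n (\<lambda>x. f (- x)) = l2n f"
  unfolding l2n_def
  using lborel_integral_real_affine[of "-1" "\<lambda>x. (norm (f x))\<^sup>2" 0] by simp

lemma square_integrable_reflect: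
  assumes "square_integrable f"
  shows "square_integrable (\<lambda>x. f (- x))"
proof -
  have [measurable]: "f \<in> borel_measurable borel" using assms by auto
  have "integrable lborel (\<lambda>x. (norm (f (- x)))\<^sup>2)"
    using lborel_integrable_real_affine[OF square_integrable_norm2[OF assms], of "-1" 0] by simp
  moreover have "(\<lambda>x. f (- x)) \<in> borel_measurable borel" by measurable
  ultimately show ?thesis by (simp add: square_integrable_def)
qed

lemma square_integrable_cnj: "square_integrable f \<Longrightarrow> square_integrable (\<lambda>x. cnj (f x))"
  by (rule square_integrable_bound[where c = 1]) (auto intro: measurable_compose[OF _ cnj_measurable])

lemma l2n_cnj: "l2n (\<lambda>x. cnj (f x)) = l2n f"
  by (simp add: l2n_def)

lemma is_fourier_L2_cnj:
  assumes "is_fourier_L2 f F"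
  shows "is_fourier_L2 (\<lambda>x. cnj (f x)) (\<lambda>\<xi>. cnj (F (- \<xi>)))"
proof -
  note si = is_fourier_L2_D[OF assms(1)]
  have fc: "fourier (cut R (\<lambda>x. cnj (f x))) \<xi> = cnj (fourier (cut R f) (- \<xi>))" for R \<xi>
  proof -
    have "cut R (\<lambda>x. cnj (f x)) = (\<lambda>x. cnj (cut R f x))" by (auto simp: cut_def indicator_def)
    then show ?thesis by (simp add: fourier_cnj)
  qed
  have "l2n (\<lambda>\<xi>. cnj (F (- \<xi>)) - fourier (cut R (\<lambda>x. cnj (f x))) \<xi>) = l2n (\<lambda>\<xi>. F \<xi> - fourier (cut R f) \<xi>)" for R
    using l2n_cnj[of "\<lambda>\<xi>. F (- \<xi>) - fourier (cut R f) (- \<xi>)"] l2n_reflect[of "\<lambda>\<xi>. F \<xi> - fourier (cut R f) \<xi>"]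
    by (simp add: fc)
  then show ?thesis
    using assms si by (simp add: is_fourier_L2_iff square_integrable_cnj square_integrable_reflect)
qed

text \<open>The \<open>L^2\<close> bound applied to the tail \<open>f - cut R f\<close> shows that
  the integral transform and the limit transform agree.\<close>

lemma is_fourier_L2_fourier:
  assumes "integrable lborel f" "square_integrable f"
  shows "is_fourier_L2 f (fourier f)"
proof -
  have le: "l2n (\<lambda>\<xi>. fourier f \<xi> - fourier (cut R f) \<xi>) \<le> sqrt (2 * pi) * l2n (\<lambda>x. cut R f x - f x)" for R
    using fourier_l2n_le(2)[of "\<lambda>x. f x - cut R f x"] assms l2n_minus_commute[of f]
    by (simp add: fourier_diff_fun integrable_cut square_integrable_cut square_integrable_diff)
  have "((\<lambda>R. sqrt (2 * pi) * l2n (\<lambda>x. cut R f x - f x)) \<longlongrightarrow> sqrt (2 * pi) * 0) at_top"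
    by (intro tendsto_intros cut_tendsto assms)
  then have "((\<lambda>R. l2n (\<lambda>\<xi>. fourier f \<xi> - fourier (cut R f) \<xi>)) \<longlongrightarrow> 0) at_top"
    by (intro tendsto_sandwich[OF _ always_eventually[OF allI[OF le]] tendsto_const]) auto
  then show ?thesis using assms by (simp add: is_fourier_L2_iff fourier_l2n_le)
qed

lemma l2_prod_tendsto:
  fixes f g :: "real \<Rightarrow> complex"
  assumes "\<And>n. square_integrable (F n)" "square_integrable f" "\<And>n. square_integrable (G n)" "square_integrable g"
    "((\<lambda>n. l2n (\<lambda>x. F n x - f x)) \<longlongrightarrow> 0) A" "((\<lambda>n. l2n (\<lambda>x. G n x - g x)) \<longlongrightarrow> 0) A"
  shows "((\<lambda>n. CLINT x|lborel. F n x * G n x) \<longlongrightarrow> (CLINT x|lborel. f x * g x)) A"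
proof (rule Lim_null[THEN iffD2], rule Lim_null_comparison)
  have le: "norm ((CLINT x|lborel. F n x * G n x) - (CLINT x|lborel. f x * g x))
      \<le> l2n (\<lambda>x. F n x - f x) * l2n (\<lambda>x. G n x - g x) + l2n f * l2n (\<lambda>x. G n x - g x) + l2n (\<lambda>x. F n x - f x) * l2n g" for n
  proof -
    note si = square_integrable_diff[OF assms(1,2), of n] square_integrable_diff[OF assms(3,4), of n]
    note ints = integrable_prod_square_integrable[OF si] integrable_prod_square_integrable[OF assms(2) si(2)]
      integrable_prod_square_integrable[OF si(1) assms(4)]
    have "(CLINT x|lborel. F n x * G n x) - (CLINT x|lborel. f x * g x) = (CLINT x|lborel. F n x * G n x - f x * g x)"
      by (intro Bochner_Integration.integral_diff[symmetric] integrable_prod_square_integrable assms)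
    also have "\<dots> = (CLINT x|lborel. (F n x - f x) * (G n x - g x) + f x * (G n x - g x) + (F n x - f x) * g x)"
      by (intro Bochner_Integration.integral_cong) (auto simp: algebra_simps)
    also have "\<dots> = (CLINT x|lborel. (F n x - f x) * (G n x - g x)) + (CLINT x|lborel. f x * (G n x - g x)) + (CLINT x|lborel. (F n x - f x) * g x)"
      using ints by simp
    finally have eq: "(CLINT x|lborel. F n x * G n x) - (CLINT x|lborel. f x * g x) =
      (CLINT x|lborel. (F n x - f x) * (G n x - g x)) + (CLINT x|lborel. f x * (G n x - g x)) + (CLINT x|lborel. (F n x - f x) * g x)" .
    show ?thesis
      unfolding eq
    proof -
      have tri: "norm (a + b + c) \<le> norm a + norm b + norm c" for a b c :: complex
        using norm_triangle_ineq[of "a + b" c] norm_triangle_ineq[of a b] by simp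
      show "norm ((CLINT x|lborel. (F n x - f x) * (G n x - g x)) + (CLINT x|lborel. f x * (G n x - g x)) + (CLINT x|lborel. (F n x - f x) * g x)) \<le> l2n (\<lambda>x. F n x - f x) * l2n (\<lambda>x. G n x - g x) + l2n f * l2n (\<lambda>x. G n x - g x) + l2n (\<lambda>x. F n x - f x) * l2n g"
        by (rule order_trans[OF tri], intro add_mono norm_integral_prod_le si assms)
    qed
  qed
  show "\<forall>\<^sub>F n in A. norm ((CLINT x|lborel. F n x * G n x) - (CLINT x|lborel. f x * g x))
      \<le> l2n (\<lambda>x. F n x - f x) * l2n (\<lambda>x. G n x - g x) + l2n f * l2n (\<lambda>x. G n x - g x) + l2n (\<lambda>x. F n x - f x) * l2n g"
    by (rule always_eventually, rule allI, rule le)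
  have "((\<lambda>n. l2n (\<lambda>x. F n x - f x) * l2n (\<lambda>x. G n x - g x) + l2n f * l2n (\<lambda>x. G n x - g x) + l2n (\<lambda>x. F n x - f x) * l2n g)
      \<longlongrightarrow> 0 * 0 + l2n f * 0 + 0 * l2n g) A"
    by (intro tendsto_intros assms)
  then show "((\<lambda>n. l2n (\<lambda>x. F n x - f x) * l2n (\<lambda>x. G n x - g x) + l2n f * l2n (\<lambda>x. G n x - g x) + l2n (\<lambda>x. F n x - f x) * l2n g)
      \<longlongrightarrow> 0) A" by simp
qed

section \<open>Parseval's identity and inversion\<close>

lemma is_fourier_L2_l2n_le:
  assumes "is_fourier_L2 f F"
  shows "l2n F \<le> sqrt (2 * pi) * l2n f"
proof -
  note si = is_fourier_L2_D[OF assms]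
  have fh: "square_integrable (fourier (cut R f))" "l2n (fourier (cut R f)) \<le> sqrt (2 * pi) * l2n f" for R
  proof -
    show "square_integrable (fourier (cut R f))"
      by (intro fourier_l2n_le integrable_cut square_integrable_cut si)
    have "l2n (fourier (cut R f)) \<le> sqrt (2 * pi) * l2n (cut R f)"
      by (intro fourier_l2n_le integrable_cut square_integrable_cut si)
    also have "l2n (cut R f) \<le> 1 * l2n f"
      by (rule l2n_mono) (use si norm_cut_le square_integrable_cut[OF si(1)] in auto)
    finally show "l2n (fourier (cut R f)) \<le> sqrt (2 * pi) * l2n f" by simp
  qed
  have "l2n F \<le> l2n (\<lambda>\<xi>. F \<xi> - fourier (cut R f) \<xi>) + sqrt (2 * pi) * l2n f" for R
    using l2n_triangle[OF square_integrable_diff[OF si(2) fh(1)[of R]] fh(1)[of R]] fh(2)[of R] by simp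
  moreover have "((\<lambda>R. l2n (\<lambda>\<xi>. F \<xi> - fourier (cut R f) \<xi>) + sqrt (2 * pi) * l2n f) \<longlongrightarrow> 0 + sqrt (2 * pi) * l2n f) at_top"
    using assms by (intro tendsto_intros) (auto simp: is_fourier_L2_iff)
  ultimately have "l2n F \<le> 0 + sqrt (2 * pi) * l2n f"
    by (intro tendsto_lowerbound[where F = "at_top :: real filter"]) auto
  then show ?thesis by simp
qed

lemma is_fourier_L2_multiplication_formula:
  assumes "is_fourier_L2 f F" "is_fourier_L2 h H"
  shows "(CLINT \<xi>|lborel. F \<xi> * h \<xi>) = (CLINT x|lborel. f x * H x)"
proof -
  note si = is_fourier_L2_D[OF assms(1)] is_fourier_L2_D[OF assms(2)]
  have "((\<lambda>R. CLINT \<xi>|lborel. fourier (cut R f) \<xi> * cut R h \<xi>) \<longlongrightarrow> (CLINT \<xi>|lborel. F \<xi> * h \<xi>)) at_top"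
    using assms
    by (intro l2_prod_tendsto cut_tendsto si fourier_l2n_le integrable_cut square_integrable_cut)
      (auto simp: is_fourier_L2_iff l2n_minus_commute[of "fourier _"])
  moreover have "((\<lambda>R. CLINT x|lborel. cut R f x * fourier (cut R h) x) \<longlongrightarrow> (CLINT x|lborel. f x * H x)) at_top"
    using assms
    by (intro l2_prod_tendsto cut_tendsto si fourier_l2n_le integrable_cut square_integrable_cut)
      (auto simp: is_fourier_L2_iff l2n_minus_commute[of "fourier _"])
  ultimately show ?thesis
    using fourier_multiplication_formula[OF integrable_cut[OF si(1)] integrable_cut[OF si(3)]]
    by (simp add: tendsto_unique[OF trivial_limit_at_top_linorder])
qed

text \<open>With \<open>f\<close> fixed, the identity is preserved under linear combinations and
  \<open>L^2\<close> limits of \<open>g\<close>; density reduces it to interval indicators.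
  \<open>Q\<close> quantifies over all transforms of \<open>g\<close>, which are unique only modulo
  null sets, and \<open>QI\<close> shows that one of them is enough.\<close>

theorem is_fourier_L2_parseval:
  assumes "is_fourier_L2 f F" "is_fourier_L2 g G"
  shows "(CLINT \<xi>|lborel. F \<xi> * cnj (G \<xi>)) = 2 * pi * (CLINT x|lborel. f x * cnj (g x))"
proof -
  note sf = is_fourier_L2_D[OF assms(1)]
  define Q where "Q g \<longleftrightarrow> (\<forall>G. is_fourier_L2 g G \<longrightarrow> (CLINT \<xi>|lborel. F \<xi> * cnj (G \<xi>)) = 2 * pi * (CLINT x|lborel. f x * cnj (g x)))" for g
  have QI: "Q g" if "is_fourier_L2 g G" "(CLINT \<xi>|lborel. F \<xi> * cnj (G \<xi>)) = 2 * pi * (CLINT x|lborel. f x * cnj (g x))" for g G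
    unfolding Q_def
  proof (intro allI impI)
    fix G' assume G': "is_fourier_L2 g G'"
    have m: "G \<in> borel_measurable borel" "G' \<in> borel_measurable borel" "F \<in> borel_measurable borel"
      using is_fourier_L2_D(2)[OF that(1)] is_fourier_L2_D(2)[OF G'] sf by auto
    have [measurable]: "(\<lambda>x. cnj (G x)) \<in> borel_measurable borel" "(\<lambda>x. cnj (G' x)) \<in> borel_measurable borel" "F \<in> borel_measurable borel"
      using m measurable_compose[OF _ cnj_measurable] by auto
    have "AE x in lborel. G' x = G x" by (rule is_fourier_L2_unique[OF G' that(1)]) simp
    then have "(CLINT \<xi>|lborel. F \<xi> * cnj (G' \<xi>)) = (CLINT \<xi>|lborel. F \<xi> * cnj (G \<xi>))"
      by (intro integral_cong_AE) (auto elim: eventually_mono)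
    then show "(CLINT \<xi>|lborel. F \<xi> * cnj (G' \<xi>)) = 2 * pi * (CLINT x|lborel. f x * cnj (g x))" using that(2) by simp
  qed
  have "Q g" using is_fourier_L2_D(1)[OF assms(2)]
  proof (induction rule: square_integrable_induct)
    case (interval a b)
    define h where "h = (indicator {a..b} :: real \<Rightarrow> complex)"
    have h: "integrable lborel h" "square_integrable h"
      unfolding h_def by (rule integrable_interval_indicator square_integrable_interval_indicator)+
    have "((\<lambda>R. CLINT \<xi>|lborel. fourier (cut R f) \<xi> * cnj (fourier h \<xi>)) \<longlongrightarrow> (CLINT \<xi>|lborel. F \<xi> * cnj (fourier h \<xi>))) at_top"
      using assms
      by (intro l2_prod_tendsto cut_tendsto sf fourier_l2n_le integrable_cut square_integrable_cut square_integrable_cnj h)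
        (auto simp: is_fourier_L2_iff l2n_minus_commute[of "fourier _"] l2n_def)
    moreover have "((\<lambda>R. 2 * pi * (CLINT x|lborel. cut R f x * cnj (h x))) \<longlongrightarrow> 2 * pi * (CLINT x|lborel. f x * cnj (h x))) at_top"
      by (intro tendsto_intros l2_prod_tendsto cut_tendsto sf integrable_cut square_integrable_cut square_integrable_cnj h)
        (auto simp: l2n_def)
    ultimately have "(CLINT \<xi>|lborel. F \<xi> * cnj (fourier h \<xi>)) = 2 * pi * (CLINT x|lborel. f x * cnj (h x))"
      using fourier_parseval_interval[OF integrable_cut[OF sf(1)] square_integrable_cut[OF sf(1)], of _ a b]
      unfolding h_def[symmetric] by (simp add: tendsto_unique[OF trivial_limit_at_top_linorder])
    then show ?case using QI[OF is_fourier_L2_fourier[OF h]] by (simp add: h_def)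
  next
    case (add g h)
    obtain G H where GH: "is_fourier_L2 g G" "is_fourier_L2 h H" using add is_fourier_L2_exists by blast
    note si = is_fourier_L2_D[OF GH(1)] is_fourier_L2_D[OF GH(2)]
    show ?case
    proof (rule QI[OF is_fourier_L2_add[OF GH]])
      note ints = si[THEN square_integrable_cnj, THEN integrable_prod_square_integrable[OF sf(1)]]
        si[THEN square_integrable_cnj, THEN integrable_prod_square_integrable[OF sf(2)]]
      show "(CLINT \<xi>|lborel. F \<xi> * cnj (G \<xi> + H \<xi>)) = 2 * pi * (CLINT x|lborel. f x * cnj (g x + h x))"
        using add.IH GH ints unfolding Q_def by (simp add: distrib_left)
    qed
  next
    case (scale g c)
    obtain G where G: "is_fourier_L2 g G" using scale is_fourier_L2_exists by blast
    show ?case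
    proof (rule QI[OF is_fourier_L2_cmult[OF G]])
      have "(CLINT \<xi>|lborel. F \<xi> * cnj (c * G \<xi>)) = (CLINT \<xi>|lborel. cnj c * (F \<xi> * cnj (G \<xi>)))"
        by (simp add: mult_ac)
      also have "\<dots> = cnj c * (2 * pi * (CLINT x|lborel. f x * cnj (g x)))"
        using scale.IH G unfolding Q_def by simp
      also have "\<dots> = 2 * pi * (CLINT x|lborel. cnj c * (f x * cnj (g x)))" by simp
      also have "\<dots> = 2 * pi * (CLINT x|lborel. f x * cnj (c * g x))" by (simp add: mult_ac)
      finally show "(CLINT \<xi>|lborel. F \<xi> * cnj (c * G \<xi>)) = 2 * pi * (CLINT x|lborel. f x * cnj (c * g x))" .
    qed
  next
    case (lim h g)
    have "\<forall>n. \<exists>H. is_fourier_L2 (h n) H" using lim is_fourier_L2_exists by blast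
    then obtain H where H: "\<And>n. is_fourier_L2 (h n) (H n)" by metis
    obtain G where G: "is_fourier_L2 g G" using lim is_fourier_L2_exists by blast
    have le: "l2n (\<lambda>\<xi>. H n \<xi> - G \<xi>) \<le> sqrt (2 * pi) * l2n (\<lambda>x. h n x - g x)" for n
      by (rule is_fourier_L2_l2n_le[OF is_fourier_L2_diff[OF H G]])
    have "(\<lambda>n. sqrt (2 * pi) * l2n (\<lambda>x. h n x - g x)) \<longlonglongrightarrow> sqrt (2 * pi) * 0"
      by (intro tendsto_intros lim)
    then have HG: "(\<lambda>n. l2n (\<lambda>\<xi>. H n \<xi> - G \<xi>)) \<longlonglongrightarrow> 0"
      by (intro tendsto_sandwich[OF _ always_eventually[OF allI[OF le]] tendsto_const]) auto
    have cnj_eq: "l2n (\<lambda>x. cnj (p x) - cnj (q x)) = l2n (\<lambda>x. p x - q x)" for p q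
      using l2n_cnj[of "\<lambda>x. p x - q x"] by simp
    have "(\<lambda>n. CLINT \<xi>|lborel. F \<xi> * cnj (H n \<xi>)) \<longlonglongrightarrow> (CLINT \<xi>|lborel. F \<xi> * cnj (G \<xi>))"
      by (intro l2_prod_tendsto square_integrable_cnj sf is_fourier_L2_D[OF H] is_fourier_L2_D[OF G])
        (simp_all add: cnj_eq HG, simp add: l2n_def)
    moreover have lim2: "(\<lambda>n. 2 * pi * (CLINT x|lborel. f x * cnj (h n x))) \<longlonglongrightarrow> 2 * pi * (CLINT x|lborel. f x * cnj (g x))"
      by (intro tendsto_intros l2_prod_tendsto square_integrable_cnj sf lim)
        (simp_all add: cnj_eq lim, simp add: l2n_def)
    moreover have "(CLINT \<xi>|lborel. F \<xi> * cnj (H n \<xi>)) = 2 * pi * (CLINT x|lborel. f x * cnj (h n x))" for n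
      using lim.IH H unfolding Q_def by blast
    ultimately have "(CLINT \<xi>|lborel. F \<xi> * cnj (G \<xi>)) = 2 * pi * (CLINT x|lborel. f x * cnj (g x))"
      by (metis (no_types, lifting) LIMSEQ_unique ext)
    then show ?case by (rule QI[OF G])
  qed
  then show ?thesis using assms(2) by (simp add: Q_def)
qed

corollary is_fourier_L2_plancherel:
  assumes "is_fourier_L2 f F"
  shows "l2n F = sqrt (2 * pi) * l2n f"
proof -
  have "complex_of_real ((l2n F)\<^sup>2) = complex_of_real ((sqrt (2 * pi) * l2n f)\<^sup>2)"
    using is_fourier_L2_parseval[OF assms assms]
    by (simp add: l2n_square power_mult_distrib complex_norm_square[symmetric] flip: integral_complex_of_real)
  then have "(l2n F)\<^sup>2 = (sqrt (2 * pi) * l2n f)\<^sup>2" by (simp only: of_real_eq_iff)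
  then show ?thesis by (rule power2_eq_imp_eq) auto
qed

lemma is_fourier_L2_inj:
  assumes "is_fourier_L2 f F" "is_fourier_L2 g G" "AE x in lborel. F x = G x"
  shows "AE x in lborel. f x = g x"
proof -
  note d = is_fourier_L2_diff[OF assms(1,2)]
  note si = is_fourier_L2_D[OF assms(1)] is_fourier_L2_D[OF assms(2)]
  have "l2n (\<lambda>\<xi>. F \<xi> - G \<xi>) = l2n (\<lambda>\<xi>. 0 :: complex)"
    by (rule l2n_cong_AE)
      (use assms(3) in \<open>auto elim: eventually_mono intro!: square_integrable_measurable square_integrable_diff si\<close>)
  then have "l2n (\<lambda>x. f x - g x) = 0" using is_fourier_L2_plancherel[OF d] by (simp add: l2n_def)
  from l2n_eq_0_AE[OF is_fourier_L2_D(1)[OF d] this] show ?thesis by simp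
qed

text \<open>Paired with an arbitrary \<open>H\<close>, the transform \<open>T\<close> of the
  candidate gives the same value as \<open>F\<close>: the multiplication formula moves the transform
  onto \<open>H\<close>, and a reflection turns the result into Parseval's identity. Taking
  \<open>H = T - F\<close> gives \<open>T = F\<close> almost everywhere.\<close>

theorem is_fourier_L2_inverse:
  assumes "is_fourier_L2 F G"
  shows "is_fourier_L2 (\<lambda>x. G (- x) / (2 * pi)) F"
proof -
  note si = is_fourier_L2_D[OF assms]
  define f where "f x = G (- x) / (2 * pi)" for x
  have f: "square_integrable f"
    using square_integrable_mult_left[OF square_integrable_reflect[OF si(2)], of "1 / (2 * pi)"] by (simp add: f_def[abs_def])
  obtain T where T: "is_fourier_L2 f T" using is_fourier_L2_exists[OF f] by blast
  note sT = is_fourier_L2_D(2)[OF T]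
  have key: "(CLINT \<xi>|lborel. T \<xi> * cnj (H \<xi>)) = (CLINT \<xi>|lborel. F \<xi> * cnj (H \<xi>))" if H: "square_integrable H" for H
  proof -
    obtain H' where H': "is_fourier_L2 H H'" using is_fourier_L2_exists[OF H] by blast
    have "(CLINT \<xi>|lborel. T \<xi> * cnj (H \<xi>)) = (CLINT x|lborel. f x * cnj (H' (- x)))"
      by (rule is_fourier_L2_multiplication_formula[OF T is_fourier_L2_cnj[OF H']])
    also have "\<dots> = (CLINT x|lborel. f (- x) * cnj (H' x))"
      using lborel_integral_real_affine[of "-1" "\<lambda>x. f x * cnj (H' (- x))" 0] by simp
    also have "\<dots> = (CLINT x|lborel. (1 / (2 * pi)) * (G x * cnj (H' x)))"
      by (simp add: f_def)
    also have "\<dots> = (CLINT \<xi>|lborel. F \<xi> * cnj (H \<xi>))"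
      using is_fourier_L2_parseval[OF assms H'] by simp
    finally show ?thesis .
  qed
  have TF: "square_integrable (\<lambda>\<xi>. T \<xi> - F \<xi>)" using sT si by (intro square_integrable_diff)
  note ints = integrable_prod_square_integrable[OF sT square_integrable_cnj[OF TF]]
    integrable_prod_square_integrable[OF si(1) square_integrable_cnj[OF TF]]
  have "(CLINT \<xi>|lborel. (T \<xi> - F \<xi>) * cnj (T \<xi> - F \<xi>)) = 0"
    using key[OF TF] ints by (simp add: left_diff_distrib)
  then have "complex_of_real ((l2n (\<lambda>\<xi>. T \<xi> - F \<xi>))\<^sup>2) = 0"
    by (simp add: l2n_square complex_norm_square[symmetric] del: complex_cnj_diff flip: integral_complex_of_real)
  then have "l2n (\<lambda>\<xi>. T \<xi> - F \<xi>) = 0" by simp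
  from l2n_eq_0_AE[OF TF this] have "AE \<xi> in lborel. T \<xi> = F \<xi>" by simp
  from is_fourier_L2_cong_AE[OF T _ _ this] have "is_fourier_L2 f F" using f si by auto
  then show ?thesis by (simp add: f_def[abs_def])
qed

corollary inverse_fourier_L2_exists:
  "square_integrable F \<Longrightarrow> \<exists>f. is_fourier_L2 f F"
  using is_fourier_L2_exists is_fourier_L2_inverse by blast

lemma fourier_L2: "square_integrable f \<Longrightarrow> is_fourier_L2 f (fourier_L2 f)"
  unfolding fourier_L2_def by (rule someI_ex[OF is_fourier_L2_exists])

lemma inv_fourier_L2: "square_integrable F \<Longrightarrow> is_fourier_L2 (inv_fourier_L2 F) F"
  unfolding inv_fourier_L2_def by (rule someI_ex[OF inverse_fourier_L2_exists])

section \<open>The algebra of bounded continuous square integrable functions\<close>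

lemma l2n_fatou:
  fixes f :: "nat \<Rightarrow> real \<Rightarrow> 'a::{real_normed_vector, second_countable_topology}"
  assumes si: "\<And>n. square_integrable (f n)" and le: "\<forall>\<^sub>F n in sequentially. l2n (f n) \<le> c"
    and lim: "AE x in lborel. (\<lambda>n. f n x) \<longlonglongrightarrow> g x" and g: "g \<in> borel_measurable borel" and c: "0 \<le> c"
  shows "square_integrable g" "l2n g \<le> c"
proof -
  have [measurable]: "f n \<in> borel_measurable borel" "g \<in> borel_measurable borel" for n using si g by auto
  have "(\<integral>\<^sup>+x. ennreal ((norm (g x))\<^sup>2) \<partial>lborel) = (\<integral>\<^sup>+x. liminf (\<lambda>n. ennreal ((norm (f n x))\<^sup>2)) \<partial>lborel)"
  proof (rule nn_integral_cong_AE, use lim in \<open>rule eventually_mono\<close>)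
    fix x assume "(\<lambda>n. f n x) \<longlonglongrightarrow> g x"
    then have "(\<lambda>n. ennreal ((norm (f n x))\<^sup>2)) \<longlonglongrightarrow> ennreal ((norm (g x))\<^sup>2)"
      by (intro tendsto_intros tendsto_ennrealI)
    then show "ennreal ((norm (g x))\<^sup>2) = liminf (\<lambda>n. ennreal ((norm (f n x))\<^sup>2))"
      by (intro lim_imp_Liminf[symmetric]) auto
  qed
  also have "\<dots> \<le> liminf (\<lambda>n. \<integral>\<^sup>+x. ennreal ((norm (f n x))\<^sup>2) \<partial>lborel)"
    by (rule nn_integral_liminf) measurable
  also have "\<dots> \<le> ennreal (c\<^sup>2)"
  proof (rule Liminf_le)
    show "\<forall>\<^sub>F n in sequentially. (\<integral>\<^sup>+x. ennreal ((norm (f n x))\<^sup>2) \<partial>lborel) \<le> ennreal (c\<^sup>2)"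
      using le by (rule eventually_mono) (auto simp: nn_integral_square_integrable[OF si] intro!: ennreal_leI power_mono)
  qed simp
  finally have *: "(\<integral>\<^sup>+x. ennreal ((norm (g x))\<^sup>2) \<partial>lborel) \<le> ennreal (c\<^sup>2)" .
  show "square_integrable g" "l2n g \<le> c"
    using square_integrable_nn_integral[OF g * c] by auto
qed

text \<open>
  Elements are represented by genuine continuous functions, so that products, powers and sup bounds are
  pointwise and the truncated system is an ordinary differential equation in a Banach algebra.
\<close>

typedef cbl2 = "{u :: real \<Rightarrow>\<^sub>C real. square_integrable (apply_bcontfun u)}"
  morphisms rep_cbl2 abs_cbl2
proof
  show "const_bcontfun 0 \<in> {u :: real \<Rightarrow>\<^sub>C real. square_integrable (apply_bcontfun u)}"
    by (simp add: const_bcontfun.rep_eq square_integrable_zero)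
qed

definition val :: "cbl2 \<Rightarrow> real \<Rightarrow> real" where
  "val u = apply_bcontfun (rep_cbl2 u)"

definition mk :: "(real \<Rightarrow> real) \<Rightarrow> cbl2" where
  "mk f = abs_cbl2 (Bcontfun f)"

lemma square_integrable_val [simp]: "square_integrable (val u)"
  using rep_cbl2[of u] by (simp add: val_def)

lemma val_measurable [measurable]: "val u \<in> borel_measurable borel"
  using square_integrable_val by (rule square_integrable_measurable)

lemma continuous_on_val [continuous_intros]: "continuous_on S (val u)"
  by (simp add: val_def)

lemma isCont_val: "isCont (val u) x"
  using continuous_on_val[of UNIV u] by (simp add: continuous_on_eq_continuous_at)

lemma cbl2_eqI: "(\<And>x. val u x = val v x) \<Longrightarrow> u = v"
  by (metis bcontfun_eqI rep_cbl2_inject val_def)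

lemma val_mk:
  assumes "continuous_on UNIV f" "\<And>x. \<bar>f x\<bar> \<le> c" "square_integrable f"
  shows "val (mk f) = f"
proof -
  have "f \<in> bcontfun" using assms by (intro bcontfun_normI) auto
  then have "apply_bcontfun (Bcontfun f) = f" by (rule Bcontfun_inverse)
  then show ?thesis using assms(3) by (simp add: val_def mk_def abs_cbl2_inverse)
qed

lemma val_le_rep: "\<bar>val u x\<bar> \<le> norm (rep_cbl2 u)"
  using norm_bounded[of "rep_cbl2 u" x] by (simp add: val_def)

instantiation cbl2 :: comm_ring
begin

definition "0 = mk (\<lambda>x. 0)"
definition "u + v = mk (\<lambda>x. val u x + val v x)"
definition "- u = mk (\<lambda>x. - val u x)"
definition "(u :: cbl2) - v = mk (\<lambda>x. val u x - val v x)"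
definition "u * v = mk (\<lambda>x. val u x * val v x)"

lemma val_zero: "val 0 = (\<lambda>x. 0)"
  unfolding zero_cbl2_def by (rule val_mk[of _ 0]) (auto simp: square_integrable_zero)

lemma val_plus: "val (u + v) = (\<lambda>x. val u x + val v x)"
  unfolding plus_cbl2_def
proof (rule val_mk)
  show "\<bar>val u x + val v x\<bar> \<le> norm (rep_cbl2 u) + norm (rep_cbl2 v)" for x
    using val_le_rep[of u x] val_le_rep[of v x] by linarith
qed (auto intro!: continuous_intros square_integrable_add)

lemma val_uminus: "val (- u) = (\<lambda>x. - val u x)"
  unfolding uminus_cbl2_def
  by (rule val_mk[of _ "norm (rep_cbl2 u)"])
    (auto intro!: continuous_intros square_integrable_minus simp: val_le_rep)

lemma val_minus: "val (u - v) = (\<lambda>x. val u x - val v x)"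
  unfolding minus_cbl2_def
proof (rule val_mk)
  show "\<bar>val u x - val v x\<bar> \<le> norm (rep_cbl2 u) + norm (rep_cbl2 v)" for x
    using val_le_rep[of u x] val_le_rep[of v x] by linarith
qed (auto intro!: continuous_intros square_integrable_diff)

lemma val_times: "val (u * v) = (\<lambda>x. val u x * val v x)"
  unfolding times_cbl2_def
proof (rule val_mk)
  show "\<bar>val u x * val v x\<bar> \<le> norm (rep_cbl2 u) * norm (rep_cbl2 v)" for x
    using val_le_rep[of u x] val_le_rep[of v x] by (auto simp: abs_mult intro!: mult_mono)
  show "square_integrable (\<lambda>x. val u x * val v x)"
    by (rule square_integrable_bounded_mult[of _ "norm (rep_cbl2 u)"]) (auto simp: val_le_rep)
qed (auto intro!: continuous_intros)

instance
  by standard (auto intro!: cbl2_eqI simp: val_zero val_plus val_uminus val_minus val_times algebra_simps)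

end

instantiation cbl2 :: real_vector
begin

definition scaleR_cbl2 :: "real \<Rightarrow> cbl2 \<Rightarrow> cbl2" where
  "c *\<^sub>R u = mk (\<lambda>x. c * val u x)"

lemma val_scaleR: "val (c *\<^sub>R u) = (\<lambda>x. c * val u x)"
  unfolding scaleR_cbl2_def
  by (rule val_mk[of _ "\<bar>c\<bar> * norm (rep_cbl2 u)"])
    (auto intro!: continuous_intros square_integrable_mult_left mult_left_mono simp: val_le_rep abs_mult)

instance
  by standard (auto intro!: cbl2_eqI simp: val_scaleR val_plus algebra_simps)

end

instantiation cbl2 :: real_normed_vector
begin

text \<open>The supremum of one factor controls both summands for a product, which makes the norm
  submultiplicative; the \<open>L^2\<close> summand makes \<open>ip\<close> bounded. Completeness
  combines uniform limits with Fatou.\<close>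

definition norm_cbl2 :: "cbl2 \<Rightarrow> real" where
  "norm u = norm (rep_cbl2 u) + l2n (val u)"
definition dist_cbl2_def: "dist u v = norm (u - v :: cbl2)"
definition sgn_cbl2_def: "sgn u = u /\<^sub>R norm (u :: cbl2)"
definition uniformity_cbl2_def:
  "(uniformity :: (cbl2 \<times> cbl2) filter) = (INF e\<in>{0 <..}. principal {(x, y). dist x y < e})"
definition open_cbl2_def:
  "open (U :: cbl2 set) \<longleftrightarrow> (\<forall>x\<in>U. \<forall>\<^sub>F (x', y) in uniformity. x' = x \<longrightarrow> y \<in> U)"

lemma rep_plus: "rep_cbl2 (u + v) = rep_cbl2 u + rep_cbl2 v"
  by (rule bcontfun_eqI) (simp add: val_plus flip: val_def)

lemma rep_scaleR: "rep_cbl2 (c *\<^sub>R u) = c *\<^sub>R rep_cbl2 u"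
  by (rule bcontfun_eqI) (simp add: val_scaleR flip: val_def)

lemma rep_zero: "rep_cbl2 0 = 0"
  by (rule bcontfun_eqI) (simp add: val_zero flip: val_def)

instance
proof
  fix u v :: cbl2 and a b :: real

  show "dist u v = norm (u - v)" by (simp add: dist_cbl2_def)
  show "sgn u = u /\<^sub>R norm u" by (simp add: sgn_cbl2_def)
  show "norm u = 0 \<longleftrightarrow> u = 0"
  proof
    assume "norm u = 0"
    then have "norm (rep_cbl2 u) = 0"
      using l2n_nonneg[of "val u"] norm_ge_zero[of "rep_cbl2 u"] unfolding norm_cbl2_def by linarith
    then have "rep_cbl2 u = rep_cbl2 0" by (simp add: rep_zero)
    then show "u = 0" by (simp only: rep_cbl2_inject)
  qed (simp add: norm_cbl2_def rep_zero val_zero l2n_def)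
  show "norm (u + v) \<le> norm u + norm v"
    using norm_triangle_ineq[of "rep_cbl2 u" "rep_cbl2 v"] l2n_triangle[of "val u" "val v"]
    by (simp add: norm_cbl2_def rep_plus val_plus)
  show "norm (a *\<^sub>R u) = \<bar>a\<bar> * norm u"
    using l2n_scaleR[of a "val u"] by (simp add: norm_cbl2_def rep_scaleR val_scaleR distrib_left)
qed (simp_all add: uniformity_cbl2_def open_cbl2_def)

end

lemmas val_simps [simp] = val_zero val_plus val_uminus val_minus val_times val_scaleR

lemma abs_val_le: "\<bar>val u x\<bar> \<le> norm u"
  using val_le_rep[of u x] l2n_nonneg[of "val u"] unfolding norm_cbl2_def by linarith

lemma l2n_val_le: "l2n (val u) \<le> norm u"
  by (simp add: norm_cbl2_def)

lemma norm_cbl2_le: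
  assumes "\<And>x. \<bar>val u x\<bar> \<le> c" "l2n (val u) \<le> d"
  shows "norm u \<le> c + d"
  unfolding norm_cbl2_def by (intro add_mono norm_bound assms) (use assms(1) in \<open>simp flip: val_def\<close>)

lemma l2n_val_times_le:
  assumes "\<And>x. \<bar>val u x\<bar> \<le> c"
  shows "l2n (val (u * v)) \<le> c * l2n (val v)"
proof (rule l2n_mono)
  show "0 \<le> c" using assms[of 0] by linarith
  show "norm (val (u * v) x) \<le> c * norm (val v x)" for x
    using assms[of x] by (simp add: abs_mult mult_right_mono)
qed auto

instance cbl2 :: real_normed_algebra
proof
  fix u v w :: cbl2 and a :: real
  show "a *\<^sub>R u * v = a *\<^sub>R (u * v)" "u * a *\<^sub>R v = a *\<^sub>R (u * v)"
    by (auto intro!: cbl2_eqI)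
  have "norm (u * v) \<le> norm (rep_cbl2 u) * norm (rep_cbl2 v) + norm (rep_cbl2 u) * l2n (val v)"
  proof (rule norm_cbl2_le)
    show "\<bar>val (u * v) x\<bar> \<le> norm (rep_cbl2 u) * norm (rep_cbl2 v)" for x
      using val_le_rep[of u x] val_le_rep[of v x] by (auto simp: abs_mult intro!: mult_mono)
  qed (intro l2n_val_times_le val_le_rep)
  also have "\<dots> = norm (rep_cbl2 u) * norm v" by (simp add: norm_cbl2_def distrib_left)
  also have "\<dots> \<le> norm u * norm v"
    by (intro mult_right_mono) (simp_all add: norm_cbl2_def[of u])
  finally show "norm (u * v) \<le> norm u * norm v" .
qed

instance cbl2 :: banach
proof
  fix X :: "nat \<Rightarrow> cbl2" assume X: "Cauchy X"
  have rep_minus: "rep_cbl2 (u - v) = rep_cbl2 u - rep_cbl2 v" for u v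
    by (rule bcontfun_eqI) (simp flip: val_def)
  have "Cauchy (\<lambda>n. rep_cbl2 (X n))"
  proof (rule metric_CauchyI)
    fix e :: real assume "e > 0"
    then obtain M where "\<forall>m\<ge>M. \<forall>n\<ge>M. dist (X m) (X n) < e" using X unfolding Cauchy_def by blast
    moreover have "dist (rep_cbl2 u) (rep_cbl2 v) \<le> dist u v" for u v
      by (simp add: dist_norm norm_cbl2_def rep_minus)
    ultimately show "\<exists>M. \<forall>m\<ge>M. \<forall>n\<ge>M. dist (rep_cbl2 (X m)) (rep_cbl2 (X n)) < e"
      by (meson order_le_less_trans)
  qed
  then obtain y where y: "(\<lambda>n. rep_cbl2 (X n)) \<longlonglongrightarrow> y"
    using Cauchy_convergent convergent_def by blast
  have pt: "(\<lambda>n. val (X n) x) \<longlonglongrightarrow> apply_bcontfun y x" for x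
  proof (rule metric_LIMSEQ_I)
    fix e :: real assume "e > 0"
    then obtain N where "\<forall>n\<ge>N. dist (rep_cbl2 (X n)) y < e" using y unfolding lim_sequentially by blast
    moreover have "dist (val (X n) x) (apply_bcontfun y x) \<le> dist (rep_cbl2 (X n)) y" for n
      unfolding val_def by (rule dist_bounded)
    ultimately show "\<exists>N. \<forall>n\<ge>N. dist (val (X n) x) (apply_bcontfun y x) < e"
      by (meson order_le_less_trans)
  qed
  have ym: "apply_bcontfun y \<in> borel_measurable borel"
    by (rule borel_measurable_continuous_onI) simp
  have close: "square_integrable (\<lambda>x. val (X n) x - apply_bcontfun y x)"
    "l2n (\<lambda>x. val (X n) x - apply_bcontfun y x) \<le> e"
    if "\<And>m. m \<ge> N \<Longrightarrow> dist (X n) (X m) \<le> e" "e > 0" for n N e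
  proof -
    have "l2n (\<lambda>x. val (X n) x - val (X m) x) \<le> e" if "m \<ge> N" for m
      using l2n_val_le[of "X n - X m"] \<open>\<And>m. m \<ge> N \<Longrightarrow> dist (X n) (X m) \<le> e\<close>[OF that] by (simp add: dist_norm)
    then have ev: "\<forall>\<^sub>F m in sequentially. l2n (\<lambda>x. val (X n) x - val (X m) x) \<le> e"
      unfolding eventually_sequentially by blast
    show "square_integrable (\<lambda>x. val (X n) x - apply_bcontfun y x)" "l2n (\<lambda>x. val (X n) x - apply_bcontfun y x) \<le> e"
      by (rule l2n_fatou[OF _ ev], use that(2) ym in \<open>auto intro!: square_integrable_diff AE_I2 tendsto_intros pt\<close>)+
  qed
  have cauchy: "\<exists>N. \<forall>n\<ge>N. \<forall>m\<ge>N. dist (X n) (X m) \<le> e" if e: "e > 0" for e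
  proof -
    obtain N where "\<And>m n. m \<ge> N \<Longrightarrow> n \<ge> N \<Longrightarrow> dist (X m) (X n) < e" using X e unfolding Cauchy_def by blast
    then show ?thesis using less_imp_le by blast
  qed
  obtain N where N: "\<forall>n\<ge>N. \<forall>m\<ge>N. dist (X n) (X m) \<le> 1" using cauchy[of 1] by auto
  have "square_integrable (\<lambda>x. val (X N) x - (val (X N) x - apply_bcontfun y x))"
    by (intro square_integrable_diff close(1)[of N N 1]) (use N in auto)
  then have y2: "square_integrable (apply_bcontfun y)" by simp
  define Y where "Y = abs_cbl2 y"
  have repY: "rep_cbl2 Y = y" unfolding Y_def using y2 by (simp add: abs_cbl2_inverse)
  have valY: "val Y = apply_bcontfun y" by (simp add: val_def repY)
  have "X \<longlonglongrightarrow> Y"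
  proof (rule metric_LIMSEQ_I)
    fix e :: real assume e: "e > 0"
    obtain N where N: "\<forall>n\<ge>N. \<forall>m\<ge>N. dist (X n) (X m) \<le> e / 3" using cauchy[of "e / 3"] e by auto
    obtain M where M: "\<forall>n\<ge>M. dist (rep_cbl2 (X n)) y < e / 3"
      using y e unfolding lim_sequentially by (meson divide_pos_pos zero_less_numeral)
    have "dist (X n) Y < e" if n: "n \<ge> max N M" for n
    proof -
      have "dist (X n) Y = dist (rep_cbl2 (X n)) y + l2n (\<lambda>x. val (X n) x - apply_bcontfun y x)"
        by (simp add: dist_norm norm_cbl2_def rep_minus repY valY)
      also have "l2n (\<lambda>x. val (X n) x - apply_bcontfun y x) \<le> e / 3"
        by (rule close(2)[of N]) (use N n e in auto)
      also have "dist (rep_cbl2 (X n)) y < e / 3" using M n by simp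
      finally show ?thesis using e by simp
    qed
    then show "\<exists>N. \<forall>n\<ge>N. dist (X n) Y < e" by blast
  qed
  then show "convergent X" by (auto simp: convergent_def)
qed

lemma bounded_linear_val: "bounded_linear (\<lambda>u. val u x)"
  by (rule bounded_linear_intro[where K = 1]) (simp_all add: abs_val_le)

section \<open>The inner product and the \<open>L^2\<close> norm on the algebra\<close>

definition ip :: "cbl2 \<Rightarrow> cbl2 \<Rightarrow> real" where
  "ip u v = (LINT x|lborel. val u x * val v x)"

abbreviation l2 :: "cbl2 \<Rightarrow> real" where "l2 u \<equiv> l2n (val u)"

lemma integrable_val_mult: "integrable lborel (\<lambda>x. val u x * val v x)"
  by (rule integrable_prod_square_integrable) auto

lemma ip_commute: "ip u v = ip v u"
  by (simp add: ip_def mult.commute)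

lemma ip_self: "ip u u = (l2 u)\<^sup>2"
  unfolding l2n_square by (simp add: ip_def power2_eq_square)

lemma abs_ip_le: "\<bar>ip u v\<bar> \<le> l2 u * l2 v"
  using norm_integral_prod_le[of "val u" "val v"] by (simp add: ip_def)

lemma bounded_bilinear_ip: "bounded_bilinear ip"
proof
  fix u u' v v' :: cbl2 and r :: real
  note [simp] = integrable_val_mult
  show "ip (u + u') v = ip u v + ip u' v" "ip u (v + v') = ip u v + ip u v'"
    by (simp_all add: ip_def distrib_left distrib_right)
  show "ip (r *\<^sub>R u) v = r *\<^sub>R ip u v" by (simp add: ip_def mult.assoc)
  show "ip u (r *\<^sub>R v) = r *\<^sub>R ip u v" by (simp add: ip_def mult.left_commute)
  show "\<exists>K. \<forall>u v. norm (ip u v) \<le> norm u * norm v * K"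
  proof (intro exI[of _ 1] allI)
    fix u v
    have "\<bar>ip u v\<bar> \<le> norm u * norm v"
      by (rule order_trans[OF abs_ip_le]) (intro mult_mono l2n_val_le; simp)
    then show "norm (ip u v) \<le> norm u * norm v * 1" by simp
  qed
qed

interpretation ip: bounded_bilinear ip by (rule bounded_bilinear_ip)

lemma ip_mult_left: "ip (w * u) v = ip u (w * v)"
  unfolding ip_def by (rule arg_cong[where f = "integral\<^sup>L lborel"]) (auto simp: mult_ac)

lemma abs_ip_mult_le:
  assumes "\<And>x. \<bar>val q x\<bar> \<le> c"
  shows "\<bar>ip (q * u) v\<bar> \<le> c * l2 u * l2 v"
  by (rule order_trans[OF abs_ip_le]) (intro mult_right_mono l2n_val_times_le assms; simp)

lemma l2_triangle: "l2 (u + v) \<le> l2 u + l2 v"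
  using l2n_triangle[of "val u" "val v"] by simp

lemma l2_minus: "l2 (- u) = l2 u"
  using l2n_minus[of "val u"] by simp

lemma l2_diff_le: "l2 (u - v) \<le> l2 u + l2 v"
  using l2_triangle[of u "- v"] l2_minus[of v] by simp

lemma l2_scaleR: "l2 (c *\<^sub>R u) = \<bar>c\<bar> * l2 u"
  using l2n_scaleR[of c "val u"] by simp

lemma l2_zero [simp]: "l2 0 = 0"
  by (simp add: l2n_def)

section \<open>Fourier multipliers\<close>

definition fh :: "cbl2 \<Rightarrow> real \<Rightarrow> complex" where
  "fh u = fourier_real (val u)"

lemma is_fourier_fh: "is_fourier_L2 (\<lambda>x. complex_of_real (val u x)) (fh u)"
  unfolding fh_def by (rule fourier_L2) simp

lemma square_integrable_fh [simp]: "square_integrable (fh u)"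
  using is_fourier_L2_D(2)[OF is_fourier_fh] .

lemma fh_measurable [measurable]: "fh u \<in> borel_measurable borel"
  using square_integrable_fh by (rule square_integrable_measurable)

lemma l2n_fh: "l2n (fh u) = sqrt (2 * pi) * l2 u"
  using is_fourier_L2_plancherel[OF is_fourier_fh[of u]] by simp

lemma fh_add: "AE \<xi> in lborel. fh (u + v) \<xi> = fh u \<xi> + fh v \<xi>"
  by (rule is_fourier_L2_unique[OF is_fourier_fh is_fourier_L2_add[OF is_fourier_fh is_fourier_fh]]) simp

lemma fh_diff: "AE \<xi> in lborel. fh (u - v) \<xi> = fh u \<xi> - fh v \<xi>"
  by (rule is_fourier_L2_unique[OF is_fourier_fh is_fourier_L2_diff[OF is_fourier_fh is_fourier_fh]]) simp

lemma fh_scaleR: "AE \<xi> in lborel. fh (c *\<^sub>R u) \<xi> = of_real c * fh u \<xi>"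
  by (rule is_fourier_L2_unique[OF is_fourier_fh is_fourier_L2_cmult[OF is_fourier_fh]]) simp

lemma fh_parseval: "complex_of_real (2 * pi * ip u v) = (CLINT \<xi>|lborel. fh u \<xi> * cnj (fh v \<xi>))"
  unfolding is_fourier_L2_parseval[OF is_fourier_fh is_fourier_fh] ip_def
  by (simp flip: of_real_mult)

text \<open>The set where \<open>f\<close> and \<open>g\<close> differ is open, and a nonempty open
  set is not negligible; hence elements of \<open>cbl2\<close> are determined by their
  classes.\<close>

lemma AE_lborel_eq_continuous:
  fixes f g :: "real \<Rightarrow> real"
  assumes "AE x in lborel. f x = g x" "continuous_on UNIV f" "continuous_on UNIV g"
  shows "f x = g x"
proof (rule ccontr)
  assume ne: "f x \<noteq> g x"
  have op: "open {x. f x \<noteq> g x}"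
    by (rule open_Collect_neq) (use assms in auto)
  have "AE x in lborel. x \<notin> {x. f x \<noteq> g x}" using assms(1) by (rule eventually_mono) simp
  then have "{x. f x \<noteq> g x} \<in> null_sets lborel"
    using op by (subst AE_iff_null_sets) auto
  then have "{x. f x \<noteq> g x} \<in> null_sets lebesgue"
    by (rule null_sets_completionI)
  then have "negligible {x. f x \<noteq> g x}" by (simp add: negligible_iff_null_sets)
  then show False using open_not_negligible[OF op] ne by auto
qed

lemma cbl2_eqI_AE: "AE x in lborel. val u x = val v x \<Longrightarrow> u = v"
  by (rule cbl2_eqI) (rule AE_lborel_eq_continuous, auto intro: continuous_on_val)

lemma fh_inj:
  assumes "AE \<xi> in lborel. fh u \<xi> = fh v \<xi>"
  shows "u = v"
proof (rule cbl2_eqI_AE)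
  show "AE x in lborel. val u x = val v x"
    using is_fourier_L2_inj[OF is_fourier_fh is_fourier_fh assms] by simp
qed

section \<open>Inversion with values in the algebra\<close>

definition hermitian :: "(real \<Rightarrow> complex) \<Rightarrow> bool" where
  "hermitian F \<longleftrightarrow> (AE \<xi> in lborel. F (- \<xi>) = cnj (F \<xi>))"

lemma hermitian_fh: "hermitian (fh u)"
proof -
  have "is_fourier_L2 (\<lambda>x. complex_of_real (val u x)) (\<lambda>\<xi>. cnj (fh u (- \<xi>)))"
    using is_fourier_L2_cnj[OF is_fourier_fh[of u]] by simp
  from is_fourier_L2_unique[OF is_fourier_fh this]
  have "AE \<xi> in lborel. fh u \<xi> = cnj (fh u (- \<xi>))" by simp
  then show ?thesis unfolding hermitian_def by (rule eventually_mono) (metis complex_cnj_cnj)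
qed

text \<open>The transforms whose inversion integral converges absolutely and yields an element of
  \<open>cbl2\<close>: integrability gives boundedness and continuity, square integrability gives
  \<open>L^2\<close>, and the symmetry gives real values.\<close>

definition \<F>dom :: "(real \<Rightarrow> complex) \<Rightarrow> bool" where
  "\<F>dom F \<longleftrightarrow> integrable lborel F \<and> square_integrable F \<and> hermitian F"

definition phys :: "(real \<Rightarrow> complex) \<Rightarrow> real \<Rightarrow> complex" where
  "phys F x = fourier F (- x) / (2 * pi)"

definition inv :: "(real \<Rightarrow> complex) \<Rightarrow> cbl2" where
  "inv F = mk (\<lambda>x. Re (phys F x))"

lemma norm_phys_le: "integrable lborel F \<Longrightarrow> norm (phys F x) \<le> (LINT \<xi>|lborel. norm (F \<xi>)) / (2 * pi)"
  using norm_fourier_le[of F "- x"] by (simp add: phys_def norm_divide divide_right_mono)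

lemma phys_real:
  assumes "\<F>dom F"
  shows "phys F x \<in> \<real>"
proof -
  have F: "integrable lborel F" and h: "AE \<xi> in lborel. F (- \<xi>) = cnj (F \<xi>)"
    using assms by (auto simp: \<F>dom_def hermitian_def)
  have [measurable]: "F \<in> borel_measurable borel" using F by auto
  have "fourier F (- x) = (CLINT \<xi>|lborel. F (- \<xi>) * iexp (- (x * \<xi>)))"
    unfolding fourier_def
    using lborel_integral_real_affine[of "-1" "\<lambda>\<xi>. F \<xi> * iexp (- (- x * \<xi>))" 0] by simp
  also have "\<dots> = (CLINT \<xi>|lborel. cnj (F \<xi> * iexp (- (- x * \<xi>))))"
    by (rule integral_cong_AE) (use h in \<open>auto elim!: eventually_mono simp: exp_cnj\<close>)
  also have "\<dots> = cnj (fourier F (- x))"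
    unfolding fourier_def by (rule Bochner_Integration.integral_cnj)
  finally have "cnj (phys F x) = phys F x" by (simp add: phys_def)
  then show ?thesis by (simp add: Reals_cnj_iff)
qed

lemma continuous_fourier:
  assumes F: "integrable lborel F"
  shows "continuous_on UNIV (fourier F)"
proof -
  have [measurable]: "F \<in> borel_measurable borel" using F by auto
  have "(\<lambda>n. fourier F (X n)) \<longlonglongrightarrow> fourier F x" if X: "X \<longlonglongrightarrow> x" for X x
    unfolding fourier_def
  proof (rule integral_dominated_convergence[where w = "\<lambda>\<xi>. norm (F \<xi>)"])
    show "AE \<xi> in lborel. (\<lambda>n. F \<xi> * iexp (- (X n * \<xi>))) \<longlonglongrightarrow> F \<xi> * iexp (- (x * \<xi>))"
      by (intro AE_I2 tendsto_intros X)
  qed (use F in \<open>auto simp: norm_mult\<close>)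
  then show ?thesis
    by (auto simp: continuous_on_eq_continuous_at continuous_at_sequentially o_def)
qed

lemma is_fourier_phys:
  assumes "integrable lborel F" "square_integrable F"
  shows "is_fourier_L2 (phys F) F"
  using is_fourier_L2_inverse[OF is_fourier_L2_fourier[OF assms]] by (simp add: phys_def[abs_def])

context
  fixes F assumes F: "\<F>dom F"
begin

lemma \<F>dom_integrable: "integrable lborel F" and \<F>dom_square_integrable: "square_integrable F"
  using F by (auto simp: \<F>dom_def)

lemma val_inv: "complex_of_real (val (inv F) x) = phys F x"
proof -
  have eq: "complex_of_real (Re (phys F x)) = phys F x" for x
    using phys_real[OF F, of x] by (simp add: complex_is_Real_iff complex_eq_iff)
  have "continuous_on UNIV (\<lambda>x. fourier F (- x))"
    by (rule continuous_on_compose2[OF continuous_fourier[OF \<F>dom_integrable]]) (auto intro!: continuous_intros)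
  then have cont: "continuous_on UNIV (\<lambda>x. Re (phys F x))"
    unfolding phys_def by (auto intro!: continuous_intros)
  have "val (inv F) = (\<lambda>x. Re (phys F x))"
    unfolding inv_def
  proof (rule val_mk[OF cont])
    show "\<bar>Re (phys F x)\<bar> \<le> (LINT \<xi>|lborel. norm (F \<xi>)) / (2 * pi)" for x
      using abs_Re_le_cmod[of "phys F x"] norm_phys_le[OF \<F>dom_integrable, of x] by linarith
    show "square_integrable (\<lambda>x. Re (phys F x))"
      using is_fourier_L2_D(1)[OF is_fourier_phys[OF \<F>dom_integrable \<F>dom_square_integrable]] eq
        square_integrable_of_real_iff[of "\<lambda>x. Re (phys F x)"] by simp
  qed
  then show ?thesis using eq by simp
qed

lemma fh_inv: "AE \<xi> in lborel. fh (inv F) \<xi> = F \<xi>"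
  by (rule is_fourier_L2_unique[OF is_fourier_fh is_fourier_phys[OF \<F>dom_integrable \<F>dom_square_integrable]])
    (simp add: val_inv)

lemma abs_val_inv_le: "\<bar>val (inv F) x\<bar> \<le> (LINT \<xi>|lborel. norm (F \<xi>)) / (2 * pi)"
  using norm_phys_le[OF \<F>dom_integrable, of x] by (simp flip: val_inv)

end

lemma inv_eqI:
  assumes "\<F>dom F" "AE \<xi> in lborel. fh u \<xi> = F \<xi>"
  shows "inv F = u"
proof (rule fh_inj)
  show "AE \<xi> in lborel. fh (inv F) \<xi> = fh u \<xi>"
    using fh_inv[OF assms(1)] assms(2) by eventually_elim simp
qed

text \<open>Differentiation under the inversion integral:
  \<open>|(e^(i h \<xi>) - 1) / h| \<le> |\<xi>|\<close>, so \<open>|\<xi> F|\<close> dominates all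
  difference quotients.\<close>

lemma inv_deriv:
  assumes F: "\<F>dom F" and G: "\<F>dom (\<lambda>\<xi>. \<i> * complex_of_real \<xi> * F \<xi>)"
  shows "(val (inv F) has_real_derivative val (inv (\<lambda>\<xi>. \<i> * complex_of_real \<xi> * F \<xi>)) x) (at x)"
proof -
  note Fi = \<F>dom_integrable[OF F] and Gi = \<F>dom_integrable[OF G]
  have [measurable]: "F \<in> borel_measurable borel" using Fi by auto
  have "((\<lambda>h. (val (inv F) (x + h) - val (inv F) x) / h) \<longlongrightarrow> val (inv (\<lambda>\<xi>. \<i> * complex_of_real \<xi> * F \<xi>)) x) (at 0)"
    unfolding tendsto_at_iff_sequentially
  proof (intro allI impI, unfold o_def)
    fix h :: "nat \<Rightarrow> real" assume h: "\<forall>n. h n \<in> UNIV - {0}" "h \<longlonglongrightarrow> 0"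
    define q where "q n \<xi> = F \<xi> * iexp (x * \<xi>) * ((iexp (h n * \<xi>) - 1) / h n)" for n \<xi>
    have "(\<lambda>n. CLINT \<xi>|lborel. q n \<xi>) \<longlonglongrightarrow> (CLINT \<xi>|lborel. F \<xi> * iexp (x * \<xi>) * (\<i> * complex_of_real \<xi>))"
    proof (rule integral_dominated_convergence[where w = "\<lambda>\<xi>. norm (\<i> * complex_of_real \<xi> * F \<xi>)"])
      show "integrable lborel (\<lambda>\<xi>. norm (\<i> * complex_of_real \<xi> * F \<xi>))" using Gi by simp
      show "AE \<xi> in lborel. (\<lambda>n. q n \<xi>) \<longlonglongrightarrow> F \<xi> * iexp (x * \<xi>) * (\<i> * complex_of_real \<xi>)"
      proof (rule AE_I2)
        fix \<xi>
        have "((\<lambda>z. exp (\<i> * complex_of_real \<xi> * z)) has_field_derivative \<i> * complex_of_real \<xi>) (at 0)"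
          by (auto intro!: derivative_eq_intros)
        then have "((\<lambda>z. (exp (\<i> * complex_of_real \<xi> * z) - 1) / z) \<longlongrightarrow> \<i> * complex_of_real \<xi>) (at 0)"
          by (simp add: has_field_derivative_iff)
        moreover have "filterlim (\<lambda>n. complex_of_real (h n)) (at 0) sequentially"
          unfolding filterlim_at using h by (auto intro!: tendsto_eq_intros)
        ultimately have "(\<lambda>n. (exp (\<i> * complex_of_real \<xi> * complex_of_real (h n)) - 1) / h n) \<longlonglongrightarrow> \<i> * complex_of_real \<xi>"
          by (rule filterlim_compose)
        then have "(\<lambda>n. F \<xi> * iexp (x * \<xi>) * ((exp (\<i> * complex_of_real \<xi> * complex_of_real (h n)) - 1) / h n)) \<longlonglongrightarrow> F \<xi> * iexp (x * \<xi>) * (\<i> * complex_of_real \<xi>)"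
          by (intro tendsto_intros)
        then show "(\<lambda>n. q n \<xi>) \<longlonglongrightarrow> F \<xi> * iexp (x * \<xi>) * (\<i> * complex_of_real \<xi>)"
          by (simp add: q_def mult_ac)
      qed
      show "AE \<xi> in lborel. norm (q n \<xi>) \<le> norm (\<i> * complex_of_real \<xi> * F \<xi>)" for n
      proof (rule AE_I2)
        fix \<xi>
        have "norm (iexp (h n * \<xi>) - 1) \<le> \<bar>h n * \<xi>\<bar>"
          using iexp_approx1[of "h n * \<xi>" 0] by simp
        then have "norm ((iexp (h n * \<xi>) - 1) / h n) \<le> \<bar>\<xi>\<bar>"
          using h(1) by (simp add: norm_divide abs_mult divide_le_eq mult.commute)
        then have "norm (F \<xi>) * norm ((iexp (h n * \<xi>) - 1) / h n) \<le> norm (F \<xi>) * \<bar>\<xi>\<bar>"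
          by (intro mult_left_mono) auto
        moreover have "norm (q n \<xi>) = norm (F \<xi>) * norm ((iexp (h n * \<xi>) - 1) / h n)"
          unfolding q_def norm_mult by simp
        ultimately show "norm (q n \<xi>) \<le> norm (\<i> * complex_of_real \<xi> * F \<xi>)"
          by (simp add: norm_mult mult.commute)
      qed
    qed (auto simp: q_def[abs_def])
    then have "(\<lambda>n. (CLINT \<xi>|lborel. q n \<xi>) / (2 * pi)) \<longlonglongrightarrow> (CLINT \<xi>|lborel. F \<xi> * iexp (x * \<xi>) * (\<i> * complex_of_real \<xi>)) / (2 * pi)"
      by (intro tendsto_intros) simp_all
    moreover have "(CLINT \<xi>|lborel. q n \<xi>) / (2 * pi) = complex_of_real ((val (inv F) (x + h n) - val (inv F) x) / h n)" for n
    proof -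
      have ints: "integrable lborel (\<lambda>\<xi>. F \<xi> * iexp (- (- (x + h n) * \<xi>)))" "integrable lborel (\<lambda>\<xi>. F \<xi> * iexp (- (- x * \<xi>)))"
        by (rule integrable_fourier_integrand[OF Fi])+
      have "(CLINT \<xi>|lborel. q n \<xi>) = (CLINT \<xi>|lborel. (F \<xi> * iexp (- (- (x + h n) * \<xi>)) - F \<xi> * iexp (- (- x * \<xi>))) / h n)"
        by (rule Bochner_Integration.integral_cong)
          (auto simp: q_def algebra_simps exp_add diff_divide_distrib)
      also have "\<dots> = (fourier F (- (x + h n)) - fourier F (- x)) / h n"
        unfolding fourier_def using ints by simp
      finally show ?thesis
        by (simp add: val_inv[OF F] phys_def diff_divide_distrib field_simps)
    qed
    moreover have "(CLINT \<xi>|lborel. F \<xi> * iexp (x * \<xi>) * (\<i> * complex_of_real \<xi>)) / (2 * pi) = complex_of_real (val (inv (\<lambda>\<xi>. \<i> * complex_of_real \<xi> * F \<xi>)) x)"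
      unfolding val_inv[OF G] phys_def fourier_def by (simp add: mult_ac)
    ultimately have "(\<lambda>n. complex_of_real ((val (inv F) (x + h n) - val (inv F) x) / h n)) \<longlonglongrightarrow> complex_of_real (val (inv (\<lambda>\<xi>. \<i> * complex_of_real \<xi> * F \<xi>)) x)"
      by simp
    then show "(\<lambda>n. (val (inv F) (x + h n) - val (inv F) x) / h n) \<longlonglongrightarrow> val (inv (\<lambda>\<xi>. \<i> * complex_of_real \<xi> * F \<xi>)) x"
      by (simp only: tendsto_of_real_iff)
  qed
  then show ?thesis by (simp add: DERIV_def)
qed

text \<open>Symbols of smoothing multipliers. Boundedness with bounded support makes the symbol
  square integrable, so that its product with any transform in \<open>L^2\<close> is integrable by
  Cauchy-Schwarz; conjugate symmetry keeps functions real.\<close>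

definition csym :: "(real \<Rightarrow> complex) \<Rightarrow> bool" where
  "csym \<phi> \<longleftrightarrow> \<phi> \<in> borel_measurable borel \<and> (\<forall>\<xi>. \<phi> (- \<xi>) = cnj (\<phi> \<xi>)) \<and>
    (\<exists>R B. \<forall>\<xi>. norm (\<phi> \<xi>) \<le> B * indicator {-R..R} \<xi>)"

lemma csym_measurable: "csym \<phi> \<Longrightarrow> \<phi> \<in> borel_measurable borel"
  by (simp add: csym_def)

lemma csymI:
  assumes "\<psi> \<in> borel_measurable borel" "\<And>\<xi>. \<psi> (- \<xi>) = cnj (\<psi> \<xi>)"
    "\<And>\<xi>. \<bar>\<xi>\<bar> \<le> R \<Longrightarrow> norm (\<psi> \<xi>) \<le> B" "\<And>\<xi>. \<bar>\<xi>\<bar> > R \<Longrightarrow> \<psi> \<xi> = 0"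
  shows "csym \<psi>"
  unfolding csym_def
proof (intro conjI exI allI)
  show "norm (\<psi> \<xi>) \<le> B * indicator {-R..R} \<xi>" for \<xi>
    using assms(3,4)[of \<xi>] by (cases "\<bar>\<xi>\<bar> \<le> R") (auto simp: indicator_def abs_le_iff)
qed (use assms in auto)

lemma csym_bounded: "csym \<phi> \<Longrightarrow> \<exists>B. \<forall>\<xi>. norm (\<phi> \<xi>) \<le> B"
proof -
  assume "csym \<phi>"
  then obtain R B where b: "\<And>\<xi>. norm (\<phi> \<xi>) \<le> B * indicator {-R..R} \<xi>" by (auto simp: csym_def)
  have "norm (\<phi> \<xi>) \<le> \<bar>B\<bar>" for \<xi>
    using b[of \<xi>] by (cases "\<xi> \<in> {-R..R}") (auto simp: indicator_def)
  then show ?thesis by blast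
qed

lemma csym_mult_cont:
  assumes "csym \<phi>" "continuous_on UNIV \<psi>" "\<And>\<xi>. \<psi> (- \<xi>) = cnj (\<psi> \<xi>)"
  shows "csym (\<lambda>\<xi>. \<psi> \<xi> * \<phi> \<xi>)"
proof -
  obtain R B where b: "\<And>\<xi>. norm (\<phi> \<xi>) \<le> B * indicator {-R..R} \<xi>" using assms by (auto simp: csym_def)
  have "compact (\<psi> ` {-R..R})"
    by (intro compact_continuous_image continuous_on_subset[OF assms(2)]) auto
  then obtain c where c: "\<And>\<xi>. \<xi> \<in> {-R..R} \<Longrightarrow> norm (\<psi> \<xi>) \<le> c"
    using compact_imp_bounded bounded_iff by (metis imageI)
  have [measurable]: "\<psi> \<in> borel_measurable borel" using assms(2) by (rule borel_measurable_continuous_onI)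
  have [measurable]: "\<phi> \<in> borel_measurable borel" using assms by (simp add: csym_def)
  show ?thesis
  proof (rule csymI[where R = R and B = "c * B"])
    show "norm (\<psi> \<xi> * \<phi> \<xi>) \<le> c * B" if "\<bar>\<xi>\<bar> \<le> R" for \<xi>
    proof -
      have i: "\<xi> \<in> {-R..R}" using that by auto
      have "norm (\<phi> \<xi>) \<le> B" using b[of \<xi>] i by simp
      then show ?thesis unfolding norm_mult
        by (intro mult_mono c i) (auto intro: order_trans[OF norm_ge_zero c[OF i]])
    qed
    show "\<psi> \<xi> * \<phi> \<xi> = 0" if "\<bar>\<xi>\<bar> > R" for \<xi>
    proof -
      have "\<xi> \<notin> {-R..R}" using that by auto
      then show ?thesis using b[of \<xi>] by simp
    qed
  qed (use assms in \<open>auto simp: csym_def\<close>)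
qed

lemma csym_deriv: "csym \<phi> \<Longrightarrow> csym (\<lambda>\<xi>. \<i> * complex_of_real \<xi> * \<phi> \<xi>)"
  by (rule csym_mult_cont) (auto intro!: continuous_intros)

lemma square_integrable_csym:
  assumes "csym \<phi>" shows "square_integrable \<phi>"
proof -
  obtain R B where b: "\<And>\<xi>. norm (\<phi> \<xi>) \<le> B * indicator {-R..R} \<xi>" using assms by (auto simp: csym_def)
  show ?thesis
    by (rule square_integrable_bound[OF csym_measurable[OF assms] square_integrable_interval_indicator[where 'a = real, of "-R" R], of B])
      (use b in simp)
qed

lemma hermitian_mult:
  assumes "\<And>\<xi>. \<phi> (- \<xi>) = cnj (\<phi> \<xi>)" "hermitian F"
  shows "hermitian (\<lambda>\<xi>. \<phi> \<xi> * F \<xi>)"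
  using assms(2) unfolding hermitian_def by (rule eventually_mono) (simp add: assms(1))

lemma \<F>dom_csym_fh:
  assumes "csym \<phi>"
  shows "\<F>dom (\<lambda>\<xi>. \<phi> \<xi> * fh u \<xi>)"
proof -
  obtain B where B: "\<forall>\<xi>. norm (\<phi> \<xi>) \<le> B" using csym_bounded[OF assms] by blast
  show ?thesis
    unfolding \<F>dom_def
  proof (intro conjI)
    show "integrable lborel (\<lambda>\<xi>. \<phi> \<xi> * fh u \<xi>)"
      by (intro integrable_prod_square_integrable square_integrable_csym assms square_integrable_fh)
    show "square_integrable (\<lambda>\<xi>. \<phi> \<xi> * fh u \<xi>)"
      by (rule square_integrable_bounded_mult[of _ B]) (use assms B in \<open>auto simp: csym_def\<close>)
    show "hermitian (\<lambda>\<xi>. \<phi> \<xi> * fh u \<xi>)"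
      by (rule hermitian_mult) (use assms in \<open>auto simp: csym_def hermitian_fh\<close>)
  qed
qed

definition mul :: "(real \<Rightarrow> complex) \<Rightarrow> cbl2 \<Rightarrow> cbl2" where
  "mul \<phi> u = inv (\<lambda>\<xi>. \<phi> \<xi> * fh u \<xi>)"

lemma fh_mul: "csym \<phi> \<Longrightarrow> AE \<xi> in lborel. fh (mul \<phi> u) \<xi> = \<phi> \<xi> * fh u \<xi>"
  unfolding mul_def by (rule fh_inv[OF \<F>dom_csym_fh])

lemma mul_eqI: "csym \<phi> \<Longrightarrow> AE \<xi> in lborel. fh v \<xi> = \<phi> \<xi> * fh u \<xi> \<Longrightarrow> mul \<phi> u = v"
  unfolding mul_def by (rule inv_eqI[OF \<F>dom_csym_fh])

lemma mul_add: "csym \<phi> \<Longrightarrow> mul \<phi> (u + v) = mul \<phi> u + mul \<phi> v"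
proof (rule mul_eqI)
  assume a: "csym \<phi>"
  show "AE \<xi> in lborel. fh (mul \<phi> u + mul \<phi> v) \<xi> = \<phi> \<xi> * fh (u + v) \<xi>"
    using fh_add[of "mul \<phi> u" "mul \<phi> v"] fh_add[of u v] fh_mul[OF a, of u] fh_mul[OF a, of v]
    by eventually_elim (simp add: distrib_left)
qed

lemma mul_scaleR: "csym \<phi> \<Longrightarrow> mul \<phi> (c *\<^sub>R u) = c *\<^sub>R mul \<phi> u"
proof (rule mul_eqI)
  assume a: "csym \<phi>"
  show "AE \<xi> in lborel. fh (c *\<^sub>R mul \<phi> u) \<xi> = \<phi> \<xi> * fh (c *\<^sub>R u) \<xi>"
    using fh_scaleR[of c "mul \<phi> u"] fh_scaleR[of c u] fh_mul[OF a, of u]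
    by eventually_elim simp
qed

lemma l2_eq_fh: "l2 u = l2n (fh u) / sqrt (2 * pi)"
  by (simp add: l2n_fh)

lemma l2n_mono_AE:
  fixes f g :: "real \<Rightarrow> complex"
  assumes "square_integrable g" "f \<in> borel_measurable borel" "AE x in lborel. norm (f x) \<le> c * norm (g x)" "0 \<le> c"
  shows "l2n f \<le> c * l2n g"
proof -
  have [measurable]: "f \<in> borel_measurable borel" "g \<in> borel_measurable borel" using assms by auto
  define h where "h x = (if norm (f x) \<le> c * norm (g x) then f x else 0)" for x
  have hm [measurable]: "h \<in> borel_measurable borel" unfolding h_def by measurable
  have "l2n f = l2n h"
    by (rule l2n_cong_AE) (use assms(3) in \<open>auto simp: h_def elim: eventually_mono\<close>)
  also have "\<dots> \<le> c * l2n g"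
    by (rule l2n_mono[OF assms(1) hm _ assms(4)]) (simp add: h_def assms(4))
  finally show ?thesis .
qed

lemma l2_mono_fh:
  assumes "AE \<xi> in lborel. norm (fh u \<xi>) \<le> c * norm (fh v \<xi>)" "0 \<le> c"
  shows "l2 u \<le> c * l2 v"
  using l2n_mono_AE[OF square_integrable_fh fh_measurable assms]
  by (simp add: l2_eq_fh divide_right_mono)

lemma l2_mul_le:
  assumes "csym \<phi>" "\<And>\<xi>. norm (\<phi> \<xi>) \<le> B"
  shows "l2 (mul \<phi> u) \<le> B * l2 u"
proof (rule l2_mono_fh)
  show "AE \<xi> in lborel. norm (fh (mul \<phi> u) \<xi>) \<le> B * norm (fh u \<xi>)"
    using fh_mul[OF assms(1), of u] by (rule eventually_mono) (simp add: norm_mult mult_right_mono assms(2))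
  show "0 \<le> B" using assms(2)[of 0] norm_ge_zero order_trans by blast
qed

text \<open>Cauchy-Schwarz between the symbol and the transform bounds the supremum, the supremum of
  the symbol bounds the \<open>L^2\<close> norm. This is what makes the truncated right-hand side
  locally Lipschitz.\<close>

lemma bounded_linear_mul:
  assumes "csym \<phi>"
  shows "bounded_linear (mul \<phi>)"
proof -
  obtain B where B: "\<And>\<xi>. norm (\<phi> \<xi>) \<le> B" using csym_bounded[OF assms] by blast
  define K where "K = l2n \<phi> * sqrt (2 * pi) / (2 * pi)"
  have "norm (mul \<phi> u) \<le> K * l2 u + B * l2 u" for u
  proof (rule norm_cbl2_le)
    show "\<bar>val (mul \<phi> u) x\<bar> \<le> K * l2 u" for x
    proof -
      have "\<bar>val (mul \<phi> u) x\<bar> \<le> (LINT \<xi>|lborel. norm (\<phi> \<xi> * fh u \<xi>)) / (2 * pi)"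
        unfolding mul_def by (rule abs_val_inv_le[OF \<F>dom_csym_fh[OF assms]])
      also have "\<dots> \<le> (l2n \<phi> * l2n (fh u)) / (2 * pi)"
        unfolding norm_mult
        by (intro divide_right_mono Cauchy_Schwarz_l2n square_integrable_csym assms square_integrable_fh) simp
      also have "\<dots> = K * l2 u" by (simp add: K_def l2n_fh)
      finally show ?thesis .
    qed
    show "l2 (mul \<phi> u) \<le> B * l2 u" by (rule l2_mul_le[OF assms B])
  qed
  moreover have "K * l2 u + B * l2 u \<le> norm u * (K + B)" for u
  proof -
    have "0 \<le> K + B" unfolding K_def
      by (intro add_nonneg_nonneg order_trans[OF norm_ge_zero B[of 0]]) auto
    then show ?thesis using mult_left_mono[OF l2n_val_le[of u], of "K + B"] by (simp add: algebra_simps)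
  qed
  ultimately show ?thesis
    by (intro bounded_linear_intro[where K = "K + B"] mul_add mul_scaleR assms) (rule order_trans)
qed

lemma ip_fh_cong:
  assumes "AE \<xi> in lborel. fh u \<xi> * cnj (fh v \<xi>) = fh u' \<xi> * cnj (fh v' \<xi>)"
  shows "ip u v = ip u' v'"
proof -
  have [measurable]: "(\<lambda>\<xi>. cnj (fh u \<xi>)) \<in> borel_measurable borel" for u
    by (rule measurable_compose[OF fh_measurable cnj_measurable])
  have "(CLINT \<xi>|lborel. fh u \<xi> * cnj (fh v \<xi>)) = (CLINT \<xi>|lborel. fh u' \<xi> * cnj (fh v' \<xi>))"
    by (rule integral_cong_AE) (use assms in auto)
  then have "complex_of_real (2 * pi * ip u v) = complex_of_real (2 * pi * ip u' v')"
    by (simp only: fh_parseval)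
  then have "2 * pi * ip u v = 2 * pi * ip u' v'" by (simp only: of_real_eq_iff)
  then show ?thesis by simp
qed

lemma mul_deriv:
  assumes "csym \<phi>"
  shows "(val (mul \<phi> u) has_real_derivative val (mul (\<lambda>\<xi>. \<i> * complex_of_real \<xi> * \<phi> \<xi>) u) x) (at x)"
  using inv_deriv[OF \<F>dom_csym_fh[OF assms]] \<F>dom_csym_fh[OF csym_deriv[OF assms]]
  by (simp add: mul_def mult.assoc)

subsection \<open>Derivatives\<close>

definition is_deriv :: "cbl2 \<Rightarrow> cbl2 \<Rightarrow> bool" where
  "is_deriv f g \<longleftrightarrow> (\<forall>x. (val f has_real_derivative val g x) (at x))"

text \<open>The integral of \<open>p (x + 1) - p x\<close> vanishes by translation invariance, and
  by Fubini it equals the integral of \<open>p'\<close>. This avoids any discussion of decay at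
  infinity.\<close>

lemma integral_deriv_eq_0:
  fixes p p' :: "real \<Rightarrow> real"
  assumes p: "integrable lborel p" and p': "integrable lborel p'"
    and deriv: "\<And>x. (p has_real_derivative p' x) (at x)" and cont: "\<And>x. isCont p' x"
  shows "(LINT x|lborel. p' x) = 0"
proof -
  have [measurable]: "p \<in> borel_measurable borel" "p' \<in> borel_measurable borel" using p p' by auto
  have shift: "integrable lborel (\<lambda>x. q (x + s))" "(LINT x|lborel. q (x + s)) = (LINT x|lborel. q x)"
    if "integrable lborel q" for q :: "real \<Rightarrow> real" and s
    using lborel_integrable_real_affine[OF that, of 1 s] lborel_integral_real_affine[of 1 q s]
    by (simp_all add: add.commute)
  define k where "k x s = p' (x + s) * indicator {0..1} s" for x s :: real
  have km: "case_prod k \<in> borel_measurable (lborel \<Otimes>\<^sub>M lborel)" unfolding k_def by measurable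
  have ki: "integrable (lborel \<Otimes>\<^sub>M lborel) (\<lambda>(s, x). k x s)"
  proof (rule lborel_pair.Fubini_integrable)
    show "(\<lambda>(s, x). k x s) \<in> borel_measurable (lborel \<Otimes>\<^sub>M lborel)" unfolding k_def by measurable
    have "(LINT x|lborel. norm (k x s)) = (LINT x|lborel. \<bar>p' x\<bar>) * indicator {0..1} s" for s
      using shift(2)[of "\<lambda>x. \<bar>p' x\<bar>" s] p' by (simp add: k_def abs_mult)
    moreover have "integrable lborel (\<lambda>s. (LINT x|lborel. \<bar>p' x\<bar>) * indicator {0..1} (s::real))"
      using emeasure_lborel_interval_finite[of 0 1] by (intro integrable_mult_right) (simp add: integrable_indicator_iff)
    ultimately show "integrable lborel (\<lambda>s. LINT x|lborel. norm (case (s, x) of (s, x) \<Rightarrow> k x s))" by simp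
    show "AE s in lborel. integrable lborel (\<lambda>x. case (s, x) of (s, x) \<Rightarrow> k x s)"
      using shift(1)[OF p'] by (simp add: k_def)
  qed
  have "(LINT x|lborel. p (x + 1) - p x) = (LINT x|lborel. LINT s|lborel. k x s)"
  proof (rule Bochner_Integration.integral_cong[OF refl])
    fix x
    have "(LINT s|lborel. p' (x + s) * indicator {0..1} s) = p (x + 1) - p (x + 0)"
    proof (rule integral_FTC_Icc_real)
      show "((\<lambda>s. p (x + s)) has_real_derivative p' (x + s)) (at s)" for s
        using DERIV_shift[of p "p' (x + s)" s x] deriv by (simp add: add.commute)
      show "isCont (\<lambda>s. p' (x + s)) s" for s
        by (rule isCont_o2[OF _ cont]) (intro continuous_intros)
    qed simp
    then show "p (x + 1) - p x = (LINT s|lborel. k x s)" by (simp add: k_def)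
  qed
  also have "\<dots> = (LINT s|lborel. LINT x|lborel. k x s)"
    using lborel_pair.Fubini_integral[OF ki] by simp
  also have "\<dots> = (LINT s|lborel. (LINT x|lborel. p' x) * indicator {0..1::real} s)"
    by (simp add: k_def shift(2)[OF p'])
  also have "\<dots> = (LINT x|lborel. p' x)" by (simp add: measure_lborel_Icc)
  finally show ?thesis using shift[OF p, of 1] p by simp
qed

lemma ip_by_parts:
  assumes "is_deriv f f'" "is_deriv g g'"
  shows "ip f' g = - ip f g'"
proof -
  have "(LINT x|lborel. val f' x * val g x + val f x * val g' x) = 0"
  proof (rule integral_deriv_eq_0)
    show "integrable lborel (\<lambda>x. val f x * val g x)" by (rule integrable_val_mult)
    show "integrable lborel (\<lambda>x. val f' x * val g x + val f x * val g' x)"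
      by (intro Bochner_Integration.integrable_add integrable_val_mult)
    show "((\<lambda>x. val f x * val g x) has_real_derivative val f' x * val g x + val f x * val g' x) (at x)" for x
      using assms by (auto simp: is_deriv_def intro!: derivative_eq_intros)
    show "isCont (\<lambda>x. val f' x * val g x + val f x * val g' x) x" for x
      by (intro continuous_intros isCont_val)
  qed
  then show ?thesis by (simp add: ip_def integrable_val_mult)
qed

text \<open>Integration by parts is tested against band-limited functions, whose derivatives are
  known explicitly. On each window \<open>{-R..R}\<close> the test function is the band-limited part
  of the discrepancy itself, which is thereby shown to have norm zero.\<close>

theorem is_deriv_fh:
  assumes "is_deriv f g"
  shows "AE \<xi> in lborel. fh g \<xi> = \<i> * complex_of_real \<xi> * fh f \<xi>"
proof -
  have zero: "AE \<xi> in lborel. indicator {-R..R} \<xi> * (fh g \<xi> - \<i> * complex_of_real \<xi> * fh f \<xi>) = 0" for R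
  proof -
    define \<psi> where "\<psi> \<xi> = complex_of_real (indicator {-R..R} \<xi>)" for \<xi>
    have "\<psi> \<in> borel_measurable borel" unfolding \<psi>_def by measurable
    then have \<psi>: "csym \<psi>"
      by (rule csymI[of _ R 1]) (auto simp: \<psi>_def indicator_def)
    note \<psi>' = csym_deriv[OF \<psi>]
    \<comment> \<open>The transform of \<open>k\<close> is the discrepancy cut off to the window.
      Since the symbol of the derivative is imaginary, the pairing of \<open>g\<close> with
      \<open>k\<close> plus that of \<open>f\<close> with \<open>k'\<close> collapses to the squared
      norm of \<open>k\<close>.\<close>
    define k where "k = mul \<psi> g - mul (\<lambda>\<xi>. \<i> * complex_of_real \<xi> * \<psi> \<xi>) f"
    define H where "H \<xi> = indicator {-R..R} \<xi> * (fh g \<xi> - \<i> * complex_of_real \<xi> * fh f \<xi>)" for \<xi>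
    have fhk: "AE \<xi> in lborel. fh k \<xi> = H \<xi>"
      using fh_diff[of "mul \<psi> g" "mul (\<lambda>\<xi>. \<i> * complex_of_real \<xi> * \<psi> \<xi>) f"] fh_mul[OF \<psi>, of g] fh_mul[OF \<psi>', of f]
      unfolding k_def by eventually_elim (simp add: H_def \<psi>_def algebra_simps of_real_indicator)
    define k' where "k' = mul (\<lambda>\<xi>. \<i> * complex_of_real \<xi> * \<psi> \<xi>) g - mul (\<lambda>\<xi>. \<i> * complex_of_real \<xi> * (\<i> * complex_of_real \<xi> * \<psi> \<xi>)) f"
    have kk': "is_deriv k k'"
      unfolding is_deriv_def k_def k'_def
      using mul_deriv[OF \<psi>, of g] mul_deriv[OF \<psi>', of f] by (auto intro!: derivative_eq_intros)
    have fhk': "AE \<xi> in lborel. fh k' \<xi> = \<i> * complex_of_real \<xi> * H \<xi>"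
      using fh_diff[of "mul (\<lambda>\<xi>. \<i> * complex_of_real \<xi> * \<psi> \<xi>) g" "mul (\<lambda>\<xi>. \<i> * complex_of_real \<xi> * (\<i> * complex_of_real \<xi> * \<psi> \<xi>)) f"]
        fh_mul[OF \<psi>', of g] fh_mul[OF csym_deriv[OF \<psi>'], of f]
      unfolding k'_def by eventually_elim (simp add: H_def \<psi>_def algebra_simps of_real_indicator)
    have [measurable]: "(\<lambda>\<xi>. cnj (fh u \<xi>)) \<in> borel_measurable borel" for u
      by (rule measurable_compose[OF fh_measurable cnj_measurable])
    note ints = integrable_prod_square_integrable[OF square_integrable_fh square_integrable_cnj[OF square_integrable_fh]]
    have "complex_of_real (2 * pi * ip g k) + complex_of_real (2 * pi * ip f k') = 0"
      using ip_by_parts[OF assms kk'] by simp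
    then have "(CLINT \<xi>|lborel. fh g \<xi> * cnj (fh k \<xi>) + fh f \<xi> * cnj (fh k' \<xi>)) = 0"
      unfolding fh_parseval using ints by simp
    also have "(CLINT \<xi>|lborel. fh g \<xi> * cnj (fh k \<xi>) + fh f \<xi> * cnj (fh k' \<xi>))
        = (CLINT \<xi>|lborel. fh k \<xi> * cnj (fh k \<xi>))"
    proof (rule integral_cong_AE)
      show "AE \<xi> in lborel. fh g \<xi> * cnj (fh k \<xi>) + fh f \<xi> * cnj (fh k' \<xi>) = fh k \<xi> * cnj (fh k \<xi>)"
        using fhk fhk'
      proof eventually_elim
        case (elim \<xi>)
        show ?case unfolding elim by (cases "\<xi> \<in> {-R..R}") (auto simp: H_def algebra_simps)
      qed
    qed measurable
    finally have "complex_of_real (2 * pi * ip k k) = 0" by (simp only: fh_parseval)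
    then have "l2 k = 0" by (simp add: ip_self)
    then have "l2n (fh k) = 0" by (simp add: l2n_fh)
    from l2n_eq_0_AE[OF square_integrable_fh this] fhk
    show ?thesis by eventually_elim (simp add: H_def)
  qed
  have "AE \<xi> in lborel. \<forall>n::nat. indicator {- real n..real n} \<xi> * (fh g \<xi> - \<i> * complex_of_real \<xi> * fh f \<xi>) = 0"
    unfolding AE_all_countable using zero by blast
  then show ?thesis
  proof (rule eventually_mono)
    fix \<xi>
    assume a: "\<forall>n::nat. indicator {- real n..real n} \<xi> * (fh g \<xi> - \<i> * complex_of_real \<xi> * fh f \<xi>) = 0"
    obtain n :: nat where "\<bar>\<xi>\<bar> \<le> real n" using real_arch_simple by blast
    then have "\<xi> \<in> {- real n..real n}" by auto
    with a[rule_format, of n] show "fh g \<xi> = \<i> * complex_of_real \<xi> * fh f \<xi>" by simp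
  qed
qed

text \<open>Constant of the one-dimensional Sobolev embedding: by Cauchy-Schwarz against this
  weight, the \<open>L^1\<close> norm of a transform is controlled by the \<open>L^2\<close> norms
  of \<open>F\<close> and \<open>\<xi> F\<close>.\<close>

definition \<kappa> :: real where
  "\<kappa> = l2n (\<lambda>\<xi>. 1 / sqrt (1 + \<xi>\<^sup>2))"

lemma square_integrable_bracket: "square_integrable (\<lambda>\<xi>. 1 / sqrt (1 + \<xi>\<^sup>2))"
proof (rule square_integrableI)
  show "integrable lborel (\<lambda>\<xi>::real. inverse (1 + \<xi>\<^sup>2))"
    using integrable_inverse_1_plus_square by (simp add: set_integrable_def einterval_eq)
qed (auto simp: power_divide inverse_eq_divide)

lemma \<kappa>_nonneg: "0 \<le> \<kappa>"
  by (simp add: \<kappa>_def)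

lemma \<F>domI:
  assumes F: "square_integrable F" and G: "square_integrable (\<lambda>\<xi>. complex_of_real \<xi> * F \<xi>)" and h: "hermitian F"
  shows "\<F>dom F" "(LINT \<xi>|lborel. norm (F \<xi>)) \<le> \<kappa> * (l2n F + l2n (\<lambda>\<xi>. complex_of_real \<xi> * F \<xi>))"
proof -
  have [measurable]: "F \<in> borel_measurable borel" using F by auto
  define w where "w \<xi> = norm (F \<xi>) + norm (complex_of_real \<xi> * F \<xi>)" for \<xi>
  have w: "square_integrable w"
    unfolding w_def by (intro square_integrable_add square_integrable_norm F G)
  have le: "norm (F \<xi>) \<le> 1 / sqrt (1 + \<xi>\<^sup>2) * w \<xi>" for \<xi>
  proof -
    have "sqrt (1 + \<xi>\<^sup>2) \<le> 1 + \<bar>\<xi>\<bar>"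
      by (rule real_le_lsqrt) (auto simp: power2_sum)
    then have "sqrt (1 + \<xi>\<^sup>2) * norm (F \<xi>) \<le> (1 + \<bar>\<xi>\<bar>) * norm (F \<xi>)"
      by (rule mult_right_mono) simp
    moreover have "0 < sqrt (1 + \<xi>\<^sup>2)" by (simp add: add_pos_nonneg)
    ultimately show ?thesis by (simp add: w_def norm_mult field_simps)
  qed
  note int = integrable_prod_square_integrable[OF square_integrable_bracket w]
  have w0: "0 \<le> w \<xi>" for \<xi> by (simp add: w_def)
  have Fi: "integrable lborel F"
    by (rule Bochner_Integration.integrable_bound[OF int]) (use le w0 in \<open>auto simp: abs_mult\<close>)
  then show "\<F>dom F" using F h by (simp add: \<F>dom_def)
  have "(LINT \<xi>|lborel. norm (F \<xi>)) \<le> (LINT \<xi>|lborel. 1 / sqrt (1 + \<xi>\<^sup>2) * w \<xi>)"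
    by (rule integral_mono) (use Fi int le in auto)
  also have "\<dots> \<le> \<kappa> * l2n w"
    using norm_integral_prod_le[OF square_integrable_bracket w] by (simp add: \<kappa>_def)
  also have "l2n w \<le> l2n F + l2n (\<lambda>\<xi>. complex_of_real \<xi> * F \<xi>)"
    unfolding w_def using l2n_triangle[OF square_integrable_norm[OF F] square_integrable_norm[OF G]]
    by (simp only: l2n_norm)
  finally show "(LINT \<xi>|lborel. norm (F \<xi>)) \<le> \<kappa> * (l2n F + l2n (\<lambda>\<xi>. complex_of_real \<xi> * F \<xi>))"
    by (simp add: mult_left_mono \<kappa>_nonneg)
qed

text \<open>Sobolev embedding: inversion bounds the supremum by the \<open>L^1\<close> norm of the
  transform. The Plancherel factor \<open>sqrt (2 * pi)\<close> and the inversion factor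
  \<open>1 / (2 * pi)\<close> combine to at most 1.\<close>

lemma is_deriv_sup_le:
  assumes "is_deriv f g"
  shows "\<bar>val f x\<bar> \<le> \<kappa> * (l2 f + l2 g)"
proof -
  note D = is_deriv_fh[OF assms]
  have AE': "AE \<xi> in lborel. norm (complex_of_real \<xi> * fh f \<xi>) = norm (fh g \<xi>)"
    using D by (rule eventually_mono) (simp add: norm_mult)
  have i: "- \<i> * (\<i> * z) = z" for z :: complex by (simp add: mult.assoc[symmetric])
  have iG: "square_integrable (\<lambda>\<xi>. - \<i> * fh g \<xi>)" by (intro square_integrable_mult_left) simp
  have iAE: "AE \<xi> in lborel. - \<i> * fh g \<xi> = complex_of_real \<xi> * fh f \<xi>"
    using D by (rule eventually_mono) (simp only: mult.assoc i)
  have G: "square_integrable (\<lambda>\<xi>. complex_of_real \<xi> * fh f \<xi>)"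
    by (rule square_integrable_cong_AE[OF iAE iG]) measurable
  have "l2n (\<lambda>\<xi>. complex_of_real \<xi> * fh f \<xi>) \<le> 1 * l2n (fh g)"
    by (rule l2n_mono_AE) (use AE' in \<open>auto elim: eventually_mono\<close>)
  then have le: "l2n (\<lambda>\<xi>. complex_of_real \<xi> * fh f \<xi>) \<le> sqrt (2 * pi) * l2 g" by (simp add: l2n_fh)
  note dom = \<F>domI[OF square_integrable_fh G hermitian_fh]
  have "inv (fh f) = f" by (rule inv_eqI[OF dom(1)]) simp
  then have "\<bar>val f x\<bar> \<le> (LINT \<xi>|lborel. norm (fh f \<xi>)) / (2 * pi)"
    using abs_val_inv_le[OF dom(1), of x] by simp
  also have "\<dots> \<le> (\<kappa> * (sqrt (2 * pi) * (l2 f + l2 g))) / (2 * pi)"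
    using dom(2) mult_left_mono[OF le \<kappa>_nonneg] by (intro divide_right_mono) (auto simp: l2n_fh algebra_simps)
  also have "\<dots> = \<kappa> * (l2 f + l2 g) * (sqrt (2 * pi) / (2 * pi))" by simp
  also have "\<dots> \<le> \<kappa> * (l2 f + l2 g) * 1"
  proof (rule mult_left_mono)
    have "sqrt (2 * pi) \<le> 2 * pi" using pi_ge_two by (intro real_le_lsqrt) (auto simp: power2_eq_square)
    then show "sqrt (2 * pi) / (2 * pi) \<le> 1" by (simp add: divide_le_eq_1)
  qed (simp add: \<kappa>_nonneg)
  finally show ?thesis by simp
qed

section \<open>The Picard theorem in a Banach space\<close>

lemma integral_exp_le:
  fixes \<rho> \<tau> :: real
  assumes "\<rho> > 0" "0 \<le> \<tau>"
  shows "integral {0..\<tau>} (\<lambda>s. exp (\<rho> * s)) \<le> exp (\<rho> * \<tau>) / \<rho>"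
proof -
  have "((\<lambda>s. exp (\<rho> * s)) has_integral exp (\<rho> * \<tau>) / \<rho> - exp (\<rho> * 0) / \<rho>) {0..\<tau>}"
    using assms
    by (intro fundamental_theorem_of_calculus)
      (auto intro!: derivative_eq_intros simp flip: has_real_derivative_iff_has_vector_derivative)
  then have "integral {0..\<tau>} (\<lambda>s. exp (\<rho> * s)) = exp (\<rho> * \<tau>) / \<rho> - 1 / \<rho>"
    by (simp add: integral_unique)
  then show ?thesis using assms by simp
qed

text \<open>
  The exponential weight makes the Picard map a contraction on the whole of \<open>{0..T}\<close>.
\<close>

theorem picard_global:
  fixes F :: "'a::banach \<Rightarrow> 'a"
  assumes lip: "\<And>x y. norm (F x - F y) \<le> L * norm (x - y)" and T: "0 \<le> T"
  obtains z where "z 0 = z0" "\<And>t. t \<in> {0..T} \<Longrightarrow> (z has_vector_derivative F (z t)) (at t within {0..T})"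
proof -
  define L' where "L' = \<bar>L\<bar> + 1"
  have L': "L' > 0" "norm (F x - F y) \<le> L' * norm (x - y)" for x y
  proof -
    show "L' > 0" by (simp add: L'_def)
    have "L * norm (x - y) \<le> L' * norm (x - y)" by (intro mult_right_mono) (auto simp: L'_def)
    then show "norm (F x - F y) \<le> L' * norm (x - y)" using lip[of x y] by simp
  qed
  have Fc: "continuous_on S F" for S
    by (rule lipschitz_on_continuous_on[of L'], rule lipschitz_onI) (use L' in \<open>auto simp: dist_norm less_imp_le\<close>)
  \<comment> \<open>Twice the Lipschitz constant, so that integrating the weight leaves the
    contraction factor \<open>L' / \<rho> = 1 / 2\<close>.\<close>
  define \<rho> where "\<rho> = 2 * L'"
  have \<rho>: "\<rho> > 0" using L' by (simp add: \<rho>_def)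
  \<comment> \<open>Clamping time to \<open>{0..T}\<close> lets the fixed point live in the complete
    space of bounded continuous functions on the whole line.\<close>
  define c where "c t = max 0 (min T t)" for t
  have c: "c t \<in> {0..T}" "continuous_on UNIV c" for t
    using T by (auto simp: c_def[abs_def] intro!: continuous_intros)
  define I where "I y \<tau> = integral {0..\<tau>} (\<lambda>s. F (exp (\<rho> * s) *\<^sub>R apply_bcontfun y s))" for y :: "real \<Rightarrow>\<^sub>C 'a" and \<tau>
  have cont: "continuous_on S (\<lambda>s. F (exp (\<rho> * s) *\<^sub>R apply_bcontfun y s))" for S and y :: "real \<Rightarrow>\<^sub>C 'a"
    by (intro continuous_on_compose2[OF Fc[of UNIV]] continuous_intros) auto
  have I_cont: "continuous_on {0..T} (I y)" for y
    unfolding I_def by (intro indefinite_integral_continuous_1 integrable_continuous_real cont)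
  define \<Phi> where "\<Phi> y = Bcontfun (\<lambda>t. exp (- \<rho> * c t) *\<^sub>R (z0 + I y (c t)))" for y
  have \<Phi>: "apply_bcontfun (\<Phi> y) = (\<lambda>t. exp (- \<rho> * c t) *\<^sub>R (z0 + I y (c t)))" for y
    unfolding \<Phi>_def
  proof (rule Bcontfun_inverse, unfold bcontfun_def mem_Collect_eq, rule conjI)
    have g: "continuous_on {0..T} (\<lambda>\<tau>. exp (- \<rho> * \<tau>) *\<^sub>R (z0 + I y \<tau>))"
      by (intro continuous_intros I_cont)
    show "continuous_on UNIV (\<lambda>t. exp (- \<rho> * c t) *\<^sub>R (z0 + I y (c t)))"
      by (rule continuous_on_compose2[OF g c(2)]) (use c(1) in auto)
    have "range (\<lambda>t. exp (- \<rho> * c t) *\<^sub>R (z0 + I y (c t))) \<subseteq> (\<lambda>\<tau>. exp (- \<rho> * \<tau>) *\<^sub>R (z0 + I y \<tau>)) ` {0..T}"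
      using c(1) by auto
    then show "bounded (range (\<lambda>t. exp (- \<rho> * c t) *\<^sub>R (z0 + I y (c t))))"
      by (rule bounded_subset[OF compact_imp_bounded[OF compact_continuous_image[OF g compact_Icc]]])
  qed
  have contr: "dist (\<Phi> y) (\<Phi> y') \<le> 1 / 2 * dist y y'" for y y'
  proof (rule dist_bound)
    fix t
    define \<tau> where "\<tau> = c t"
    have \<tau>: "0 \<le> \<tau>" using c(1)[of t] by (simp add: \<tau>_def)
    have "I y \<tau> - I y' \<tau> = integral {0..\<tau>} (\<lambda>s. F (exp (\<rho> * s) *\<^sub>R apply_bcontfun y s) - F (exp (\<rho> * s) *\<^sub>R apply_bcontfun y' s))"
      unfolding I_def by (intro Henstock_Kurzweil_Integration.integral_diff[symmetric] integrable_continuous_real cont)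
    also have "norm \<dots> \<le> integral {0..\<tau>} (\<lambda>s. L' * dist y y' * exp (\<rho> * s))"
    proof (rule integral_norm_bound_integral)
      show "(\<lambda>s. F (exp (\<rho> * s) *\<^sub>R apply_bcontfun y s) - F (exp (\<rho> * s) *\<^sub>R apply_bcontfun y' s)) integrable_on {0..\<tau>}"
        by (intro integrable_continuous_real continuous_intros cont)
      show "(\<lambda>s. L' * dist y y' * exp (\<rho> * s)) integrable_on {0..\<tau>}"
        by (intro integrable_continuous_real continuous_intros)
      fix s
      have "norm (F (exp (\<rho> * s) *\<^sub>R apply_bcontfun y s) - F (exp (\<rho> * s) *\<^sub>R apply_bcontfun y' s))
          \<le> L' * (exp (\<rho> * s) * dist (apply_bcontfun y s) (apply_bcontfun y' s))"
        using L'(2)[of "exp (\<rho> * s) *\<^sub>R apply_bcontfun y s" "exp (\<rho> * s) *\<^sub>R apply_bcontfun y' s"]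
        by (simp add: dist_norm flip: scaleR_diff_right)
      also have "\<dots> \<le> L' * (exp (\<rho> * s) * dist y y')"
        using L'(1) by (intro mult_left_mono dist_bounded) auto
      finally show "norm (F (exp (\<rho> * s) *\<^sub>R apply_bcontfun y s) - F (exp (\<rho> * s) *\<^sub>R apply_bcontfun y' s)) \<le> L' * dist y y' * exp (\<rho> * s)"
        by (simp add: mult_ac)
    qed
    also have "\<dots> = L' * dist y y' * integral {0..\<tau>} (\<lambda>s. exp (\<rho> * s))" by simp
    also have "\<dots> \<le> L' * dist y y' * (exp (\<rho> * \<tau>) / \<rho>)"
      using L'(1) by (intro mult_left_mono integral_exp_le \<rho> \<tau>) auto
    also have "\<dots> = 1 / 2 * dist y y' * exp (\<rho> * \<tau>)" using L'(1) by (simp add: \<rho>_def)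
    finally have "exp (- \<rho> * \<tau>) * norm (I y \<tau> - I y' \<tau>) \<le> exp (- \<rho> * \<tau>) * (1 / 2 * dist y y' * exp (\<rho> * \<tau>))"
      by (intro mult_left_mono) auto
    also have "\<dots> = 1 / 2 * dist y y'" by (simp add: exp_minus)
    finally show "dist (apply_bcontfun (\<Phi> y) t) (apply_bcontfun (\<Phi> y') t) \<le> 1 / 2 * dist y y'"
      by (simp add: \<Phi> dist_norm \<tau>_def flip: scaleR_diff_right)
  qed
  obtain y where y: "\<Phi> y = y"
    using banach_fix_type[of "1 / 2" \<Phi>] contr by auto
  \<comment> \<open>On \<open>{0..T}\<close> the fixed point \<open>y\<close> is the solution times
    \<open>exp (- \<rho> * t)\<close>; \<open>z\<close> is the solution without the weight.\<close>
  define z where "z t = z0 + I y t" for t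
  have z_eq: "exp (\<rho> * t) *\<^sub>R apply_bcontfun y t = z t" if "t \<in> {0..T}" for t
  proof -
    have "c t = t" using that by (auto simp: c_def)
    then have "apply_bcontfun y t = exp (- \<rho> * t) *\<^sub>R z t"
      using fun_cong[OF \<Phi>[of y], of t] by (simp add: y z_def)
    then show ?thesis by (simp add: exp_minus)
  qed
  show ?thesis
  proof (rule that)
    show "z 0 = z0" by (simp add: z_def I_def)
    fix t assume t: "t \<in> {0..T}"
    have "(z has_vector_derivative 0 + F (exp (\<rho> * t) *\<^sub>R apply_bcontfun y t)) (at t within {0..T})"
      unfolding z_def I_def
      by (intro has_vector_derivative_add has_vector_derivative_const integral_has_vector_derivative cont t)
    then show "(z has_vector_derivative F (z t)) (at t within {0..T})" using z_eq[OF t] by simp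
  qed
qed

section \<open>Radial cutoff and the continuity argument\<close>

definition retract :: "real \<Rightarrow> 'a::real_normed_vector \<Rightarrow> 'a" where
  "retract R x = (R / max R (norm x)) *\<^sub>R x"

lemma retract_id: "0 < R \<Longrightarrow> norm x \<le> R \<Longrightarrow> retract R x = x"
  by (simp add: retract_def max_absorb1)

lemma norm_retract_le:
  assumes "0 < R" shows "norm (retract R x) \<le> R"
proof -
  have "R * norm x \<le> R * max R (norm x)" using assms by (intro mult_left_mono) auto
  then show ?thesis using assms by (simp add: retract_def divide_le_eq max_def)
qed

lemma retract_lipschitz:
  fixes x y :: "'a::real_normed_vector"
  assumes R: "0 < R"
  shows "norm (retract R x - retract R y) \<le> 2 * norm (x - y)"
proof -
  define a where "a = max R (norm x)"
  define b where "b = max R (norm y)"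
  have ab: "0 < a" "0 < b" "R \<le> a" "norm y \<le> b" using R by (auto simp: a_def b_def)
  have d: "\<bar>b - a\<bar> \<le> norm (x - y)"
    using norm_triangle_ineq3[of x y] unfolding a_def b_def by linarith
  have "retract R x - retract R y = (R / a) *\<^sub>R (x - y) + (R / a - R / b) *\<^sub>R y"
    by (simp add: retract_def a_def b_def algebra_simps)
  then have "norm (retract R x - retract R y) \<le> \<bar>R / a\<bar> * norm (x - y) + \<bar>R / a - R / b\<bar> * norm y"
    using norm_triangle_ineq[of "(R / a) *\<^sub>R (x - y)" "(R / a - R / b) *\<^sub>R y"] by simp
  also have "\<bar>R / a - R / b\<bar> * norm y = (R / a) * (norm y / b) * \<bar>b - a\<bar>"
  proof -
    have "R / a - R / b = (R / a) * (b - a) / b" using ab by (simp add: field_simps)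
    then show ?thesis using ab R by (simp add: abs_mult)
  qed
  also have "\<dots> \<le> 1 * 1 * norm (x - y)"
    using ab R d by (intro mult_mono) auto
  also have "\<bar>R / a\<bar> * norm (x - y) \<le> 1 * norm (x - y)"
    using ab R by (intro mult_right_mono) auto
  finally show ?thesis by simp
qed

text \<open>A field that is Lipschitz on a ball becomes globally Lipschitz after the radial
  retraction, so a solution exists up to any \<open>T\<close>. It solves the original equation as
  long as it stays in the ball, which is left to an a priori bound.\<close>

theorem picard_cutoff:
  fixes F :: "'a::banach \<Rightarrow> 'a"
  assumes lip: "\<And>x y. norm x \<le> R \<Longrightarrow> norm y \<le> R \<Longrightarrow> norm (F x - F y) \<le> L * norm (x - y)"
    and R: "0 < R" and T: "0 \<le> T"
  obtains z where "z 0 = z0"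
    "\<And>t. t \<in> {0..T} \<Longrightarrow> (z has_vector_derivative F (retract R (z t))) (at t within {0..T})"
proof (rule picard_global[where F = "\<lambda>x. F (retract R x)" and L = "\<bar>L\<bar> * 2" and T = T and ?z0.0 = z0])
  fix x y
  have "norm (F (retract R x) - F (retract R y)) \<le> L * norm (retract R x - retract R y)"
    by (intro lip norm_retract_le R)
  also have "\<dots> \<le> \<bar>L\<bar> * (2 * norm (x - y))"
    using retract_lipschitz[OF R, of x y] by (intro mult_mono) auto
  finally show "norm (F (retract R x) - F (retract R y)) \<le> \<bar>L\<bar> * 2 * norm (x - y)" by simp
qed (use T that in auto)

text \<open>At the first time \<open>m\<close> with \<open>X m \<ge> B\<close>, all earlier values
  are at most \<open>A\<close> by \<open>step\<close>, hence so is \<open>X m\<close> by continuity,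
  against \<open>A < B\<close>.\<close>

lemma bootstrap:
  fixes X :: "real \<Rightarrow> real"
  assumes cont: "continuous_on {0..T} X" and X0: "X 0 \<le> A" and AB: "A < B"
    and step: "\<And>t. t \<in> {0..T} \<Longrightarrow> (\<And>s. s \<in> {0..t} \<Longrightarrow> X s \<le> B) \<Longrightarrow> X t \<le> A"
    and t: "t \<in> {0..T}"
  shows "X t \<le> A"
proof -
  have "X s \<le> B" if s: "s \<in> {0..t}" for s
  proof (rule ccontr)
    assume "\<not> X s \<le> B"
    then have B: "B < X s" by simp
    have sT: "{0..s} \<subseteq> {0..T}" using s t by auto
    define M where "M = {0..s} \<inter> X -` {B..}"
    have "closed M"
      unfolding M_def by (rule continuous_closed_preimage[OF continuous_on_subset[OF cont sT]]) auto
    then have "compact M" unfolding M_def using compact_Int_closed[of "{0..s}" M]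
      by (simp add: M_def Int_absorb1)
    moreover have "M \<noteq> {}" using B s by (auto simp: M_def)
    ultimately obtain m where m: "m \<in> M" "\<And>r. r \<in> M \<Longrightarrow> m \<le> r"
      using compact_attains_inf by metis
    have m0: "0 < m" using m(1) X0 AB by (cases "m = 0") (auto simp: M_def)
    have mT: "{0..m} \<subseteq> {0..T}" using m(1) sT by (auto simp: M_def)
    have less: "X r \<le> A" if r: "r \<in> {0..<m}" for r
    proof (rule step)
      show "r \<in> {0..T}" using r mT by auto
      fix q assume q: "q \<in> {0..r}"
      then have "q \<notin> M" using m(2)[of q] r by auto
      moreover have "q \<in> {0..s}" using q r m(1) by (auto simp: M_def)
      ultimately show "X q \<le> B" by (auto simp: M_def)
    qed
    have "closed ({0..m} \<inter> X -` {..A})"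
      by (rule continuous_closed_preimage[OF continuous_on_subset[OF cont mT]]) auto
    moreover have "{0..<m} \<subseteq> {0..m} \<inter> X -` {..A}" using less by auto
    ultimately have "closure {0..<m} \<subseteq> {0..m} \<inter> X -` {..A}" by (rule closure_minimal[rotated])
    moreover have "m \<in> closure {0..<m}" using m0 by simp
    ultimately have "X m \<le> A" by blast
    then show False using m(1) AB by (simp add: M_def)
  qed
  then show ?thesis using step[OF t] by blast
qed

section \<open>Higher derivatives and products\<close>

lemma is_deriv_unique: "is_deriv f g \<Longrightarrow> is_deriv f h \<Longrightarrow> g = h"
  by (rule cbl2_eqI) (metis DERIV_unique is_deriv_def)

lemma is_deriv_add: "is_deriv f f' \<Longrightarrow> is_deriv g g' \<Longrightarrow> is_deriv (f + g) (f' + g')"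
  by (auto simp: is_deriv_def intro!: derivative_eq_intros)

lemma is_deriv_scaleR: "is_deriv f f' \<Longrightarrow> is_deriv (c *\<^sub>R f) (c *\<^sub>R f')"
  by (auto simp: is_deriv_def intro!: derivative_eq_intros)

lemma is_deriv_mult: "is_deriv f f' \<Longrightarrow> is_deriv g g' \<Longrightarrow> is_deriv (f * g) (f' * g + f * g')"
  by (auto simp: is_deriv_def intro!: derivative_eq_intros)

lemma is_deriv_sum:
  assumes "finite I" "\<And>i. i \<in> I \<Longrightarrow> is_deriv (f i) (g i)"
  shows "is_deriv (\<Sum>i\<in>I. f i) (\<Sum>i\<in>I. g i)"
  using assms
  by (induction I rule: finite_induct) (auto simp: is_deriv_add, simp add: is_deriv_def)

text \<open>Carrying all derivatives as one sequence lets products and powers be differentiated to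
  any order by induction; \<open>dseq_unique\<close> recovers the sequence from its entry at
  0.\<close>

definition dseq :: "(nat \<Rightarrow> cbl2) \<Rightarrow> bool" where
  "dseq F \<longleftrightarrow> (\<forall>n. is_deriv (F n) (F (Suc n)))"

lemma dseqD: "dseq F \<Longrightarrow> is_deriv (F n) (F (Suc n))"
  by (simp add: dseq_def)

lemma dseq_unique:
  assumes "dseq F" "dseq G" "F 0 = G 0"
  shows "F = G"
proof
  show "F n = G n" for n
  proof (induction n)
    case (Suc n)
    show ?case using dseqD[OF assms(1), of n] dseqD[OF assms(2), of n] unfolding Suc by (rule is_deriv_unique)
  qed (rule assms)
qed

lemma dseq_shift: "dseq F \<Longrightarrow> dseq (\<lambda>n. F (Suc n))"
  by (simp add: dseq_def)

lemma dseq_scaleR: "dseq F \<Longrightarrow> dseq (\<lambda>n. c *\<^sub>R F n)"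
  by (simp add: dseq_def is_deriv_scaleR)

lemma dseq_fh:
  assumes "dseq F"
  shows "AE \<xi> in lborel. fh (F n) \<xi> = (\<i> * complex_of_real \<xi>) ^ n * fh (F 0) \<xi>"
proof (induction n)
  case (Suc n)
  then show ?case
    using is_deriv_fh[OF dseqD[OF assms, of n]] by eventually_elim simp
qed simp

definition leibniz :: "(nat \<Rightarrow> cbl2) \<Rightarrow> (nat \<Rightarrow> cbl2) \<Rightarrow> nat \<Rightarrow> cbl2" where
  "leibniz F G n = (\<Sum>i\<le>n. real (n choose i) *\<^sub>R (F i * G (n - i)))"

lemma leibniz_0 [simp]: "leibniz F G 0 = F 0 * G 0"
  by (simp add: leibniz_def)

lemma dseq_leibniz:
  assumes F: "dseq F" and G: "dseq G"
  shows "dseq (leibniz F G)"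
  unfolding dseq_def
proof
  fix n
  define T where "T i = F i * G (Suc n - i)" for i
  have "is_deriv (leibniz F G n) (\<Sum>i\<le>n. real (n choose i) *\<^sub>R (F (Suc i) * G (n - i) + F i * G (Suc (n - i))))"
    unfolding leibniz_def
    by (intro is_deriv_sum is_deriv_scaleR is_deriv_mult dseqD F G) simp
  also have "(\<Sum>i\<le>n. real (n choose i) *\<^sub>R (F (Suc i) * G (n - i) + F i * G (Suc (n - i))))
      = (\<Sum>i\<le>n. real (n choose i) *\<^sub>R T (Suc i)) + (\<Sum>i\<le>n. real (n choose i) *\<^sub>R T i)"
    by (simp add: T_def scaleR_add_right sum.distrib Suc_diff_le)
  also have "(\<Sum>i\<le>n. real (n choose i) *\<^sub>R T i) = (\<Sum>i\<le>Suc n. real (n choose i) *\<^sub>R T i)"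
    by simp
  also have "\<dots> = T 0 + (\<Sum>i\<le>n. real (n choose Suc i) *\<^sub>R T (Suc i))"
    by (subst sum.atMost_Suc_shift) simp
  also have "(\<Sum>i\<le>n. real (n choose i) *\<^sub>R T (Suc i)) + (T 0 + (\<Sum>i\<le>n. real (n choose Suc i) *\<^sub>R T (Suc i)))
      = T 0 + (\<Sum>i\<le>n. real (Suc n choose Suc i) *\<^sub>R T (Suc i))"
    by (simp add: scaleR_add_left sum.distrib algebra_simps)
  also have "\<dots> = (\<Sum>i\<le>Suc n. real (Suc n choose i) *\<^sub>R T i)"
    by (subst sum.atMost_Suc_shift) simp
  also have "\<dots> = leibniz F G (Suc n)" by (simp only: leibniz_def T_def)
  finally show "is_deriv (leibniz F G n) (leibniz F G (Suc n))" .
qed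

definition l2bd :: "nat \<Rightarrow> (nat \<Rightarrow> cbl2) \<Rightarrow> real \<Rightarrow> bool" where
  "l2bd N F c \<longleftrightarrow> (\<forall>n\<le>N. l2 (F n) \<le> c)"

lemma l2bdD: "l2bd N F c \<Longrightarrow> n \<le> N \<Longrightarrow> l2 (F n) \<le> c"
  by (simp add: l2bd_def)

lemma l2bd_nonneg: "l2bd N F c \<Longrightarrow> 0 \<le> c"
  using l2bdD[of N F c 0] l2n_nonneg order_trans by blast

lemma l2bd_sup:
  assumes "dseq F" "l2bd N F c" "n < N"
  shows "\<bar>val (F n) x\<bar> \<le> 2 * \<kappa> * c"
proof -
  have "\<bar>val (F n) x\<bar> \<le> \<kappa> * (l2 (F n) + l2 (F (Suc n)))"
    by (rule is_deriv_sup_le[OF dseqD[OF assms(1)]])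
  also have "\<dots> \<le> \<kappa> * (c + c)"
    by (intro mult_left_mono add_mono l2bdD[OF assms(2)] \<kappa>_nonneg) (use assms(3) in auto)
  finally show ?thesis by simp
qed

text \<open>Only derivatives of order below \<open>N\<close> have a sup bound, since the embedding
  costs one derivative. One factor has such an order and is estimated in the supremum, the other in
  \<open>L^2\<close>.\<close>

lemma l2bd_prod:
  assumes F: "dseq F" "l2bd N F c" and G: "dseq G" "l2bd N G d" and ij: "i \<le> N" "j \<le> N" "i < N \<or> j < N"
  shows "l2 (F i * G j) \<le> 2 * \<kappa> * c * d"
proof -
  have nn: "0 \<le> c" "0 \<le> d" using F G by (auto dest: l2bd_nonneg)
  show ?thesis
  proof (cases "i < N")
    case True
    have "l2 (F i * G j) \<le> (2 * \<kappa> * c) * l2 (G j)"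
      by (rule l2n_val_times_le[OF l2bd_sup[OF F True]])
    also have "\<dots> \<le> (2 * \<kappa> * c) * d"
      using nn \<kappa>_nonneg by (intro mult_left_mono l2bdD[OF G(2)] ij) auto
    finally show ?thesis .
  next
    case False
    then have j: "j < N" using ij by auto
    have "l2 (G j * F i) \<le> (2 * \<kappa> * d) * l2 (F i)"
      by (rule l2n_val_times_le[OF l2bd_sup[OF G j]])
    also have "\<dots> \<le> (2 * \<kappa> * d) * c"
      using nn \<kappa>_nonneg by (intro mult_left_mono l2bdD[OF F(2)] ij) auto
    finally show ?thesis by (simp add: mult_ac)
  qed
qed

lemma l2_sum_le:
  assumes "finite I"
  shows "l2 (\<Sum>i\<in>I. f i) \<le> (\<Sum>i\<in>I. l2 (f i))"
  using assms
proof (induction I rule: finite_induct)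
  case (insert i I)
  then show ?case using l2_triangle[of "f i" "\<Sum>i\<in>I. f i"] by (simp del: val_simps)
qed (simp del: val_simps)

text \<open>The index set may be smaller than \<open>{..n}\<close>, so that the top-order term of a
  Leibniz sum can be split off before the rest is estimated.\<close>

lemma l2_binomial_sum_le:
  assumes "I \<subseteq> {..n}" "n \<le> N" "\<And>i. i \<in> I \<Longrightarrow> l2 (f i) \<le> b" "0 \<le> b"
  shows "l2 (\<Sum>i\<in>I. real (n choose i) *\<^sub>R f i) \<le> 2 ^ N * b"
proof -
  have fin: "finite I" using assms(1) finite_subset by blast
  have "l2 (\<Sum>i\<in>I. real (n choose i) *\<^sub>R f i) \<le> (\<Sum>i\<in>I. l2 (real (n choose i) *\<^sub>R f i))"
    by (rule l2_sum_le[OF fin])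
  also have "\<dots> \<le> (\<Sum>i\<in>I. real (n choose i) * b)"
    unfolding l2_scaleR by (intro sum_mono) (auto intro!: mult_left_mono assms)
  also have "\<dots> \<le> (\<Sum>i\<le>n. real (n choose i) * b)"
    using assms by (intro sum_mono2) auto
  also have "\<dots> = 2 ^ n * b"
    by (simp add: choose_row_sum flip: sum_distrib_right of_nat_sum)
  also have "\<dots> \<le> 2 ^ N * b"
    by (intro mult_right_mono power_increasing assms) simp
  finally show ?thesis .
qed

lemma l2bd_leibniz:
  assumes F: "dseq F" "l2bd N F c" and G: "dseq G" "l2bd N G d" and N: "0 < N"
  shows "l2bd N (leibniz F G) (2 ^ N * (2 * \<kappa> * c * d))"
  unfolding l2bd_def leibniz_def
proof (intro allI impI l2_binomial_sum_le)
  fix n i assume "n \<le> N" "i \<in> {..n}"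
  then show "l2 (F i * G (n - i)) \<le> 2 * \<kappa> * c * d"
    using N by (intro l2bd_prod[OF F G]) auto
qed (use F G in \<open>auto dest!: l2bd_nonneg simp: \<kappa>_nonneg\<close>)

text \<open>The power is shifted: \<open>pw u k\<close> is the power of \<open>u\<close> with exponent \<open>k + 1\<close>, as the ring has no unit.\<close>

primrec pw :: "cbl2 \<Rightarrow> nat \<Rightarrow> cbl2" where
  "pw u 0 = u"
| "pw u (Suc k) = u * pw u k"

lemma val_pw: "val (pw u k) x = val u x ^ (k + 1)"
  by (induction k) auto

primrec pwseq :: "(nat \<Rightarrow> cbl2) \<Rightarrow> nat \<Rightarrow> nat \<Rightarrow> cbl2" where
  "pwseq F 0 = F"
| "pwseq F (Suc k) = leibniz F (pwseq F k)"

lemma pwseq_0: "pwseq F k 0 = pw (F 0) k"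
  by (induction k) auto

lemma dseq_pwseq: "dseq F \<Longrightarrow> dseq (pwseq F k)"
  by (induction k) (auto intro: dseq_leibniz)

lemma l2bd_pwseq:
  assumes F: "dseq F" "l2bd N F c" and N: "0 < N"
  shows "l2bd N (pwseq F k) ((2 ^ N * 2 * \<kappa>) ^ k * c ^ (k + 1))"
proof (induction k)
  case (Suc k)
  have "2 ^ N * (2 * \<kappa> * c * ((2 ^ N * 2 * \<kappa>) ^ k * c ^ (k + 1))) = (2 ^ N * 2 * \<kappa>) ^ Suc k * c ^ (Suc k + 1)"
    by (simp add: mult_ac)
  from l2bd_leibniz[OF F dseq_pwseq[OF F(1)] Suc N, unfolded this] show ?case by simp
qed (use F in simp)

lemma is_deriv_pw:
  assumes "is_deriv u u'"
  shows "is_deriv (pw u (Suc k)) (real (k + 2) *\<^sub>R (pw u k * u'))"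
proof -
  have "((\<lambda>x. val u x ^ (k + 2)) has_real_derivative real (k + 2) * (val u x ^ (k + 1) * val u' x)) (at x)" for x
    using DERIV_power[of "val u" "val u' x" x UNIV "k + 2"] assms by (simp add: is_deriv_def mult_ac)
  moreover have "val (pw u (Suc k)) = (\<lambda>x. val u x ^ (k + 2))"
    by (rule ext) (simp add: val_pw del: pw.simps)
  ultimately show ?thesis by (simp add: is_deriv_def val_pw del: pw.simps)
qed

text \<open>
  The highest order part of the derivative of a power is a transport term in conservative form.
\<close>

lemma pwseq_top_order:
  fixes N k :: nat
  assumes F: "dseq F" "l2bd N F c" and N: "2 \<le> N"
  defines "a \<equiv> real (k + 2) *\<^sub>R pw (F 0) k"
    and "K \<equiv> real (k + 2) * ((2 ^ N * 2 * \<kappa>) ^ k * c ^ (k + 1))"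
  obtains h r where "is_deriv (a * F N) h" "pwseq F (Suc k) (Suc N) = h + r"
    "l2 r \<le> (2 ^ N + 1) * (2 * \<kappa> * K * c)"
proof -
  \<comment> \<open>The first derivative of the power is \<open>a * F 1\<close>. So
    \<open>A\<close>, the derivative sequence of \<open>a\<close>, and the shifted \<open>F\<close>
    give all further derivatives by a single Leibniz formula.\<close>
  define A where "A n = real (k + 2) *\<^sub>R pwseq F k n" for n
  have A: "dseq A" unfolding A_def[abs_def] by (intro dseq_scaleR dseq_pwseq F)
  have A0: "A 0 = a" by (simp add: A_def a_def pwseq_0)
  have AK: "l2bd N A K"
    using l2bd_pwseq[OF F, of k] N unfolding l2bd_def A_def K_def l2_scaleR by (auto intro!: mult_left_mono)
  define G where "G n = F (Suc n)" for n
  have G: "dseq G" unfolding G_def[abs_def] by (rule dseq_shift[OF F(1)])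
  have "pwseq F (Suc k) 1 = real (k + 2) *\<^sub>R (pw (F 0) k * F 1)"
  proof (rule is_deriv_unique)
    show "is_deriv (pw (F 0) (Suc k)) (pwseq F (Suc k) 1)"
      using dseqD[OF dseq_pwseq[OF F(1), of "Suc k"], of 0] by (simp add: pwseq_0 del: pwseq.simps pw.simps)
    show "is_deriv (pw (F 0) (Suc k)) (real (k + 2) *\<^sub>R (pw (F 0) k * F 1))"
      using is_deriv_pw[OF dseqD[OF F(1), of 0], of k] by simp
  qed
  then have "pwseq F (Suc k) (Suc 0) = leibniz A G 0"
    unfolding leibniz_0 A0 by (simp add: G_def a_def del: pwseq.simps)
  then have eq: "(\<lambda>n. pwseq F (Suc k) (Suc n)) = leibniz A G"
    by (intro dseq_unique dseq_shift dseq_pwseq dseq_leibniz A G F)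
  \<comment> \<open>In these terms both orders are at most \<open>N\<close>, and one is below
    \<open>N\<close> because \<open>2 \<le> N\<close>. The missing term \<open>i = 0\<close> is
    \<open>a * F (Suc N)\<close>, which together with \<open>A 1 * F N\<close> forms the derivative
    of \<open>a * F N\<close>; hence \<open>A 1 * F N\<close> is subtracted from the
    remainder.\<close>
  define S where "S = (\<Sum>i\<in>{1..N}. real (N choose i) *\<^sub>R (A i * G (N - i)))"
  have split: "leibniz A G N = A 0 * G N + S"
    unfolding leibniz_def S_def by (simp add: atMost_atLeast0 sum.atLeast_Suc_atMost)
  have nn: "0 \<le> 2 * \<kappa> * K * c"
    using AK F(2) by (auto dest!: l2bd_nonneg simp: \<kappa>_nonneg)
  have "l2 S \<le> 2 ^ N * (2 * \<kappa> * K * c)"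
    unfolding S_def
  proof (rule l2_binomial_sum_le[OF _ order_refl _ nn])
    fix i assume i: "i \<in> {1..N}"
    have "l2 (A i * F (Suc (N - i))) \<le> 2 * \<kappa> * K * c"
      using i N by (intro l2bd_prod[OF A AK F]) auto
    then show "l2 (A i * G (N - i)) \<le> 2 * \<kappa> * K * c" by (simp add: G_def)
  qed auto
  moreover have "l2 (A 1 * F N) \<le> 2 * \<kappa> * K * c"
    using N by (intro l2bd_prod[OF A AK F]) auto
  ultimately have r: "l2 (S - A 1 * F N) \<le> (2 ^ N + 1) * (2 * \<kappa> * K * c)"
    using l2_diff_le[of S "A 1 * F N"] by (simp add: distrib_right del: val_simps)
  show ?thesis
  proof (rule that[OF _ _ r])
    show "is_deriv (a * F N) (A 1 * F N + A 0 * G N)"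
      using is_deriv_mult[OF dseqD[OF A, of 0] dseqD[OF F(1), of N]] by (simp add: A0 G_def)
    show "pwseq F (Suc k) (Suc N) = A 1 * F N + A 0 * G N + (S - A 1 * F N)"
      using fun_cong[OF eq, of N] split by (simp del: pwseq.simps)
  qed
qed

section \<open>The energy identity\<close>

text \<open>Multiplication by \<open>q\<close> is symmetric, so differentiating the quadratic form
  pairs \<open>d + c q d\<close> with \<open>d'\<close> and \<open>e\<close> with \<open>e'\<close>.
  The skewness hypothesis removes the principal parts, leaving only \<open>q'\<close> and the
  remainders \<open>r1\<close>, \<open>r2\<close>.\<close>

lemma energy_has_derivative:
  assumes d: "(d has_vector_derivative d') (at t within S)"
    and e: "(e has_vector_derivative e') (at t within S)"
    and q: "(q has_vector_derivative q') (at t within S)"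
    and skew: "ip (d t + c *\<^sub>R (q t * d t)) (d' - r1) + ip (e t) (e' - r2) = 0"
  shows "((\<lambda>t. ip (d t) (d t) + c * ip (q t * d t) (d t) + ip (e t) (e t)) has_real_derivative
    c * ip (q' * d t) (d t) + 2 * ip (d t + c *\<^sub>R (q t * d t)) r1 + 2 * ip (e t) r2) (at t within S)"
proof -
  note ipd = bounded_bilinear.has_vector_derivative[OF bounded_bilinear_ip]
  have dv: "((\<lambda>t. ip (d t) (d t) + c *\<^sub>R ip (q t * d t) (d t) + ip (e t) (e t)) has_vector_derivative
      ip (d t) d' + ip d' (d t) + c *\<^sub>R (ip (q t * d t) d' + ip (q t * d' + q' * d t) (d t)) + (ip (e t) e' + ip e' (e t))) (at t within S)"
    by (intro has_vector_derivative_add ipd d e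
        bounded_linear.has_vector_derivative[OF bounded_linear_scaleR_right] has_vector_derivative_mult q)
  have "ip (q t * d') (d t) = ip (q t * d t) d'"
    by (metis ip_commute ip_mult_left)
  then have e1: "ip (d t) d' + ip d' (d t) + c *\<^sub>R (ip (q t * d t) d' + ip (q t * d' + q' * d t) (d t)) + (ip (e t) e' + ip e' (e t))
      = 2 * (ip (d t) d' + c * ip (q t * d t) d' + ip (e t) e') + c * ip (q' * d t) (d t)"
    by (simp add: ip.add_left ip_commute[of d'] ip_commute[of e'] algebra_simps)
  have e2: "ip (d t) d' + c * ip (q t * d t) d' + ip (e t) e' = ip (d t + c *\<^sub>R (q t * d t)) r1 + ip (e t) r2"
    using skew by (simp add: ip.add_left ip.diff_right ip.scaleR_left algebra_simps)
  show ?thesis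
    using dv unfolding e1 e2
    by (simp add: has_real_derivative_iff_has_vector_derivative algebra_simps)
qed

text \<open>Product-rule derivative of \<open>pw u k\<close> in direction \<open>u'\<close>, used
  with the time derivative of a curve.\<close>

primrec pwd :: "cbl2 \<Rightarrow> cbl2 \<Rightarrow> nat \<Rightarrow> cbl2" where
  "pwd u u' 0 = u'"
| "pwd u u' (Suc k) = u * pwd u u' k + u' * pw u k"

lemma val_pwd: "val (pwd u u' k) x = real (k + 1) * val u x ^ k * val u' x"
proof (induction k)
  case (Suc k)
  have "val (pwd u u' (Suc k)) x = val u x * (real (k + 1) * val u x ^ k * val u' x) + val u' x * val u x ^ (k + 1)"
    using Suc val_pw[of u k x] by simp
  then show ?case by (simp add: algebra_simps)
qed simp

lemma pw_has_vector_derivative: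
  assumes "(u has_vector_derivative u') (at t within S)"
  shows "((\<lambda>t. pw (u t) k) has_vector_derivative pwd (u t) u' k) (at t within S)"
  by (induction k) (auto intro!: has_vector_derivative_mult assms)

lemma norm_pw_le:
  assumes "norm u \<le> r"
  shows "norm (pw u k) \<le> r ^ (k + 1)"
proof (induction k)
  case (Suc k)
  have "norm (u * pw u k) \<le> norm u * norm (pw u k)" by (rule norm_mult_ineq)
  also have "\<dots> \<le> r * r ^ (k + 1)" by (intro mult_mono Suc assms order_trans[OF norm_ge_zero assms]) simp
  finally show ?case by simp
qed (use assms in simp)

lemma norm_pw_diff_le:
  assumes "norm u \<le> r" "norm v \<le> r"
  shows "norm (pw u k - pw v k) \<le> real (k + 1) * r ^ k * norm (u - v)"
proof (induction k)
  case (Suc k)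
  have r: "0 \<le> r" using assms(1) norm_ge_zero order_trans by blast
  have "norm (pw u (Suc k) - pw v (Suc k)) = norm ((u - v) * pw u k + v * (pw u k - pw v k))"
    by (simp add: algebra_simps)
  also have "\<dots> \<le> norm ((u - v) * pw u k) + norm (v * (pw u k - pw v k))"
    by (rule norm_triangle_ineq)
  also have "\<dots> \<le> norm (u - v) * norm (pw u k) + norm v * norm (pw u k - pw v k)"
    by (intro add_mono norm_mult_ineq)
  also have "\<dots> \<le> norm (u - v) * r ^ (k + 1) + r * (real (k + 1) * r ^ k * norm (u - v))"
    using r by (intro add_mono mult_mono norm_pw_le assms Suc) auto
  finally show ?case by (simp add: algebra_simps)
qed simp

section \<open>The truncated system\<close>

text \<open>\<open>m\<close> stands for the square root of the kernel transform and \<open>B\<close>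
  for its bound. Evenness is what makes the multiplier with symbol \<open>m\<close> preserve real
  functions.\<close>

locale symbol =
  fixes m :: "real \<Rightarrow> real" and B :: real
  assumes m_measurable [measurable]: "m \<in> borel_measurable borel"
    and m_even: "m (- \<xi>) = m \<xi>" and m_nonneg: "0 \<le> m \<xi>" and m_le: "m \<xi> \<le> B"
begin

lemma B_nonneg: "0 \<le> B"
  using m_nonneg[of 0] m_le[of 0] by linarith

definition ct :: "real \<Rightarrow> real \<Rightarrow> complex" where
  "ct n \<xi> = indicator {-n..n} \<xi>"

lemma csym_ct: "csym (ct n)"
proof -
  have "ct n \<in> borel_measurable borel" unfolding ct_def[abs_def] by simp
  then show ?thesis by (rule csymI[of _ n 1]) (auto simp: ct_def indicator_def)
qed

lemma csym_mct: "csym (\<lambda>\<xi>. m \<xi> * ct n \<xi>)"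
proof (rule csymI[of _ n B])
  show "(\<lambda>\<xi>. m \<xi> * ct n \<xi>) \<in> borel_measurable borel"
    using csym_measurable[OF csym_ct] by measurable
qed (auto simp: ct_def indicator_def m_even m_nonneg m_le B_nonneg)

text \<open>Truncations to \<open>|\<xi>| \<le> n\<close> of the identity, of \<open>K\<close>, of
  \<open>K \<partial>\<^sub>x\<close> and of the derivative of order \<open>j\<close>. All are
  bounded operators; on functions with \<open>P n u = u\<close> the truncated derivatives are the
  true ones.\<close>

definition P :: "real \<Rightarrow> cbl2 \<Rightarrow> cbl2" where "P n = mul (ct n)"
definition K :: "real \<Rightarrow> cbl2 \<Rightarrow> cbl2" where "K n = mul (\<lambda>\<xi>. m \<xi> * ct n \<xi>)"
definition A :: "real \<Rightarrow> cbl2 \<Rightarrow> cbl2" where "A n = mul (\<lambda>\<xi>. \<i> * complex_of_real \<xi> * (m \<xi> * ct n \<xi>))"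
definition D :: "real \<Rightarrow> nat \<Rightarrow> cbl2 \<Rightarrow> cbl2" where "D n j = mul (\<lambda>\<xi>. (\<i> * complex_of_real \<xi>) ^ j * ct n \<xi>)"

lemma csym_D: "csym (\<lambda>\<xi>. (\<i> * complex_of_real \<xi>) ^ j * ct n \<xi>)"
  by (rule csym_mult_cont[OF csym_ct]) (auto intro!: continuous_intros simp flip: power_mult_distrib)

lemma csym_A: "csym (\<lambda>\<xi>. \<i> * complex_of_real \<xi> * (m \<xi> * ct n \<xi>))"
  by (rule csym_deriv[OF csym_mct])

lemma bounded_linear_A: "bounded_linear (A n)"
  unfolding A_def by (rule bounded_linear_mul[OF csym_A])

lemma bounded_linear_P: "bounded_linear (P n)"
  unfolding P_def by (rule bounded_linear_mul[OF csym_ct])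

lemma bounded_linear_D: "bounded_linear (D n j)"
  unfolding D_def by (rule bounded_linear_mul[OF csym_D])

lemma bounded_linear_K: "bounded_linear (K n)"
  unfolding K_def by (rule bounded_linear_mul[OF csym_mct])

lemma fh_A: "AE \<xi> in lborel. fh (A n u) \<xi> = \<i> * complex_of_real \<xi> * (m \<xi> * ct n \<xi>) * fh u \<xi>"
  unfolding A_def by (rule fh_mul[OF csym_A])

lemma fh_K: "AE \<xi> in lborel. fh (K n u) \<xi> = m \<xi> * ct n \<xi> * fh u \<xi>"
  unfolding K_def by (rule fh_mul[OF csym_mct])

lemma fh_P: "AE \<xi> in lborel. fh (P n u) \<xi> = ct n \<xi> * fh u \<xi>"
  unfolding P_def by (rule fh_mul[OF csym_ct])

lemma fh_D: "AE \<xi> in lborel. fh (D n j u) \<xi> = (\<i> * complex_of_real \<xi>) ^ j * ct n \<xi> * fh u \<xi>"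
  unfolding D_def by (rule fh_mul[OF csym_D])

lemma cnj_ct [simp]: "cnj (ct n \<xi>) = ct n \<xi>"
  by (simp add: ct_def indicator_def)

lemma ct_idem [simp]: "ct n \<xi> * ct n \<xi> = ct n \<xi>" "ct n \<xi> * (ct n \<xi> * z) = ct n \<xi> * z"
  by (simp_all add: ct_def indicator_def)

text \<open>The symbol is purely imaginary, because \<open>m\<close> and the cutoff are
  real.\<close>

lemma A_skew: "ip (A n u) v = - ip u (A n v)"
proof -
  have "ip (A n u) v = ip u (- A n v)"
  proof (rule ip_fh_cong)
    show "AE \<xi> in lborel. fh (A n u) \<xi> * cnj (fh v \<xi>) = fh u \<xi> * cnj (fh (- A n v) \<xi>)"
      using fh_A[of n u] fh_A[of n v] fh_scaleR[of "-1" "A n v"]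
      by eventually_elim (simp add: mult_ac)
  qed
  then show ?thesis by (simp add: ip.minus_right)
qed

text \<open>Trades an operator whose norm may grow with \<open>n\<close> for \<open>K n\<close>,
  which \<open>l2_K_le\<close> bounds by \<open>B\<close> uniformly in \<open>n\<close>.\<close>

lemma A_is_deriv:
  assumes "is_deriv f g"
  shows "A n f = K n g"
proof (rule fh_inj)
  show "AE \<xi> in lborel. fh (A n f) \<xi> = fh (K n g) \<xi>"
    using fh_A[of n f] fh_K[of n g] is_deriv_fh[OF assms]
    by eventually_elim (simp add: mult_ac)
qed

lemma is_deriv_K:
  assumes "is_deriv f g"
  shows "is_deriv (K n f) (K n g)"
  using mul_deriv[OF csym_mct, of n f] A_is_deriv[OF assms]
  by (simp add: is_deriv_def K_def A_def)

lemma l2_K_le: "l2 (K n u) \<le> B * l2 u"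
  unfolding K_def
  by (rule l2_mul_le[OF csym_mct]) (auto simp: norm_mult ct_def indicator_def m_nonneg m_le B_nonneg)

lemma P_A: "P n (A n u) = A n u"
proof (rule fh_inj)
  show "AE \<xi> in lborel. fh (P n (A n u)) \<xi> = fh (A n u) \<xi>"
    using fh_P[of n "A n u"] fh_A[of n u] by eventually_elim (simp add: mult_ac)
qed

lemma P_P: "P n (P n u) = P n u"
proof (rule fh_inj)
  show "AE \<xi> in lborel. fh (P n (P n u)) \<xi> = fh (P n u) \<xi>"
    using fh_P[of n "P n u"] fh_P[of n u] by eventually_elim (simp add: mult_ac)
qed

lemma D_A: "D n j (A n u) = A n (D n j u)"
proof (rule fh_inj)
  show "AE \<xi> in lborel. fh (D n j (A n u)) \<xi> = fh (A n (D n j u)) \<xi>"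
    using fh_D[of n j "A n u"] fh_D[of n j u] fh_A[of n u] fh_A[of n "D n j u"]
    by eventually_elim (simp add: mult_ac)
qed

lemma D_A_dseq:
  assumes "dseq W"
  shows "D n j (A n (W 0)) = K n (W (Suc j))"
proof (rule fh_inj)
  show "AE \<xi> in lborel. fh (D n j (A n (W 0))) \<xi> = fh (K n (W (Suc j))) \<xi>"
    using fh_D[of n j "A n (W 0)"] fh_A[of n "W 0"] fh_K[of n "W (Suc j)"] dseq_fh[OF assms, of "Suc j"]
    by eventually_elim (simp add: mult_ac)
qed

lemma D_0: "P n u = u \<Longrightarrow> D n 0 u = u"
  by (simp add: D_def P_def)

lemma dseq_D: "dseq (\<lambda>j. D n j u)"
  unfolding dseq_def
proof
  fix j
  show "is_deriv (D n j u) (D n (Suc j) u)"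
    using mul_deriv[OF csym_D, of j n u] by (simp add: is_deriv_def D_def mult.assoc)
qed

text \<open>On the transform side \<open>|\<xi>|^j \<le> 1 + |\<xi>|^N\<close>; so only the orders 0
  and \<open>N\<close> have to be propagated by the energy.\<close>

lemma l2_D_le:
  assumes "j \<le> N" "P n u = u"
  shows "l2 (D n j u) \<le> l2 u + l2 (D n N u)"
proof -
  have "l2n (fh (D n j u)) \<le> 1 * l2n (\<lambda>\<xi>. norm (fh u \<xi>) + norm (fh (D n N u) \<xi>))"
  proof -
    have "l2n (fh (D n j u)) = l2n (\<lambda>\<xi>. norm (fh (D n j u) \<xi>))" by simp
    also have "\<dots> \<le> 1 * l2n (\<lambda>\<xi>. complex_of_real (norm (fh u \<xi>) + norm (fh (D n N u) \<xi>)))"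
      unfolding l2n_norm
    proof (rule l2n_mono_AE)
      show "square_integrable (\<lambda>\<xi>. complex_of_real (norm (fh u \<xi>) + norm (fh (D n N u) \<xi>)))"
        unfolding square_integrable_of_real_iff by (intro square_integrable_add square_integrable_norm square_integrable_fh)
      show "AE \<xi> in lborel. norm (fh (D n j u) \<xi>) \<le> 1 * norm (complex_of_real (norm (fh u \<xi>) + norm (fh (D n N u) \<xi>)))"
        using fh_D[of n j u] fh_D[of n N u]
      proof eventually_elim
        case (elim \<xi>)
        have "\<bar>\<xi>\<bar> ^ j \<le> 1 + \<bar>\<xi>\<bar> ^ N"
        proof (cases "\<bar>\<xi>\<bar> \<le> 1")
          case True
          then have "\<bar>\<xi>\<bar> ^ j \<le> 1" by (simp add: power_le_one)
          then show ?thesis by (simp add: add_increasing2)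
        next
          case False
          then have "\<bar>\<xi>\<bar> ^ j \<le> \<bar>\<xi>\<bar> ^ N" using assms(1) by (intro power_increasing) auto
          then show ?thesis by simp
        qed
        from mult_right_mono[OF this norm_ge_zero, of "fh u \<xi>"]
        have "\<bar>\<xi>\<bar> ^ j * norm (fh u \<xi>) \<le> norm (fh u \<xi>) + \<bar>\<xi>\<bar> ^ N * norm (fh u \<xi>)"
          by (simp add: algebra_simps)
        then show ?case
          unfolding elim norm_of_real by (cases "\<xi> \<in> {-n..n}") (auto simp: ct_def norm_mult norm_power)
      qed
    qed auto
    finally show ?thesis by (simp only: l2n_of_real)
  qed
  also have "\<dots> \<le> l2n (fh u) + l2n (fh (D n N u))"
    using l2n_triangle[OF square_integrable_norm[OF square_integrable_fh] square_integrable_norm[OF square_integrable_fh], of u "D n N u"]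
    by simp
  finally have "sqrt (2 * pi) * l2 (D n j u) \<le> sqrt (2 * pi) * (l2 u + l2 (D n N u))"
    by (simp add: l2n_fh distrib_left)
  then show ?thesis by simp
qed

definition rhs :: "real \<Rightarrow> nat \<Rightarrow> real \<Rightarrow> cbl2 \<times> cbl2 \<Rightarrow> cbl2 \<times> cbl2" where
  "rhs n k c z = (A n (snd z), A n (fst z + c *\<^sub>R pw (fst z) (Suc k)))"

lemma rhs_lipschitz:
  "\<exists>L. \<forall>x y. norm x \<le> r \<longrightarrow> norm y \<le> r \<longrightarrow> norm (rhs n k c x - rhs n k c y) \<le> L * norm (x - y)"
proof -
  obtain KA where KA: "0 \<le> KA" "\<And>u. norm (A n u) \<le> norm u * KA"
    using bounded_linear.nonneg_bounded[OF bounded_linear_A] by blast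
  note Adiff = linear_diff[OF bounded_linear.linear[OF bounded_linear_A], symmetric]
  define Q where "Q = real (k + 2) * r ^ (k + 1)"
  have "norm (rhs n k c x - rhs n k c y) \<le> (KA + (1 + \<bar>c\<bar> * Q) * KA) * norm (x - y)"
    if r: "norm x \<le> r" "norm y \<le> r" for x y
  proof -
    have f: "norm (fst x) \<le> r" "norm (fst y) \<le> r" "norm (fst x - fst y) \<le> norm (x - y)" "norm (snd x - snd y) \<le> norm (x - y)"
      using r norm_fst_le[of "fst x" "snd x"] norm_fst_le[of "fst y" "snd y"]
        norm_fst_le[of "fst (x - y)" "snd (x - y)"] norm_snd_le[of "snd (x - y)" "fst (x - y)"]
      unfolding prod.collapse unfolding fst_diff snd_diff by linarith+
    have Q: "0 \<le> Q" using order_trans[OF norm_ge_zero r(1)] by (simp add: Q_def)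
    have eq: "rhs n k c x - rhs n k c y = (A n (snd x - snd y), A n ((fst x - fst y) + c *\<^sub>R (pw (fst x) (Suc k) - pw (fst y) (Suc k))))"
      by (simp add: rhs_def Adiff algebra_simps)
    have "norm (rhs n k c x - rhs n k c y) \<le> norm (A n (snd x - snd y)) + norm (A n ((fst x - fst y) + c *\<^sub>R (pw (fst x) (Suc k) - pw (fst y) (Suc k))))"
      unfolding eq by (rule norm_Pair_le)
    also have "\<dots> \<le> norm (snd x - snd y) * KA + norm ((fst x - fst y) + c *\<^sub>R (pw (fst x) (Suc k) - pw (fst y) (Suc k))) * KA"
      by (intro add_mono KA)
    also have "\<dots> \<le> norm (x - y) * KA + (norm (x - y) + \<bar>c\<bar> * (Q * norm (x - y))) * KA"
    proof (intro add_mono mult_right_mono f KA order_trans[OF norm_triangle_ineq])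
      have "norm (pw (fst x) (Suc k) - pw (fst y) (Suc k)) \<le> Q * norm (fst x - fst y)"
        using norm_pw_diff_le[OF f(1,2), of "Suc k"] by (simp add: Q_def)
      also have "\<dots> \<le> Q * norm (x - y)" by (intro mult_left_mono f Q)
      finally show "norm (c *\<^sub>R (pw (fst x) (Suc k) - pw (fst y) (Suc k))) \<le> \<bar>c\<bar> * (Q * norm (x - y))"
        by (simp add: mult_left_mono)
    qed
    finally show ?thesis by (simp add: algebra_simps)
  qed
  then show ?thesis by blast
qed

definition size :: "real \<Rightarrow> nat \<Rightarrow> cbl2 \<Rightarrow> cbl2 \<Rightarrow> real" where
  "size n N u v = (l2 u)\<^sup>2 + (l2 v)\<^sup>2 + (l2 (D n N u))\<^sup>2 + (l2 (D n N v))\<^sup>2"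

lemma size_bounds:
  assumes "size n N u v \<le> R\<^sup>2" "0 \<le> R"
  shows "l2 u \<le> R" "l2 v \<le> R" "l2 (D n N u) \<le> R" "l2 (D n N v) \<le> R"
proof -
  note nn = zero_le_power2[of "l2 u"] zero_le_power2[of "l2 v"] zero_le_power2[of "l2 (D n N u)"] zero_le_power2[of "l2 (D n N v)"]
  show "l2 u \<le> R" "l2 v \<le> R" "l2 (D n N u) \<le> R" "l2 (D n N v) \<le> R"
    by (rule power2_le_imp_le[OF _ assms(2)], use assms(1) nn in \<open>unfold size_def, linarith\<close>)+
qed

lemma size_l2bd:
  assumes "size n N u v \<le> R\<^sup>2" "0 \<le> R" "P n u = u" "P n v = v"
  shows "l2bd N (\<lambda>j. D n j u) (2 * R)" "l2bd N (\<lambda>j. D n j v) (2 * R)"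
  using size_bounds[OF assms(1,2)] l2_D_le[OF _ assms(3), of _ N] l2_D_le[OF _ assms(4), of _ N]
  unfolding l2bd_def by fastforce+

definition solves :: "real \<Rightarrow> nat \<Rightarrow> real \<Rightarrow> real set \<Rightarrow> (real \<Rightarrow> cbl2) \<Rightarrow> (real \<Rightarrow> cbl2) \<Rightarrow> bool" where
  "solves n k c S u v \<longleftrightarrow> (\<forall>t\<in>S. P n (u t) = u t \<and> P n (v t) = v t \<and>
    (u has_vector_derivative A n (v t)) (at t within S) \<and>
    (v has_vector_derivative A n (u t + c *\<^sub>R pw (u t) (Suc k))) (at t within S))"

text \<open>When \<open>size\<close> is at most \<open>R\<^sup>2\<close>, all derivatives up to
  order \<open>N\<close> are bounded by \<open>2 * R\<close> in \<open>L^2\<close>, and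
  \<open>l2bd_sup\<close> contributes the factor \<open>2 * \<kappa>\<close>.\<close>

definition sup_const :: "real \<Rightarrow> real" where "sup_const R = 4 * \<kappa> * R"

text \<open>Bound for the energy derivative divided by \<open>c\<close>. The first summand comes
  from the time derivative of the coefficient \<open>q\<close>, the second from pairing the order
  \<open>N\<close> component of \<open>v\<close> with the Leibniz remainder.\<close>

definition growth_const :: "nat \<Rightarrow> nat \<Rightarrow> real \<Rightarrow> real" where
  "growth_const N k R =
    real (k + 2) * (real (k + 1) * sup_const R ^ k * (4 * \<kappa> * B * R)) * R\<^sup>2 +
    2 * R * B * ((2 ^ N + 1) * (2 * \<kappa> * (real (k + 2) * ((2 ^ N * 2 * \<kappa>) ^ k * (2 * R) ^ (k + 1))) * (2 * R)))"

lemma growth_const_nonneg: "0 \<le> R \<Longrightarrow> 0 \<le> growth_const N k R"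
  unfolding growth_const_def sup_const_def using \<kappa>_nonneg B_nonneg by (intro add_nonneg_nonneg mult_nonneg_nonneg) auto

text \<open>Controls the time derivative of \<open>u\<close> in the supremum, uniformly in
  \<open>n\<close>: after rewriting it as \<open>K n\<close> of a first derivative, the embedding
  uses derivatives of \<open>v\<close> up to order 2, whence \<open>2 \<le> N\<close>.\<close>

lemma abs_val_A_le:
  assumes "size n N u v \<le> R\<^sup>2" "0 \<le> R" "P n u = u" "P n v = v" "2 \<le> N"
  shows "\<bar>val (A n v) x\<bar> \<le> 4 * \<kappa> * B * R"
proof -
  define F where "F j = D n j v" for j
  have F: "dseq F" "F 0 = v" unfolding F_def[abs_def] using dseq_D D_0[OF assms(4)] by auto
  have bd: "l2 (F 1) \<le> 2 * R" "l2 (F 2) \<le> 2 * R"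
    using size_l2bd(2)[OF assms(1-4)] assms(5) unfolding F_def l2bd_def by auto
  have A_eq: "A n v = K n (F 1)" using A_is_deriv[OF dseqD[OF F(1), of 0], of n] F(2) by simp
  have "\<bar>val (K n (F 1)) x\<bar> \<le> \<kappa> * (l2 (K n (F 1)) + l2 (K n (F 2)))"
    using is_deriv_sup_le[OF is_deriv_K[OF dseqD[OF F(1), of 1], of n]] by (simp add: numeral_2_eq_2)
  also have "\<dots> \<le> \<kappa> * (B * (2 * R) + B * (2 * R))"
    by (intro mult_left_mono add_mono \<kappa>_nonneg order_trans[OF l2_K_le] bd B_nonneg)
  finally show ?thesis unfolding A_eq by (simp add: algebra_simps)
qed

text \<open>The energy adds an order 0 part with \<open>q = u^(k+1)\<close>, which is exact, and an
  order \<open>N\<close> part with \<open>q = (k+2) u^(k+1)\<close>, whose only remainder is the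
  Leibniz one. It lies between 1/2 and 3/2 times \<open>size\<close>, which gives the factors 3 and
  2; its derivative carries the factor \<open>c\<close>.\<close>

lemma energy_estimate:
  fixes R c X0 \<tau> :: real
  assumes N: "2 \<le> N" and R: "0 \<le> R" and c: "0 < c" and small: "c * (real (k + 2) * sup_const R ^ (k + 1)) \<le> 1 / 2"
    and \<tau>: "0 \<le> \<tau>" and sol: "solves n k c {0..\<tau>} u v"
    and bd: "\<And>t. t \<in> {0..\<tau>} \<Longrightarrow> size n N (u t) (v t) \<le> R\<^sup>2" and X0: "size n N (u 0) (v 0) \<le> X0"
  shows "size n N (u \<tau>) (v \<tau>) \<le> 3 * X0 + 2 * (c * growth_const N k R * \<tau>)"
proof -
  define a where "a t = real (k + 2) *\<^sub>R pw (u t) k" for t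
  define a' where "a' t = real (k + 2) *\<^sub>R pwd (u t) (A n (v t)) k" for t
  define U where "U t = D n N (u t)" for t
  define V where "V t = D n N (v t)" for t
  define S where "S = sup_const R"
  define Q where "Q = real (k + 2) * (real (k + 1) * S ^ k * (4 * \<kappa> * B * R))"
  define Kc where "Kc = (2 ^ N + 1) * (2 * \<kappa> * (real (k + 2) * ((2 ^ N * 2 * \<kappa>) ^ k * (2 * R) ^ (k + 1))) * (2 * R))"
  define E where "E t = (ip (u t) (u t) + c * ip (pw (u t) k * u t) (u t) + ip (v t) (v t)) +
    (ip (U t) (U t) + c * ip (a t * U t) (U t) + ip (V t) (V t))" for t
  have S0: "0 \<le> S" using R \<kappa>_nonneg by (simp add: S_def sup_const_def)
  have PP: "P n (u t) = u t" "P n (v t) = v t" if "t \<in> {0..\<tau>}" for t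
    using sol that by (auto simp: solves_def)
  have ud: "(u has_vector_derivative A n (v t)) (at t within {0..\<tau>})"
    and vd: "(v has_vector_derivative A n (u t + c *\<^sub>R pw (u t) (Suc k))) (at t within {0..\<tau>})" if "t \<in> {0..\<tau>}" for t
    using sol that by (auto simp: solves_def)
  have sup_u: "\<bar>val (u t) x\<bar> \<le> S" if t: "t \<in> {0..\<tau>}" for t x
  proof -
    have "\<bar>val (D n 0 (u t)) x\<bar> \<le> 2 * \<kappa> * (2 * R)"
      by (rule l2bd_sup[OF dseq_D size_l2bd(1)[OF bd[OF t] R PP[OF t]]]) (use N in simp)
    then show ?thesis by (simp add: D_0[OF PP(1)[OF t]] S_def sup_const_def)
  qed
  have sup_pw: "\<bar>val (pw (u t) k) x\<bar> \<le> S ^ (k + 1)" if t: "t \<in> {0..\<tau>}" for t x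
    unfolding val_pw power_abs by (intro power_mono sup_u t) simp
  have sup_pwd: "\<bar>val (pwd (u t) (A n (v t)) k) x\<bar> \<le> real (k + 1) * S ^ k * (4 * \<kappa> * B * R)" if t: "t \<in> {0..\<tau>}" for t x
    unfolding val_pwd abs_mult power_abs
    by (intro mult_mono power_mono sup_u t abs_val_A_le[OF bd[OF t] R PP[OF t] N]) (auto simp: S0)
  have Q0: "0 \<le> real (k + 1) * S ^ k * (4 * \<kappa> * B * R)"
    using S0 \<kappa>_nonneg B_nonneg R by simp
  have growth: "E \<tau> - E 0 \<le> c * growth_const N k R * \<tau>"
  proof -
    have "\<exists>E'. (E has_real_derivative E') (at t within {0..\<tau>}) \<and> \<bar>E'\<bar> \<le> c * growth_const N k R" if t: "t \<in> {0..\<tau>}" for t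
    proof -
      note b = bd[OF t] and p = PP[OF t]
      note sb = size_bounds[OF b R]
      have aderiv: "((\<lambda>t. pw (u t) k) has_vector_derivative pwd (u t) (A n (v t)) k) (at t within {0..\<tau>})"
        by (rule pw_has_vector_derivative[OF ud[OF t]])
      have ad: "(a has_vector_derivative a' t) (at t within {0..\<tau>})"
        unfolding a_def[abs_def] a'_def
        by (rule bounded_linear.has_vector_derivative[OF bounded_linear_scaleR_right aderiv])
      have low: "((\<lambda>t. ip (u t) (u t) + c * ip (pw (u t) k * u t) (u t) + ip (v t) (v t)) has_real_derivative
          c * ip (pwd (u t) (A n (v t)) k * u t) (u t) + 2 * ip (u t + c *\<^sub>R (pw (u t) k * u t)) 0 + 2 * ip (v t) 0) (at t within {0..\<tau>})"
        by (rule energy_has_derivative[OF ud[OF t] vd[OF t] aderiv])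
          (simp add: A_skew[of n _ "v t"] ip_commute[of "v t"] mult.commute[of "u t"])
      define F where "F j = D n j (u t)" for j
      have F: "dseq F" "F 0 = u t" "F N = U t" "l2bd N F (2 * R)"
        unfolding F_def[abs_def] U_def using dseq_D D_0[OF p(1)] size_l2bd(1)[OF b R p] by auto
      \<comment> \<open>Here no derivative is lost: the top-order term is the derivative of
        \<open>a t * U t\<close>, so under \<open>A n\<close> it completes \<open>U t\<close> to the
        same expression \<open>U t + c *\<^sub>R (a t * U t)\<close> that the energy pairs
        with.\<close>
      obtain h r where hr: "is_deriv (a t * U t) h" "pwseq F (Suc k) (Suc N) = h + r" "l2 r \<le> Kc"
        using pwseq_top_order[OF F(1,4) N, of k thesis] unfolding F(2,3) a_def Kc_def by blast
      have U': "(U has_vector_derivative A n (V t)) (at t within {0..\<tau>})"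
        unfolding U_def[abs_def] V_def D_A[symmetric]
        by (rule bounded_linear.has_vector_derivative[OF bounded_linear_D ud[OF t]])
      have V': "(V has_vector_derivative D n N (A n (u t + c *\<^sub>R pw (u t) (Suc k)))) (at t within {0..\<tau>})"
        unfolding V_def[abs_def]
        by (rule bounded_linear.has_vector_derivative[OF bounded_linear_D vd[OF t]])
      have "D n N (A n (pw (u t) (Suc k))) = K n (h + r)"
        using D_A_dseq[OF dseq_pwseq[OF F(1), of "Suc k"], of n N] by (simp only: pwseq_0 F(2) hr(2))
      also have "\<dots> = A n (a t * U t) + K n r"
        by (simp add: linear_add[OF bounded_linear.linear[OF bounded_linear_K]] A_is_deriv[OF hr(1)])
      finally have V'_eq: "D n N (A n (u t + c *\<^sub>R pw (u t) (Suc k))) = A n (U t + c *\<^sub>R (a t * U t)) + c *\<^sub>R K n r"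
        by (simp add: linear_add[OF bounded_linear.linear[OF bounded_linear_A]] linear_add[OF bounded_linear.linear[OF bounded_linear_D]]
            linear_scale[OF bounded_linear.linear[OF bounded_linear_A]] linear_scale[OF bounded_linear.linear[OF bounded_linear_D]]
            D_A[of n N "u t"] U_def scaleR_add_right del: pw.simps)
      have high: "((\<lambda>t. ip (U t) (U t) + c * ip (a t * U t) (U t) + ip (V t) (V t)) has_real_derivative
          c * ip (a' t * U t) (U t) + 2 * ip (U t + c *\<^sub>R (a t * U t)) 0 + 2 * ip (V t) (c *\<^sub>R K n r)) (at t within {0..\<tau>})"
        by (rule energy_has_derivative[OF U' V' ad])
          (simp add: V'_eq A_skew[of n _ "V t"] ip_commute[of "V t"] del: pw.simps)
      define E' where "E' = c * ip (pwd (u t) (A n (v t)) k * u t) (u t) + c * ip (a' t * U t) (U t) + 2 * ip (V t) (c *\<^sub>R K n r)"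
      have Ed: "(E has_real_derivative E') (at t within {0..\<tau>})"
        unfolding E_def[abs_def] using DERIV_add[OF low high] by (simp add: E'_def ip.zero_right add.assoc)
      have "\<bar>ip (pwd (u t) (A n (v t)) k * u t) (u t)\<bar> \<le> (real (k + 1) * S ^ k * (4 * \<kappa> * B * R)) * l2 (u t) * l2 (u t)"
        by (rule abs_ip_mult_le[OF sup_pwd[OF t]])
      \<comment> \<open>The order 0 coefficient is smaller by the factor \<open>k + 2\<close>;
        enlarging its bound lets both parts share \<open>Q\<close>.\<close>
      also have "\<dots> \<le> Q * l2 (u t) * l2 (u t)"
      proof -
        have "1 * (real (k + 1) * S ^ k * (4 * \<kappa> * B * R)) \<le> Q"
          unfolding Q_def by (rule mult_right_mono[OF _ Q0]) simp
        then show ?thesis by (intro mult_right_mono) auto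
      qed
      finally have i1: "\<bar>ip (pwd (u t) (A n (v t)) k * u t) (u t)\<bar> \<le> Q * (l2 (u t))\<^sup>2" by (simp add: power2_eq_square mult.assoc)
      have "\<bar>val (a' t) x\<bar> \<le> Q" for x
        unfolding a'_def Q_def val_scaleR abs_mult by (intro mult_mono sup_pwd[OF t]) auto
      then have "\<bar>ip (a' t * U t) (U t)\<bar> \<le> Q * l2 (U t) * l2 (U t)" by (rule abs_ip_mult_le)
      then have i2: "\<bar>ip (a' t * U t) (U t)\<bar> \<le> Q * (l2 (U t))\<^sup>2" by (simp add: power2_eq_square mult.assoc)
      have "\<bar>ip (V t) (K n r)\<bar> \<le> l2 (V t) * l2 (K n r)" by (rule abs_ip_le)
      also have "\<dots> \<le> R * (B * Kc)"
        using sb(4) hr(3) R B_nonneg by (intro mult_mono order_trans[OF l2_K_le] mult_left_mono) (auto simp: V_def)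
      finally have i3: "\<bar>ip (V t) (K n r)\<bar> \<le> R * (B * Kc)" .
      have Qnn: "0 \<le> Q" unfolding Q_def using Q0 by simp
      have "(l2 (u t))\<^sup>2 + (l2 (U t))\<^sup>2 \<le> R\<^sup>2"
        using b zero_le_power2[of "l2 (v t)"] zero_le_power2[of "l2 (D n N (v t))"] unfolding size_def U_def by linarith
      from mult_left_mono[OF this Qnn] have i4: "Q * (l2 (u t))\<^sup>2 + Q * (l2 (U t))\<^sup>2 \<le> Q * R\<^sup>2" by (simp add: distrib_left)
      have "E' = c * (ip (pwd (u t) (A n (v t)) k * u t) (u t) + ip (a' t * U t) (U t) + 2 * ip (V t) (K n r))"
        by (simp add: E'_def ip.scaleR_right algebra_simps)
      moreover have "\<bar>ip (pwd (u t) (A n (v t)) k * u t) (u t) + ip (a' t * U t) (U t) + 2 * ip (V t) (K n r)\<bar> \<le> Q * R\<^sup>2 + 2 * (R * (B * Kc))"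
        using i1 i2 i3 i4 by linarith
      moreover have "Q * R\<^sup>2 + 2 * (R * (B * Kc)) = growth_const N k R"
        unfolding growth_const_def Q_def Kc_def S_def by (simp add: mult_ac)
      ultimately have "\<bar>E'\<bar> \<le> c * growth_const N k R"
        using c by (simp add: abs_mult)
      with Ed show ?thesis by blast
    qed
    then obtain E' where E': "\<And>t. t \<in> {0..\<tau>} \<Longrightarrow> (E has_real_derivative E' t) (at t within {0..\<tau>})"
      "\<And>t. t \<in> {0..\<tau>} \<Longrightarrow> norm (E' t) \<le> c * growth_const N k R"
      by (simp only: real_norm_def) metis
    have "norm (E \<tau> - E 0) \<le> c * growth_const N k R * norm (\<tau> - 0)"
      by (rule field_differentiable_bound[OF _ E']) (use \<tau> in auto)
    then show ?thesis using \<tau> by simp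
  qed
  \<comment> \<open>Coercivity: \<open>small\<close> bounds \<open>c\<close> times either
    coefficient by 1/2, so the indefinite term is at most half of the square that it
    accompanies.\<close>
  have equiv: "size n N (u t) (v t) \<le> 2 * E t \<and> E t \<le> 3 / 2 * size n N (u t) (v t)" if t: "t \<in> {0..\<tau>}" for t
  proof -
    have pos: "0 \<le> S ^ (k + 1)" using S0 by simp
    have "\<bar>ip (pw (u t) k * u t) (u t)\<bar> \<le> S ^ (k + 1) * l2 (u t) * l2 (u t)"
      by (rule abs_ip_mult_le[OF sup_pw[OF t]])
    also have "\<dots> \<le> (real (k + 2) * S ^ (k + 1)) * l2 (u t) * l2 (u t)"
      using mult_right_mono[OF _ pos, of 1 "real (k + 2)"] by (intro mult_right_mono) auto
    finally have "\<bar>c * ip (pw (u t) k * u t) (u t)\<bar> \<le> c * ((real (k + 2) * S ^ (k + 1)) * l2 (u t) * l2 (u t))"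
      using c by (simp add: abs_mult)
    also have "\<dots> = (c * (real (k + 2) * S ^ (k + 1))) * (l2 (u t))\<^sup>2" by (simp add: power2_eq_square)
    also have "\<dots> \<le> 1 / 2 * (l2 (u t))\<^sup>2" using small unfolding S_def by (intro mult_right_mono) auto
    finally have i1: "\<bar>c * ip (pw (u t) k * u t) (u t)\<bar> \<le> 1 / 2 * (l2 (u t))\<^sup>2" .
    have "\<bar>val (a t) x\<bar> \<le> real (k + 2) * S ^ (k + 1)" for x
      unfolding a_def val_scaleR abs_mult by (intro mult_mono sup_pw[OF t]) auto
    then have "\<bar>ip (a t * U t) (U t)\<bar> \<le> (real (k + 2) * S ^ (k + 1)) * l2 (U t) * l2 (U t)"
      by (rule abs_ip_mult_le)
    then have "\<bar>c * ip (a t * U t) (U t)\<bar> \<le> c * ((real (k + 2) * S ^ (k + 1)) * l2 (U t) * l2 (U t))"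
      using c by (simp add: abs_mult)
    also have "\<dots> = (c * (real (k + 2) * S ^ (k + 1))) * (l2 (U t))\<^sup>2" by (simp add: power2_eq_square)
    also have "\<dots> \<le> 1 / 2 * (l2 (U t))\<^sup>2" using small unfolding S_def by (intro mult_right_mono) auto
    finally have i2: "\<bar>c * ip (a t * U t) (U t)\<bar> \<le> 1 / 2 * (l2 (U t))\<^sup>2" .
    have lin: "x + v + y + w \<le> 2 * ((x + p + v) + (y + q + w)) \<and> (x + p + v) + (y + q + w) \<le> 3 / 2 * (x + v + y + w)"
      if "\<bar>p\<bar> \<le> 1 / 2 * x" "\<bar>q\<bar> \<le> 1 / 2 * y" "0 \<le> v" "0 \<le> w" for x y v w p q :: real
      using that by (simp add: abs_le_iff field_simps)
    show ?thesis
      unfolding E_def size_def ip_self U_def[symmetric] V_def[symmetric]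
      by (rule lin[OF i1 i2 zero_le_power2 zero_le_power2])
  qed
  have "0 \<in> {0..\<tau>}" "\<tau> \<in> {0..\<tau>}" using \<tau> by auto
  from conjunct2[OF equiv[OF this(1)]] conjunct1[OF equiv[OF this(2)]] growth X0
  show ?thesis by linarith
qed

text \<open>While \<open>size\<close> is at most \<open>R\<^sup>2\<close>, the energy estimate and
  the choice of \<open>T\<close> give the bound \<open>3 * X0 + 1\<close> on
  \<open>{0..T / c}\<close>; the gap to \<open>R\<^sup>2 = 3 * X0 + 2\<close> closes the continuity
  argument. Neither bound nor time depends on \<open>n\<close>.\<close>

theorem truncated_solution:
  fixes R c X0 T :: real
  assumes N: "2 \<le> N" and R: "R\<^sup>2 = 3 * X0 + 2" "0 \<le> R" and c: "0 < c"
    and small: "c * (real (k + 2) * sup_const R ^ (k + 1)) \<le> 1 / 2"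
    and T: "0 \<le> T" "2 * growth_const N k R * T \<le> 1"
    and init: "P n u0 = u0" "P n v0 = v0" "size n N u0 v0 \<le> X0"
  obtains u v where "u 0 = u0" "v 0 = v0" "solves n k c {0..T / c} u v"
    "\<And>t. t \<in> {0..T / c} \<Longrightarrow> size n N (u t) (v t) \<le> R\<^sup>2"
proof -
  define T' where "T' = T / c"
  have T': "0 \<le> T'" using T c by (simp add: T'_def)
  \<comment> \<open>Large enough that a pair with \<open>size\<close> at most
    \<open>R\<^sup>2\<close> lies inside the ball, where the retraction is the identity: each
    component then has norm at most \<open>sup_const R + R\<close>.\<close>
  define \<rho> where "\<rho> = 2 * (sup_const R + R) + 1"
  have \<rho>: "0 < \<rho>" using R \<kappa>_nonneg by (simp add: \<rho>_def sup_const_def add_nonneg_pos)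
  obtain L where L: "\<And>x y. norm x \<le> \<rho> \<Longrightarrow> norm y \<le> \<rho> \<Longrightarrow> norm (rhs n k c x - rhs n k c y) \<le> L * norm (x - y)"
    using rhs_lipschitz by blast
  obtain z where z: "z 0 = (u0, v0)"
    "\<And>t. t \<in> {0..T'} \<Longrightarrow> (z has_vector_derivative rhs n k c (retract \<rho> (z t))) (at t within {0..T'})"
    using picard_cutoff[OF L \<rho> T', of "(u0, v0)"] by blast
  define u where "u t = fst (z t)" for t
  define v where "v t = snd (z t)" for t
  have ud: "(u has_vector_derivative fst (rhs n k c (retract \<rho> (z t)))) (at t within {0..T'})"
    and vd: "(v has_vector_derivative snd (rhs n k c (retract \<rho> (z t)))) (at t within {0..T'})" if "t \<in> {0..T'}" for t
    unfolding u_def v_def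
    by (rule bounded_linear.has_vector_derivative[OF bounded_linear_fst z(2)[OF that]]
        bounded_linear.has_vector_derivative[OF bounded_linear_snd z(2)[OF that]])+
  \<comment> \<open>\<open>A n\<close> takes values in the range of \<open>P n\<close>, so the part
    of the solution outside the band has zero derivative and stays zero.\<close>
  have supp: "P n (w t) = w t"
    if w: "\<And>t. t \<in> {0..T'} \<Longrightarrow> (w has_vector_derivative A n (g t)) (at t within {0..T'})" "P n (w 0) = w 0" "t \<in> {0..T'}"
    for w g t
  proof -
    have "((\<lambda>t. w t - P n (w t)) has_vector_derivative 0) (at t within {0..T'})" if t: "t \<in> {0..T'}" for t
      using has_vector_derivative_diff[OF w(1)[OF t] bounded_linear.has_vector_derivative[OF bounded_linear_P w(1)[OF t]], of n]
      by (simp add: P_A)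
    then obtain q where "\<And>t. t \<in> {0..T'} \<Longrightarrow> w t - P n (w t) = q"
      using has_vector_derivative_zero_constant[of "{0..T'}" "\<lambda>t. w t - P n (w t)"] by auto
    from this[of 0] this[OF w(3)] w(2) T' show ?thesis by simp
  qed
  have Pu: "P n (u t) = u t" if "t \<in> {0..T'}" for t
    by (rule supp[OF _ _ that, of _ "\<lambda>t. snd (retract \<rho> (z t))"])
      (use ud z(1) init in \<open>auto simp: rhs_def u_def[of 0]\<close>)
  have Pv: "P n (v t) = v t" if "t \<in> {0..T'}" for t
    by (rule supp[OF _ _ that, of _ "\<lambda>t. fst (retract \<rho> (z t)) + c *\<^sub>R pw (fst (retract \<rho> (z t))) (Suc k)"])
      (use vd z(1) init in \<open>auto simp: rhs_def v_def[of 0]\<close>)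
  have inside: "retract \<rho> (z t) = z t" if t: "t \<in> {0..T'}" and b: "size n N (u t) (v t) \<le> R\<^sup>2" for t
  proof (rule retract_id[OF \<rho>])
    have nb: "norm w \<le> sup_const R + R" if w: "P n w = w" "l2bd N (\<lambda>j. D n j w) (2 * R)" "l2 w \<le> R" for w
    proof (rule norm_cbl2_le)
      show "\<bar>val w x\<bar> \<le> sup_const R" for x
        using l2bd_sup[OF dseq_D w(2), of 0 x] N by (simp add: D_0[OF w(1)] sup_const_def)
    qed (rule w)
    have "norm (z t) \<le> norm (u t) + norm (v t)"
      using norm_Pair_le[of "u t" "v t"] by (simp add: u_def v_def)
    also have "\<dots> \<le> (sup_const R + R) + (sup_const R + R)"
      by (intro add_mono nb Pu Pv t size_l2bd[OF b R(2) Pu[OF t] Pv[OF t]] size_bounds(1,2)[OF b R(2)])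
    finally show "norm (z t) \<le> \<rho>" by (simp add: \<rho>_def)
  qed
  have sol: "solves n k c {0..\<tau>} u v" if \<tau>: "\<tau> \<in> {0..T'}" and b: "\<And>t. t \<in> {0..\<tau>} \<Longrightarrow> size n N (u t) (v t) \<le> R\<^sup>2" for \<tau>
    unfolding solves_def
  proof (intro ballI conjI)
    fix t assume t: "t \<in> {0..\<tau>}"
    have tT: "t \<in> {0..T'}" and sub: "{0..\<tau>} \<subseteq> {0..T'}" using t \<tau> by auto
    show "P n (u t) = u t" "P n (v t) = v t" using Pu Pv tT by auto
    show "(u has_vector_derivative A n (v t)) (at t within {0..\<tau>})"
      "(v has_vector_derivative A n (u t + c *\<^sub>R pw (u t) (Suc k))) (at t within {0..\<tau>})"
      using has_vector_derivative_within_subset[OF ud[OF tT] sub] has_vector_derivative_within_subset[OF vd[OF tT] sub]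
      by (simp_all add: inside[OF tT b[OF t]] rhs_def u_def v_def del: pw.simps)
  qed
  have cont_l2: "continuous_on {0..T'} (\<lambda>t. (l2 (L (w t)))\<^sup>2)" if "continuous_on {0..T'} w" "bounded_linear L" for w :: "real \<Rightarrow> cbl2" and L
    unfolding ip_self[symmetric]
    by (intro ip.continuous_on bounded_linear.continuous_on[OF that(2)] that(1))
  have uc: "continuous_on {0..T'} u" and vc: "continuous_on {0..T'} v"
    by (rule continuous_on_vector_derivative[OF ud] continuous_on_vector_derivative[OF vd]; assumption)+
  have size_cont: "continuous_on {0..T'} (\<lambda>t. size n N (u t) (v t))"
    unfolding size_def
    by (intro continuous_on_add cont_l2[OF uc bounded_linear_ident] cont_l2[OF vc bounded_linear_ident]
        cont_l2[OF uc bounded_linear_D] cont_l2[OF vc bounded_linear_D])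
  have le: "size n N (u t) (v t) \<le> 3 * X0 + 1" if "t \<in> {0..T'}" for t
  proof (rule bootstrap[OF size_cont, where B = "R\<^sup>2", OF _ _ _ that])
    have z0: "u 0 = u0" "v 0 = v0" using z(1) by (auto simp: u_def v_def)
    have "0 \<le> X0" using init(3) by (rule order_trans[rotated]) (simp add: size_def)
    then show "size n N (u 0) (v 0) \<le> 3 * X0 + 1" using init(3) z0 by simp
    show "3 * X0 + 1 < R\<^sup>2" using R by simp
    fix \<tau> assume \<tau>: "\<tau> \<in> {0..T'}" and b: "\<And>s. s \<in> {0..\<tau>} \<Longrightarrow> size n N (u s) (v s) \<le> R\<^sup>2"
    have "size n N (u \<tau>) (v \<tau>) \<le> 3 * X0 + 2 * (c * growth_const N k R * \<tau>)"
      by (rule energy_estimate[OF N R(2) c small _ sol[OF \<tau> b] b]) (use \<tau> init(3) z0 in auto)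
    also have "2 * (c * growth_const N k R * \<tau>) \<le> 2 * (c * growth_const N k R * T')"
      using \<tau> c growth_const_nonneg[OF R(2), of N k] by (intro mult_left_mono) auto
    also have "\<dots> \<le> 1" using T(2) c by (simp add: T'_def)
    finally show "size n N (u \<tau>) (v \<tau>) \<le> 3 * X0 + 1" by simp
  qed
  show ?thesis
  proof (rule that)
    show "u 0 = u0" "v 0 = v0" using z(1) by (auto simp: u_def v_def)
    show bd: "size n N (u t) (v t) \<le> R\<^sup>2" if "t \<in> {0..T / c}" for t
      using le[of t] that R(1) by (simp add: T'_def)
    show "solves n k c {0..T / c} u v"
      using sol[of T'] T' bd by (simp add: T'_def)
  qed
qed

end

section \<open>Differences of solutions\<close>

text \<open>By the mean value theorem, \<open>exp (- L * t) * G t - \<delta> * t\<close> is no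
  larger at \<open>T\<close> than at 0.\<close>

lemma gronwall:
  fixes G :: "real \<Rightarrow> real"
  assumes T: "0 \<le> T" and G: "\<And>t. t \<in> {0..T} \<Longrightarrow> (G has_real_derivative G' t) (at t within {0..T})"
    and le: "\<And>t. t \<in> {0..T} \<Longrightarrow> G' t \<le> L * G t + \<delta>" and nn: "0 \<le> L" "0 \<le> \<delta>"
  shows "G T \<le> (G 0 + \<delta> * T) * exp (L * T)"
proof -
  define H where "H t = exp (- L * t) * G t - \<delta> * t" for t
  have "(H has_derivative (\<lambda>h. (exp (- L * t) * (G' t - L * G t) - \<delta>) * h)) (at t within {0..T})" if "t \<in> {0..T}" for t
  proof -
    have "(H has_real_derivative (exp (- L * t) * (- L) * G t + G' t * exp (- L * t) - \<delta>)) (at t within {0..T})"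
      unfolding H_def[abs_def]
      by (rule derivative_eq_intros G[OF that] refl | simp)+
    moreover have "exp (- L * t) * (- L) * G t + G' t * exp (- L * t) - \<delta> = exp (- L * t) * (G' t - L * G t) - \<delta>"
      by (simp add: algebra_simps)
    ultimately show ?thesis by (simp add: has_field_derivative_def)
  qed
  then obtain x where x: "x \<in> {0..T}" "H T - H 0 = (exp (- L * x) * (G' x - L * G x) - \<delta>) * (T - 0)"
    using mvt_very_simple[OF T, of H "\<lambda>t h. (exp (- L * t) * (G' t - L * G t) - \<delta>) * h"] by auto
  have "exp (- L * x) * (G' x - L * G x) \<le> exp (- L * x) * \<delta>"
    using le[OF x(1)] by (intro mult_left_mono) auto
  also have "\<dots> \<le> 1 * \<delta>"
    using x(1) nn by (intro mult_right_mono) auto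
  finally have "H T \<le> H 0"
    using x(2) T mult_right_mono[of "exp (- L * x) * (G' x - L * G x) - \<delta>" 0 T] by simp
  then have "exp (- L * T) * G T \<le> G 0 + \<delta> * T" by (simp add: H_def)
  then have "exp (- L * T) * G T * exp (L * T) \<le> (G 0 + \<delta> * T) * exp (L * T)"
    by (rule mult_right_mono) simp
  then show ?thesis by (simp add: exp_minus field_simps)
qed

text \<open>Difference form of the energy argument, in order 0 only: the equations for
  \<open>d\<close> and \<open>e\<close> are linear with coefficient \<open>q\<close>. It serves both
  the comparison of two cutoffs and uniqueness. The summand 1 in the exponent comes from absorbing
  the remainder \<open>r\<close> by \<open>2ab \<le> a\<^sup>2 + b\<^sup>2\<close>.\<close>

lemma energy_gronwall:
  assumes T: "0 \<le> T" and c: "0 \<le> c"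
    and d: "\<And>t. t \<in> {0..T} \<Longrightarrow> (d has_vector_derivative d' t) (at t within {0..T})"
    and e: "\<And>t. t \<in> {0..T} \<Longrightarrow> (e has_vector_derivative e' t) (at t within {0..T})"
    and q: "\<And>t. t \<in> {0..T} \<Longrightarrow> (q has_vector_derivative q' t) (at t within {0..T})"
    and skew: "\<And>t. t \<in> {0..T} \<Longrightarrow> ip (d t + c *\<^sub>R (q t * d t)) (d' t) + ip (e t) (e' t - r t) = 0"
    and r: "\<And>t. t \<in> {0..T} \<Longrightarrow> l2 (r t) \<le> \<delta>"
    and small: "\<And>t x. t \<in> {0..T} \<Longrightarrow> c * \<bar>val (q t) x\<bar> \<le> 1 / 2"
    and Q: "\<And>t x. t \<in> {0..T} \<Longrightarrow> \<bar>val (q' t) x\<bar> \<le> Q"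
  shows "(l2 (d T))\<^sup>2 + (l2 (e T))\<^sup>2
    \<le> (3 * ((l2 (d 0))\<^sup>2 + (l2 (e 0))\<^sup>2) + 2 * \<delta>\<^sup>2 * T) * exp (2 * (c * Q + 1) * T)"
proof -
  define G where "G t = ip (d t) (d t) + c * ip (q t * d t) (d t) + ip (e t) (e t)" for t
  define Y where "Y t = (l2 (d t))\<^sup>2 + (l2 (e t))\<^sup>2" for t
  have Q0: "0 \<le> Q" using Q[of 0 0] T by force
  have equiv: "Y t \<le> 2 * G t \<and> G t \<le> 3 / 2 * Y t" if t: "t \<in> {0..T}" for t
  proof -
    have "\<bar>ip ((c *\<^sub>R q t) * d t) (d t)\<bar> \<le> 1 / 2 * l2 (d t) * l2 (d t)"
      using small[OF t] c by (intro abs_ip_mult_le) (simp add: abs_mult)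
    then have "\<bar>c * ip (q t * d t) (d t)\<bar> \<le> 1 / 2 * (l2 (d t))\<^sup>2"
      by (simp add: ip.scaleR_left power2_eq_square)
    moreover have "x + v \<le> 2 * (x + p + v) \<and> x + p + v \<le> 3 / 2 * (x + v)"
      if "\<bar>p\<bar> \<le> 1 / 2 * x" "0 \<le> v" for x v p :: real
      using that by (simp add: abs_le_iff field_simps)
    ultimately show ?thesis
      unfolding G_def Y_def ip_self by simp
  qed
  define G' where "G' t = c * ip (q' t * d t) (d t) + 2 * ip (d t + c *\<^sub>R (q t * d t)) 0 + 2 * ip (e t) (r t)" for t
  have "G T \<le> (G 0 + \<delta>\<^sup>2 * T) * exp (2 * (c * Q + 1) * T)"
  proof (rule gronwall[OF T, where G' = G'])
    show "(G has_real_derivative G' t) (at t within {0..T})" if "t \<in> {0..T}" for t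
      unfolding G_def[abs_def] G'_def
      by (rule energy_has_derivative[OF d[OF that] e[OF that] q[OF that]]) (simp add: skew[OF that])
    show "G' t \<le> 2 * (c * Q + 1) * G t + \<delta>\<^sup>2" if t: "t \<in> {0..T}" for t
    proof -
      have "\<bar>ip (q' t * d t) (d t)\<bar> \<le> Q * l2 (d t) * l2 (d t)" by (rule abs_ip_mult_le[OF Q[OF t]])
      then have "c * ip (q' t * d t) (d t) \<le> c * (Q * l2 (d t) * l2 (d t))"
        using c by (intro mult_left_mono) auto
      also have "\<dots> \<le> c * Q * Y t"
        using c Q0 by (simp add: Y_def power2_eq_square distrib_left)
      finally have 1: "c * ip (q' t * d t) (d t) \<le> c * Q * Y t" .
      have "2 * ip (e t) (r t) \<le> 2 * (l2 (e t) * \<delta>)"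
        using abs_ip_le[of "e t" "r t"] mult_left_mono[OF r[OF t], of "l2 (e t)"] by simp
      also have "\<dots> \<le> (l2 (e t))\<^sup>2 + \<delta>\<^sup>2" using sum_squares_bound[of "l2 (e t)" \<delta>] by simp
      finally have 2: "2 * ip (e t) (r t) \<le> Y t + \<delta>\<^sup>2" unfolding Y_def using zero_le_power2[of "l2 (d t)"] by linarith
      have "(c * Q + 1) * Y t \<le> (c * Q + 1) * (2 * G t)"
        using equiv[OF t] c Q0 by (intro mult_left_mono) auto
      then show ?thesis using 1 2 by (simp add: G'_def ip.zero_right algebra_simps)
    qed
  qed (use c Q0 in auto)
  then have "2 * G T \<le> (2 * G 0 + 2 * \<delta>\<^sup>2 * T) * exp (2 * (c * Q + 1) * T)"
    by (simp add: distrib_right mult.assoc)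
  also have "\<dots> \<le> (3 * Y 0 + 2 * \<delta>\<^sup>2 * T) * exp (2 * (c * Q + 1) * T)"
    using equiv[of 0] T by (intro mult_right_mono) auto
  finally show ?thesis using equiv[of T] T by (simp add: Y_def)
qed

text \<open>Division-free form of the quotient of \<open>u^(k+2) - w^(k+2)\<close> by
  \<open>u - w\<close>; it is the coefficient \<open>q\<close> in the equation for a difference of
  solutions. \<open>pdqd\<close> is its derivative along two curves.\<close>

primrec pdq :: "cbl2 \<Rightarrow> cbl2 \<Rightarrow> nat \<Rightarrow> cbl2" where
  "pdq u w 0 = u + w"
| "pdq u w (Suc k) = pw u (Suc k) + w * pdq u w k"

primrec pdqd :: "cbl2 \<Rightarrow> cbl2 \<Rightarrow> cbl2 \<Rightarrow> cbl2 \<Rightarrow> nat \<Rightarrow> cbl2" where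
  "pdqd u u' w w' 0 = u' + w'"
| "pdqd u u' w w' (Suc k) = pwd u u' (Suc k) + (w * pdqd u u' w w' k + w' * pdq u w k)"

lemma pdq_mult: "pdq u w k * (u - w) = pw u (Suc k) - pw w (Suc k)"
proof (induction k)
  case (Suc k)
  have "pdq u w (Suc k) * (u - w) = pw u (Suc k) * (u - w) + w * (pdq u w k * (u - w))"
    by (simp add: algebra_simps)
  also have "\<dots> = pw u (Suc (Suc k)) - pw w (Suc (Suc k))"
    unfolding Suc by (simp add: algebra_simps)
  finally show ?case .
qed (simp add: algebra_simps)

lemma pdq_has_vector_derivative:
  assumes "(u has_vector_derivative u') (at t within S)" "(w has_vector_derivative w') (at t within S)"
  shows "((\<lambda>t. pdq (u t) (w t) k) has_vector_derivative pdqd (u t) u' (w t) w' k) (at t within S)"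
proof (induction k)
  case (Suc k)
  show ?case
    unfolding pdq.simps pdqd.simps
    by (intro has_vector_derivative_add pw_has_vector_derivative has_vector_derivative_mult Suc assms)
qed (auto intro!: has_vector_derivative_add assms)

lemma abs_val_pdq_le:
  assumes "\<bar>val u x\<bar> \<le> S" "\<bar>val w x\<bar> \<le> S"
  shows "\<bar>val (pdq u w k) x\<bar> \<le> real (k + 2) * S ^ (k + 1)"
proof (induction k)
  case (Suc k)
  have S: "0 \<le> S" using assms(1) by linarith
  have "\<bar>val (pw u (Suc k)) x\<bar> \<le> S ^ (k + 2)"
    unfolding val_pw power_abs using power_mono[OF assms(1), of "k + 2"] by (simp del: power_Suc)
  moreover have "\<bar>val w x * val (pdq u w k) x\<bar> \<le> S * (real (k + 2) * S ^ (k + 1))"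
    unfolding abs_mult by (intro mult_mono assms Suc S) simp
  moreover have "val (pdq u w (Suc k)) x = val (pw u (Suc k)) x + val w x * val (pdq u w k) x" by simp
  ultimately have "\<bar>val (pdq u w (Suc k)) x\<bar> \<le> S ^ (k + 2) + S * (real (k + 2) * S ^ (k + 1))"
    using abs_triangle_ineq[of "val (pw u (Suc k)) x" "val w x * val (pdq u w k) x"] by linarith
  also have "\<dots> = real (Suc k + 2) * S ^ (Suc k + 1)" by (simp add: algebra_simps)
  finally show ?case .
qed (use assms in simp)

lemma abs_val_pdqd_le:
  assumes "\<bar>val u x\<bar> \<le> S" "\<bar>val w x\<bar> \<le> S" "\<bar>val u' x\<bar> \<le> S'" "\<bar>val w' x\<bar> \<le> S'"
  shows "\<bar>val (pdqd u u' w w' k) x\<bar> \<le> (real (k + 2))\<^sup>2 * (S ^ k * S')"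
proof (induction k)
  case 0
  then show ?case using assms by simp
next
  case (Suc k)
  have S: "0 \<le> S" "0 \<le> S'" using assms by linarith+
  have 1: "\<bar>val (pwd u u' (Suc k)) x\<bar> \<le> real (k + 2) * S ^ (k + 1) * S'"
    unfolding val_pwd abs_mult power_abs
    using assms S power_mono[OF assms(1), of "k + 1"] by (intro mult_mono) (auto simp: power_abs)
  have 2: "\<bar>val w x * val (pdqd u u' w w' k) x\<bar> \<le> S * ((real (k + 2))\<^sup>2 * (S ^ k * S'))"
    unfolding abs_mult by (intro mult_mono assms Suc S) simp
  have 3: "\<bar>val w' x * val (pdq u w k) x\<bar> \<le> S' * (real (k + 2) * S ^ (k + 1))"
    unfolding abs_mult by (intro mult_mono assms abs_val_pdq_le S) simp
  have "val (pdqd u u' w w' (Suc k)) x = val (pwd u u' (Suc k)) x + (val w x * val (pdqd u u' w w' k) x + val w' x * val (pdq u w k) x)"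
    by simp
  then have "\<bar>val (pdqd u u' w w' (Suc k)) x\<bar> \<le> real (k + 2) * S ^ (k + 1) * S' + (S * ((real (k + 2))\<^sup>2 * (S ^ k * S')) + S' * (real (k + 2) * S ^ (k + 1)))"
    using 1 2 3 by linarith
  also have "\<dots> = ((real (k + 2))\<^sup>2 + 2 * real (k + 2)) * (S ^ (k + 1) * S')"
    by (simp add: algebra_simps)
  also have "\<dots> \<le> (real (Suc k + 2))\<^sup>2 * (S ^ (k + 1) * S')"
    using S by (intro mult_right_mono) (auto simp: power2_eq_square algebra_simps)
  finally show ?case by simp
qed

section \<open>Sobolev bounds of integer order\<close>

text \<open>Membership and bound in \<open>H^N\<close> by one constant, with only the two extreme
  orders recorded. In contrast to \<open>size\<close> it refers to no cutoff, so it survives the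
  limit.\<close>

definition HN :: "nat \<Rightarrow> cbl2 \<Rightarrow> real \<Rightarrow> bool" where
  "HN N w C \<longleftrightarrow> l2 w \<le> C \<and> square_integrable (\<lambda>\<xi>. complex_of_real \<xi> ^ N * fh w \<xi>) \<and>
    l2n (\<lambda>\<xi>. complex_of_real \<xi> ^ N * fh w \<xi>) \<le> C"

lemma HN_nonneg: "HN N w C \<Longrightarrow> 0 \<le> C"
  unfolding HN_def using l2n_nonneg order_trans by blast

lemma HN_mono: "HN N w C \<Longrightarrow> C \<le> C' \<Longrightarrow> HN N w C'"
  by (auto simp: HN_def)

lemma xi_fh_measurable [measurable]: "(\<lambda>\<xi>. complex_of_real \<xi> ^ N * fh w \<xi>) \<in> borel_measurable borel"
  by measurable

lemma HN_diff:
  assumes "HN N w C" "HN N z C'"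
  shows "HN N (w - z) (C + C')"
proof -
  let ?f = "\<lambda>w \<xi>. complex_of_real \<xi> ^ N * fh w \<xi>"
  have si: "square_integrable (?f w)" "square_integrable (?f z)" using assms by (auto simp: HN_def)
  have AE: "AE \<xi> in lborel. ?f w \<xi> - ?f z \<xi> = ?f (w - z) \<xi>"
    using fh_diff[of w z] by eventually_elim (simp add: right_diff_distrib)
  have "square_integrable (?f (w - z))"
    by (rule square_integrable_cong_AE[OF AE square_integrable_diff[OF si] xi_fh_measurable])
  moreover have "l2n (?f (w - z)) \<le> l2n (?f w) + l2n (?f z)"
  proof -
    have "l2n (?f (w - z)) = l2n (\<lambda>\<xi>. ?f w \<xi> + - ?f z \<xi>)"
      by (rule l2n_cong_AE) (use AE in \<open>auto elim: eventually_mono\<close>)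
    also have "\<dots> \<le> l2n (?f w) + l2n (\<lambda>\<xi>. - ?f z \<xi>)" by (intro l2n_triangle si square_integrable_minus)
    finally show ?thesis by (simp only: l2n_minus)
  qed
  moreover have "l2 (w - z) \<le> l2 w + l2 z" by (rule l2_diff_le)
  ultimately show ?thesis using assms unfolding HN_def by linarith
qed

lemma HN_scaleR:
  assumes "HN N w C"
  shows "HN N (a *\<^sub>R w) (\<bar>a\<bar> * C)"
proof -
  let ?f = "\<lambda>w \<xi>. complex_of_real \<xi> ^ N * fh w \<xi>"
  have AE: "AE \<xi> in lborel. complex_of_real a * ?f w \<xi> = ?f (a *\<^sub>R w) \<xi>"
    using fh_scaleR[of a w] by eventually_elim simp
  have si: "square_integrable (\<lambda>\<xi>. complex_of_real a * ?f w \<xi>)"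
    using assms by (intro square_integrable_mult_left) (simp add: HN_def)
  have "l2n (?f (a *\<^sub>R w)) = l2n (\<lambda>\<xi>. complex_of_real a * ?f w \<xi>)"
    by (rule l2n_cong_AE) (use AE in \<open>auto elim: eventually_mono\<close>)
  then have "l2n (?f (a *\<^sub>R w)) = \<bar>a\<bar> * l2n (?f w)" unfolding l2n_mult_left by simp
  then show ?thesis
    using assms square_integrable_cong_AE[OF AE si xi_fh_measurable]
    by (auto simp: HN_def l2_scaleR mult_left_mono simp del: val_simps)
qed

lemma HN_add: "HN N w C \<Longrightarrow> HN N z C' \<Longrightarrow> HN N (w + z) (C + C')"
  using HN_diff[of N w C "- z" C'] HN_scaleR[of N z C' "-1"] by simp

lemma sqrt_2pi_le: "1 \<le> sqrt (2 * pi)" "sqrt (2 * pi) \<le> 3"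
proof -
  show "1 \<le> sqrt (2 * pi)" using pi_ge_two by (simp add: real_le_rsqrt)
  show "sqrt (2 * pi) \<le> 3" using pi_less_4 by (intro real_le_lsqrt) auto
qed

text \<open>The factor 3 absorbs the Plancherel constant \<open>sqrt (2 * pi)\<close>.\<close>

lemma dseq_HN:
  assumes W: "dseq W" and c: "l2 (W 0) \<le> c" "l2 (W N) \<le> c"
  shows "HN N (W 0) (3 * c)"
proof -
  have AE: "AE \<xi> in lborel. (- \<i>) ^ N * fh (W N) \<xi> = complex_of_real \<xi> ^ N * fh (W 0) \<xi>"
    using dseq_fh[OF W, of N]
  proof eventually_elim
    case (elim \<xi>)
    have "(- \<i>) ^ N * (\<i> ^ N * z) = z" for z :: complex
      by (simp add: mult.assoc[symmetric] flip: power_mult_distrib)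
    then show ?case unfolding elim by (simp add: power_mult_distrib mult.assoc)
  qed
  have si: "square_integrable (\<lambda>\<xi>. (- \<i>) ^ N * fh (W N) \<xi>)" by (intro square_integrable_mult_left) simp
  have "l2n (\<lambda>\<xi>. complex_of_real \<xi> ^ N * fh (W 0) \<xi>) = l2n (\<lambda>\<xi>. (- \<i>) ^ N * fh (W N) \<xi>)"
    by (rule l2n_cong_AE) (use AE in \<open>auto elim: eventually_mono\<close>)
  also have "\<dots> = sqrt (2 * pi) * l2 (W N)" unfolding l2n_mult_left by (simp add: norm_power l2n_fh)
  also have "\<dots> \<le> 3 * c" by (intro mult_mono sqrt_2pi_le c) auto
  finally have "l2n (\<lambda>\<xi>. complex_of_real \<xi> ^ N * fh (W 0) \<xi>) \<le> 3 * c" .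
  moreover have "0 \<le> c" using c(1) l2n_nonneg order_trans by blast
  ultimately show ?thesis
    using square_integrable_cong_AE[OF AE si xi_fh_measurable] c(1) by (simp add: HN_def)
qed

text \<open>Because \<open>\<sigma> < N\<close>, the weight is dominated by
  \<open>\<eta> |\<xi>|^N\<close> outside a large interval and by a constant inside.\<close>

lemma interpolation_weight:
  fixes \<sigma> \<eta> :: real
  assumes \<sigma>: "0 \<le> \<sigma>" "\<sigma> < real N" and \<eta>: "0 < \<eta>"
  obtains L where "0 \<le> L" "\<And>\<xi>. (1 + \<xi>\<^sup>2) powr (\<sigma> / 2) \<le> L + \<eta> * \<bar>\<xi>\<bar> ^ N"
proof -
  \<comment> \<open>Beyond \<open>R\<close> the inequality
    \<open>2 powr (\<sigma> / 2) \<le> \<eta> * y powr (N - \<sigma>)\<close> holds, and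
    \<open>1 \<le> R\<close> gives \<open>1 + y\<^sup>2 \<le> 2 * y\<^sup>2\<close>.\<close>
  define R where "R = max 1 ((2 powr (\<sigma> / 2) / \<eta>) powr (1 / (real N - \<sigma>)))"
  have R: "1 \<le> R" by (simp add: R_def)
  have "(1 + \<xi>\<^sup>2) powr (\<sigma> / 2) \<le> (1 + R\<^sup>2) powr (\<sigma> / 2) + \<eta> * \<bar>\<xi>\<bar> ^ N" for \<xi> :: real
  proof (cases "\<bar>\<xi>\<bar> \<le> R")
    case True
    then have "\<xi>\<^sup>2 \<le> R\<^sup>2" using power_mono[OF True, of 2] by simp
    then have "(1 + \<xi>\<^sup>2) powr (\<sigma> / 2) \<le> (1 + R\<^sup>2) powr (\<sigma> / 2)" using \<sigma> by (intro powr_mono2) auto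
    then show ?thesis using \<eta> by (simp add: add_increasing2)
  next
    case False
    define y where "y = \<bar>\<xi>\<bar>"
    have y: "R \<le> y" "1 \<le> y" "0 < y" using False R by (auto simp: y_def)
    have "(1 + \<xi>\<^sup>2) powr (\<sigma> / 2) \<le> (2 * y\<^sup>2) powr (\<sigma> / 2)"
      using y(2) \<sigma> power_mono[OF y(2), of 2] by (intro powr_mono2) (auto simp: y_def)
    also have "\<dots> = 2 powr (\<sigma> / 2) * y powr \<sigma>"
      using y by (simp add: powr_mult powr_powr flip: powr_numeral)
    also have "2 powr (\<sigma> / 2) = \<eta> * (2 powr (\<sigma> / 2) / \<eta>)" using \<eta> by simp
    also have "2 powr (\<sigma> / 2) / \<eta> = ((2 powr (\<sigma> / 2) / \<eta>) powr (1 / (real N - \<sigma>))) powr (real N - \<sigma>)"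
      using \<sigma> \<eta> by (simp add: powr_powr)
    also have "\<eta> * \<dots> * y powr \<sigma> \<le> \<eta> * y powr (real N - \<sigma>) * y powr \<sigma>"
      using y \<eta> \<sigma> by (intro mult_right_mono mult_left_mono powr_mono2) (auto simp: R_def)
    also have "\<dots> = \<eta> * y ^ N"
      using y by (simp add: mult.assoc powr_realpow flip: powr_add)
    finally show ?thesis by (simp add: y_def add_increasing)
  qed
  then show ?thesis by (intro that[of "(1 + R\<^sup>2) powr (\<sigma> / 2)"]) auto
qed

definition sobf :: "real \<Rightarrow> cbl2 \<Rightarrow> real \<Rightarrow> complex" where
  "sobf \<sigma> w \<xi> = complex_of_real ((1 + \<xi>\<^sup>2) powr (\<sigma> / 2)) * fh w \<xi>"

lemma sobf_measurable [measurable]: "sobf \<sigma> w \<in> borel_measurable borel"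
  unfolding sobf_def[abs_def] by measurable

lemma norm_sobf: "(norm (sobf \<sigma> w \<xi>))\<^sup>2 = (1 + \<xi>\<^sup>2) powr \<sigma> * (norm (fh w \<xi>))\<^sup>2"
proof -
  have "((1 + \<xi>\<^sup>2) powr (\<sigma> / 2))\<^sup>2 = (1 + \<xi>\<^sup>2) powr \<sigma>"
    by (simp add: powr_powr flip: powr_numeral)
  then show ?thesis by (simp add: sobf_def norm_mult power_mult_distrib)
qed

lemma sobolev_val_iff: "val w \<in> sobolev \<sigma> \<longleftrightarrow> square_integrable (sobf \<sigma> w)"
  unfolding sobolev_def by (simp add: square_integrable_def[of "sobf \<sigma> w"] norm_sobf fh_def)

lemma sobolev_norm_val: "sobolev_norm \<sigma> (val w) = l2n (sobf \<sigma> w)"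
  unfolding sobolev_norm_def l2n_def norm_sobf by (simp add: fh_def)

lemma HN_sobolev:
  assumes w: "HN N w C" and L: "0 \<le> L" "0 \<le> \<eta>" "\<And>\<xi>. (1 + \<xi>\<^sup>2) powr (\<sigma> / 2) \<le> L + \<eta> * \<bar>\<xi>\<bar> ^ N"
  shows "val w \<in> sobolev \<sigma>" "sobolev_norm \<sigma> (val w) \<le> 3 * L * l2 w + \<eta> * C"
proof -
  define g where "g \<xi> = complex_of_real (L * norm (fh w \<xi>)) + complex_of_real (\<eta> * norm (complex_of_real \<xi> ^ N * fh w \<xi>))" for \<xi>
  have si: "square_integrable (\<lambda>\<xi>. L * norm (fh w \<xi>))" "square_integrable (\<lambda>\<xi>. \<eta> * norm (complex_of_real \<xi> ^ N * fh w \<xi>))"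
    using w by (auto intro!: square_integrable_mult_left square_integrable_norm simp: HN_def)
  have g: "square_integrable g"
    unfolding g_def by (intro square_integrable_add) (simp_all only: square_integrable_of_real_iff si)
  have le: "norm (sobf \<sigma> w \<xi>) \<le> 1 * norm (g \<xi>)" for \<xi>
  proof -
    have "norm (sobf \<sigma> w \<xi>) \<le> (L + \<eta> * \<bar>\<xi>\<bar> ^ N) * norm (fh w \<xi>)"
      unfolding sobf_def norm_mult using L(3)[of \<xi>] by (intro mult_right_mono) auto
    also have "\<dots> = norm (g \<xi>)"
    proof -
      have g_eq: "g \<xi> = complex_of_real (L * norm (fh w \<xi>) + \<eta> * norm (complex_of_real \<xi> ^ N * fh w \<xi>))"
        by (simp add: g_def)
      show ?thesis using L(1,2) unfolding g_eq norm_of_real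
        by (simp add: norm_mult norm_power distrib_right mult.assoc)
    qed
    finally show ?thesis by simp
  qed
  show "val w \<in> sobolev \<sigma>"
    unfolding sobolev_val_iff by (rule square_integrable_bound[OF _ g le]) simp
  have "l2n (sobf \<sigma> w) \<le> 1 * l2n g" by (rule l2n_mono[OF g _ le]) auto
  also have "l2n g \<le> l2n (\<lambda>\<xi>. L * norm (fh w \<xi>)) + l2n (\<lambda>\<xi>. \<eta> * norm (complex_of_real \<xi> ^ N * fh w \<xi>))"
    unfolding g_def using l2n_triangle[of "\<lambda>\<xi>. complex_of_real (L * norm (fh w \<xi>))" "\<lambda>\<xi>. complex_of_real (\<eta> * norm (complex_of_real \<xi> ^ N * fh w \<xi>))"] si
    by (simp only: square_integrable_of_real_iff l2n_of_real)
  also have "l2n (\<lambda>\<xi>. L * norm (fh w \<xi>)) = L * (sqrt (2 * pi) * l2 w)"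
    unfolding l2n_mult_left l2n_norm l2n_fh using L by simp
  also have "\<dots> \<le> L * (3 * l2 w)" using L by (intro mult_left_mono mult_right_mono sqrt_2pi_le) auto
  also have "l2n (\<lambda>\<xi>. \<eta> * norm (complex_of_real \<xi> ^ N * fh w \<xi>)) \<le> \<eta> * C"
    unfolding l2n_mult_left l2n_norm using w L by (simp add: HN_def mult_left_mono)
  finally show "sobolev_norm \<sigma> (val w) \<le> 3 * L * l2 w + \<eta> * C" by (simp add: sobolev_norm_val)
qed

lemma HN_sobolev_mem:
  assumes "HN N w C" "0 \<le> \<sigma>" "\<sigma> < real N"
  shows "val w \<in> sobolev \<sigma>"
proof -
  obtain L where "0 \<le> L" "\<And>\<xi>. (1 + \<xi>\<^sup>2) powr (\<sigma> / 2) \<le> L + 1 * \<bar>\<xi>\<bar> ^ N"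
    using interpolation_weight[OF assms(2,3), of 1] by auto
  then show ?thesis using HN_sobolev(1)[OF assms(1), of L 1 \<sigma>] by simp
qed

text \<open>First \<eta> is chosen to make the order \<open>N\<close> contribution small, then
  \<delta> according to the resulting \<open>L\<close>. Boundedness in \<open>H^N\<close> thus
  upgrades smallness in \<open>L^2\<close> to smallness in \<open>H^\<sigma>\<close>.\<close>

lemma HN_interpolation:
  assumes "0 \<le> \<sigma>" "\<sigma> < real N" "0 < e" "0 \<le> C"
  obtains \<delta> where "0 < \<delta>" "\<And>w. HN N w C \<Longrightarrow> l2 w \<le> \<delta> \<Longrightarrow> sobolev_norm \<sigma> (val w) < e"
proof -
  define \<eta> where "\<eta> = e / (2 * (C + 1))"
  have \<eta>: "0 < \<eta>" using assms by (simp add: \<eta>_def)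
  obtain L where L: "0 \<le> L" "\<And>\<xi>. (1 + \<xi>\<^sup>2) powr (\<sigma> / 2) \<le> L + \<eta> * \<bar>\<xi>\<bar> ^ N"
    using interpolation_weight[OF assms(1,2) \<eta>] by blast
  define \<delta> where "\<delta> = e / (6 * (L + 1))"
  have "sobolev_norm \<sigma> (val w) < e" if w: "HN N w C" "l2 w \<le> \<delta>" for w
  proof -
    have "sobolev_norm \<sigma> (val w) \<le> 3 * L * l2 w + \<eta> * C"
      by (rule HN_sobolev(2)[OF w(1) L(1) _ L(2)]) (use \<eta> in simp)
    also have "\<dots> \<le> 3 * L * \<delta> + \<eta> * C"
      using w(2) L(1) by (intro add_right_mono mult_left_mono) auto
    also have "3 * L * \<delta> < e / 2" using L(1) assms(3) by (simp add: \<delta>_def field_simps)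
    also have "\<eta> * C \<le> e / 2" using assms(3,4) by (simp add: \<eta>_def field_simps)
    finally show ?thesis by simp
  qed
  moreover have "0 < \<delta>" using L(1) assms(3) by (simp add: \<delta>_def)
  ultimately show ?thesis by (rule that[rotated])
qed

text \<open>Embedding into the algebra for \<open>\<sigma> \<ge> 1\<close>, because the weight
  dominates both 1 and \<open>|\<xi>|\<close>.\<close>

lemma norm_le_sobolev_norm:
  assumes "val w \<in> sobolev \<sigma>" "1 \<le> \<sigma>"
  shows "norm w \<le> (2 * \<kappa> + 1) * sobolev_norm \<sigma> (val w)"
proof -
  have si: "square_integrable (sobf \<sigma> w)" using assms(1) by (simp add: sobolev_val_iff)
  define M where "M = l2n (sobf \<sigma> w)"
  have weight: "1 \<le> (1 + \<xi>\<^sup>2) powr (\<sigma> / 2)" "\<bar>\<xi>\<bar> \<le> (1 + \<xi>\<^sup>2) powr (\<sigma> / 2)" for \<xi> :: real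
  proof -
    show "1 \<le> (1 + \<xi>\<^sup>2) powr (\<sigma> / 2)" using assms(2) by (intro ge_one_powr_ge_zero) auto
    have "\<bar>\<xi>\<bar> = (\<xi>\<^sup>2) powr (1 / 2)" by (simp add: powr_half_sqrt)
    also have "\<dots> \<le> (1 + \<xi>\<^sup>2) powr (1 / 2)" by (intro powr_mono2) auto
    also have "\<dots> \<le> (1 + \<xi>\<^sup>2) powr (\<sigma> / 2)" using assms(2) by (intro powr_mono) auto
    finally show "\<bar>\<xi>\<bar> \<le> (1 + \<xi>\<^sup>2) powr (\<sigma> / 2)" .
  qed
  have 1: "norm (fh w \<xi>) \<le> 1 * norm (sobf \<sigma> w \<xi>)" for \<xi>
    using mult_right_mono[OF weight(1)[of \<xi>] norm_ge_zero[of "fh w \<xi>"]] by (simp add: sobf_def norm_mult)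
  have 2: "norm (complex_of_real \<xi> * fh w \<xi>) \<le> 1 * norm (sobf \<sigma> w \<xi>)" for \<xi>
    using mult_right_mono[OF weight(2)[of \<xi>] norm_ge_zero[of "fh w \<xi>"]] by (simp add: sobf_def norm_mult)
  have xi: "square_integrable (\<lambda>\<xi>. complex_of_real \<xi> * fh w \<xi>)"
    by (rule square_integrable_bound[OF _ si 2]) measurable
  have M1: "l2n (fh w) \<le> M" and M2: "l2n (\<lambda>\<xi>. complex_of_real \<xi> * fh w \<xi>) \<le> M"
    using l2n_mono[OF si _ 1] l2n_mono[OF si _ 2] by (simp_all add: M_def)
  note dom = \<F>domI[OF square_integrable_fh xi hermitian_fh]
  have inv: "inv (fh w) = w" by (rule inv_eqI[OF dom(1)]) simp
  have pi1: "1 \<le> 2 * pi" using pi_ge_two by simp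
  have "\<bar>val w x\<bar> \<le> 2 * \<kappa> * M" for x
  proof -
    define I where "I = (LINT \<xi>|lborel. norm (fh w \<xi>))"
    have I: "0 \<le> I" unfolding I_def by (rule integral_nonneg_AE) simp
    have "\<bar>val w x\<bar> \<le> I / (2 * pi)"
      using abs_val_inv_le[OF dom(1), of x] unfolding inv I_def .
    also have "\<dots> \<le> I / 1"
      by (rule divide_left_mono[OF pi1 I]) simp
    also have "I / 1 \<le> \<kappa> * (l2n (fh w) + l2n (\<lambda>\<xi>. complex_of_real \<xi> * fh w \<xi>))"
      using dom(2) unfolding I_def by simp
    also have "\<dots> \<le> \<kappa> * (M + M)" by (intro mult_left_mono add_mono M1 M2 \<kappa>_nonneg)
    finally show ?thesis by simp
  qed
  moreover have "l2 w \<le> M"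
  proof -
    have "1 * l2 w \<le> sqrt (2 * pi) * l2 w" by (intro mult_right_mono sqrt_2pi_le) simp
    then show ?thesis using M1 by (simp add: l2n_fh)
  qed
  ultimately have "norm w \<le> 2 * \<kappa> * M + M" by (rule norm_cbl2_le)
  then show ?thesis by (simp add: M_def sobolev_norm_val algebra_simps)
qed

lemma HN_norm_interpolation:
  assumes "1 < N" "0 < e" "0 \<le> C"
  obtains \<delta> where "0 < \<delta>" "\<And>w. HN N w C \<Longrightarrow> l2 w \<le> \<delta> \<Longrightarrow> norm w < e"
proof -
  have pos: "0 < 2 * \<kappa> + 1" using \<kappa>_nonneg by simp
  obtain \<delta> where \<delta>: "0 < \<delta>" "\<And>w. HN N w C \<Longrightarrow> l2 w \<le> \<delta> \<Longrightarrow> sobolev_norm 1 (val w) < e / (2 * \<kappa> + 1)"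
    using HN_interpolation[of 1 N "e / (2 * \<kappa> + 1)" C] assms pos by auto
  have "norm w < e" if w: "HN N w C" "l2 w \<le> \<delta>" for w
  proof -
    have "norm w \<le> (2 * \<kappa> + 1) * sobolev_norm 1 (val w)"
      by (rule norm_le_sobolev_norm) (use HN_sobolev_mem[OF w(1)] assms in auto)
    also have "\<dots> < (2 * \<kappa> + 1) * (e / (2 * \<kappa> + 1))"
      by (rule mult_strict_left_mono[OF \<delta>(2)[OF w] pos])
    finally show ?thesis using pos by simp
  qed
  then show ?thesis using \<delta>(1) that by blast
qed

text \<open>The velocity is bounded only in \<open>L^2\<close>, which is weaker than the norm of
  \<open>cbl2\<close>; pairing with the increment itself reduces the claim to the scalar mean value
  inequality.\<close>

lemma l2_lipschitz:
  assumes f: "\<And>t. t \<in> {a..b} \<Longrightarrow> (f has_vector_derivative f' t) (at t within {a..b})"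
    and le: "\<And>t. t \<in> {a..b} \<Longrightarrow> l2 (f' t) \<le> \<beta>" and st: "s \<in> {a..b}" "t \<in> {a..b}"
  shows "l2 (f s - f t) \<le> \<beta> * \<bar>s - t\<bar>"
proof -
  define w where "w = f s - f t"
  have "norm (ip (f s) w - ip (f t) w) \<le> \<beta> * l2 w * norm (s - t)"
  proof (rule field_differentiable_bound[of "{a..b}"])
    show "((\<lambda>x. ip (f x) w) has_field_derivative ip (f' x) w) (at x within {a..b})" if "x \<in> {a..b}" for x
      using bounded_linear.has_vector_derivative[OF ip.bounded_linear_left f[OF that]]
      by (simp add: has_real_derivative_iff_has_vector_derivative)
    show "norm (ip (f' x) w) \<le> \<beta> * l2 w" if "x \<in> {a..b}" for x
      using abs_ip_le[of "f' x" w] mult_right_mono[OF le[OF that], of "l2 w"] by simp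
  qed (use st in auto)
  moreover have "(l2 w)\<^sup>2 = ip (f s) w - ip (f t) w"
    unfolding ip_self[symmetric] by (subst (1) w_def) (rule ip.diff_left)
  ultimately have "(l2 w)\<^sup>2 \<le> \<beta> * l2 w * \<bar>s - t\<bar>" by simp
  then have "l2 w * l2 w \<le> l2 w * (\<beta> * \<bar>s - t\<bar>)" by (simp add: power2_eq_square mult_ac)
  moreover have "0 \<le> \<beta> * \<bar>s - t\<bar>"
    using le[OF st(1)] l2n_nonneg[of "val (f' s)"] by (intro mult_nonneg_nonneg) linarith+
  ultimately show ?thesis
    unfolding w_def[symmetric] using mult_le_cancel_left_pos[of "l2 w" "l2 w" "\<beta> * \<bar>s - t\<bar>"] l2n_nonneg[of "val w"]
    by (cases "l2 w = 0") (auto simp: less_le)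
qed

lemma l2_limit_le:
  assumes "\<And>n. l2 (w n) \<le> C" "w \<longlonglongrightarrow> z"
  shows "l2 z \<le> C"
proof -
  have "l2 z \<le> C + norm (z - w n)" for n
    using l2_triangle[of "w n" "z - w n"] l2n_val_le[of "z - w n"] assms(1)[of n] by (simp del: val_simps)
  moreover have "(\<lambda>n. C + norm (z - w n)) \<longlonglongrightarrow> C + norm (z - z)"
    by (intro tendsto_intros assms(2))
  ultimately show ?thesis
    using tendsto_lowerbound[of "\<lambda>n. C + norm (z - w n)" C sequentially "l2 z"] by auto
qed

text \<open>Convergence in \<open>cbl2\<close> does not see order \<open>N\<close>, so the bound is
  first passed to the limit on each window \<open>|\<xi>| \<le> r\<close>, where the multiplier is
  bounded; Fatou then removes the window.\<close>

lemma HN_limit: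
  assumes w: "\<And>n. HN N (w n) C" and lim: "w \<longlonglongrightarrow> z"
  shows "HN N z C"
proof -
  define c where "c R \<xi> = (indicator {-R..R} \<xi> :: complex)" for R \<xi> :: real
  define f where "f r \<xi> = c (real r) \<xi> * (complex_of_real \<xi> ^ N * fh z \<xi>)" for r \<xi>
  have C: "0 \<le> C" using HN_nonneg[OF w] .
  have [measurable]: "c R \<in> borel_measurable borel" for R unfolding c_def by simp
  have f: "square_integrable (f r) \<and> l2n (f r) \<le> C" for r
  proof -
    define \<phi> where "\<phi> \<xi> = (\<i> * complex_of_real \<xi>) ^ N * c (real r) \<xi>" for \<xi>
    have "csym (c (real r))" by (rule csymI[of _ "real r" 1]) (auto simp: c_def indicator_def)
    then have \<phi>: "csym \<phi>"
      unfolding \<phi>_def by (rule csym_mult_cont) (auto intro!: continuous_intros simp flip: power_mult_distrib)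
    have fm: "f r \<in> borel_measurable borel" unfolding f_def by measurable
    have nf: "norm (\<phi> \<xi> * x) = norm (c (real r) \<xi> * (complex_of_real \<xi> ^ N * x))" for \<xi> x
      by (simp add: \<phi>_def norm_mult norm_power)
    have "l2 (mul \<phi> (w n)) \<le> C / sqrt (2 * pi)" for n
    proof -
      have "l2n (fh (mul \<phi> (w n))) \<le> 1 * l2n (\<lambda>\<xi>. complex_of_real \<xi> ^ N * fh (w n) \<xi>)"
      proof (rule l2n_mono_AE)
        show "AE \<xi> in lborel. norm (fh (mul \<phi> (w n)) \<xi>) \<le> 1 * norm (complex_of_real \<xi> ^ N * fh (w n) \<xi>)"
          using fh_mul[OF \<phi>, of "w n"]
          by eventually_elim (simp add: nf, simp add: c_def indicator_def)
      qed (use w in \<open>auto simp: HN_def\<close>)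
      also have "\<dots> \<le> C" using w by (simp add: HN_def)
      finally show ?thesis by (simp add: l2_eq_fh divide_right_mono)
    qed
    moreover have "(\<lambda>n. mul \<phi> (w n)) \<longlonglongrightarrow> mul \<phi> z"
      by (rule bounded_linear.tendsto[OF bounded_linear_mul[OF \<phi>] lim])
    ultimately have "l2 (mul \<phi> z) \<le> C / sqrt (2 * pi)" by (rule l2_limit_le)
    then have le: "l2n (fh (mul \<phi> z)) \<le> C" by (simp add: l2_eq_fh divide_le_cancel)
    have AE: "AE \<xi> in lborel. norm (f r \<xi>) \<le> 1 * norm (fh (mul \<phi> z) \<xi>)"
      using fh_mul[OF \<phi>, of z] by eventually_elim (simp add: f_def nf)
    have "l2n (f r) \<le> 1 * l2n (fh (mul \<phi> z))" by (rule l2n_mono_AE[OF _ fm AE]) auto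
    moreover have "square_integrable (f r)"
    proof (rule square_integrable_bound[OF fm square_integrable_fh[of z]])
      show "norm (f r \<xi>) \<le> (real r ^ N) * norm (fh z \<xi>)" for \<xi>
        unfolding f_def c_def by (auto simp: norm_mult norm_power indicator_def abs_le_iff intro!: mult_right_mono power_mono)
    qed
    ultimately show ?thesis using le by simp
  qed
  have lim_f: "(\<lambda>r. f r \<xi>) \<longlonglongrightarrow> complex_of_real \<xi> ^ N * fh z \<xi>" for \<xi>
  proof -
    obtain k :: nat where k: "\<bar>\<xi>\<bar> \<le> real k" using real_arch_simple by blast
    have "\<forall>\<^sub>F r in sequentially. f r \<xi> = complex_of_real \<xi> ^ N * fh z \<xi>"
      using eventually_ge_at_top[of k] by (rule eventually_mono) (use k in \<open>auto simp: f_def c_def indicator_def\<close>)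
    then show ?thesis by (rule tendsto_eventually)
  qed
  have "square_integrable (\<lambda>\<xi>. complex_of_real \<xi> ^ N * fh z \<xi>)" "l2n (\<lambda>\<xi>. complex_of_real \<xi> ^ N * fh z \<xi>) \<le> C"
    by (rule l2n_fatou[of f C]; use f lim_f C in auto)+
  moreover have "l2 z \<le> C" by (rule l2_limit_le[OF _ lim]) (use w in \<open>auto simp: HN_def\<close>)
  ultimately show ?thesis by (simp add: HN_def)
qed

lemma tendsto_pw: "(w \<longlongrightarrow> z) F \<Longrightarrow> ((\<lambda>n. pw (w n) k) \<longlongrightarrow> pw z k) F"
  by (induction k) (auto intro: tendsto_mult)

section \<open>The untruncated operator and the limit of the approximations\<close>

context symbol
begin

text \<open>The bound of \<open>l2bd_pwseq\<close> for the power with exponent \<open>k + 2\<close>,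
  the derivatives of \<open>u\<close> being bounded by \<open>2 * R\<close>.\<close>

definition pw_const :: "nat \<Rightarrow> nat \<Rightarrow> real \<Rightarrow> real" where
  "pw_const N k R = (2 ^ N * 2 * \<kappa>) ^ Suc k * (2 * R) ^ (k + 2)"

lemma size_HN:
  assumes b: "size n N u v \<le> R\<^sup>2" "0 \<le> R" "P n u = u" "P n v = v" "2 \<le> N"
  shows "HN N u (3 * R)" "HN N v (3 * R)" "HN N (pw u (Suc k)) (3 * pw_const N k R)"
proof -
  note sb = size_bounds[OF b(1,2)]
  show "HN N u (3 * R)" using dseq_HN[OF dseq_D, of n u R N] sb by (simp add: D_0[OF b(3)])
  show "HN N v (3 * R)" using dseq_HN[OF dseq_D, of n v R N] sb by (simp add: D_0[OF b(4)])
  have "l2bd N (pwseq (\<lambda>j. D n j u) (Suc k)) (pw_const N k R)"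
    using l2bd_pwseq[OF dseq_D size_l2bd(1)[OF b(1-4)], of "Suc k"] b(5) by (simp only: pw_const_def) auto
  from dseq_HN[OF dseq_pwseq[OF dseq_D, of n u "Suc k"] l2bdD[OF this] l2bdD[OF this], of N]
  show "HN N (pw u (Suc k)) (3 * pw_const N k R)"
    by (simp add: pwseq_0 D_0[OF b(3)] del: pw.simps pwseq.simps)
qed

text \<open>The operator \<open>K \<partial>\<^sub>x\<close> itself. Two derivatives of
  \<open>w\<close> in \<open>L^2\<close> put the transform into \<open>\<F>dom\<close>, so that the
  value is the intended element of the algebra.\<close>

definition AA :: "cbl2 \<Rightarrow> cbl2" where
  "AA w = inv (\<lambda>\<xi>. \<i> * complex_of_real \<xi> * m \<xi> * fh w \<xi>)"

lemma HN_low: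
  assumes "HN N w C" "j \<le> N"
  shows "square_integrable (\<lambda>\<xi>. complex_of_real \<xi> ^ j * fh w \<xi>)" "l2n (\<lambda>\<xi>. complex_of_real \<xi> ^ j * fh w \<xi>) \<le> 4 * C"
proof -
  define g where "g \<xi> = complex_of_real (norm (fh w \<xi>) + norm (complex_of_real \<xi> ^ N * fh w \<xi>))" for \<xi>
  have si: "square_integrable (\<lambda>\<xi>. complex_of_real \<xi> ^ N * fh w \<xi>)" using assms by (simp add: HN_def)
  have g: "square_integrable g"
    unfolding g_def square_integrable_of_real_iff by (intro square_integrable_add square_integrable_norm si square_integrable_fh)
  have le: "norm (complex_of_real \<xi> ^ j * fh w \<xi>) \<le> 1 * norm (g \<xi>)" for \<xi>
  proof -
    have "\<bar>\<xi>\<bar> ^ j \<le> 1 + \<bar>\<xi>\<bar> ^ N"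
    proof (cases "\<bar>\<xi>\<bar> \<le> 1")
      case True
      then have "\<bar>\<xi>\<bar> ^ j \<le> 1" by (simp add: power_le_one)
      then show ?thesis by (simp add: add_increasing2)
    next
      case False
      then have "\<bar>\<xi>\<bar> ^ j \<le> \<bar>\<xi>\<bar> ^ N" using assms(2) by (intro power_increasing) auto
      then show ?thesis by simp
    qed
    from mult_right_mono[OF this norm_ge_zero, of "fh w \<xi>"] show ?thesis
      unfolding g_def norm_of_real by (simp add: norm_mult norm_power distrib_right)
  qed
  show "square_integrable (\<lambda>\<xi>. complex_of_real \<xi> ^ j * fh w \<xi>)"
    by (rule square_integrable_bound[OF xi_fh_measurable g le])
  have "l2n (\<lambda>\<xi>. complex_of_real \<xi> ^ j * fh w \<xi>) \<le> 1 * l2n g"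
    by (rule l2n_mono[OF g xi_fh_measurable le]) simp
  also have "l2n g \<le> l2n (fh w) + l2n (\<lambda>\<xi>. complex_of_real \<xi> ^ N * fh w \<xi>)"
    unfolding g_def l2n_of_real
    using l2n_triangle[OF square_integrable_norm[OF square_integrable_fh] square_integrable_norm[OF si], of w] by (simp only: l2n_norm)
  also have "l2n (fh w) \<le> 3 * C"
    unfolding l2n_fh using assms(1) by (intro mult_mono sqrt_2pi_le) (auto simp: HN_def)
  also have "l2n (\<lambda>\<xi>. complex_of_real \<xi> ^ N * fh w \<xi>) \<le> C" using assms by (simp add: HN_def)
  finally show "l2n (\<lambda>\<xi>. complex_of_real \<xi> ^ j * fh w \<xi>) \<le> 4 * C" by simp
qed

lemma norm_symbol: "norm (\<i> * complex_of_real \<xi> * complex_of_real (m \<xi>) * z) = m \<xi> * (\<bar>\<xi>\<bar> * norm z)"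
  using m_nonneg[of \<xi>] by (simp add: norm_mult)

lemma symbol_le: "0 \<le> a \<Longrightarrow> m \<xi> * a \<le> B * a"
  by (rule mult_right_mono[OF m_le])

lemma hermitian_AA: "hermitian (\<lambda>\<xi>. \<i> * complex_of_real \<xi> * m \<xi> * fh w \<xi>)"
  by (rule hermitian_mult) (auto simp: m_even hermitian_fh)

lemma \<F>dom_AA:
  assumes "square_integrable (\<lambda>\<xi>. complex_of_real \<xi> * fh w \<xi>)" "square_integrable (\<lambda>\<xi>. complex_of_real \<xi> ^ 2 * fh w \<xi>)"
  shows "\<F>dom (\<lambda>\<xi>. \<i> * complex_of_real \<xi> * m \<xi> * fh w \<xi>)"
proof (rule \<F>domI)
  show "square_integrable (\<lambda>\<xi>. \<i> * complex_of_real \<xi> * m \<xi> * fh w \<xi>)"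
  proof (rule square_integrable_bound[OF _ assms(1), of _ B])
    show "norm (\<i> * complex_of_real \<xi> * m \<xi> * fh w \<xi>) \<le> B * norm (complex_of_real \<xi> * fh w \<xi>)" for \<xi>
    proof -
      have "m \<xi> * (\<bar>\<xi>\<bar> * norm (fh w \<xi>)) \<le> B * (\<bar>\<xi>\<bar> * norm (fh w \<xi>))" by (rule symbol_le) simp
      then show ?thesis unfolding norm_symbol by (simp only: norm_mult norm_of_real)
    qed
  qed measurable
  show "square_integrable (\<lambda>\<xi>. complex_of_real \<xi> * (\<i> * complex_of_real \<xi> * m \<xi> * fh w \<xi>))"
  proof (rule square_integrable_bound[OF _ assms(2), of _ B])
    show "norm (complex_of_real \<xi> * (\<i> * complex_of_real \<xi> * m \<xi> * fh w \<xi>)) \<le> B * norm (complex_of_real \<xi> ^ 2 * fh w \<xi>)" for \<xi>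
    proof -
      have "norm (complex_of_real \<xi> * (\<i> * complex_of_real \<xi> * m \<xi> * fh w \<xi>)) = m \<xi> * (\<bar>\<xi>\<bar> * (\<bar>\<xi>\<bar> * norm (fh w \<xi>)))"
        unfolding norm_mult[of "complex_of_real \<xi>"] norm_symbol norm_of_real by (rule mult.left_commute)
      also have "\<dots> \<le> B * (\<bar>\<xi>\<bar> * (\<bar>\<xi>\<bar> * norm (fh w \<xi>)))" by (rule symbol_le) simp
      also have "\<bar>\<xi>\<bar> * (\<bar>\<xi>\<bar> * norm (fh w \<xi>)) = norm (complex_of_real \<xi> ^ 2 * fh w \<xi>)"
        by (simp add: norm_mult power2_eq_square)
      finally show ?thesis .
    qed
  qed measurable
qed (rule hermitian_AA)

lemma fh_AA:
  assumes "HN N w C" "2 \<le> N"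
  shows "AE \<xi> in lborel. fh (AA w) \<xi> = \<i> * complex_of_real \<xi> * m \<xi> * fh w \<xi>"
  unfolding AA_def by (rule fh_inv[OF \<F>dom_AA]) (use HN_low[OF assms(1), of 1] HN_low[OF assms(1), of 2] assms in auto)

text \<open>One estimate for \<open>A n\<close> and \<open>AA\<close> at once: the constant is free
  of \<open>n\<close>, at the price of one derivative.\<close>

lemma HN_deriv_dominated:
  assumes w: "HN N w C" "2 \<le> N" and z: "AE \<xi> in lborel. norm (fh z \<xi>) \<le> B * (\<bar>\<xi>\<bar> * norm (fh w \<xi>))"
  shows "HN (N - 1) z (4 * B * C)"
proof -
  obtain M where M: "N = Suc M" using w(2) by (cases N) auto
  have "l2n (fh z) \<le> B * l2n (\<lambda>\<xi>. complex_of_real \<xi> ^ 1 * fh w \<xi>)"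
    by (rule l2n_mono_AE[OF HN_low(1)[OF w(1)]]) (use z w B_nonneg in \<open>auto simp: norm_mult\<close>)
  also have "\<dots> \<le> B * (4 * C)" by (intro mult_left_mono HN_low[OF w(1)] B_nonneg) (use w in simp)
  finally have 1: "l2n (fh z) \<le> 4 * B * C" by simp
  have "1 * l2 z \<le> sqrt (2 * pi) * l2 z" by (intro mult_right_mono sqrt_2pi_le) simp
  then have l2z: "l2 z \<le> 4 * B * C" using 1 by (simp add: l2n_fh)
  have si: "square_integrable (\<lambda>\<xi>. complex_of_real \<xi> ^ N * fh w \<xi>)" using w by (simp add: HN_def)
  have AE: "AE \<xi> in lborel. norm (complex_of_real \<xi> ^ M * fh z \<xi>) \<le> B * norm (complex_of_real \<xi> ^ N * fh w \<xi>)"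
    using z
  proof eventually_elim
    case (elim \<xi>)
    from mult_left_mono[OF elim, of "\<bar>\<xi>\<bar> ^ M"] show ?case
      by (simp add: M norm_mult norm_power mult_ac)
  qed
  have m: "(\<lambda>\<xi>. complex_of_real \<xi> ^ M * fh z \<xi>) \<in> borel_measurable borel" by measurable
  have 2: "l2n (\<lambda>\<xi>. complex_of_real \<xi> ^ M * fh z \<xi>) \<le> B * l2n (\<lambda>\<xi>. complex_of_real \<xi> ^ N * fh w \<xi>)"
    by (rule l2n_mono_AE[OF si m AE B_nonneg])
  also have "\<dots> \<le> B * C" using w B_nonneg by (intro mult_left_mono) (auto simp: HN_def)
  also have "\<dots> \<le> 4 * B * C" using B_nonneg HN_nonneg[OF w(1)] by simp
  finally have 3: "l2n (\<lambda>\<xi>. complex_of_real \<xi> ^ M * fh z \<xi>) \<le> 4 * B * C" .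
  \<comment> \<open>A version for which the bound holds everywhere and not only almost
    everywhere.\<close>
  define g where "g \<xi> = (if norm (complex_of_real \<xi> ^ M * fh z \<xi>) \<le> B * norm (complex_of_real \<xi> ^ N * fh w \<xi>) then complex_of_real \<xi> ^ M * fh z \<xi> else 0)" for \<xi>
  have gm: "g \<in> borel_measurable borel" unfolding g_def by measurable
  have g: "square_integrable g"
    by (rule square_integrable_bound[OF gm si, of B]) (simp add: g_def B_nonneg)
  have g_AE: "AE \<xi> in lborel. g \<xi> = complex_of_real \<xi> ^ M * fh z \<xi>" using AE by eventually_elim (simp add: g_def)
  have "square_integrable (\<lambda>\<xi>. complex_of_real \<xi> ^ M * fh z \<xi>)"
    by (rule square_integrable_cong_AE[OF g_AE g m])
  then show ?thesis using l2z 3 by (simp add: HN_def M)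
qed

lemma HN_AA: "HN N w C \<Longrightarrow> 2 \<le> N \<Longrightarrow> HN (N - 1) (AA w) (4 * B * C)"
proof (rule HN_deriv_dominated)
  assume w: "HN N w C" "2 \<le> N"
  show "AE \<xi> in lborel. norm (fh (AA w) \<xi>) \<le> B * (\<bar>\<xi>\<bar> * norm (fh w \<xi>))"
    using fh_AA[OF w]
  proof eventually_elim
    case (elim \<xi>)
    show ?case unfolding elim norm_symbol by (rule symbol_le) simp
  qed
qed

lemma HN_A: "HN N w C \<Longrightarrow> 2 \<le> N \<Longrightarrow> HN (N - 1) (A n w) (4 * B * C)"
proof (rule HN_deriv_dominated)
  show "AE \<xi> in lborel. norm (fh (A n w) \<xi>) \<le> B * (\<bar>\<xi>\<bar> * norm (fh w \<xi>))"
    using fh_A[of n w]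
  proof eventually_elim
    case (elim \<xi>)
    have "ct n \<xi> = 0 \<or> ct n \<xi> = 1" by (simp add: ct_def indicator_def)
    then have "norm (\<i> * complex_of_real \<xi> * (m \<xi> * ct n \<xi>) * fh w \<xi>) \<le> norm (\<i> * complex_of_real \<xi> * m \<xi> * fh w \<xi>)"
      by (elim disjE) simp_all
    also have "\<dots> \<le> B * (\<bar>\<xi>\<bar> * norm (fh w \<xi>))" unfolding norm_symbol by (rule symbol_le) simp
    finally show ?case unfolding elim .
  qed
qed

lemma tail_weight:
  fixes \<xi> n :: real
  assumes "n < \<bar>\<xi>\<bar>" "1 \<le> n" "2 \<le> N"
  shows "\<bar>\<xi>\<bar> \<le> \<bar>\<xi>\<bar> ^ N / n" "1 \<le> \<bar>\<xi>\<bar> ^ N / n"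
proof -
  have "\<bar>\<xi>\<bar> * n \<le> \<bar>\<xi>\<bar> * \<bar>\<xi>\<bar>" using assms by (intro mult_left_mono) auto
  also have "\<dots> = \<bar>\<xi>\<bar> ^ 2" by (simp add: power2_eq_square)
  also have "\<dots> \<le> \<bar>\<xi>\<bar> ^ N" using assms by (intro power_increasing) auto
  finally have "\<bar>\<xi>\<bar> * n \<le> \<bar>\<xi>\<bar> ^ N" .
  then show 1: "\<bar>\<xi>\<bar> \<le> \<bar>\<xi>\<bar> ^ N / n" using assms by (simp add: field_simps)
  then show "1 \<le> \<bar>\<xi>\<bar> ^ N / n" using assms by linarith
qed

text \<open>Beyond frequency \<open>n\<close> one has
  \<open>|\<xi>| + 1 \<le> 2 |\<xi>|^N / n\<close>, so a bound in \<open>H^N\<close> with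
  \<open>2 \<le> N\<close> makes cutoff errors of order \<open>1 / n\<close>.\<close>

lemma l2_tail_le:
  assumes w: "HN N w C" "2 \<le> N" and n: "1 \<le> n" and b: "0 \<le> b"
    and z: "AE \<xi> in lborel. norm (fh z \<xi>) \<le> (if n < \<bar>\<xi>\<bar> then b * ((\<bar>\<xi>\<bar> + 1) * norm (fh w \<xi>)) else 0)"
  shows "l2 z \<le> 2 * b * C / n"
proof -
  have "l2n (fh z) \<le> (2 * b / n) * l2n (\<lambda>\<xi>. complex_of_real \<xi> ^ N * fh w \<xi>)"
  proof (rule l2n_mono_AE)
    show "AE \<xi> in lborel. norm (fh z \<xi>) \<le> 2 * b / n * norm (complex_of_real \<xi> ^ N * fh w \<xi>)"
      using z
    proof eventually_elim
      case (elim \<xi>)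
      show ?case
      proof (cases "n < \<bar>\<xi>\<bar>")
        case True
        then have "\<bar>\<xi>\<bar> + 1 \<le> 2 * (\<bar>\<xi>\<bar> ^ N / n)" using tail_weight[OF True n w(2)] by linarith
        from mult_left_mono[OF mult_right_mono[OF this norm_ge_zero[of "fh w \<xi>"]] b]
        show ?thesis using elim True by (simp add: norm_mult norm_power mult_ac)
      next
        case False
        then show ?thesis using elim b n by (auto intro: order_trans)
      qed
    qed
  qed (use w n b in \<open>auto simp: HN_def\<close>)
  also have "\<dots> \<le> (2 * b / n) * C" using w n b by (intro mult_left_mono) (auto simp: HN_def)
  finally have "l2n (fh z) \<le> 2 * b * C / n" by simp
  moreover have "1 * l2 z \<le> sqrt (2 * pi) * l2 z" by (intro mult_right_mono sqrt_2pi_le) simp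
  ultimately show ?thesis by (simp add: l2n_fh)
qed

lemma tail_cases:
  assumes "n \<le> n'"
  shows "\<not> n < \<bar>\<xi>\<bar> \<Longrightarrow> ct n' \<xi> = 1 \<and> ct n \<xi> = 1" "ct n \<xi> = 0 \<or> ct n \<xi> = 1" "n < \<bar>\<xi>\<bar> \<Longrightarrow> ct n \<xi> = 0"
  using assms by (auto simp: ct_def indicator_def)

lemma l2_A_diff_le:
  assumes w: "HN N w C" "2 \<le> N" and n: "1 \<le> n" "n \<le> n'"
  shows "l2 (A n' w - A n w) \<le> 2 * B * C / n"
proof (rule l2_tail_le[OF w n(1) B_nonneg])
  show "AE \<xi> in lborel. norm (fh (A n' w - A n w) \<xi>) \<le> (if n < \<bar>\<xi>\<bar> then B * ((\<bar>\<xi>\<bar> + 1) * norm (fh w \<xi>)) else 0)"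
    using fh_diff[of "A n' w" "A n w"] fh_A[of n w] fh_A[of n' w]
  proof eventually_elim
    case (elim \<xi>)
    have le: "m \<xi> * (\<bar>\<xi>\<bar> * norm (fh w \<xi>)) \<le> B * ((\<bar>\<xi>\<bar> + 1) * norm (fh w \<xi>))"
      by (intro mult_mono m_le mult_right_mono B_nonneg) auto
    have nn: "0 \<le> B * ((\<bar>\<xi>\<bar> + 1) * norm (fh w \<xi>))" using B_nonneg by simp
    show ?case
    proof (cases "n < \<bar>\<xi>\<bar>")
      case True
      then have "norm (fh (A n' w - A n w) \<xi>) = norm (\<i> * complex_of_real \<xi> * (m \<xi> * ct n' \<xi>) * fh w \<xi>)"
        unfolding elim by (simp add: tail_cases(3)[OF order_refl])
      also have "\<dots> \<le> norm (\<i> * complex_of_real \<xi> * m \<xi> * fh w \<xi>)"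
        using tail_cases(2)[OF order_refl, of n' \<xi>] by (elim disjE) simp_all
      finally show ?thesis using le True unfolding norm_symbol by simp
    next
      case False
      then show ?thesis unfolding elim using tail_cases(1)[OF n(2) False] by simp
    qed
  qed
qed

lemma l2_AA_diff_le:
  assumes w: "HN N w C" "2 \<le> N" and n: "1 \<le> n"
  shows "l2 (A n w - AA w) \<le> 2 * B * C / n"
proof (rule l2_tail_le[OF w n(1) B_nonneg])
  show "AE \<xi> in lborel. norm (fh (A n w - AA w) \<xi>) \<le> (if n < \<bar>\<xi>\<bar> then B * ((\<bar>\<xi>\<bar> + 1) * norm (fh w \<xi>)) else 0)"
    using fh_diff[of "A n w" "AA w"] fh_A[of n w] fh_AA[OF w]
  proof eventually_elim
    case (elim \<xi>)
    have le: "m \<xi> * (\<bar>\<xi>\<bar> * norm (fh w \<xi>)) \<le> B * ((\<bar>\<xi>\<bar> + 1) * norm (fh w \<xi>))"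
      by (intro mult_mono m_le mult_right_mono B_nonneg) auto
    show ?case
    proof (cases "n < \<bar>\<xi>\<bar>")
      case True
      then have "norm (fh (A n w - AA w) \<xi>) = norm (\<i> * complex_of_real \<xi> * m \<xi> * fh w \<xi>)"
        unfolding elim by (simp add: tail_cases(3)[OF order_refl])
      then show ?thesis using le True unfolding norm_symbol by simp
    next
      case False
      then show ?thesis unfolding elim using tail_cases(1)[OF order_refl False] by simp
    qed
  qed
qed

lemma l2_P_diff_le:
  assumes w: "HN N w C" "2 \<le> N" and n: "1 \<le> n" "n \<le> n'"
  shows "l2 (P n' w - P n w) \<le> 2 * C / n"
proof -
  have "l2 (P n' w - P n w) \<le> 2 * 1 * C / n"
  proof (rule l2_tail_le[OF w n(1)])
    show "AE \<xi> in lborel. norm (fh (P n' w - P n w) \<xi>) \<le> (if n < \<bar>\<xi>\<bar> then 1 * ((\<bar>\<xi>\<bar> + 1) * norm (fh w \<xi>)) else 0)"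
      using fh_diff[of "P n' w" "P n w"] fh_P[of n w] fh_P[of n' w]
    proof eventually_elim
      case (elim \<xi>)
      have "1 * norm (fh w \<xi>) \<le> (\<bar>\<xi>\<bar> + 1) * norm (fh w \<xi>)" by (intro mult_right_mono) auto
      moreover have "0 \<le> (\<bar>\<xi>\<bar> + 1) * norm (fh w \<xi>)" by simp
      ultimately show ?case
        unfolding elim using tail_cases[OF n(2), of \<xi>] tail_cases(2)[OF order_refl, of n' \<xi>] by auto
    qed
  qed simp
  then show ?thesis by simp
qed

lemma A_mono:
  assumes "P n w = w" "n \<le> n'"
  shows "A n' w = A n w"
proof (rule fh_inj)
  show "AE \<xi> in lborel. fh (A n' w) \<xi> = fh (A n w) \<xi>"
    using fh_A[of n w] fh_A[of n' w] fh_P[of n w]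
  proof eventually_elim
    case (elim \<xi>)
    have e: "fh w \<xi> = ct n \<xi> * fh w \<xi>" using elim(3) assms(1) by simp
    have "ct n' \<xi> * ct n \<xi> = ct n \<xi>" using assms(2) by (auto simp: ct_def indicator_def)
    then have "ct n' \<xi> * (ct n \<xi> * fh w \<xi>) = ct n \<xi> * (ct n \<xi> * fh w \<xi>)" by (simp add: mult.assoc[symmetric])
    then have "ct n' \<xi> * fh w \<xi> = ct n \<xi> * fh w \<xi>" unfolding e[symmetric] .
    then show ?case unfolding elim(1,2) by (simp add: mult.assoc)
  qed
qed

lemma size_sup:
  assumes "size n N u v \<le> R\<^sup>2" "0 \<le> R" "P n u = u" "P n v = v" "0 < N"
  shows "\<bar>val u x\<bar> \<le> sup_const R"
  using l2bd_sup[OF dseq_D size_l2bd(1)[OF assms(1-4)] assms(5), of x] by (simp add: D_0[OF assms(3)] sup_const_def)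

lemma solves_subset:
  assumes "solves n k c S u v" "S' \<subseteq> S"
  shows "solves n k c S' u v"
  unfolding solves_def
proof (intro ballI conjI)
  fix t assume "t \<in> S'"
  then have t: "t \<in> S" using assms(2) by auto
  show "P n (u t) = u t" "P n (v t) = v t" using assms(1) t by (auto simp: solves_def)
  show "(u has_vector_derivative A n (v t)) (at t within S')"
    "(v has_vector_derivative A n (u t + c *\<^sub>R pw (u t) (Suc k))) (at t within S')"
    using assms(1) t unfolding solves_def by (blast intro: has_vector_derivative_within_subset[OF _ assms(2)])+
qed

definition rate_const :: "nat \<Rightarrow> real \<Rightarrow> real" where
  "rate_const k R = (real (k + 2))\<^sup>2 * (sup_const R ^ k * (4 * \<kappa> * B * R))"

text \<open>The solution with the smaller cutoff \<open>n\<close> is band-limited, so its linear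
  terms do not notice the change to \<open>n'\<close>, by \<open>A_mono\<close>. The only remainder
  is the cutoff error of its nonlinear term, of order \<open>1 / n\<close>. The divided difference
  plays the role of \<open>q\<close>.\<close>

lemma truncated_difference:
  assumes N: "2 \<le> N" and R: "0 \<le> R" and c: "0 < c" and small: "c * (real (k + 2) * sup_const R ^ (k + 1)) \<le> 1 / 2"
    and \<tau>: "0 \<le> \<tau>" and n: "1 \<le> n" "n \<le> n'"
    and sol: "solves n k c {0..\<tau>} u v" "\<And>t. t \<in> {0..\<tau>} \<Longrightarrow> size n N (u t) (v t) \<le> R\<^sup>2"
    and sol': "solves n' k c {0..\<tau>} u' v'" "\<And>t. t \<in> {0..\<tau>} \<Longrightarrow> size n' N (u' t) (v' t) \<le> R\<^sup>2"
  shows "(l2 (u' \<tau> - u \<tau>))\<^sup>2 + (l2 (v' \<tau> - v \<tau>))\<^sup>2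
    \<le> (3 * ((l2 (u' 0 - u 0))\<^sup>2 + (l2 (v' 0 - v 0))\<^sup>2) + 2 * (c * (2 * B * (3 * pw_const N k R) / n))\<^sup>2 * \<tau>)
      * exp (2 * (c * rate_const k R + 1) * \<tau>)"
proof (rule energy_gronwall[OF \<tau>])
  let ?r = "\<lambda>t. c *\<^sub>R (A n' (pw (u t) (Suc k)) - A n (pw (u t) (Suc k)))"
  note s = sol(1)[unfolded solves_def, rule_format] and s' = sol'(1)[unfolded solves_def, rule_format]
  note lin = linear_add[OF bounded_linear.linear[OF bounded_linear_A]] linear_diff[OF bounded_linear.linear[OF bounded_linear_A]]
    linear_scale[OF bounded_linear.linear[OF bounded_linear_A]]
  show "0 \<le> c" using c by simp
  fix t assume t: "t \<in> {0..\<tau>}"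
  show "((\<lambda>t. u' t - u t) has_vector_derivative A n' (v' t) - A n (v t)) (at t within {0..\<tau>})"
    by (intro has_vector_derivative_diff) (use s[OF t] s'[OF t] in auto)
  show "((\<lambda>t. v' t - v t) has_vector_derivative A n' (u' t + c *\<^sub>R pw (u' t) (Suc k)) - A n (u t + c *\<^sub>R pw (u t) (Suc k))) (at t within {0..\<tau>})"
    by (intro has_vector_derivative_diff) (use s[OF t] s'[OF t] in auto)
  show "((\<lambda>t. pdq (u' t) (u t) k) has_vector_derivative pdqd (u' t) (A n' (v' t)) (u t) (A n (v t)) k) (at t within {0..\<tau>})"
    by (rule pdq_has_vector_derivative) (use s[OF t] s'[OF t] in auto)
  have Av: "A n (v t) = A n' (v t)" "A n (u t) = A n' (u t)" using A_mono[of n "v t" n'] A_mono[of n "u t" n'] s[OF t] n(2) by auto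
  have e1: "A n' (v' t) - A n (v t) = A n' (v' t - v t)" by (simp add: Av lin)
  have e2: "A n' (u' t + c *\<^sub>R pw (u' t) (Suc k)) - A n (u t + c *\<^sub>R pw (u t) (Suc k)) - ?r t
      = A n' ((u' t - u t) + c *\<^sub>R (pdq (u' t) (u t) k * (u' t - u t)))"
    unfolding pdq_mult by (simp add: Av lin algebra_simps del: pw.simps)
  show "ip (u' t - u t + c *\<^sub>R (pdq (u' t) (u t) k * (u' t - u t))) (A n' (v' t) - A n (v t)) +
      ip (v' t - v t) (A n' (u' t + c *\<^sub>R pw (u' t) (Suc k)) - A n (u t + c *\<^sub>R pw (u t) (Suc k)) - ?r t) = 0"
    unfolding e1 e2 by (simp add: A_skew[of n' _ "v' t - v t"] ip_commute[of "v' t - v t"])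
  have b: "size n N (u t) (v t) \<le> R\<^sup>2" "size n' N (u' t) (v' t) \<le> R\<^sup>2" using sol(2) sol'(2) t by auto
  have p: "P n (u t) = u t" "P n (v t) = v t" "P n' (u' t) = u' t" "P n' (v' t) = v' t" using s[OF t] s'[OF t] by auto
  have "l2 (A n' (pw (u t) (Suc k)) - A n (pw (u t) (Suc k))) \<le> 2 * B * (3 * pw_const N k R) / n"
    by (rule l2_A_diff_le[OF size_HN(3)[OF b(1) R p(1,2) N] N n])
  then show "l2 (?r t) \<le> c * (2 * B * (3 * pw_const N k R) / n)"
    using mult_left_mono[OF _ less_imp_le[OF c]] c unfolding l2_scaleR by (simp only: abs_of_pos)
  have N0: "0 < N" using N by simp
  fix x
  note su = size_sup[OF b(1) R p(1,2) N0, of x] size_sup[OF b(2) R p(3,4) N0, of x]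
  have "c * \<bar>val (pdq (u' t) (u t) k) x\<bar> \<le> c * (real (k + 2) * sup_const R ^ (k + 1))"
    using c by (intro mult_left_mono abs_val_pdq_le su) auto
  then show "c * \<bar>val (pdq (u' t) (u t) k) x\<bar> \<le> 1 / 2" using small by linarith
  show "\<bar>val (pdqd (u' t) (A n' (v' t)) (u t) (A n (v t)) k) x\<bar> \<le> rate_const k R"
    unfolding rate_const_def
    by (rule abs_val_pdqd_le[OF su(2,1) abs_val_A_le[OF b(2) R p(3,4) N] abs_val_A_le[OF b(1) R p(1,2) N]])
qed

lemma size_P_le:
  assumes "HN N u0 M" "HN N v0 M"
  shows "size n N (P n u0) (P n v0) \<le> 4 * M\<^sup>2"
proof -
  have M: "0 \<le> M" by (rule HN_nonneg[OF assms(1)])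
  have 1: "l2 (P n w) \<le> M" if "HN N w M" for w
  proof -
    have "l2 (P n w) \<le> 1 * l2 w"
      unfolding P_def by (rule l2_mul_le[OF csym_ct]) (simp add: ct_def indicator_def)
    then show ?thesis using that by (simp add: HN_def)
  qed
  have 2: "l2 (D n N (P n w)) \<le> M" if w: "HN N w M" for w
  proof -
    have "l2n (fh (D n N (P n w))) \<le> 1 * l2n (\<lambda>\<xi>. complex_of_real \<xi> ^ N * fh w \<xi>)"
    proof (rule l2n_mono_AE)
      show "AE \<xi> in lborel. norm (fh (D n N (P n w)) \<xi>) \<le> 1 * norm (complex_of_real \<xi> ^ N * fh w \<xi>)"
        using fh_D[of n N "P n w"] fh_P[of n w]
      proof eventually_elim
        case (elim \<xi>)
        show ?case unfolding elim by (cases "\<xi> \<in> {-n..n}") (simp_all add: ct_def norm_mult norm_power)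
      qed
    qed (use w in \<open>auto simp: HN_def\<close>)
    moreover have "1 * l2 (D n N (P n w)) \<le> sqrt (2 * pi) * l2 (D n N (P n w))"
      by (intro mult_right_mono sqrt_2pi_le) simp
    ultimately show ?thesis using w by (simp add: HN_def l2n_fh)
  qed
  have "(l2 (P n u0))\<^sup>2 \<le> M\<^sup>2" "(l2 (P n v0))\<^sup>2 \<le> M\<^sup>2" "(l2 (D n N (P n u0)))\<^sup>2 \<le> M\<^sup>2" "(l2 (D n N (P n v0)))\<^sup>2 \<le> M\<^sup>2"
    by (intro power_mono 1 2 assms; simp)+
  then show ?thesis unfolding size_def by linarith
qed

lemma P_tendsto:
  assumes "HN N w C" "2 \<le> N"
  shows "(\<lambda>n. P (real (Suc n)) w) \<longlonglongrightarrow> w"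
proof (rule metric_LIMSEQ_I)
  fix e :: real assume e: "0 < e"
  have hn: "HN N (P n w) C" for n
  proof -
    have "l2 (P n w) \<le> 1 * l2 w"
      unfolding P_def by (rule l2_mul_le[OF csym_ct]) (simp add: ct_def indicator_def)
    moreover have AE: "AE \<xi> in lborel. ct n \<xi> * (complex_of_real \<xi> ^ N * fh w \<xi>) = complex_of_real \<xi> ^ N * fh (P n w) \<xi>"
      using fh_P[of n w] by eventually_elim (simp add: mult_ac)
    have si: "square_integrable (\<lambda>\<xi>. complex_of_real \<xi> ^ N * fh w \<xi>)" using assms by (simp add: HN_def)
    have si': "square_integrable (\<lambda>\<xi>. ct n \<xi> * (complex_of_real \<xi> ^ N * fh w \<xi>))"
      by (rule square_integrable_bounded_mult[OF csym_measurable[OF csym_ct] _ si, of _ 1]) (simp add: ct_def indicator_def)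
    have "l2n (\<lambda>\<xi>. complex_of_real \<xi> ^ N * fh (P n w) \<xi>) \<le> 1 * l2n (\<lambda>\<xi>. complex_of_real \<xi> ^ N * fh w \<xi>)"
    proof (rule l2n_mono_AE[OF si])
      show "AE \<xi> in lborel. norm (complex_of_real \<xi> ^ N * fh (P n w) \<xi>) \<le> 1 * norm (complex_of_real \<xi> ^ N * fh w \<xi>)"
        using fh_P[of n w]
      proof eventually_elim
        case (elim \<xi>)
        show ?case unfolding elim by (cases "\<xi> \<in> {-n..n}") (simp_all add: ct_def)
      qed
    qed auto
    ultimately show ?thesis
      using assms square_integrable_cong_AE[OF AE si' xi_fh_measurable] by (simp add: HN_def)
  qed
  obtain \<delta> where \<delta>: "0 < \<delta>" "\<And>z. HN N z (C + C) \<Longrightarrow> l2 z \<le> \<delta> \<Longrightarrow> norm z < e"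
    using HN_norm_interpolation[of N e "C + C"] assms(2) e HN_nonneg[OF assms(1)] by auto
  obtain M :: nat where M: "2 * C / \<delta> < real M" using reals_Archimedean2 by blast
  have "dist (P (real (Suc n)) w) w < e" if n: "n \<ge> M" for n
  proof -
    have "l2 (P (real (Suc n)) w - w) \<le> 2 * 1 * C / real (Suc n)"
    proof (rule l2_tail_le[OF assms])
      show "AE \<xi> in lborel. norm (fh (P (real (Suc n)) w - w) \<xi>) \<le> (if real (Suc n) < \<bar>\<xi>\<bar> then 1 * ((\<bar>\<xi>\<bar> + 1) * norm (fh w \<xi>)) else 0)"
        using fh_diff[of "P (real (Suc n)) w" w] fh_P[of "real (Suc n)" w]
      proof eventually_elim
        case (elim \<xi>)
        have "1 * norm (fh w \<xi>) \<le> (\<bar>\<xi>\<bar> + 1) * norm (fh w \<xi>)" by (intro mult_right_mono) auto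
        then show ?case
          unfolding elim using tail_cases(1,3)[OF order_refl, of "real (Suc n)" \<xi>] by auto
      qed
    qed auto
    also have "\<dots> \<le> \<delta>"
    proof -
      have "2 * C / \<delta> \<le> real (Suc n)" using M n by simp
      then show ?thesis using \<delta>(1) by (simp add: field_simps)
    qed
    finally show ?thesis unfolding dist_norm by (intro \<delta>(2) HN_diff hn assms)
  qed
  then show "\<exists>M. \<forall>n\<ge>M. dist (P (real (Suc n)) w) w < e" by blast
qed

text \<open>\<open>A n\<close> loses one derivative with a constant free of \<open>n\<close>, so the
  velocity is bounded in order \<open>N - 1\<close>. The factor 12 is 4 from \<open>HN_A\<close>
  times 3 from \<open>dseq_HN\<close>.\<close>

lemma solves_lipschitz:
  assumes N: "2 \<le> N" and w: "\<And>t. t \<in> {0..T} \<Longrightarrow> (w has_vector_derivative A n (g t)) (at t within {0..T})"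
    "\<And>t. t \<in> {0..T} \<Longrightarrow> HN N (g t) C" "\<And>t. t \<in> {0..T} \<Longrightarrow> P n (w t) = w t" and st: "s \<in> {0..T}" "t \<in> {0..T}"
  shows "HN (N - 1) (w s - w t) (12 * B * C * \<bar>s - t\<bar>)"
proof -
  define W where "W j = D n j (w s - w t)" for j
  have W: "dseq W" unfolding W_def[abs_def] by (rule dseq_D)
  have Pst: "P n (w s - w t) = w s - w t"
    by (simp add: linear_diff[OF bounded_linear.linear[OF bounded_linear_P]] w(3)[OF st(1)] w(3)[OF st(2)])
  have W0: "W 0 = w s - w t" by (simp add: W_def D_0[OF Pst])
  have "l2 (w s - w t) \<le> 4 * B * C * \<bar>s - t\<bar>"
    by (rule l2_lipschitz[OF w(1) _ st]) (use HN_A[OF w(2) N, of _ n] in \<open>auto simp: HN_def\<close>)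
  then have W0_le: "l2 (W 0) \<le> 4 * B * C * \<bar>s - t\<bar>" unfolding W0 .
  have "l2 (D n (N - 1) (w s) - D n (N - 1) (w t)) \<le> 4 * B * C * \<bar>s - t\<bar>"
  proof (rule l2_lipschitz[OF _ _ st])
    fix t assume t: "t \<in> {0..T}"
    show "((\<lambda>t. D n (N - 1) (w t)) has_vector_derivative D n (N - 1) (A n (g t))) (at t within {0..T})"
      by (rule bounded_linear.has_vector_derivative[OF bounded_linear_D w(1)[OF t]])
    have hn: "HN (N - 1) (A n (g t)) (4 * B * C)" by (rule HN_A[OF w(2)[OF t] N])
    have "l2n (fh (D n (N - 1) (A n (g t)))) \<le> 1 * l2n (\<lambda>\<xi>. complex_of_real \<xi> ^ (N - 1) * fh (A n (g t)) \<xi>)"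
    proof (rule l2n_mono_AE)
      show "AE \<xi> in lborel. norm (fh (D n (N - 1) (A n (g t))) \<xi>) \<le> 1 * norm (complex_of_real \<xi> ^ (N - 1) * fh (A n (g t)) \<xi>)"
        using fh_D[of n "N - 1" "A n (g t)"]
      proof eventually_elim
        case (elim \<xi>)
        show ?case unfolding elim by (cases "\<xi> \<in> {-n..n}") (simp_all add: ct_def norm_mult norm_power)
      qed
    qed (use hn in \<open>auto simp: HN_def\<close>)
    moreover have "1 * l2 (D n (N - 1) (A n (g t))) \<le> sqrt (2 * pi) * l2 (D n (N - 1) (A n (g t)))"
      by (intro mult_right_mono sqrt_2pi_le) simp
    ultimately show "l2 (D n (N - 1) (A n (g t))) \<le> 4 * B * C" using hn by (simp add: HN_def l2n_fh)
  qed
  then have "l2 (W (N - 1)) \<le> 4 * B * C * \<bar>s - t\<bar>"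
    unfolding W_def linear_diff[OF bounded_linear.linear[OF bounded_linear_D]] .
  from dseq_HN[OF W W0_le this] show ?thesis by (simp add: W0 mult.assoc)
qed

text \<open>The error splits into \<open>A\<close> applied to a small difference and a cutoff tail.
  Both are small in \<open>L^2\<close>, and a bound of order \<open>N - 1\<close> upgrades this to
  the norm of the algebra; interpolation there needs \<open>1 < N - 1\<close>, whence
  \<open>3 \<le> N\<close>. Uniformity in \<open>t\<close> is what allows the limit to be
  differentiated.\<close>

lemma AA_limit:
  assumes N: "3 \<le> N" and h: "\<And>n t. t \<in> S \<Longrightarrow> HN N (h n t) C" "\<And>t. t \<in> S \<Longrightarrow> HN N (g t) C"
    and lim: "\<And>e. 0 < e \<Longrightarrow> \<forall>\<^sub>F n in sequentially. \<forall>t\<in>S. l2 (h n t - g t) \<le> e" and e: "0 < e" and C: "0 \<le> C"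
  shows "\<forall>\<^sub>F n in sequentially. \<forall>t\<in>S. norm (A (real (Suc n)) (h n t) - AA (g t)) < e"
proof -
  have N2: "2 \<le> N" using N by simp
  define C' where "C' = 4 * B * C + 4 * B * C"
  have C': "0 \<le> C'" using C B_nonneg by (simp add: C'_def)
  obtain \<delta> where \<delta>: "0 < \<delta>" "\<And>z. HN (N - 1) z C' \<Longrightarrow> l2 z \<le> \<delta> \<Longrightarrow> norm z < e"
  proof -
    have "1 < N - 1" using N by simp
    from HN_norm_interpolation[OF this e C'] show ?thesis using that by blast
  qed
  define d1 where "d1 = \<delta> / (4 * (B + 1))"
  have d1: "0 < d1" using \<delta>(1) B_nonneg by (simp add: d1_def)
  \<comment> \<open>The truncated operators are bounded uniformly in \<open>n\<close> from
    \<open>H^1\<close> to \<open>L^2\<close>, so the difference is first made small in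
    \<open>H^1\<close>.\<close>
  obtain \<delta>' where \<delta>': "0 < \<delta>'" "\<And>z. HN N z (C + C) \<Longrightarrow> l2 z \<le> \<delta>' \<Longrightarrow> sobolev_norm 1 (val z) < d1"
    using HN_interpolation[of 1 N d1 "C + C"] N d1 C by auto
  obtain M :: nat where M: "2 * (2 * B * C) / \<delta> < real M" using reals_Archimedean2 by blast
  show ?thesis
    using lim[OF \<delta>'(1)] eventually_ge_at_top[of M]
  proof eventually_elim
    case (elim n)
    show ?case
    proof
      fix t assume t: "t \<in> S"
      define z where "z = h n t - g t"
      have z: "HN N z (C + C)" unfolding z_def by (intro HN_diff h t)
      have "l2 (A (real (Suc n)) (g t) - AA (g t)) \<le> 2 * B * C / real (Suc n)"
        by (rule l2_AA_diff_le[OF h(2)[OF t] N2]) simp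
      also have "\<dots> \<le> \<delta> / 2"
      proof -
        have "2 * (2 * B * C) / \<delta> \<le> real (Suc n)" using M elim(2) by simp
        then show ?thesis using \<delta>(1) by (simp add: field_simps)
      qed
      finally have 1: "l2 (A (real (Suc n)) (g t) - AA (g t)) \<le> \<delta> / 2" .
      have si: "square_integrable (sobf 1 z)"
        using HN_sobolev_mem[OF z, of 1] N by (simp add: sobolev_val_iff)
      have "l2n (fh (A (real (Suc n)) z)) \<le> B * l2n (sobf 1 z)"
      proof (rule l2n_mono_AE[OF si _ _ B_nonneg])
        show "AE \<xi> in lborel. norm (fh (A (real (Suc n)) z) \<xi>) \<le> B * norm (sobf 1 z \<xi>)"
          using fh_A[of "real (Suc n)" z]
        proof eventually_elim
          case (elim \<xi>)
          have "norm (\<i> * complex_of_real \<xi> * (m \<xi> * ct (real (Suc n)) \<xi>) * fh z \<xi>) \<le> norm (\<i> * complex_of_real \<xi> * m \<xi> * fh z \<xi>)"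
            using tail_cases(2)[OF order_refl, of "real (Suc n)" \<xi>] by (elim disjE) simp_all
          also have "\<dots> \<le> B * (\<bar>\<xi>\<bar> * norm (fh z \<xi>))" unfolding norm_symbol by (rule symbol_le) simp
          also have "\<dots> \<le> B * norm (sobf 1 z \<xi>)"
          proof (intro mult_left_mono B_nonneg)
            have "\<bar>\<xi>\<bar> = (\<xi>\<^sup>2) powr (1 / 2)" by (simp add: powr_half_sqrt)
            also have "\<dots> \<le> (1 + \<xi>\<^sup>2) powr (1 / 2)" by (intro powr_mono2) auto
            finally show "\<bar>\<xi>\<bar> * norm (fh z \<xi>) \<le> norm (sobf 1 z \<xi>)"
              by (simp add: sobf_def norm_mult mult_right_mono)
          qed
          finally show ?case unfolding elim .
        qed
      qed simp
      also have "\<dots> \<le> B * d1"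
        using \<delta>'(2)[OF z] elim(1) t B_nonneg by (intro mult_left_mono) (auto simp: z_def sobolev_norm_val less_imp_le simp del: val_simps)
      also have "\<dots> \<le> \<delta> / 2" using \<delta>(1) B_nonneg by (simp add: d1_def field_simps)
      finally have "sqrt (2 * pi) * l2 (A (real (Suc n)) z) \<le> \<delta> / 2" by (simp add: l2n_fh)
      moreover have "1 * l2 (A (real (Suc n)) z) \<le> sqrt (2 * pi) * l2 (A (real (Suc n)) z)"
        by (intro mult_right_mono sqrt_2pi_le) simp
      ultimately have 2: "l2 (A (real (Suc n)) z) \<le> \<delta> / 2" by linarith
      have eq: "A (real (Suc n)) (h n t) - AA (g t) = A (real (Suc n)) z + (A (real (Suc n)) (g t) - AA (g t))"
        by (simp add: z_def linear_diff[OF bounded_linear.linear[OF bounded_linear_A]])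
      have "l2 (A (real (Suc n)) (h n t) - AA (g t)) \<le> \<delta>"
        unfolding eq using l2_triangle[of "A (real (Suc n)) z" "A (real (Suc n)) (g t) - AA (g t)"] 1 2 by linarith
      then show "norm (A (real (Suc n)) (h n t) - AA (g t)) < e"
        by (intro \<delta>(2)) (auto simp only: C'_def intro!: HN_diff HN_A HN_AA h t N2)
    qed
  qed
qed

lemma square_le_scaled:
  fixes x n :: real
  assumes "x\<^sup>2 \<le> Z / n\<^sup>2" "1 \<le> n"
  shows "x \<le> sqrt (\<bar>Z\<bar>) / n"
proof (rule power2_le_imp_le)
  have "Z / n\<^sup>2 \<le> \<bar>Z\<bar> / n\<^sup>2" by (intro divide_right_mono) auto
  then show "x\<^sup>2 \<le> (sqrt \<bar>Z\<bar> / n)\<^sup>2" using assms(1) by (simp add: power_divide)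
qed (use assms in simp)

text \<open>The approximations are bounded in \<open>H^N\<close> and Cauchy in \<open>L^2\<close> at
  rate \<open>1 / n\<close>, hence Cauchy in the algebra by interpolation; their velocities converge
  uniformly in time. The Lipschitz bounds of order \<open>N - 1\<close> are recorded for the time
  derivative in Sobolev norm.\<close>

theorem limit_solution:
  fixes M R c T :: real
  assumes N: "3 \<le> N" and data: "HN N u0 M" "HN N v0 M"
    and R: "R\<^sup>2 = 3 * (4 * M\<^sup>2) + 2" "0 \<le> R" and c: "0 < c"
    and small: "c * (real (k + 2) * sup_const R ^ (k + 1)) \<le> 1 / 2"
    and T: "0 \<le> T" "2 * growth_const N k R * T \<le> 1"
  obtains u v CL where "u 0 = u0" "v 0 = v0"
    "\<And>t. t \<in> {0..T / c} \<Longrightarrow> HN N (u t) (3 * R)" "\<And>t. t \<in> {0..T / c} \<Longrightarrow> HN N (v t) (3 * R)"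
    "\<And>t. t \<in> {0..T / c} \<Longrightarrow> HN N (u t + c *\<^sub>R pw (u t) (Suc k)) (3 * R + c * (3 * pw_const N k R))"
    "\<And>t. t \<in> {0..T / c} \<Longrightarrow> (u has_vector_derivative AA (v t)) (at t within {0..T / c})"
    "\<And>t. t \<in> {0..T / c} \<Longrightarrow> (v has_vector_derivative AA (u t + c *\<^sub>R pw (u t) (Suc k))) (at t within {0..T / c})"
    "\<And>s t. s \<in> {0..T / c} \<Longrightarrow> t \<in> {0..T / c} \<Longrightarrow> HN (N - 1) (u s - u t) (CL * \<bar>s - t\<bar>)"
    "\<And>s t. s \<in> {0..T / c} \<Longrightarrow> t \<in> {0..T / c} \<Longrightarrow> HN (N - 1) (v s - v t) (CL * \<bar>s - t\<bar>)"
    "\<And>t x. t \<in> {0..T / c} \<Longrightarrow> \<bar>val (u t) x\<bar> \<le> sup_const R"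
proof -
  define I where "I = {0..T / c}"
  have zI: "0 \<in> I" using T c by (simp add: I_def)
  have N2: "2 \<le> N" "0 < N" using N by auto
  have "\<forall>n::nat. \<exists>u v. u 0 = P (real (Suc n)) u0 \<and> v 0 = P (real (Suc n)) v0 \<and> solves (real (Suc n)) k c I u v \<and>
      (\<forall>t\<in>I. size (real (Suc n)) N (u t) (v t) \<le> R\<^sup>2)"
  proof
    fix n :: nat
    show "\<exists>u v. u 0 = P (real (Suc n)) u0 \<and> v 0 = P (real (Suc n)) v0 \<and> solves (real (Suc n)) k c I u v \<and>
      (\<forall>t\<in>I. size (real (Suc n)) N (u t) (v t) \<le> R\<^sup>2)"
      by (rule truncated_solution[OF N2(1) R c small T P_P P_P size_P_le[OF data], of "real (Suc n)"])
        (unfold I_def, blast)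
  qed
  then obtain u v where init: "\<And>n. u n 0 = P (real (Suc n)) u0" "\<And>n. v n 0 = P (real (Suc n)) v0"
    and sol: "\<And>n. solves (real (Suc n)) k c I (u n) (v n)"
    and sz: "\<And>n t. t \<in> I \<Longrightarrow> size (real (Suc n)) N (u n t) (v n t) \<le> R\<^sup>2"
    by metis
  have PP: "P (real (Suc n)) (u n t) = u n t" "P (real (Suc n)) (v n t) = v n t"
    and ud: "(u n has_vector_derivative A (real (Suc n)) (v n t)) (at t within I)"
    and vd: "(v n has_vector_derivative A (real (Suc n)) (u n t + c *\<^sub>R pw (u n t) (Suc k))) (at t within I)"
    if "t \<in> I" for n t
    using sol[of n] that by (auto simp: solves_def)
  define Cp where "Cp = 3 * pw_const N k R"
  define h where "h n t = u n t + c *\<^sub>R pw (u n t) (Suc k)" for n t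
  define Ch where "Ch = 3 * R + c * Cp"
  have hnu: "HN N (u n t) (3 * R)" and hnv: "HN N (v n t) (3 * R)" and hnp: "HN N (pw (u n t) (Suc k)) Cp" if t: "t \<in> I" for n t
    unfolding Cp_def by (rule size_HN[OF sz[OF t] R(2) PP[OF t] N2(1)])+
  have hnh: "HN N (h n t) Ch" if t: "t \<in> I" for n t
    unfolding h_def Ch_def
    using HN_add[OF hnu[OF t] HN_scaleR[OF hnp[OF t], of c]] c by (simp del: pw.simps)
  have sup: "\<bar>val (u n t) x\<bar> \<le> sup_const R" if t: "t \<in> I" for n t x
    by (rule size_sup[OF sz[OF t] R(2) PP[OF t] N2(2)])
  \<comment> \<open>Collects the constants of \<open>truncated_difference\<close> at the final time.
    Initial error and remainder are both of order \<open>1 / n\<close>, so the squared difference is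
    at most \<open>E / n\<^sup>2\<close>; the exponential may be large for small \<open>c\<close>,
    but \<open>c\<close> is fixed here.\<close>
  define E where "E = (3 * ((2 * M)\<^sup>2 + (2 * M)\<^sup>2) + 2 * (c * (2 * B * Cp))\<^sup>2 * (T / c)) * exp (2 * (c * rate_const k R + 1) * (T / c))"
  define e where "e = sqrt \<bar>E\<bar>"
  have diff: "l2 (u n' t - u n t) \<le> e / real (Suc n) \<and> l2 (v n' t - v n t) \<le> e / real (Suc n)"
    if t: "t \<in> I" and n: "n \<le> n'" for t n n'
  proof -
    let ?n = "real (Suc n)"
    have sub: "{0..t} \<subseteq> I" and t0: "0 \<le> t" "t \<le> T / c" using t by (auto simp: I_def)
    have nn: "1 \<le> ?n" "?n \<le> real (Suc n')" using n by auto
    have rate: "0 \<le> rate_const k R"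
      unfolding rate_const_def sup_const_def using R(2) \<kappa>_nonneg B_nonneg by simp
    have i: "(l2 (u n' 0 - u n 0))\<^sup>2 \<le> (2 * M / ?n)\<^sup>2" "(l2 (v n' 0 - v n 0))\<^sup>2 \<le> (2 * M / ?n)\<^sup>2"
      unfolding init by (intro power_mono l2_P_diff_le[OF _ N2(1) nn] data; simp)+
    have "(l2 (u n' t - u n t))\<^sup>2 + (l2 (v n' t - v n t))\<^sup>2
      \<le> (3 * ((l2 (u n' 0 - u n 0))\<^sup>2 + (l2 (v n' 0 - v n 0))\<^sup>2) + 2 * (c * (2 * B * (3 * pw_const N k R) / ?n))\<^sup>2 * t)
        * exp (2 * (c * rate_const k R + 1) * t)"
      by (rule truncated_difference[OF N2(1) R(2) c small t0(1) nn solves_subset[OF sol sub] _ solves_subset[OF sol sub]])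
        (use sz sub in auto)
    also have "\<dots> \<le> (3 * ((2 * M / ?n)\<^sup>2 + (2 * M / ?n)\<^sup>2) + 2 * (c * (2 * B * Cp / ?n))\<^sup>2 * (T / c))
        * exp (2 * (c * rate_const k R + 1) * (T / c))"
    proof (rule mult_mono)
      show "exp (2 * (c * rate_const k R + 1) * t) \<le> exp (2 * (c * rate_const k R + 1) * (T / c))"
        unfolding exp_le_cancel_iff using rate c t0 by (intro mult_left_mono) auto
      show "3 * ((l2 (u n' 0 - u n 0))\<^sup>2 + (l2 (v n' 0 - v n 0))\<^sup>2) + 2 * (c * (2 * B * (3 * pw_const N k R) / ?n))\<^sup>2 * t
          \<le> 3 * ((2 * M / ?n)\<^sup>2 + (2 * M / ?n)\<^sup>2) + 2 * (c * (2 * B * Cp / ?n))\<^sup>2 * (T / c)"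
        unfolding Cp_def using t0 by (intro add_mono mult_left_mono i) auto
      show "0 \<le> 3 * ((2 * M / ?n)\<^sup>2 + (2 * M / ?n)\<^sup>2) + 2 * (c * (2 * B * Cp / ?n))\<^sup>2 * (T / c)"
        using T c by (intro add_nonneg_nonneg mult_nonneg_nonneg) auto
    qed simp
    also have "\<dots> = E / ?n\<^sup>2"
    proof -
      have alg: "(3 * ((x / r)\<^sup>2 + (x / r)\<^sup>2) + 2 * (c * (y / r))\<^sup>2 * z) * w
          = ((3 * (x\<^sup>2 + x\<^sup>2) + 2 * (c * y)\<^sup>2 * z) * w) / r\<^sup>2" if "r \<noteq> 0" for x y z w r :: real
        using that by (simp add: field_simps)
      show ?thesis unfolding E_def by (rule alg) simp
    qed
    finally have le: "(l2 (u n' t - u n t))\<^sup>2 + (l2 (v n' t - v n t))\<^sup>2 \<le> E / ?n\<^sup>2" .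
    have "(l2 (u n' t - u n t))\<^sup>2 \<le> E / ?n\<^sup>2" "(l2 (v n' t - v n t))\<^sup>2 \<le> E / ?n\<^sup>2"
      using le zero_le_power2[of "l2 (u n' t - u n t)"] zero_le_power2[of "l2 (v n' t - v n t)"] by linarith+
    then show ?thesis unfolding e_def using square_le_scaled nn(1) by blast
  qed
  have e0: "0 \<le> e" by (simp add: e_def)
  have small_n: "\<exists>n0. \<forall>n\<ge>n0. e / real (Suc n) \<le> \<delta>" if \<delta>: "0 < \<delta>" for \<delta>
  proof -
    obtain n0 :: nat where n0: "e / \<delta> < real n0" using reals_Archimedean2 by blast
    have "e / real (Suc n) \<le> \<delta>" if n: "n0 \<le> n" for n
    proof -
      have "e / \<delta> \<le> real (Suc n)" using n0 n by simp
      then show ?thesis using \<delta> by (simp add: field_simps)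
    qed
    then show ?thesis by blast
  qed
  have lim: "\<exists>z. \<forall>t\<in>I. (\<lambda>n. w n t) \<longlonglongrightarrow> z t"
    if hw: "\<And>n t. t \<in> I \<Longrightarrow> HN N (w n t) (3 * R)"
      and dw: "\<And>t n n'. t \<in> I \<Longrightarrow> n \<le> n' \<Longrightarrow> l2 (w n' t - w n t) \<le> e / real (Suc n)" for w :: "nat \<Rightarrow> real \<Rightarrow> cbl2"
  proof -
    have "\<exists>l. (\<lambda>n. w n t) \<longlonglongrightarrow> l" if t: "t \<in> I" for t
    proof -
      have "Cauchy (\<lambda>n. w n t)"
      proof (rule metric_CauchyI)
        fix r :: real assume r: "0 < r"
        have "1 < N" "0 \<le> 3 * R + 3 * R" using N R by auto
        from HN_norm_interpolation[OF this(1) r this(2)]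
        obtain \<delta> where \<delta>: "0 < \<delta>" "\<And>z. HN N z (3 * R + 3 * R) \<Longrightarrow> l2 z \<le> \<delta> \<Longrightarrow> norm z < r" by blast
        obtain n0 where n0: "\<And>n. n0 \<le> n \<Longrightarrow> e / real (Suc n) \<le> \<delta>" using small_n[OF \<delta>(1)] by blast
        have half: "norm (w n' t - w n t) < r" if "n0 \<le> n" "n \<le> n'" for n n'
          using \<delta>(2)[OF HN_diff[OF hw[OF t] hw[OF t]] order_trans[OF dw[OF t that(2)] n0[OF that(1)]]] .
        have "dist (w n' t) (w n t) < r" if "n0 \<le> n" "n0 \<le> n'" for n n'
        proof (cases "n \<le> n'")
          case True
          then show ?thesis using half[OF that(1) True] by (simp only: dist_norm)
        next
          case False
          then show ?thesis using half[OF that(2), of n] by (simp add: dist_norm norm_minus_commute)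
        qed
        then show "\<exists>M. \<forall>m\<ge>M. \<forall>n\<ge>M. dist (w m t) (w n t) < r" by blast
      qed
      then show ?thesis using Cauchy_convergent convergent_def by blast
    qed
    then show ?thesis by metis
  qed
  obtain us where us: "\<And>t. t \<in> I \<Longrightarrow> (\<lambda>n. u n t) \<longlonglongrightarrow> us t" using lim[of u] hnu diff by blast
  obtain vs where vs: "\<And>t. t \<in> I \<Longrightarrow> (\<lambda>n. v n t) \<longlonglongrightarrow> vs t" using lim[of v] hnv diff by blast
  define g where "g t = us t + c *\<^sub>R pw (us t) (Suc k)" for t
  have gs: "(\<lambda>n. h n t) \<longlonglongrightarrow> g t" if "t \<in> I" for t
    unfolding h_def g_def by (intro tendsto_intros tendsto_pw us that)
  have close: "l2 (w n - z) \<le> b" if "w \<longlonglongrightarrow> z" "\<And>n'. n \<le> n' \<Longrightarrow> l2 (w n' - w n) \<le> b" for w :: "nat \<Rightarrow> cbl2" and z n b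
  proof -
    have "l2 (z - w n) \<le> b"
    proof (rule l2_limit_le)
      show "(\<lambda>i. w (i + n) - w n) \<longlonglongrightarrow> z - w n" by (intro tendsto_intros LIMSEQ_ignore_initial_segment that(1))
    qed (use that(2) in simp)
    then show ?thesis using l2_minus[of "z - w n"] by simp
  qed
  have us_n: "l2 (u n t - us t) \<le> e / real (Suc n)" and vs_n: "l2 (v n t - vs t) \<le> e / real (Suc n)" if t: "t \<in> I" for n t
    using diff[OF t] by (auto intro!: close[OF us[OF t]] close[OF vs[OF t]] simp del: val_simps)
  define S where "S = sup_const R"
  have S0: "0 \<le> S" using R(2) \<kappa>_nonneg by (simp add: S_def sup_const_def)
  have sups: "\<bar>val (us t) x\<bar> \<le> S" if t: "t \<in> I" for t x
  proof -
    have "(\<lambda>n. \<bar>val (u n t) x\<bar>) \<longlonglongrightarrow> \<bar>val (us t) x\<bar>"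
      by (intro tendsto_intros bounded_linear.tendsto[OF bounded_linear_val us[OF t]])
    then show ?thesis
      by (rule tendsto_upperbound) (use sup[OF t] in \<open>auto simp: S_def\<close>)
  qed
  \<comment> \<open>Lipschitz constant in \<open>L^2\<close> of the map sending \<open>u\<close> to
    \<open>u + c u^(k+2)\<close>, on functions bounded by \<open>S\<close>; it comes from the
    divided difference.\<close>
  define q where "q = 1 + c * (real (k + 2) * S ^ (k + 1))"
  have q0: "0 < q" using c S0 by (simp add: q_def add_pos_nonneg)
  have g_n: "l2 (h n t - g t) \<le> q * (e / real (Suc n))" if t: "t \<in> I" for n t
  proof -
    have "h n t - g t = (u n t - us t) + c *\<^sub>R (pdq (u n t) (us t) k * (u n t - us t))"
      unfolding pdq_mult h_def g_def by (simp add: algebra_simps del: pw.simps)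
    then have "l2 (h n t - g t) \<le> l2 (u n t - us t) + \<bar>c\<bar> * l2 (pdq (u n t) (us t) k * (u n t - us t))"
      using l2_triangle[of "u n t - us t" "c *\<^sub>R (pdq (u n t) (us t) k * (u n t - us t))"] by (simp only: l2_scaleR)
    also have "l2 (pdq (u n t) (us t) k * (u n t - us t)) \<le> real (k + 2) * S ^ (k + 1) * l2 (u n t - us t)"
      by (rule l2n_val_times_le, rule abs_val_pdq_le) (use sup[OF t] sups[OF t] in \<open>auto simp: S_def\<close>)
    also have "l2 (u n t - us t) + \<bar>c\<bar> * (real (k + 2) * S ^ (k + 1) * l2 (u n t - us t)) = q * l2 (u n t - us t)"
      using c by (simp add: q_def distrib_right mult.assoc del: val_simps)
    also have "\<dots> \<le> q * (e / real (Suc n))" using q0 us_n[OF t] by (intro mult_left_mono) auto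
    finally show ?thesis using c by (simp del: val_simps)
  qed
  have hus: "HN N (us t) (3 * R)" and hvs: "HN N (vs t) (3 * R)" and hgs: "HN N (g t) Ch" if t: "t \<in> I" for t
    using HN_limit[OF hnu[OF t] us[OF t]] HN_limit[OF hnv[OF t] vs[OF t]] HN_limit[OF hnh[OF t] gs[OF t]] by auto
  have R3: "0 \<le> 3 * R" and Ch0: "0 \<le> Ch" using R(2) HN_nonneg[OF hnh[OF zI]] by auto
  have ev_v: "\<forall>\<^sub>F n in sequentially. \<forall>t\<in>I. l2 (v n t - vs t) \<le> \<delta>" if \<delta>: "0 < \<delta>" for \<delta>
    using small_n[OF \<delta>] vs_n unfolding eventually_sequentially by (meson order_trans)
  have ev_g: "\<forall>\<^sub>F n in sequentially. \<forall>t\<in>I. l2 (h n t - g t) \<le> \<delta>" if \<delta>: "0 < \<delta>" for \<delta>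
  proof -
    obtain n0 where n0: "\<And>n. n0 \<le> n \<Longrightarrow> e / real (Suc n) \<le> \<delta> / q" using small_n[of "\<delta> / q"] \<delta> q0 by auto
    have "l2 (h n t - g t) \<le> \<delta>" if "n0 \<le> n" "t \<in> I" for n t
    proof -
      have "q * (e / real (Suc n)) \<le> q * (\<delta> / q)" using n0[OF that(1)] q0 by (intro mult_left_mono) auto
      then show ?thesis using g_n[OF that(2), of n] q0 by simp
    qed
    then show ?thesis unfolding eventually_sequentially by blast
  qed
  \<comment> \<open>Uniform convergence of the velocities on an interval, together with convergence
    at one point, gives the derivative of the limit.\<close>
  have deriv: "(ws has_vector_derivative G t) (at t within I)"
    if w: "\<And>n t. t \<in> I \<Longrightarrow> (w n has_vector_derivative W n t) (at t within I)"
      and ws: "\<And>t. t \<in> I \<Longrightarrow> (\<lambda>n. w n t) \<longlonglongrightarrow> ws t"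
      and W: "\<And>r. 0 < r \<Longrightarrow> \<forall>\<^sub>F n in sequentially. \<forall>t\<in>I. norm (W n t - G t) < r" and t: "t \<in> I"
    for w W :: "nat \<Rightarrow> real \<Rightarrow> cbl2" and ws G :: "real \<Rightarrow> cbl2" and t
  proof -
    have "\<exists>z. \<forall>t\<in>I. (\<lambda>n. w n t) \<longlonglongrightarrow> z t \<and> (z has_derivative (\<lambda>x. x *\<^sub>R G t)) (at t within I)"
    proof (rule has_derivative_sequence[where f' = "\<lambda>n t x. x *\<^sub>R W n t"])
      show "convex I" by (simp add: I_def)
      show "(w n has_derivative (\<lambda>x. x *\<^sub>R W n t)) (at t within I)" if "t \<in> I" for n t
        using w[OF that] by (simp add: has_vector_derivative_def)
      show "\<forall>\<^sub>F n in sequentially. \<forall>t\<in>I. \<forall>x. norm (x *\<^sub>R W n t - x *\<^sub>R G t) \<le> r * norm x" if "0 < r" for r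
        using W[OF that]
      proof (rule eventually_mono, intro ballI allI)
        fix n t and x :: real assume "\<forall>t\<in>I. norm (W n t - G t) < r" "t \<in> I"
        then have "\<bar>x\<bar> * norm (W n t - G t) \<le> \<bar>x\<bar> * r" by (intro mult_left_mono) auto
        then show "norm (x *\<^sub>R W n t - x *\<^sub>R G t) \<le> r * norm x"
          by (simp add: mult.commute flip: scaleR_diff_right)
      qed
      show "0 \<in> I" by (rule zI)
      show "(\<lambda>n. w n 0) \<longlonglongrightarrow> ws 0" by (rule ws[OF zI])
    qed
    then obtain z where z: "\<And>t. t \<in> I \<Longrightarrow> (\<lambda>n. w n t) \<longlonglongrightarrow> z t"
      "\<And>t. t \<in> I \<Longrightarrow> (z has_vector_derivative G t) (at t within I)"
      by (auto simp: has_vector_derivative_def)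
    have "z s = ws s" if "s \<in> I" for s using LIMSEQ_unique[OF z(1)[OF that] ws[OF that]] .
    then show ?thesis using has_vector_derivative_transform[OF t _ z(2)[OF t], of ws] by auto
  qed
  define CL where "CL = max (12 * B * (3 * R)) (12 * B * Ch)"
  show ?thesis
  proof (rule that[of us vs CL])
    show "us 0 = u0"
      using LIMSEQ_unique[OF us[OF zI]] P_tendsto[OF data(1) N2(1)] by (simp add: init)
    show "vs 0 = v0"
      using LIMSEQ_unique[OF vs[OF zI]] P_tendsto[OF data(2) N2(1)] by (simp add: init)
    fix t assume t: "t \<in> {0..T / c}"
    then have tI: "t \<in> I" by (simp add: I_def)
    show "HN N (us t) (3 * R)" "HN N (vs t) (3 * R)" by (rule hus[OF tI] hvs[OF tI])+
    show "HN N (us t + c *\<^sub>R pw (us t) (Suc k)) (3 * R + c * (3 * pw_const N k R))"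
      using hgs[OF tI] by (simp only: g_def Ch_def Cp_def)
    show "(us has_vector_derivative AA (vs t)) (at t within {0..T / c})"
      unfolding I_def[symmetric]
      by (rule deriv[OF ud us AA_limit[OF N hnv hvs ev_v _ R3] tI])
    show "(vs has_vector_derivative AA (us t + c *\<^sub>R pw (us t) (Suc k))) (at t within {0..T / c})"
      unfolding I_def[symmetric] g_def[symmetric]
      by (rule deriv[OF vd[folded h_def] vs AA_limit[OF N hnh hgs ev_g _ Ch0] tI])
    show "\<bar>val (us t) x\<bar> \<le> sup_const R" for x using sups[OF tI] by (simp add: S_def)
    fix s assume s: "s \<in> {0..T / c}"
    then have sI: "s \<in> I" by (simp add: I_def)
    have "HN (N - 1) (u n s - u n t) (12 * B * (3 * R) * \<bar>s - t\<bar>)" for n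
      by (rule solves_lipschitz[OF N2(1) ud[unfolded I_def] hnv[unfolded I_def] PP(1)[unfolded I_def] s t])
    from HN_limit[OF this tendsto_diff[OF us[OF sI] us[OF tI]]]
    show "HN (N - 1) (us s - us t) (CL * \<bar>s - t\<bar>)"
      by (rule HN_mono) (auto simp: CL_def intro!: mult_right_mono)
    have "HN (N - 1) (v n s - v n t) (12 * B * Ch * \<bar>s - t\<bar>)" for n
      by (rule solves_lipschitz[OF N2(1) vd[folded h_def, unfolded I_def] hnh[unfolded I_def] PP(2)[unfolded I_def] s t])
    from HN_limit[OF this tendsto_diff[OF vs[OF sI] vs[OF tI]]]
    show "HN (N - 1) (vs s - vs t) (CL * \<bar>s - t\<bar>)"
      by (rule HN_mono) (auto simp: CL_def intro!: mult_right_mono)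
  qed
qed

end

section \<open>Sobolev functions and their continuous representatives\<close>

lemma is_fourier_real: "square_integrable u \<Longrightarrow> is_fourier_L2 (\<lambda>x. complex_of_real (u x)) (fourier_real u)"
  by (rule fourier_L2) simp

lemma fourier_real_cong_AE:
  assumes "AE x in lborel. u x = w x" "square_integrable u" "square_integrable w"
  shows "AE \<xi> in lborel. fourier_real u \<xi> = fourier_real w \<xi>"
  by (rule is_fourier_L2_unique[OF is_fourier_real[OF assms(2)] is_fourier_real[OF assms(3)]])
    (use assms(1) in \<open>auto elim: eventually_mono\<close>)

lemma fourier_real_measurable: "square_integrable u \<Longrightarrow> fourier_real u \<in> borel_measurable borel"
  using is_fourier_L2_D(2)[OF is_fourier_real] by blast

lemma sobolev_cong_AE:
  assumes AE: "AE x in lborel. u x = w x" and u: "square_integrable u" and w: "square_integrable w"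
  shows "u \<in> sobolev r \<longleftrightarrow> w \<in> sobolev r" "sobolev_norm r u = sobolev_norm r w"
proof -
  have [measurable]: "fourier_real u \<in> borel_measurable borel" "fourier_real w \<in> borel_measurable borel"
    using fourier_real_measurable u w by auto
  have eq: "AE \<xi> in lborel. (1 + \<xi>\<^sup>2) powr r * (norm (fourier_real u \<xi>))\<^sup>2 = (1 + \<xi>\<^sup>2) powr r * (norm (fourier_real w \<xi>))\<^sup>2"
    using fourier_real_cong_AE[OF assms] by eventually_elim simp
  have "integrable lborel (\<lambda>\<xi>. (1 + \<xi>\<^sup>2) powr r * (norm (fourier_real u \<xi>))\<^sup>2) \<longleftrightarrow>
      integrable lborel (\<lambda>\<xi>. (1 + \<xi>\<^sup>2) powr r * (norm (fourier_real w \<xi>))\<^sup>2)"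
    by (rule integrable_cong_AE[OF _ _ eq]) measurable
  then show "u \<in> sobolev r \<longleftrightarrow> w \<in> sobolev r" using u w by (simp add: sobolev_def)
  show "sobolev_norm r u = sobolev_norm r w"
    unfolding sobolev_norm_def by (rule arg_cong[where f = sqrt], rule integral_cong_AE[OF _ _ eq]) measurable
qed

text \<open>Continuous representative, meant for classes in \<open>H^r\<close> with
  \<open>r \<ge> 1\<close>; it translates between the functions modulo null sets of the statement
  and the algebra.\<close>

definition cr :: "(real \<Rightarrow> real) \<Rightarrow> cbl2" where
  "cr u = inv (fourier_real u)"

lemma hermitian_fourier_real:
  assumes "square_integrable u"
  shows "hermitian (fourier_real u)"
proof -
  have "is_fourier_L2 (\<lambda>x. complex_of_real (u x)) (\<lambda>\<xi>. cnj (fourier_real u (- \<xi>)))"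
    using is_fourier_L2_cnj[OF is_fourier_real[OF assms]] by simp
  from is_fourier_L2_unique[OF is_fourier_real[OF assms] this]
  have "AE \<xi> in lborel. fourier_real u \<xi> = cnj (fourier_real u (- \<xi>))" by simp
  then show ?thesis unfolding hermitian_def by (rule eventually_mono) (metis complex_cnj_cnj)
qed

lemma cr:
  assumes u: "u \<in> sobolev r" and r: "1 \<le> r"
  shows "AE \<xi> in lborel. fh (cr u) \<xi> = fourier_real u \<xi>" "AE x in lborel. u x = val (cr u) x"
    "val (cr u) \<in> sobolev r" "sobolev_norm r (val (cr u)) = sobolev_norm r u"
proof -
  have u2: "square_integrable u" and ui: "integrable lborel (\<lambda>\<xi>. (1 + \<xi>\<^sup>2) powr r * (norm (fourier_real u \<xi>))\<^sup>2)"
    using u by (auto simp: sobolev_def)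
  have F: "square_integrable (fourier_real u)" using is_fourier_L2_D(2)[OF is_fourier_real[OF u2]] .
  have [measurable]: "fourier_real u \<in> borel_measurable borel" by (rule fourier_real_measurable[OF u2])
  have "square_integrable (\<lambda>\<xi>. complex_of_real \<xi> * fourier_real u \<xi>)"
  proof (rule square_integrableI[OF _ ui])
    show "(norm (complex_of_real \<xi> * fourier_real u \<xi>))\<^sup>2 \<le> (1 + \<xi>\<^sup>2) powr r * (norm (fourier_real u \<xi>))\<^sup>2" for \<xi>
    proof -
      have "\<xi>\<^sup>2 \<le> (1 + \<xi>\<^sup>2) powr 1" by simp
      also have "\<dots> \<le> (1 + \<xi>\<^sup>2) powr r" using r by (intro powr_mono) auto
      finally show ?thesis by (simp add: norm_mult power_mult_distrib mult_right_mono)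
    qed
  qed measurable
  from \<F>domI(1)[OF F this hermitian_fourier_real[OF u2]] have dom: "\<F>dom (fourier_real u)" .
  show fh: "AE \<xi> in lborel. fh (cr u) \<xi> = fourier_real u \<xi>"
    unfolding cr_def by (rule fh_inv[OF dom])
  from is_fourier_L2_inj[OF is_fourier_fh is_fourier_real[OF u2] this]
  have "AE x in lborel. complex_of_real (val (cr u) x) = complex_of_real (u x)" .
  then show AE: "AE x in lborel. u x = val (cr u) x" by (rule eventually_mono) simp
  show "val (cr u) \<in> sobolev r" "sobolev_norm r (val (cr u)) = sobolev_norm r u"
    using sobolev_cong_AE[OF AE u2] u by auto
qed

lemma sobolev_square_integrable: "u \<in> sobolev r \<Longrightarrow> square_integrable u"
  by (simp add: sobolev_def)

section \<open>Weak derivatives\<close>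

text \<open>Squaring makes the positive part continuously differentiable, which supplies compactly
  supported test functions.\<close>

lemma DERIV_max_0_square: "((\<lambda>y::real. (max 0 y)\<^sup>2) has_real_derivative 2 * max 0 y) (at y)"
proof -
  consider "y < 0" | "y > 0" | "y = 0" by linarith
  then show ?thesis
  proof cases
    case 1
    have "((\<lambda>y::real. 0) has_real_derivative 0) (at y)" by simp
    then have "((\<lambda>y::real. (max 0 y)\<^sup>2) has_real_derivative 0) (at y)"
      by (rule has_field_derivative_transform_within_open[of _ _ _ "{..<0}"]) (use 1 in auto)
    then show ?thesis using 1 by simp
  next
    case 2
    have "((\<lambda>y::real. y\<^sup>2) has_real_derivative 2 * y) (at y)" by (auto intro!: derivative_eq_intros)
    then have "((\<lambda>y::real. (max 0 y)\<^sup>2) has_real_derivative 2 * y) (at y)"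
      by (rule has_field_derivative_transform_within_open[of _ _ _ "{0<..}"]) (use 2 in auto)
    then show ?thesis using 2 by simp
  next
    case 3
    have "((\<lambda>h::real. ((max 0 h)\<^sup>2) / h) \<longlongrightarrow> 0) (at 0)"
    proof (rule Lim_null_comparison)
      have "norm ((max 0 h)\<^sup>2 / h) \<le> \<bar>h\<bar>" for h :: real by (auto simp: max_def power2_eq_square)
      then show "\<forall>\<^sub>F h in at 0. norm ((max 0 h)\<^sup>2 / h) \<le> \<bar>h :: real\<bar>" by simp
      have "((\<lambda>h::real. \<bar>h\<bar>) \<longlongrightarrow> \<bar>0\<bar>) (at 0)" by (intro tendsto_intros)
      then show "((\<lambda>h::real. \<bar>h\<bar>) \<longlongrightarrow> 0) (at 0)" by simp
    qed
    then show ?thesis using 3 by (simp add: DERIV_def)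
  qed
qed

text \<open>The difference \<open>h\<close> is orthogonal to all admissible test functions, and
  these approximate indicators of intervals; density then gives orthogonality to \<open>h\<close>
  itself.\<close>

lemma weak_deriv_unique:
  assumes "is_weak_deriv f g1" "is_weak_deriv f g2"
  shows "AE x in lborel. g1 x = g2 x"
proof -
  define h where "h x = g1 x - g2 x" for x
  have g: "square_integrable g1" "square_integrable g2" using assms by (auto simp: is_weak_deriv_def)
  have h: "square_integrable h" unfolding h_def by (intro square_integrable_diff g)
  have [measurable]: "h \<in> borel_measurable borel" using h by auto
  have test: "(LINT x|lborel. h x * \<phi> x) = 0"
    if "\<And>x. (\<phi> has_real_derivative \<phi>' x) (at x)" "continuous_on UNIV \<phi>'" "\<And>x. \<bar>x\<bar> > R \<Longrightarrow> \<phi> x = 0"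
      "square_integrable \<phi>" for \<phi> \<phi>' R
  proof -
    have "(LINT x|lborel. f x * \<phi>' x) = - (LINT x|lborel. g1 x * \<phi> x)" "(LINT x|lborel. f x * \<phi>' x) = - (LINT x|lborel. g2 x * \<phi> x)"
      using assms that(1-3) unfolding is_weak_deriv_def by blast+
    moreover have "(LINT x|lborel. h x * \<phi> x) = (LINT x|lborel. g1 x * \<phi> x) - (LINT x|lborel. g2 x * \<phi> x)"
      unfolding h_def left_diff_distrib
      by (intro Bochner_Integration.integral_diff integrable_prod_square_integrable g that)
    ultimately show ?thesis by simp
  qed
  have indicator_0: "(LINT x|lborel. h x * indicator {a..b} x) = 0" if ab: "a \<le> b" for a b
  proof -
    define p where "p x = (max 0 ((x - a) * (b - x)))\<^sup>2" for x
    define p' where "p' x = 2 * max 0 ((x - a) * (b - x)) * (a + b - 2 * x)" for x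
    have p: "(p has_real_derivative p' x) (at x)" for x
    proof -
      have "((\<lambda>x. (x - a) * (b - x)) has_real_derivative (a + b - 2 * x)) (at x)"
        by (auto intro!: derivative_eq_intros simp: algebra_simps)
      from DERIV_chain2[OF DERIV_max_0_square this] show ?thesis by (simp add: p_def[abs_def] p'_def)
    qed
    have p0: "0 \<le> p x" for x by (simp add: p_def)
    have pc: "continuous_on UNIV p" "continuous_on UNIV p'"
      unfolding p_def p'_def by (auto intro!: continuous_intros)
    \<comment> \<open>As \<open>p\<close> is positive exactly on \<open>{a<..<b}\<close>, these
      functions stay between 0 and 1 and tend to the indicator off the end points, while remaining
      continuously differentiable.\<close>
    define \<phi> where "\<phi> n x = real n * p x / (real n * p x + 1)" for n x
    have den: "real n * p x + 1 > 0" for n x using p0[of x] by (simp add: add_nonneg_pos)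
    have \<phi>_le: "0 \<le> \<phi> n x" "\<phi> n x \<le> 1" for n x
      unfolding \<phi>_def using den[of n x] p0[of x] by (auto simp: divide_le_eq_1)
    have outside: "p x = 0" if "x \<notin> {a<..<b}" for x
    proof -
      have "(x - a) * (b - x) \<le> 0" using that ab by (auto simp: mult_le_0_iff)
      then show ?thesis by (simp add: p_def max_def)
    qed
    have \<phi>0: "\<phi> n x = 0" if "x \<notin> {a<..<b}" for n x using outside[OF that] by (simp add: \<phi>_def)
    have \<phi>c: "continuous_on UNIV (\<phi> n)" for n
      unfolding \<phi>_def by (intro continuous_intros pc) (use den in \<open>auto simp: less_imp_neq[symmetric]\<close>)
    have [measurable]: "\<phi> n \<in> borel_measurable borel" for n by (rule borel_measurable_continuous_onI[OF \<phi>c])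
    have \<phi>si: "square_integrable (\<phi> n)" for n
    proof (rule square_integrable_bound[OF _ square_integrable_interval_indicator[where 'a = real, of a b], of _ 1])
      show "norm (\<phi> n x) \<le> 1 * norm (indicator {a..b} x :: real)" for x
        using \<phi>0[of x n] \<phi>_le[of n x] by (cases "x \<in> {a<..<b}") (auto simp: indicator_def)
    qed measurable
    have zero: "(LINT x|lborel. h x * \<phi> n x) = 0" for n
    proof (rule test[OF _ _ _ \<phi>si])
      show "(\<phi> n has_real_derivative real n * p' x / (real n * p x + 1)\<^sup>2) (at x)" for x
        unfolding \<phi>_def
        by (rule derivative_eq_intros p refl)+ (use den[of n x] in \<open>auto simp: power2_eq_square field_simps\<close>)
      show "continuous_on UNIV (\<lambda>x. real n * p' x / (real n * p x + 1)\<^sup>2)"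
        by (intro continuous_intros pc) (use den in \<open>auto simp: less_imp_neq[symmetric]\<close>)
      show "\<phi> n x = 0" if "\<bar>x\<bar> > \<bar>a\<bar> + \<bar>b\<bar>" for x
        by (rule \<phi>0) (use that in auto)
    qed
    have "(\<lambda>n. LINT x|lborel. h x * \<phi> n x) \<longlonglongrightarrow> (LINT x|lborel. h x * indicator {a..b} x)"
    proof (rule integral_dominated_convergence[where w = "\<lambda>x. \<bar>h x * indicator {a..b} x\<bar>"])
      show "integrable lborel (\<lambda>x. \<bar>h x * indicator {a..b} x\<bar>)"
        by (intro integrable_abs integrable_prod_square_integrable h square_integrable_interval_indicator)
      have "AE x in lborel. x \<noteq> a" "AE x in lborel. x \<noteq> b" by (rule AE_lborel_singleton)+
      then show "AE x in lborel. (\<lambda>n. h x * \<phi> n x) \<longlonglongrightarrow> h x * indicator {a..b} x"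
      proof eventually_elim
        case (elim x)
        have "(\<lambda>n. \<phi> n x) \<longlonglongrightarrow> indicator {a..b} x"
        proof (cases "x \<in> {a<..<b}")
          case True
          then have px: "0 < p x" by (simp add: p_def max_def)
          have "(\<lambda>n. 1 / (real n * p x + 1)) \<longlonglongrightarrow> 0"
          proof (rule Lim_null_comparison)
            have "norm (1 / (real n * p x + 1)) \<le> 1 / p x * (1 / real n)" if "1 \<le> n" for n
            proof -
              have 0: "0 < real n * p x" using that px by simp
              then have "1 / (real n * p x + 1) \<le> 1 / (real n * p x)" by (intro frac_le) auto
              then show ?thesis using 0 by (simp add: mult.commute)
            qed
            then show "\<forall>\<^sub>F n in sequentially. norm (1 / (real n * p x + 1)) \<le> 1 / p x * (1 / real n)"
              unfolding eventually_sequentially by blast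
            show "(\<lambda>n. 1 / p x * (1 / real n)) \<longlonglongrightarrow> 0"
              by (rule tendsto_mult_right_zero[OF lim_1_over_n])
          qed
          then have "(\<lambda>n. 1 - 1 / (real n * p x + 1)) \<longlonglongrightarrow> 1 - 0" by (intro tendsto_diff tendsto_const)
          moreover have "\<phi> n x = 1 - 1 / (real n * p x + 1)" for n
            using den[of n x] by (simp add: \<phi>_def field_simps)
          ultimately have "(\<lambda>n. \<phi> n x) \<longlonglongrightarrow> 1" by simp
          then show ?thesis using True by simp
        next
          case False
          then show ?thesis using elim \<phi>0[OF False] by (auto simp: indicator_def)
        qed
        then show ?case by (intro tendsto_intros)
      qed
      show "AE x in lborel. norm (h x * \<phi> n x) \<le> \<bar>h x * indicator {a..b} x\<bar>" for n
      proof (rule AE_I2)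
        fix x
        show "norm (h x * \<phi> n x) \<le> \<bar>h x * indicator {a..b} x\<bar>"
          using \<phi>0[of x n] \<phi>_le[of n x] by (cases "x \<in> {a<..<b}") (auto simp: abs_mult intro!: mult_left_le)
      qed
    qed measurable
    then show ?thesis using LIMSEQ_unique[of "\<lambda>n. 0" 0] by (simp add: zero LIMSEQ_const_iff)
  qed
  have hc: "square_integrable (\<lambda>x. complex_of_real (h x))" using h by simp
  have "(CLINT x|lborel. complex_of_real (h x) * F x) = 0" if "square_integrable F" for F
    using that
  proof (induction rule: square_integrable_induct)
    case (interval a b)
    have "(CLINT x|lborel. complex_of_real (h x) * indicator {a..b} x) = (CLINT x|lborel. complex_of_real (h x * indicator {a..b} x))"
      by (simp add: of_real_indicator)
    also have "\<dots> = complex_of_real (LINT x|lborel. h x * indicator {a..b} x)" by (rule integral_complex_of_real)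
    also have "(LINT x|lborel. h x * indicator {a..b} x) = 0" using indicator_0[of a b] by (cases "a \<le> b") auto
    finally show ?case by simp
  next
    case (add f g)
    then show ?case
      using integrable_prod_square_integrable[OF hc, of f] integrable_prod_square_integrable[OF hc, of g]
      by (simp add: distrib_left)
  next
    case (scale f c)
    have "(CLINT x|lborel. complex_of_real (h x) * (c * f x)) = (CLINT x|lborel. c * (complex_of_real (h x) * f x))"
      by (simp add: mult_ac)
    then show ?case using scale by simp
  next
    case (lim F f)
    have "(\<lambda>n. CLINT x|lborel. complex_of_real (h x) * F n x) \<longlonglongrightarrow> (CLINT x|lborel. complex_of_real (h x) * f x)"
      by (intro l2_prod_tendsto hc lim) (simp add: l2n_def)
    then show ?case using lim by (simp add: LIMSEQ_const_iff)
  qed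
  from this[OF hc] have "complex_of_real (LINT x|lborel. h x * h x) = 0"
    by (simp flip: integral_complex_of_real)
  then have "l2n h = 0" by (simp add: l2n_def power2_eq_square)
  from l2n_eq_0_AE[OF h this] show ?thesis by (simp add: h_def)
qed

text \<open>A test function of compact support is itself an element of the algebra, so
  \<open>ip_by_parts\<close> shows that the classical derivative of the representative is a weak
  derivative; uniqueness then settles the choice operator in \<open>weak_deriv\<close>.\<close>

lemma weak_deriv_val:
  assumes w: "is_deriv w w'" and u: "AE x in lborel. u x = val w x" "square_integrable u"
  shows "AE x in lborel. weak_deriv u x = val w' x" "square_integrable (weak_deriv u)"
proof -
  have "is_weak_deriv u (val w')"
    unfolding is_weak_deriv_def
  proof (intro conjI allI impI u(2) square_integrable_val)
    fix \<phi> \<phi>' :: "real \<Rightarrow> real"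
    assume "(\<forall>x. (\<phi> has_real_derivative \<phi>' x) (at x)) \<and> continuous_on UNIV \<phi>' \<and> (\<exists>R. \<forall>x. \<bar>x\<bar> > R \<longrightarrow> \<phi> x = 0)"
    then obtain R where \<phi>: "\<And>x. (\<phi> has_real_derivative \<phi>' x) (at x)" "continuous_on UNIV \<phi>'" "\<And>x. \<bar>x\<bar> > R \<Longrightarrow> \<phi> x = 0"
      by blast
    have \<phi>'0: "\<phi>' x = 0" if "\<bar>x\<bar> > R" for x
    proof -
      have op: "open {x. R < \<bar>x\<bar>}" by (intro open_Collect_less continuous_intros)
      have "((\<lambda>x. 0) has_real_derivative \<phi>' x) (at x)"
        by (rule has_field_derivative_transform_within_open[OF \<phi>(1) op]) (use that \<phi>(3) in auto)
      then show ?thesis using DERIV_unique[OF _ DERIV_const[of 0]] by blast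
    qed
    have mk: "val (mk f) = f" if f: "continuous_on UNIV f" "\<And>x. \<bar>x\<bar> > R \<Longrightarrow> f x = 0" for f :: "real \<Rightarrow> real"
    proof -
      have "compact (f ` {-\<bar>R\<bar>..\<bar>R\<bar>})" by (intro compact_continuous_image continuous_on_subset[OF f(1)]) auto
      then obtain B where B: "\<And>x. x \<in> {-\<bar>R\<bar>..\<bar>R\<bar>} \<Longrightarrow> \<bar>f x\<bar> \<le> B"
        using compact_imp_bounded bounded_iff by (metis imageI real_norm_def)
      have B': "\<bar>f x\<bar> \<le> \<bar>B\<bar> * norm (indicator {-\<bar>R\<bar>..\<bar>R\<bar>} x :: real)" for x
        using B[of x] f(2)[of x] by (cases "x \<in> {-\<bar>R\<bar>..\<bar>R\<bar>}") (auto simp: abs_le_iff)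
      have "square_integrable f"
        by (rule square_integrable_bound[OF borel_measurable_continuous_onI[OF f(1)] square_integrable_interval_indicator[where 'a = real, of "-\<bar>R\<bar>" "\<bar>R\<bar>"], of "\<bar>B\<bar>"])
          (use B' in simp)
      moreover have "\<bar>f x\<bar> \<le> \<bar>B\<bar>" for x
        using B'[of x] by (cases "x \<in> {-\<bar>R\<bar>..\<bar>R\<bar>}") auto
      ultimately show ?thesis by (intro val_mk[OF f(1)])
    qed
    have "continuous_on UNIV \<phi>" using \<phi>(1) by (intro continuous_at_imp_continuous_on ballI) (rule DERIV_isCont)
    note v = mk[OF this \<phi>(3)] mk[OF \<phi>(2) \<phi>'0]
    have "is_deriv (mk \<phi>) (mk \<phi>')" using \<phi>(1) by (simp add: is_deriv_def v)
    from ip_by_parts[OF w this] have "(LINT x|lborel. val w x * \<phi>' x) = - (LINT x|lborel. val w' x * \<phi> x)"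
      by (simp add: ip_def v)
    moreover have "(LINT x|lborel. u x * \<phi>' x) = (LINT x|lborel. val w x * \<phi>' x)"
    proof (rule integral_cong_AE)
      have [measurable]: "u \<in> borel_measurable borel" "\<phi>' \<in> borel_measurable borel"
        using u(2) borel_measurable_continuous_onI[OF \<phi>(2)] by auto
      show "(\<lambda>x. u x * \<phi>' x) \<in> borel_measurable lborel" "(\<lambda>x. val w x * \<phi>' x) \<in> borel_measurable lborel"
        by measurable
      show "AE x in lborel. u x * \<phi>' x = val w x * \<phi>' x" using u(1) by (rule eventually_mono) simp
    qed
    ultimately show "(LINT x|lborel. u x * \<phi>' x) = - (LINT x|lborel. val w' x * \<phi> x)" by simp
  qed
  then have wd: "is_weak_deriv u (weak_deriv u)" unfolding weak_deriv_def by (rule someI[of "is_weak_deriv u"])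
  show "AE x in lborel. weak_deriv u x = val w' x"
    by (rule weak_deriv_unique[OF wd \<open>is_weak_deriv u (val w')\<close>])
  show "square_integrable (weak_deriv u)" using wd by (simp add: is_weak_deriv_def)
qed

section \<open>The operator \<open>K \<partial>\<^sub>x\<close> and uniqueness\<close>

text \<open>With \<open>\<sigma> \<ge> 2\<close> both \<open>|\<xi>|\<close> and
  \<open>\<xi>\<^sup>2\<close> are dominated by the weight, so the transforms of \<open>w\<close>
  and of its derivative are integrable and inversion may be differentiated.\<close>

lemma sobolev_is_deriv:
  assumes w: "val w \<in> sobolev \<sigma>" and \<sigma>: "2 \<le> \<sigma>"
  shows "\<exists>w'. is_deriv w w'"
proof -
  have si: "square_integrable (sobf \<sigma> w)" using w by (simp add: sobolev_val_iff)
  have weight: "\<bar>\<xi>\<bar> \<le> (1 + \<xi>\<^sup>2) powr (\<sigma> / 2)" "\<bar>\<xi>\<bar> * \<bar>\<xi>\<bar> \<le> (1 + \<xi>\<^sup>2) powr (\<sigma> / 2)" for \<xi> :: real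
  proof -
    have "1 + \<xi>\<^sup>2 = (1 + \<xi>\<^sup>2) powr 1" by simp
    also have "\<dots> \<le> (1 + \<xi>\<^sup>2) powr (\<sigma> / 2)" using \<sigma> by (intro powr_mono) auto
    finally have *: "1 + \<xi>\<^sup>2 \<le> (1 + \<xi>\<^sup>2) powr (\<sigma> / 2)" .
    have "0 \<le> (\<bar>\<xi>\<bar> - 1)\<^sup>2" by simp
    then have "2 * \<bar>\<xi>\<bar> \<le> 1 + \<xi>\<^sup>2" by (simp add: power2_eq_square algebra_simps)
    then show "\<bar>\<xi>\<bar> \<le> (1 + \<xi>\<^sup>2) powr (\<sigma> / 2)" "\<bar>\<xi>\<bar> * \<bar>\<xi>\<bar> \<le> (1 + \<xi>\<^sup>2) powr (\<sigma> / 2)"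
      using * by (auto simp: power2_eq_square)
  qed
  have 1: "square_integrable (\<lambda>\<xi>. complex_of_real \<xi> * fh w \<xi>)"
  proof (rule square_integrable_bound[OF _ si, of _ 1])
    show "norm (complex_of_real \<xi> * fh w \<xi>) \<le> 1 * norm (sobf \<sigma> w \<xi>)" for \<xi>
      using mult_right_mono[OF weight(1)[of \<xi>] norm_ge_zero[of "fh w \<xi>"]] by (simp add: sobf_def norm_mult)
  qed measurable
  have 2: "square_integrable (\<lambda>\<xi>. complex_of_real \<xi> * (\<i> * complex_of_real \<xi> * fh w \<xi>))"
  proof (rule square_integrable_bound[OF _ si, of _ 1])
    show "norm (complex_of_real \<xi> * (\<i> * complex_of_real \<xi> * fh w \<xi>)) \<le> 1 * norm (sobf \<sigma> w \<xi>)" for \<xi>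
      using mult_right_mono[OF weight(2)[of \<xi>] norm_ge_zero[of "fh w \<xi>"]] by (simp add: sobf_def norm_mult mult.assoc)
  qed measurable
  have 3: "square_integrable (\<lambda>\<xi>. \<i> * complex_of_real \<xi> * fh w \<xi>)"
    by (rule square_integrable_bound[OF _ 1, of _ 1]) (measurable, simp add: norm_mult)
  have h: "hermitian (\<lambda>\<xi>. \<i> * complex_of_real \<xi> * fh w \<xi>)"
    by (rule hermitian_mult[OF _ hermitian_fh]) simp
  note dom = \<F>domI(1)[OF square_integrable_fh 1 hermitian_fh]
  have "is_deriv (inv (fh w)) (inv (\<lambda>\<xi>. \<i> * complex_of_real \<xi> * fh w \<xi>))"
    unfolding is_deriv_def using inv_deriv[OF dom \<F>domI(1)[OF 3 2 h]] by blast
  then show ?thesis using inv_eqI[OF dom, of w] by auto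
qed

lemma sobolev_HN:
  assumes w: "val w \<in> sobolev \<sigma>" and \<sigma>: "real N \<le> \<sigma>"
  shows "HN N w (sobolev_norm \<sigma> (val w))"
proof -
  have si: "square_integrable (sobf \<sigma> w)" using w by (simp add: sobolev_val_iff)
  have weight: "1 \<le> (1 + \<xi>\<^sup>2) powr (\<sigma> / 2)" "\<bar>\<xi>\<bar> ^ N \<le> (1 + \<xi>\<^sup>2) powr (\<sigma> / 2)" for \<xi> :: real
  proof -
    show "1 \<le> (1 + \<xi>\<^sup>2) powr (\<sigma> / 2)" using \<sigma> by (intro ge_one_powr_ge_zero) auto
    have "\<bar>\<xi>\<bar> = (\<xi>\<^sup>2) powr (1 / 2)" by (simp add: powr_half_sqrt)
    also have "\<dots> \<le> (1 + \<xi>\<^sup>2) powr (1 / 2)" by (intro powr_mono2) auto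
    finally have "\<bar>\<xi>\<bar> ^ N \<le> ((1 + \<xi>\<^sup>2) powr (1 / 2)) ^ N" by (intro power_mono) auto
    also have "\<dots> = (1 + \<xi>\<^sup>2) powr (real N / 2)"
      using add_pos_nonneg[OF zero_less_one zero_le_power2[of \<xi>]]
      by (subst powr_realpow[symmetric]) (simp_all add: powr_powr)
    also have "\<dots> \<le> (1 + \<xi>\<^sup>2) powr (\<sigma> / 2)" using \<sigma> by (intro powr_mono) auto
    finally show "\<bar>\<xi>\<bar> ^ N \<le> (1 + \<xi>\<^sup>2) powr (\<sigma> / 2)" .
  qed
  have 1: "norm (fh w \<xi>) \<le> 1 * norm (sobf \<sigma> w \<xi>)" for \<xi>
    using mult_right_mono[OF weight(1)[of \<xi>] norm_ge_zero[of "fh w \<xi>"]] by (simp add: sobf_def norm_mult)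
  have 2: "norm (complex_of_real \<xi> ^ N * fh w \<xi>) \<le> 1 * norm (sobf \<sigma> w \<xi>)" for \<xi>
    using mult_right_mono[OF weight(2)[of \<xi>] norm_ge_zero[of "fh w \<xi>"]]
    by (simp add: sobf_def norm_mult norm_power)
  have "1 * l2 w \<le> sqrt (2 * pi) * l2 w" by (intro mult_right_mono sqrt_2pi_le) simp
  then have "l2 w \<le> l2n (sobf \<sigma> w)" using l2n_mono[OF si _ 1] by (simp add: l2n_fh)
  moreover have "square_integrable (\<lambda>\<xi>. complex_of_real \<xi> ^ N * fh w \<xi>)"
    by (rule square_integrable_bound[OF xi_fh_measurable si 2])
  moreover have "l2n (\<lambda>\<xi>. complex_of_real \<xi> ^ N * fh w \<xi>) \<le> l2n (sobf \<sigma> w)"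
    using l2n_mono[OF si xi_fh_measurable 2] by simp
  ultimately show ?thesis by (simp add: HN_def sobolev_norm_val)
qed

lemma sobolev_val_diff:
  assumes "val w \<in> sobolev \<sigma>" "val z \<in> sobolev \<sigma>"
  shows "val (a *\<^sub>R w - z) \<in> sobolev \<sigma>"
proof -
  have AE: "AE \<xi> in lborel. complex_of_real a * sobf \<sigma> w \<xi> - sobf \<sigma> z \<xi> = sobf \<sigma> (a *\<^sub>R w - z) \<xi>"
    using fh_diff[of "a *\<^sub>R w" z] fh_scaleR[of a w]
  proof eventually_elim
    case (elim \<xi>)
    show ?case unfolding sobf_def elim by (simp add: algebra_simps)
  qed
  have "square_integrable (\<lambda>\<xi>. complex_of_real a * sobf \<sigma> w \<xi> - sobf \<sigma> z \<xi>)"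
    using assms by (intro square_integrable_diff square_integrable_mult_left) (simp_all add: sobolev_val_iff)
  from square_integrable_cong_AE[OF AE this sobf_measurable] show ?thesis by (simp only: sobolev_val_iff)
qed

text \<open>Brings the derivative into the difference quotient form used by
  \<open>has_sobolev_derivative\<close>.\<close>

lemma has_vector_derivative_quotient_iff:
  "(f has_vector_derivative g) (at t within S) \<longleftrightarrow>
    ((\<lambda>\<tau>. (1 / (\<tau> - t)) *\<^sub>R (f \<tau> - f t) - g) \<longlongrightarrow> 0) (at t within S)"
proof -
  have eq: "norm ((1 / norm (\<tau> - t)) *\<^sub>R (f \<tau> - (f t + (\<tau> - t) *\<^sub>R g))) = norm ((1 / (\<tau> - t)) *\<^sub>R (f \<tau> - f t) - g)"
    if "\<tau> \<noteq> t" for \<tau>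
  proof -
    have "(1 / (\<tau> - t)) *\<^sub>R (f \<tau> - (f t + (\<tau> - t) *\<^sub>R g)) = (1 / (\<tau> - t)) *\<^sub>R (f \<tau> - f t) - g"
      using that unfolding diff_diff_add[symmetric] scaleR_diff_right[of _ _ "(\<tau> - t) *\<^sub>R g"] scaleR_scaleR by simp
    then show ?thesis by (metis norm_scaleR abs_divide abs_one abs_abs real_norm_def)
  qed
  have "((\<lambda>\<tau>. (1 / norm (\<tau> - t)) *\<^sub>R (f \<tau> - (f t + (\<tau> - t) *\<^sub>R g))) \<longlongrightarrow> 0) (at t within S) \<longleftrightarrow>
      ((\<lambda>\<tau>. (1 / (\<tau> - t)) *\<^sub>R (f \<tau> - f t) - g) \<longlongrightarrow> 0) (at t within S)"
    unfolding tendsto_norm_zero_iff[of "\<lambda>\<tau>. (1 / norm (\<tau> - t)) *\<^sub>R (f \<tau> - (f t + (\<tau> - t) *\<^sub>R g))", symmetric]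
      tendsto_norm_zero_iff[of "\<lambda>\<tau>. (1 / (\<tau> - t)) *\<^sub>R (f \<tau> - f t) - g", symmetric]
    by (rule tendsto_cong, unfold eventually_at_filter, rule always_eventually, intro allI impI, rule eq)
  then show ?thesis
    by (simp add: has_vector_derivative_def has_derivative_within bounded_linear_scaleR_left)
qed

section \<open>Uniqueness of curves in the algebra, and the operator \<open>K_op\<close>\<close>

context symbol
begin

text \<open>A relation rather than the function \<open>AA\<close>: for an arbitrary competitor the
  right-hand side is given beforehand and is identified only through its transform.\<close>

definition Kdx :: "cbl2 \<Rightarrow> cbl2 \<Rightarrow> bool" where
  "Kdx w g \<longleftrightarrow> (AE \<xi> in lborel. fh g \<xi> = \<i> * complex_of_real \<xi> * m \<xi> * fh w \<xi>)"

lemma Kdx_diff: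
  assumes "Kdx w g" "Kdx z h"
  shows "Kdx (w - z) (g - h)"
  unfolding Kdx_def
  using assms[unfolded Kdx_def] fh_diff[of w z] fh_diff[of g h]
proof eventually_elim
  case (elim \<xi>)
  show ?case unfolding elim by (simp add: algebra_simps)
qed

text \<open>Polarised skewness, again because the symbol is imaginary, in the form that
  \<open>energy_gronwall\<close> asks for.\<close>

lemma Kdx_skew:
  assumes "Kdx w g" "Kdx z h"
  shows "ip z g + ip w h = 0"
proof -
  have "ip (- g) z = ip w h"
  proof (rule ip_fh_cong)
    show "AE \<xi> in lborel. fh (- g) \<xi> * cnj (fh z \<xi>) = fh w \<xi> * cnj (fh h \<xi>)"
      using assms[unfolded Kdx_def] fh_scaleR[of "- 1" g] by eventually_elim simp
  qed
  then show ?thesis by (simp add: ip.minus_left ip_commute[of g])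
qed

lemma Kdx_sobolev:
  assumes w: "val w \<in> sobolev \<sigma>" and K: "Kdx w g"
  shows "val g \<in> sobolev (\<sigma> - 1)" "sobolev_norm (\<sigma> - 1) (val g) \<le> B * sobolev_norm \<sigma> (val w)"
proof -
  have si: "square_integrable (sobf \<sigma> w)" using w by (simp add: sobolev_val_iff)
  define F where "F \<xi> = complex_of_real ((1 + \<xi>\<^sup>2) powr ((\<sigma> - 1) / 2)) * (\<i> * complex_of_real \<xi> * m \<xi> * fh w \<xi>)" for \<xi>
  have [measurable]: "F \<in> borel_measurable borel" unfolding F_def by measurable
  have le: "norm (F \<xi>) \<le> B * norm (sobf \<sigma> w \<xi>)" for \<xi>
  proof -
    have "\<bar>\<xi>\<bar> = (\<xi>\<^sup>2) powr (1 / 2)" by (simp add: powr_half_sqrt)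
    also have "\<dots> \<le> (1 + \<xi>\<^sup>2) powr (1 / 2)" by (intro powr_mono2) auto
    finally have "(1 + \<xi>\<^sup>2) powr ((\<sigma> - 1) / 2) * \<bar>\<xi>\<bar> \<le> (1 + \<xi>\<^sup>2) powr ((\<sigma> - 1) / 2) * (1 + \<xi>\<^sup>2) powr (1 / 2)"
      by (intro mult_left_mono) auto
    also have "\<dots> = (1 + \<xi>\<^sup>2) powr (\<sigma> / 2)" by (simp add: diff_divide_distrib flip: powr_add)
    finally have "(1 + \<xi>\<^sup>2) powr ((\<sigma> - 1) / 2) * \<bar>\<xi>\<bar> * norm (fh w \<xi>) \<le> (1 + \<xi>\<^sup>2) powr (\<sigma> / 2) * norm (fh w \<xi>)"
      by (intro mult_right_mono) auto
    then have 1: "B * ((1 + \<xi>\<^sup>2) powr ((\<sigma> - 1) / 2) * \<bar>\<xi>\<bar> * norm (fh w \<xi>)) \<le> B * norm (sobf \<sigma> w \<xi>)"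
      by (intro mult_left_mono B_nonneg) (simp add: sobf_def norm_mult)
    have "norm (F \<xi>) = m \<xi> * ((1 + \<xi>\<^sup>2) powr ((\<sigma> - 1) / 2) * \<bar>\<xi>\<bar> * norm (fh w \<xi>))"
      unfolding F_def norm_mult[of "complex_of_real _" "_ * _"] norm_symbol by simp
    also have "\<dots> \<le> B * ((1 + \<xi>\<^sup>2) powr ((\<sigma> - 1) / 2) * \<bar>\<xi>\<bar> * norm (fh w \<xi>))" by (rule symbol_le) simp
    finally show ?thesis using 1 by simp
  qed
  have F: "square_integrable F" by (rule square_integrable_bound[OF _ si le]) measurable
  have AE: "AE \<xi> in lborel. F \<xi> = sobf (\<sigma> - 1) g \<xi>"
    using K[unfolded Kdx_def] by eventually_elim (simp add: F_def sobf_def)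
  show "val g \<in> sobolev (\<sigma> - 1)"
    using square_integrable_cong_AE[OF AE F sobf_measurable] by (simp add: sobolev_val_iff)
  have "l2n (sobf (\<sigma> - 1) g) = l2n F" by (rule l2n_cong_AE[symmetric, OF AE]) measurable
  then show "sobolev_norm (\<sigma> - 1) (val g) \<le> B * sobolev_norm \<sigma> (val w)"
    using l2n_mono[OF si _ le B_nonneg] by (simp add: sobolev_norm_val)
qed

text \<open>The bootstrap keeps the second solution within distance 1 of the first, so that the energy
  of the difference stays coercive.\<close>

lemma curves_unique:
  fixes u v u' v' :: "real \<Rightarrow> cbl2"
  assumes c: "0 \<le> c"
    and small: "c * (real (k + 2) * (S + 1) ^ (k + 1)) \<le> 1 / 2"
    and sol: "\<And>t. t \<in> {0..T} \<Longrightarrow> (u has_vector_derivative gu t) (at t within {0..T})"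
      "\<And>t. t \<in> {0..T} \<Longrightarrow> (v has_vector_derivative gv t) (at t within {0..T})"
      "\<And>t. t \<in> {0..T} \<Longrightarrow> Kdx (v t) (gu t)" "\<And>t. t \<in> {0..T} \<Longrightarrow> Kdx (u t + c *\<^sub>R pw (u t) (Suc k)) (gv t)"
    and sol': "\<And>t. t \<in> {0..T} \<Longrightarrow> (u' has_vector_derivative gu' t) (at t within {0..T})"
      "\<And>t. t \<in> {0..T} \<Longrightarrow> (v' has_vector_derivative gv' t) (at t within {0..T})"
      "\<And>t. t \<in> {0..T} \<Longrightarrow> Kdx (v' t) (gu' t)" "\<And>t. t \<in> {0..T} \<Longrightarrow> Kdx (u' t + c *\<^sub>R pw (u' t) (Suc k)) (gv' t)"
    and init: "u' 0 = u 0" "v' 0 = v 0"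
    and S: "\<And>t x. t \<in> {0..T} \<Longrightarrow> \<bar>val (u t) x\<bar> \<le> S"
    and G: "\<And>t x. t \<in> {0..T} \<Longrightarrow> \<bar>val (gu t) x\<bar> \<le> G" "\<And>t x. t \<in> {0..T} \<Longrightarrow> \<bar>val (gu' t) x\<bar> \<le> G"
    and t: "t \<in> {0..T}"
  shows "u' t = u t" "v' t = v t"
proof -
  have l2_0: "w = 0" if "l2 w = 0" for w
  proof (rule cbl2_eqI_AE)
    show "AE x in lborel. val w x = val 0 x"
      using l2n_eq_0_AE[OF square_integrable_val that] by (simp add: val_zero)
  qed
  \<comment> \<open>Within distance 1 the competitor is bounded by \<open>S + 1\<close>, and the
    difference has zero data and zero remainder; the energy inequality forces equality. Distance 0
    then closes the bootstrap with \<open>A = 0\<close> and \<open>B = 1\<close>.\<close>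
  have step: "u' \<tau> = u \<tau> \<and> v' \<tau> = v \<tau>"
    if \<tau>: "\<tau> \<in> {0..T}" and X: "\<And>s. s \<in> {0..\<tau>} \<Longrightarrow> norm (u' s - u s) \<le> 1" for \<tau>
  proof -
    have sub: "{0..\<tau>} \<subseteq> {0..T}" using \<tau> by auto
    have sup: "\<bar>val (u s) x\<bar> \<le> S + 1" "\<bar>val (u' s) x\<bar> \<le> S + 1" if s: "s \<in> {0..\<tau>}" for s x
    proof -
      have "\<bar>val (u' s) x - val (u s) x\<bar> \<le> 1"
        using order_trans[OF abs_val_le X[OF s], of x] by (simp add: val_minus)
      then show "\<bar>val (u s) x\<bar> \<le> S + 1" "\<bar>val (u' s) x\<bar> \<le> S + 1"
        using S[of s x] s sub by (auto simp: abs_le_iff)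
    qed
    have "(l2 (u' \<tau> - u \<tau>))\<^sup>2 + (l2 (v' \<tau> - v \<tau>))\<^sup>2
      \<le> (3 * ((l2 (u' 0 - u 0))\<^sup>2 + (l2 (v' 0 - v 0))\<^sup>2) + 2 * 0\<^sup>2 * \<tau>) * exp (2 * (c * ((real (k + 2))\<^sup>2 * ((S + 1) ^ k * G)) + 1) * \<tau>)"
    proof (rule energy_gronwall[where r = "\<lambda>s. 0" and d = "\<lambda>s. u' s - u s" and e = "\<lambda>s. v' s - v s" and T = \<tau>])
      show "0 \<le> \<tau>" using \<tau> by simp
      show "0 \<le> c" by (rule c)
      fix s assume s: "s \<in> {0..\<tau>}"
      then have sT: "s \<in> {0..T}" using sub by auto
      note w = has_vector_derivative_within_subset[OF _ sub]
      show "((\<lambda>s. u' s - u s) has_vector_derivative gu' s - gu s) (at s within {0..\<tau>})"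
        by (intro has_vector_derivative_diff w sol sol' sT)
      show "((\<lambda>s. v' s - v s) has_vector_derivative gv' s - gv s) (at s within {0..\<tau>})"
        by (intro has_vector_derivative_diff w sol sol' sT)
      show "((\<lambda>s. pdq (u' s) (u s) k) has_vector_derivative pdqd (u' s) (gu' s) (u s) (gu s) k) (at s within {0..\<tau>})"
        by (intro pdq_has_vector_derivative w sol sol' sT)
      have eq: "u' s - u s + c *\<^sub>R (pdq (u' s) (u s) k * (u' s - u s)) = (u' s + c *\<^sub>R pw (u' s) (Suc k)) - (u s + c *\<^sub>R pw (u s) (Suc k))"
        unfolding pdq_mult by (simp add: algebra_simps del: pw.simps)
      show "ip (u' s - u s + c *\<^sub>R (pdq (u' s) (u s) k * (u' s - u s))) (gu' s - gu s) + ip (v' s - v s) (gv' s - gv s - 0) = 0"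
        unfolding eq diff_zero by (intro Kdx_skew Kdx_diff sol sol' sT)
      show "l2 0 \<le> 0" unfolding l2_zero ..
      fix x
      have "c * \<bar>val (pdq (u' s) (u s) k) x\<bar> \<le> c * (real (k + 2) * (S + 1) ^ (k + 1))"
        by (intro mult_left_mono abs_val_pdq_le sup s c)
      then show "c * \<bar>val (pdq (u' s) (u s) k) x\<bar> \<le> 1 / 2" using small by linarith
      show "\<bar>val (pdqd (u' s) (gu' s) (u s) (gu s) k) x\<bar> \<le> (real (k + 2))\<^sup>2 * ((S + 1) ^ k * G)"
        by (intro abs_val_pdqd_le sup s G sT)
    qed
    also have "\<dots> = 0" by (simp add: init l2n_def)
    finally have le: "(l2 (u' \<tau> - u \<tau>))\<^sup>2 + (l2 (v' \<tau> - v \<tau>))\<^sup>2 \<le> 0" .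
    have "(l2 (u' \<tau> - u \<tau>))\<^sup>2 = 0" "(l2 (v' \<tau> - v \<tau>))\<^sup>2 = 0"
      using le zero_le_power2[of "l2 (u' \<tau> - u \<tau>)"] zero_le_power2[of "l2 (v' \<tau> - v \<tau>)"] by linarith+
    then have "l2 (u' \<tau> - u \<tau>) = 0" "l2 (v' \<tau> - v \<tau>) = 0" by (simp_all only: zero_eq_power2)
    from this[THEN l2_0] show ?thesis by simp
  qed
  have cont: "continuous_on {0..T} (\<lambda>s. norm (u' s - u s))"
    by (intro continuous_intros continuous_on_vector_derivative[OF sol(1)] continuous_on_vector_derivative[OF sol'(1)])
  have X: "norm (u' s - u s) \<le> 0" if s: "s \<in> {0..T}" for s
  proof (rule bootstrap[OF cont _ zero_less_one _ s])
    show "norm (u' 0 - u 0) \<le> 0" by (simp add: init)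
    show "norm (u' \<tau> - u \<tau>) \<le> 0" if "\<tau> \<in> {0..T}" "\<And>s. s \<in> {0..\<tau>} \<Longrightarrow> norm (u' s - u s) \<le> 1" for \<tau>
      using step[OF that] by simp
  qed
  have "u' t = u t \<and> v' t = v t"
  proof (rule step[OF t])
    fix s assume "s \<in> {0..t}"
    then show "norm (u' s - u s) \<le> 1" using X[of s] t by simp
  qed
  then show "u' t = u t" "v' t = v t" by auto
qed

text \<open>Evenness of \<open>m\<close> makes the product hermitian, so its inverse transform is
  real almost everywhere and the real part taken in \<open>K_op\<close> changes only a null
  set.\<close>

lemma K_op_fourier:
  assumes mb: "\<And>\<xi>. sqrt (Re (b \<xi>)) = m \<xi>" and w: "square_integrable w"
  shows "is_fourier_L2 (\<lambda>x. complex_of_real (K_op b w x)) (\<lambda>\<xi>. complex_of_real (m \<xi>) * fourier_real w \<xi>)"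
proof -
  define F where "F \<xi> = complex_of_real (m \<xi>) * fourier_real w \<xi>" for \<xi>
  have wF: "square_integrable (fourier_real w)" using is_fourier_L2_D(2)[OF is_fourier_real[OF w]] .
  have [measurable]: "fourier_real w \<in> borel_measurable borel" by (rule fourier_real_measurable[OF w])
  have F: "square_integrable F"
  proof (rule square_integrable_bound[OF _ wF, of _ B])
    show "norm (F \<xi>) \<le> B * norm (fourier_real w \<xi>)" for \<xi>
      using symbol_le[OF norm_ge_zero, of \<xi> "fourier_real w \<xi>"] m_nonneg[of \<xi>] by (simp add: F_def norm_mult)
  qed (unfold F_def, measurable)
  define g where "g = inv_fourier_L2 F"
  have g: "is_fourier_L2 g F" unfolding g_def by (rule inv_fourier_L2[OF F])
  have "AE \<xi> in lborel. F \<xi> = cnj (F (- \<xi>))"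
    using hermitian_fourier_real[OF w] unfolding hermitian_def
    by (rule eventually_mono) (simp add: F_def m_even)
  from is_fourier_L2_inj[OF g is_fourier_L2_cnj[OF g] this]
  have AE: "AE x in lborel. g x = complex_of_real (Re (g x))"
    by (rule eventually_mono) (simp add: complex_eq_iff)
  have [measurable]: "g \<in> borel_measurable borel" using is_fourier_L2_D(1)[OF g] by auto
  have "is_fourier_L2 (\<lambda>x. complex_of_real (Re (g x))) F"
    by (rule is_fourier_L2_cong_AE[OF g AE _ _]) (use F in auto)
  moreover have "K_op b w = (\<lambda>x. Re (g x))" unfolding K_op_def mb g_def F_def ..
  ultimately show ?thesis unfolding F_def by simp
qed

lemma K_op_weak_deriv:
  assumes mb: "\<And>\<xi>. sqrt (Re (b \<xi>)) = m \<xi>"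
    and w: "is_deriv w w'" and u: "AE x in lborel. u x = val w x" "square_integrable u"
  shows "square_integrable (K_op b (weak_deriv u))"
    and "AE \<xi> in lborel. fourier_real (K_op b (weak_deriv u)) \<xi> = \<i> * complex_of_real \<xi> * m \<xi> * fh w \<xi>"
proof -
  note wd = weak_deriv_val[OF w u]
  note K = K_op_fourier[OF mb wd(2)]
  have "square_integrable (\<lambda>x. complex_of_real (K_op b (weak_deriv u) x))" using is_fourier_L2_D(1)[OF K] .
  then show si: "square_integrable (K_op b (weak_deriv u))" by simp
  have "AE \<xi> in lborel. fourier_real (K_op b (weak_deriv u)) \<xi> = complex_of_real (m \<xi>) * fourier_real (weak_deriv u) \<xi>"
    by (rule is_fourier_L2_unique[OF is_fourier_real[OF si] K]) simp
  moreover have "AE \<xi> in lborel. fourier_real (weak_deriv u) \<xi> = fh w' \<xi>"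
    unfolding fh_def by (rule fourier_real_cong_AE[OF wd]) simp
  ultimately show "AE \<xi> in lborel. fourier_real (K_op b (weak_deriv u)) \<xi> = \<i> * complex_of_real \<xi> * m \<xi> * fh w \<xi>"
    using is_deriv_fh[OF w] by eventually_elim simp
qed

lemma K_op_val:
  assumes mb: "\<And>\<xi>. sqrt (Re (b \<xi>)) = m \<xi>" and w: "is_deriv w w'" and K: "Kdx w g"
  shows "AE x in lborel. K_op b (weak_deriv (val w)) x = val g x"
proof -
  note k = K_op_weak_deriv[OF mb w AE_I2 square_integrable_val, OF refl]
  have "AE \<xi> in lborel. fourier_real (K_op b (weak_deriv (val w))) \<xi> = fh g \<xi>"
    using k(2) K[unfolded Kdx_def] by eventually_elim simp
  from is_fourier_L2_inj[OF is_fourier_real[OF k(1)] is_fourier_fh this]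
  show ?thesis by (rule eventually_mono) simp
qed

end

section \<open>The Cauchy problem\<close>

lemma sobolev_norm_nonneg: "0 \<le> sobolev_norm r u"
  unfolding sobolev_norm_def by (intro real_sqrt_ge_zero integral_nonneg_AE AE_I2) simp

text \<open>A Lipschitz bound in \<open>L^2\<close> and a bound in \<open>H^N\<close> interpolate to
  continuity in \<open>H^\<sigma>\<close> for \<open>\<sigma> < N\<close>.\<close>

lemma curve_continuous:
  assumes w: "\<And>t. t \<in> S \<Longrightarrow> HN N (w t) C" "\<And>s t. s \<in> S \<Longrightarrow> t \<in> S \<Longrightarrow> l2 (w s - w t) \<le> L * \<bar>s - t\<bar>"
    and \<sigma>: "0 \<le> \<sigma>" "\<sigma> < real N" and t: "t \<in> S"
  shows "((\<lambda>\<tau>. sobolev_norm \<sigma> (val (w \<tau> - w t))) \<longlongrightarrow> 0) (at t within S)"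
proof (rule tendstoI)
  fix e :: real assume e: "0 < e"
  obtain \<delta> where \<delta>: "0 < \<delta>" "\<And>z. HN N z (C + C) \<Longrightarrow> l2 z \<le> \<delta> \<Longrightarrow> sobolev_norm \<sigma> (val z) < e"
    using HN_interpolation[OF \<sigma> e, of "C + C"] HN_nonneg[OF w(1)[OF t]] by auto
  have "((\<lambda>\<tau>. L * \<bar>\<tau> - t\<bar>) \<longlongrightarrow> L * \<bar>t - t\<bar>) (at t within S)" by (intro tendsto_intros)
  then have "\<forall>\<^sub>F \<tau> in at t within S. L * \<bar>\<tau> - t\<bar> < \<delta>" using \<delta>(1) by (auto dest: order_tendstoD(2))
  moreover have "\<forall>\<^sub>F \<tau> in at t within S. \<tau> \<in> S" by (simp add: eventually_at_filter)
  ultimately show "\<forall>\<^sub>F \<tau> in at t within S. dist (sobolev_norm \<sigma> (val (w \<tau> - w t))) 0 < e"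
  proof eventually_elim
    case (elim \<tau>)
    have "sobolev_norm \<sigma> (val (w \<tau> - w t)) < e"
      by (rule \<delta>(2)[OF HN_diff[OF w(1)[OF elim(2)] w(1)[OF t]] order_trans[OF w(2)[OF elim(2) t]]])
        (use elim(1) in simp)
    then show ?case unfolding dist_real_def using sobolev_norm_nonneg[of \<sigma> "val (w \<tau> - w t)"] by linarith
  qed
qed

text \<open>The Lipschitz bound keeps the difference quotients bounded in \<open>H^N\<close>, and
  they converge in the algebra, hence in \<open>L^2\<close>; interpolation gives convergence in
  \<open>H^r\<close>.\<close>

lemma curve_has_sobolev_derivative:
  assumes w: "(w has_vector_derivative g) (at t within S)" and lip: "\<And>\<tau>. \<tau> \<in> S \<Longrightarrow> HN N (w \<tau> - w t) (L * \<bar>\<tau> - t\<bar>)"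
    and g: "HN N g C" and r: "0 \<le> r" "r < real N" and mem: "\<And>\<tau>. \<tau> \<in> S \<Longrightarrow> val (w \<tau>) \<in> sobolev r"
    and f: "AE x in lborel. f x = val g x" "square_integrable f"
  shows "has_sobolev_derivative r (\<lambda>\<tau>. val (w \<tau>)) f t S"
  unfolding has_sobolev_derivative_def
proof (intro conjI ballI mem)
  show "f \<in> sobolev r"
    using sobolev_cong_AE(1)[OF f square_integrable_val] HN_sobolev_mem[OF g r] by simp
  define Q where "Q \<tau> = (1 / (\<tau> - t)) *\<^sub>R (w \<tau> - w t) - g" for \<tau>
  have eq: "sobolev_norm r (\<lambda>x. (val (w \<tau>) x - val (w t) x) / (\<tau> - t) - f x) = sobolev_norm r (val (Q \<tau>))" for \<tau>
  proof (rule sobolev_cong_AE(2))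
    show "AE x in lborel. (val (w \<tau>) x - val (w t) x) / (\<tau> - t) - f x = val (Q \<tau>) x"
      using f(1) by eventually_elim (simp add: Q_def val_simps)
    have "square_integrable (\<lambda>x. val ((1 / (\<tau> - t)) *\<^sub>R (w \<tau> - w t)) x - f x)"
      by (intro square_integrable_diff square_integrable_val f)
    then show "square_integrable (\<lambda>x. (val (w \<tau>) x - val (w t) x) / (\<tau> - t) - f x)" by (simp add: val_simps)
  qed simp
  have Q0: "((\<lambda>\<tau>. norm (Q \<tau>)) \<longlongrightarrow> 0) (at t within S)"
    using w unfolding has_vector_derivative_quotient_iff Q_def by (rule tendsto_norm_zero)
  show "((\<lambda>\<tau>. sobolev_norm r (\<lambda>x. (val (w \<tau>) x - val (w t) x) / (\<tau> - t) - f x)) \<longlongrightarrow> 0) (at t within S)"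
    unfolding eq
  proof (rule tendstoI)
    fix e :: real assume e: "0 < e"
    have L: "0 \<le> \<bar>L\<bar> + C" using HN_nonneg[OF g] by simp
    obtain \<delta> where \<delta>: "0 < \<delta>" "\<And>z. HN N z (\<bar>L\<bar> + C) \<Longrightarrow> l2 z \<le> \<delta> \<Longrightarrow> sobolev_norm r (val z) < e"
      using HN_interpolation[OF r e L] by blast
    have "\<forall>\<^sub>F \<tau> in at t within S. norm (Q \<tau>) < \<delta>" using Q0 \<delta>(1) by (rule order_tendstoD(2))
    moreover have "\<forall>\<^sub>F \<tau> in at t within S. \<tau> \<in> S \<and> \<tau> \<noteq> t" by (simp add: eventually_at_filter)
    ultimately show "\<forall>\<^sub>F \<tau> in at t within S. dist (sobolev_norm r (val (Q \<tau>))) 0 < e"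
    proof eventually_elim
      case (elim \<tau>)
      have "\<bar>1 / (\<tau> - t)\<bar> * (L * \<bar>\<tau> - t\<bar>) \<le> \<bar>L\<bar>" using elim(2) by (simp add: abs_divide)
      then have "HN N (Q \<tau>) (\<bar>L\<bar> + C)"
        unfolding Q_def using elim(2) by (intro HN_diff[OF HN_mono[OF HN_scaleR[OF lip]] g]) auto
      then have "sobolev_norm r (val (Q \<tau>)) < e"
        by (rule \<delta>(2)) (use elim(1) l2n_val_le[of "Q \<tau>"] in linarith)
      then show ?case unfolding dist_real_def using sobolev_norm_nonneg[of r "val (Q \<tau>)"] by linarith
    qed
  qed
qed

lemma cr_val:
  assumes "val w \<in> sobolev r" "1 \<le> r"
  shows "cr (val w) = w"
  by (rule cbl2_eqI_AE) (use cr(2)[OF assms] in \<open>auto elim: eventually_mono\<close>)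

lemma cr_cong:
  assumes "AE x in lborel. u x = w x" "u \<in> sobolev r" "w \<in> sobolev r" "1 \<le> r"
  shows "cr u = cr w"
  by (rule cbl2_eqI_AE) (use assms(1) cr(2)[OF assms(2,4)] cr(2)[OF assms(3,4)] in eventually_elim, simp)

text \<open>The embedding of \<open>H^r\<close> into the algebra turns convergence of the quotients
  in \<open>H^r\<close> into convergence of continuous representatives. This brings an arbitrary
  competitor into the setting of \<open>curves_unique\<close>.\<close>

lemma sobolev_derivative_imp_vector_derivative:
  assumes d: "has_sobolev_derivative r u f t S" and r: "1 \<le> r" and t: "t \<in> S"
  shows "((\<lambda>\<tau>. cr (u \<tau>)) has_vector_derivative cr f) (at t within S)"
  unfolding has_vector_derivative_quotient_iff
proof (rule Lim_null_comparison)
  have mem: "\<And>\<tau>. \<tau> \<in> S \<Longrightarrow> u \<tau> \<in> sobolev r" "f \<in> sobolev r"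
    and lim: "((\<lambda>\<tau>. sobolev_norm r (\<lambda>x. (u \<tau> x - u t x) / (\<tau> - t) - f x)) \<longlongrightarrow> 0) (at t within S)"
    using d by (auto simp: has_sobolev_derivative_def)
  define Q where "Q \<tau> = (1 / (\<tau> - t)) *\<^sub>R (cr (u \<tau>) - cr (u t)) - cr f" for \<tau>
  have le: "norm (Q \<tau>) \<le> (2 * \<kappa> + 1) * sobolev_norm r (\<lambda>x. (u \<tau> x - u t x) / (\<tau> - t) - f x)" if \<tau>: "\<tau> \<in> S" for \<tau>
  proof -
    have "val (1 *\<^sub>R cr (u \<tau>) - cr (u t)) \<in> sobolev r" by (intro sobolev_val_diff cr(3)[OF _ r] mem \<tau> t)
    then have Q: "val (Q \<tau>) \<in> sobolev r" unfolding Q_def by (intro sobolev_val_diff cr(3)[OF _ r] mem) simp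
    have si: "square_integrable (\<lambda>x. inverse (\<tau> - t) * (u \<tau> x - u t x) - f x)"
      by (intro square_integrable_diff square_integrable_mult_left sobolev_square_integrable[OF mem(1)] sobolev_square_integrable[OF mem(2)] \<tau> t)
    have "sobolev_norm r (\<lambda>x. (u \<tau> x - u t x) / (\<tau> - t) - f x) = sobolev_norm r (val (Q \<tau>))"
    proof (rule sobolev_cong_AE(2))
      show "AE x in lborel. (u \<tau> x - u t x) / (\<tau> - t) - f x = val (Q \<tau>) x"
        using cr(2)[OF mem(1)[OF \<tau>] r] cr(2)[OF mem(1)[OF t] r] cr(2)[OF mem(2) r]
        by eventually_elim (simp add: Q_def val_simps)
      show "square_integrable (\<lambda>x. (u \<tau> x - u t x) / (\<tau> - t) - f x)"
        using si by (simp add: divide_inverse mult.commute)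
    qed simp
    then show ?thesis using norm_le_sobolev_norm[OF Q r] by simp
  qed
  show "\<forall>\<^sub>F \<tau> in at t within S. norm ((1 / (\<tau> - t)) *\<^sub>R (cr (u \<tau>) - cr (u t)) - cr f)
      \<le> (2 * \<kappa> + 1) * sobolev_norm r (\<lambda>x. (u \<tau> x - u t x) / (\<tau> - t) - f x)"
    using le by (auto simp: eventually_at_filter Q_def)
  show "((\<lambda>\<tau>. (2 * \<kappa> + 1) * sobolev_norm r (\<lambda>x. (u \<tau> x - u t x) / (\<tau> - t) - f x)) \<longlongrightarrow> 0) (at t within S)"
    by (rule tendsto_mult_right_zero[OF lim])
qed

context symbol
begin

text \<open>Translates the limit curves into the Sobolev setting: states in
  \<open>H^\<sigma>\<close>, velocities in \<open>H^(\<sigma>-1)\<close>, with room below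
  \<open>N\<close> and \<open>N - 1\<close> for interpolation. The weight constants \<open>L\<close>
  and \<eta> are parameters, so that the bound on the solution is the same for all
  \<epsilon>.\<close>

lemma existence:
  fixes M R c T \<sigma> :: real
  assumes mb: "\<And>\<xi>. sqrt (Re (b \<xi>)) = m \<xi>"
    and N: "3 \<le> N" and data: "HN N u0 M" "HN N v0 M"
    and R: "R\<^sup>2 = 3 * (4 * M\<^sup>2) + 2" "0 \<le> R" and \<epsilon>: "0 < \<epsilon>"
    and small: "\<epsilon> ^ Suc k * (real (k + 2) * sup_const R ^ (k + 1)) \<le> 1 / 2"
    and T: "0 \<le> T" "2 * growth_const N k R * T \<le> 1"
    and \<sigma>: "2 \<le> \<sigma>" "\<sigma> < real N" and L: "0 \<le> L" "0 \<le> \<eta>" "\<And>\<xi>. (1 + \<xi>\<^sup>2) powr (\<sigma> / 2) \<le> L + \<eta> * \<bar>\<xi>\<bar> ^ N"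
  obtains u v where "u 0 = u0" "v 0 = v0" "\<And>t x. t \<in> {0..T / \<epsilon> ^ Suc k} \<Longrightarrow> \<bar>val (u t) x\<bar> \<le> sup_const R"
    "X_continuous_on \<sigma> {0..T / \<epsilon> ^ Suc k} (\<lambda>t. (val (u t), val (v t)))"
    "\<And>t. t \<in> {0..T / \<epsilon> ^ Suc k} \<Longrightarrow> X_norm \<sigma> (val (u t), val (v t)) \<le> 2 * (3 * L * (3 * R) + \<eta> * (3 * R))"
    "solves_system b (Suc k) \<epsilon> \<sigma> {0..T / \<epsilon> ^ Suc k} (\<lambda>t. (val (u t), val (v t)))"
proof -
  define c where "c = \<epsilon> ^ Suc k"
  have c: "0 < c" using \<epsilon> by (simp add: c_def)
  define I where "I = {0..T / c}"
  obtain u v CL where init: "u 0 = u0" "v 0 = v0"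
    and hu: "\<And>t. t \<in> I \<Longrightarrow> HN N (u t) (3 * R)" and hv: "\<And>t. t \<in> I \<Longrightarrow> HN N (v t) (3 * R)"
    and hg: "\<And>t. t \<in> I \<Longrightarrow> HN N (u t + c *\<^sub>R pw (u t) (Suc k)) (3 * R + c * (3 * pw_const N k R))"
    and du: "\<And>t. t \<in> I \<Longrightarrow> (u has_vector_derivative AA (v t)) (at t within I)"
    and dv: "\<And>t. t \<in> I \<Longrightarrow> (v has_vector_derivative AA (u t + c *\<^sub>R pw (u t) (Suc k))) (at t within I)"
    and lu: "\<And>s t. s \<in> I \<Longrightarrow> t \<in> I \<Longrightarrow> HN (N - 1) (u s - u t) (CL * \<bar>s - t\<bar>)"
    and lv: "\<And>s t. s \<in> I \<Longrightarrow> t \<in> I \<Longrightarrow> HN (N - 1) (v s - v t) (CL * \<bar>s - t\<bar>)"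
    and sup: "\<And>t x. t \<in> I \<Longrightarrow> \<bar>val (u t) x\<bar> \<le> sup_const R"
    unfolding I_def by (rule limit_solution[OF N data R c small[folded c_def] T]) blast
  have N2: "2 \<le> N" using N by simp
  have \<sigma>0: "0 \<le> \<sigma>" "0 \<le> \<sigma> - 1" "\<sigma> - 1 < real (N - 1)" using \<sigma> N by auto
  have r1: "\<sigma> - 1 < real N" using \<sigma> by simp
  have mem: "val (u t) \<in> sobolev \<sigma>" "val (v t) \<in> sobolev \<sigma>" if "t \<in> I" for t
    using HN_sobolev_mem[OF hu[OF that] \<sigma>0(1) \<sigma>(2)] HN_sobolev_mem[OF hv[OF that] \<sigma>0(1) \<sigma>(2)] .
  have mem1: "val (u t) \<in> sobolev (\<sigma> - 1)" "val (v t) \<in> sobolev (\<sigma> - 1)" if "t \<in> I" for t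
    using HN_sobolev_mem[OF hu[OF that] \<sigma>0(2) r1] HN_sobolev_mem[OF hv[OF that] \<sigma>0(2) r1] .
  have bd: "sobolev_norm \<sigma> (val w) \<le> 3 * L * (3 * R) + \<eta> * (3 * R)" if w: "HN N w (3 * R)" for w
  proof -
    have "3 * L * l2 w \<le> 3 * L * (3 * R)" using w L(1) by (intro mult_left_mono) (auto simp: HN_def)
    then show ?thesis using HN_sobolev(2)[OF w L] by simp
  qed
  have cont: "X_continuous_on \<sigma> I (\<lambda>t. (val (u t), val (v t)))"
    unfolding X_continuous_on_def
  proof (intro conjI ballI)
    fix t assume t: "t \<in> I"
    show "(val (u t), val (v t)) \<in> X_space \<sigma>" using mem[OF t] by (simp add: X_space_def)
    have "((\<lambda>\<tau>. sobolev_norm \<sigma> (val (u \<tau> - u t)) + sobolev_norm \<sigma> (val (v \<tau> - v t))) \<longlongrightarrow> 0 + 0) (at t within I)"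
      by (intro tendsto_add curve_continuous[OF hu _ \<sigma>0(1) \<sigma>(2) t] curve_continuous[OF hv _ \<sigma>0(1) \<sigma>(2) t])
        (use lu lv in \<open>auto simp: HN_def\<close>)
    then show "((\<lambda>\<tau>. X_norm \<sigma> (state_diff (val (u \<tau>), val (v \<tau>)) (val (u t), val (v t)))) \<longlongrightarrow> 0) (at t within I)"
      by (simp add: X_norm_def state_diff_def val_minus)
  qed
  have sys: "solves_system b (Suc k) \<epsilon> \<sigma> I (\<lambda>t. (val (u t), val (v t)))"
    unfolding solves_system_def Let_def fst_conv snd_conv
  proof (intro ballI conjI)
    fix t assume t: "t \<in> I"
    obtain u' v' where u': "is_deriv (u t) u'" and v': "is_deriv (v t) v'"
      using sobolev_is_deriv[OF mem(1)[OF t] \<sigma>(1)] sobolev_is_deriv[OF mem(2)[OF t] \<sigma>(1)] by blast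
    have Kv: "Kdx (v t) (AA (v t))" unfolding Kdx_def by (rule fh_AA[OF hv[OF t] N2])
    show "has_sobolev_derivative (\<sigma> - 1) (\<lambda>t. val (u t)) (K_op b (weak_deriv (val (v t)))) t I"
    proof (rule curve_has_sobolev_derivative[OF du[OF t] lu[OF _ t] HN_AA[OF hv[OF t] N2] \<sigma>0(2,3) mem1(1)])
      show "AE x in lborel. K_op b (weak_deriv (val (v t))) x = val (AA (v t)) x"
        by (rule K_op_val[OF mb v' Kv])
      show "square_integrable (K_op b (weak_deriv (val (v t))))"
        by (rule K_op_weak_deriv(1)[OF mb v']) simp_all
    qed
    let ?f = "\<lambda>x. K_op b (weak_deriv (val (u t))) x + \<epsilon> ^ Suc k * K_op b (weak_deriv (\<lambda>y. val (u t) y ^ (Suc k + 1))) x"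
    have pw: "(\<lambda>y. val (u t) y ^ (Suc k + 1)) = val (pw (u t) (Suc k))" by (rule ext) (rule val_pw[symmetric])
    note pw' = is_deriv_pw[OF u', of k]
    note Ku = K_op_weak_deriv[OF mb u' AE_I2 square_integrable_val, OF refl]
    note Kp = K_op_weak_deriv[OF mb pw' AE_I2 square_integrable_val, OF refl]
    show "has_sobolev_derivative (\<sigma> - 1) (\<lambda>t. val (v t)) ?f t I"
    proof (rule curve_has_sobolev_derivative[OF dv[OF t] lv[OF _ t] HN_AA[OF hg[OF t] N2] \<sigma>0(2,3) mem1(2)])
      show si: "square_integrable ?f"
        unfolding pw by (intro square_integrable_add square_integrable_mult_left Ku(1) Kp(1))
      have four: "is_fourier_L2 (\<lambda>x. complex_of_real (?f x))
          (\<lambda>\<xi>. fourier_real (K_op b (weak_deriv (val (u t)))) \<xi> + complex_of_real c * fourier_real (K_op b (weak_deriv (val (pw (u t) (Suc k))))) \<xi>)"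
        using is_fourier_L2_add[OF is_fourier_real[OF Ku(1)] is_fourier_L2_cmult[OF is_fourier_real[OF Kp(1)], of "complex_of_real c"]]
        by (simp only: pw c_def of_real_add of_real_mult)
      have eq: "AE \<xi> in lborel. fourier_real (K_op b (weak_deriv (val (u t)))) \<xi> + complex_of_real c * fourier_real (K_op b (weak_deriv (val (pw (u t) (Suc k))))) \<xi>
          = fh (AA (u t + c *\<^sub>R pw (u t) (Suc k))) \<xi>"
        using Ku(2) Kp(2) fh_AA[OF hg[OF t] N2] fh_add[of "u t" "c *\<^sub>R pw (u t) (Suc k)"] fh_scaleR[of c "pw (u t) (Suc k)"]
      proof eventually_elim
        case (elim \<xi>)
        show ?case unfolding elim by (simp add: algebra_simps)
      qed
      from is_fourier_L2_inj[OF four is_fourier_fh eq]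
      show "AE x in lborel. ?f x = val (AA (u t + c *\<^sub>R pw (u t) (Suc k))) x"
        by (rule eventually_mono) (simp only: of_real_eq_iff)
    qed
  qed
  show ?thesis
  proof (rule that[of u v])
    show "u 0 = u0" "v 0 = v0" by (rule init)+
    show "X_continuous_on \<sigma> {0..T / \<epsilon> ^ Suc k} (\<lambda>t. (val (u t), val (v t)))" using cont unfolding I_def c_def .
    show "solves_system b (Suc k) \<epsilon> \<sigma> {0..T / \<epsilon> ^ Suc k} (\<lambda>t. (val (u t), val (v t)))" using sys unfolding I_def c_def .
    fix t assume "t \<in> {0..T / \<epsilon> ^ Suc k}"
    then have t: "t \<in> I" by (simp add: I_def c_def)
    show "\<bar>val (u t) x\<bar> \<le> sup_const R" for x by (rule sup[OF t])
    show "X_norm \<sigma> (val (u t), val (v t)) \<le> 2 * (3 * L * (3 * R) + \<eta> * (3 * R))"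
      using bd[OF hu[OF t]] bd[OF hv[OF t]] by (simp add: X_norm_def)
  qed
qed

text \<open>Since \<open>\<sigma> \<ge> 2\<close>, velocities lie in \<open>H^(\<sigma>-1)\<close>
  with \<open>\<sigma> - 1 \<ge> 1\<close>, where continuous representatives exist; thus any
  solution yields curves in the algebra. The last conclusion supplies the sup bound on the velocity
  of \<open>u\<close> needed by \<open>curves_unique\<close>.\<close>

lemma solution_curves:
  assumes mb: "\<And>\<xi>. sqrt (Re (b \<xi>)) = m \<xi>" and \<sigma>: "2 \<le> \<sigma>"
    and mem: "\<And>t. t \<in> S \<Longrightarrow> U t \<in> X_space \<sigma>" and bd: "\<And>t. t \<in> S \<Longrightarrow> X_norm \<sigma> (U t) \<le> M"
    and sys: "solves_system b (Suc k) \<epsilon> \<sigma> S U"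
  defines "u \<equiv> \<lambda>t. cr (fst (U t))" and "v \<equiv> \<lambda>t. cr (snd (U t))"
  obtains gu gv where "\<And>t. t \<in> S \<Longrightarrow> (u has_vector_derivative gu t) (at t within S)"
    "\<And>t. t \<in> S \<Longrightarrow> (v has_vector_derivative gv t) (at t within S)"
    "\<And>t. t \<in> S \<Longrightarrow> Kdx (v t) (gu t)" "\<And>t. t \<in> S \<Longrightarrow> Kdx (u t + \<epsilon> ^ Suc k *\<^sub>R pw (u t) (Suc k)) (gv t)"
    "\<And>t x. t \<in> S \<Longrightarrow> \<bar>val (gu t) x\<bar> \<le> (2 * \<kappa> + 1) * (B * M)"
proof -
  define c where "c = \<epsilon> ^ Suc k"
  define fu where "fu t = K_op b (weak_deriv (snd (U t)))" for t
  define fv where "fv t = (\<lambda>x. K_op b (weak_deriv (fst (U t))) x + c * K_op b (weak_deriv (\<lambda>y. fst (U t) y ^ (Suc k + 1))) x)" for t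
  have d: "has_sobolev_derivative (\<sigma> - 1) (\<lambda>t. fst (U t)) (fu t) t S" "has_sobolev_derivative (\<sigma> - 1) (\<lambda>t. snd (U t)) (fv t) t S"
    if "t \<in> S" for t
    using sys that unfolding solves_system_def Let_def fu_def fv_def c_def by blast+
  have \<sigma>1: "1 \<le> \<sigma>" "1 \<le> \<sigma> - 1" using \<sigma> by auto
  have uv: "fst (U t) \<in> sobolev \<sigma>" "snd (U t) \<in> sobolev \<sigma>" if "t \<in> S" for t
    using mem[OF that] by (auto simp: X_space_def mem_Times_iff)
  have fmem: "fu t \<in> sobolev (\<sigma> - 1)" "fv t \<in> sobolev (\<sigma> - 1)" if "t \<in> S" for t
    using d[OF that] by (auto simp: has_sobolev_derivative_def)
  have ut: "u t = cr (fst (U t))" and vt: "v t = cr (snd (U t))" for t by (simp_all add: u_def v_def)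
  have Kv: "Kdx (v t) (cr (fu t))" if t: "t \<in> S" for t
  proof -
    note v = cr[OF uv(2)[OF t] \<sigma>1(1), folded vt]
    obtain v' where v': "is_deriv (v t) v'" using sobolev_is_deriv[OF v(3) \<sigma>] by blast
    note k = K_op_weak_deriv(2)[OF mb v' v(2) sobolev_square_integrable[OF uv(2)[OF t]]]
    show ?thesis
      unfolding Kdx_def using k cr(1)[OF fmem(1)[OF t] \<sigma>1(2)] unfolding fu_def by eventually_elim simp
  qed
  have Ku: "Kdx (u t + c *\<^sub>R pw (u t) (Suc k)) (cr (fv t))" if t: "t \<in> S" for t
  proof -
    note u = cr[OF uv(1)[OF t] \<sigma>1(1), folded ut]
    obtain u' where u': "is_deriv (u t) u'" using sobolev_is_deriv[OF u(3) \<sigma>] by blast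
    have usi: "square_integrable (fst (U t))" by (rule sobolev_square_integrable[OF uv(1)[OF t]])
    have pAE: "AE x in lborel. fst (U t) x ^ (Suc k + 1) = val (pw (u t) (Suc k)) x"
      using u(2) by eventually_elim (simp only: val_pw)
    have psi: "square_integrable (\<lambda>x. fst (U t) x ^ (Suc k + 1))"
    proof (rule square_integrable_cong_AE[OF _ square_integrable_val[of "pw (u t) (Suc k)"]])
      show "AE x in lborel. val (pw (u t) (Suc k)) x = fst (U t) x ^ (Suc k + 1)"
        using pAE by (rule eventually_mono) (rule sym)
      have [measurable]: "fst (U t) \<in> borel_measurable borel" using usi by auto
      show "(\<lambda>x. fst (U t) x ^ (Suc k + 1)) \<in> borel_measurable borel" by measurable
    qed
    note k = K_op_weak_deriv[OF mb u' u(2) usi]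
    note kp = K_op_weak_deriv[OF mb is_deriv_pw[OF u', of k] pAE psi]
    have four: "is_fourier_L2 (\<lambda>x. complex_of_real (fv t x))
        (\<lambda>\<xi>. fourier_real (K_op b (weak_deriv (fst (U t)))) \<xi> + complex_of_real c * fourier_real (K_op b (weak_deriv (\<lambda>y. fst (U t) y ^ (Suc k + 1)))) \<xi>)"
      using is_fourier_L2_add[OF is_fourier_real[OF k(1)] is_fourier_L2_cmult[OF is_fourier_real[OF kp(1)], of "complex_of_real c"]]
      by (simp only: fv_def of_real_add of_real_mult)
    have "AE \<xi> in lborel. fourier_real (fv t) \<xi> =
        fourier_real (K_op b (weak_deriv (fst (U t)))) \<xi> + complex_of_real c * fourier_real (K_op b (weak_deriv (\<lambda>y. fst (U t) y ^ (Suc k + 1)))) \<xi>"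
      by (rule is_fourier_L2_unique[OF is_fourier_real four]) (simp_all add: sobolev_square_integrable[OF fmem(2)[OF t]])
    then show ?thesis
      unfolding Kdx_def
      using k(2) kp(2) cr(1)[OF fmem(2)[OF t] \<sigma>1(2)] fh_add[of "u t" "c *\<^sub>R pw (u t) (Suc k)"] fh_scaleR[of c "pw (u t) (Suc k)"]
    proof eventually_elim
      case (elim \<xi>)
      show ?case unfolding elim by (simp add: algebra_simps)
    qed
  qed
  show ?thesis
  proof (rule that[of "\<lambda>t. cr (fu t)" "\<lambda>t. cr (fv t)"])
    fix t assume t: "t \<in> S"
    show "(u has_vector_derivative cr (fu t)) (at t within S)" "(v has_vector_derivative cr (fv t)) (at t within S)"
      unfolding u_def v_def by (intro sobolev_derivative_imp_vector_derivative[OF _ \<sigma>1(2) t] d t)+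
    show "Kdx (v t) (cr (fu t))" by (rule Kv[OF t])
    show "Kdx (u t + \<epsilon> ^ Suc k *\<^sub>R pw (u t) (Suc k)) (cr (fv t))" using Ku[OF t] unfolding c_def .
    fix x
    note v = cr[OF uv(2)[OF t] \<sigma>1(1), folded vt]
    note g = Kdx_sobolev[OF v(3) Kv[OF t]]
    have "sobolev_norm \<sigma> (val (v t)) \<le> M"
      using bd[OF t] sobolev_norm_nonneg[of \<sigma> "fst (U t)"] unfolding v(4) X_norm_def by linarith
    then have "B * sobolev_norm \<sigma> (val (v t)) \<le> B * M" by (rule mult_left_mono[OF _ B_nonneg])
    then have "(2 * \<kappa> + 1) * sobolev_norm (\<sigma> - 1) (val (cr (fu t))) \<le> (2 * \<kappa> + 1) * (B * M)"
      using g(2) \<kappa>_nonneg by (intro mult_left_mono) auto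
    then show "\<bar>val (cr (fu t)) x\<bar> \<le> (2 * \<kappa> + 1) * (B * M)"
      using abs_val_le[of "cr (fu t)" x] norm_le_sobolev_norm[OF g(1) \<sigma>1(2)] by linarith
  qed
qed

text \<open>Only \<open>U\<close> carries the sup bound \<open>S\<close>; that of the competitor
  \<open>V\<close> comes from the bootstrap in \<open>curves_unique\<close>, which is why
  \<open>small\<close> involves \<open>S + 1\<close>.\<close>

lemma uniqueness:
  assumes mb: "\<And>\<xi>. sqrt (Re (b \<xi>)) = m \<xi>" and \<sigma>: "2 \<le> \<sigma>" and \<epsilon>: "0 < \<epsilon>" and T: "0 \<le> T"
    and small: "\<epsilon> ^ Suc k * (real (k + 2) * (S + 1) ^ (k + 1)) \<le> 1 / 2"
    and U: "\<And>t. t \<in> {0..T} \<Longrightarrow> U t \<in> X_space \<sigma>" "\<And>t. t \<in> {0..T} \<Longrightarrow> X_norm \<sigma> (U t) \<le> M"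
      "solves_system b (Suc k) \<epsilon> \<sigma> {0..T} U"
    and V: "\<And>t. t \<in> {0..T} \<Longrightarrow> V t \<in> X_space \<sigma>" "\<And>t. t \<in> {0..T} \<Longrightarrow> X_norm \<sigma> (V t) \<le> M"
      "solves_system b (Suc k) \<epsilon> \<sigma> {0..T} V"
    and S: "\<And>t x. t \<in> {0..T} \<Longrightarrow> \<bar>val (cr (fst (U t))) x\<bar> \<le> S" and init: "state_eq (V 0) (U 0)"
    and t: "t \<in> {0..T}"
  shows "state_eq (V t) (U t)"
proof -
  have \<sigma>1: "1 \<le> \<sigma>" using \<sigma> by simp
  have mem: "fst w \<in> sobolev \<sigma>" "snd w \<in> sobolev \<sigma>" if "w \<in> X_space \<sigma>" for w
    using that by (auto simp: X_space_def mem_Times_iff)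
  obtain gu gv where g: "\<And>t. t \<in> {0..T} \<Longrightarrow> ((\<lambda>t. cr (fst (U t))) has_vector_derivative gu t) (at t within {0..T})"
    "\<And>t. t \<in> {0..T} \<Longrightarrow> ((\<lambda>t. cr (snd (U t))) has_vector_derivative gv t) (at t within {0..T})"
    "\<And>t. t \<in> {0..T} \<Longrightarrow> Kdx (cr (snd (U t))) (gu t)" "\<And>t. t \<in> {0..T} \<Longrightarrow> Kdx (cr (fst (U t)) + \<epsilon> ^ Suc k *\<^sub>R pw (cr (fst (U t))) (Suc k)) (gv t)"
    "\<And>t x. t \<in> {0..T} \<Longrightarrow> \<bar>val (gu t) x\<bar> \<le> (2 * \<kappa> + 1) * (B * M)"
    by (rule solution_curves[OF mb \<sigma> U]) (assumption, assumption, blast)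
  obtain gu' gv' where g': "\<And>t. t \<in> {0..T} \<Longrightarrow> ((\<lambda>t. cr (fst (V t))) has_vector_derivative gu' t) (at t within {0..T})"
    "\<And>t. t \<in> {0..T} \<Longrightarrow> ((\<lambda>t. cr (snd (V t))) has_vector_derivative gv' t) (at t within {0..T})"
    "\<And>t. t \<in> {0..T} \<Longrightarrow> Kdx (cr (snd (V t))) (gu' t)" "\<And>t. t \<in> {0..T} \<Longrightarrow> Kdx (cr (fst (V t)) + \<epsilon> ^ Suc k *\<^sub>R pw (cr (fst (V t))) (Suc k)) (gv' t)"
    "\<And>t x. t \<in> {0..T} \<Longrightarrow> \<bar>val (gu' t) x\<bar> \<le> (2 * \<kappa> + 1) * (B * M)"
    by (rule solution_curves[OF mb \<sigma> V]) (assumption, assumption, blast)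
  have 0: "0 \<in> {0..T}" using T by simp
  have i: "cr (fst (V 0)) = cr (fst (U 0))" "cr (snd (V 0)) = cr (snd (U 0))"
    using init unfolding state_eq_def
    by (auto intro!: cr_cong[OF _ _ _ \<sigma>1] mem U(1)[OF 0] V(1)[OF 0] elim: eventually_mono)
  have c: "0 \<le> \<epsilon> ^ Suc k" using \<epsilon> by simp
  have "cr (fst (V t)) = cr (fst (U t))" "cr (snd (V t)) = cr (snd (U t))"
    using curves_unique[OF c small g(1-4) g'(1-4) i S g(5) g'(5) t] by auto
  then show ?thesis
    unfolding state_eq_def
    using cr(2)[OF mem(1)[OF U(1)[OF t]] \<sigma>1] cr(2)[OF mem(2)[OF U(1)[OF t]] \<sigma>1]
      cr(2)[OF mem(1)[OF V(1)[OF t]] \<sigma>1] cr(2)[OF mem(2)[OF V(1)[OF t]] \<sigma>1]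
    by (auto elim!: eventually_elim2 simp: eventually_conj_iff)
qed

end

section \<open>From kernels to symbols\<close>

lemma char_measurable:
  assumes "finite_borel_measure \<mu>"
  shows "char \<mu> \<in> borel_measurable borel"
proof -
  interpret finite_borel_measure \<mu> by (rule assms)
  have "(\<lambda>(t, x). iexp (t * x)) \<in> borel_measurable (borel \<Otimes>\<^sub>M borel)" by measurable
  then have "(\<lambda>(t, x). iexp (t * x)) \<in> borel_measurable (borel \<Otimes>\<^sub>M \<mu>)"
    using measurable_cong_sets[OF sets_pair_measure_cong[OF refl M_is_borel] refl] by blast
  then have "(\<lambda>t. CLINT x|\<mu>. iexp (t * x)) \<in> borel_measurable borel" by (rule borel_measurable_lebesgue_integral)
  then show ?thesis unfolding char_def .
qed

lemma char_uminus: "char \<mu> (- t) = cnj (char \<mu> t)"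
proof -
  have "(CLINT x|\<mu>. iexp (- t * x)) = (CLINT x|\<mu>. cnj (iexp (t * x)))"
    by (intro Bochner_Integration.integral_cong refl) (simp add: exp_cnj)
  then show ?thesis unfolding char_def by (rule trans[OF _ Bochner_Integration.integral_cnj])
qed

lemma symbol_sqrt_kernel:
  assumes "finite_borel_measure \<mu>" "finite_borel_measure \<nu>" "nonneg_bounded_symbol (kernel_fourier \<mu> \<nu>) C"
  shows "symbol (\<lambda>\<xi>. sqrt (Re (kernel_fourier \<mu> \<nu> \<xi>))) (sqrt C)"
proof
  have [measurable]: "char \<mu> \<in> borel_measurable borel" "char \<nu> \<in> borel_measurable borel"
    by (intro char_measurable assms)+
  show "(\<lambda>\<xi>. sqrt (Re (kernel_fourier \<mu> \<nu> \<xi>))) \<in> borel_measurable borel"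
    unfolding kernel_fourier_def by measurable
  fix \<xi>
  show "sqrt (Re (kernel_fourier \<mu> \<nu> (- \<xi>))) = sqrt (Re (kernel_fourier \<mu> \<nu> \<xi>))"
    by (simp add: kernel_fourier_def char_uminus)
  show "0 \<le> sqrt (Re (kernel_fourier \<mu> \<nu> \<xi>))" "sqrt (Re (kernel_fourier \<mu> \<nu> \<xi>)) \<le> sqrt C"
    using assms(3) by (auto simp: nonneg_bounded_symbol_def)
qed

text \<open>Room for an integer \<open>N\<close> with \<open>s + D < N \<le> s + P\<close>: energy
  estimates work with integer orders, and interpolation needs \<open>N\<close> strictly above
  \<open>s + D\<close>. The bound follows from \<open>D / (D - 3) \<ge> 1\<close> after discarding
  the cross term of the square.\<close>

lemma exponent_bound:
  fixes D P :: real
  assumes D: "D > 3" and P: "P > 3 + D / (D - 3) * (sqrt 3 + sqrt (2 * D))\<^sup>2"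
  shows "D + 2 \<le> P"
proof -
  have "(sqrt 3)\<^sup>2 + (sqrt (2 * D))\<^sup>2 \<le> (sqrt 3 + sqrt (2 * D))\<^sup>2"
    using D by (simp add: power2_sum)
  then have 1: "D \<le> (sqrt 3 + sqrt (2 * D))\<^sup>2" using D by simp
  have "1 * (sqrt 3 + sqrt (2 * D))\<^sup>2 \<le> D / (D - 3) * (sqrt 3 + sqrt (2 * D))\<^sup>2"
    using D by (intro mult_right_mono) auto
  then show ?thesis using 1 P by linarith
qed

theorem theorem5p1:
  fixes s\<^sub>0 s D P C E :: real and p :: nat
    and \<mu> \<nu> :: "real measure"
    and U0 :: "real \<Rightarrow> state"
  assumes s0: "s\<^sub>0 > 1 / 2"
    and p: "p \<ge> 1"
    and beta: "finite_borel_measure \<mu>" "finite_borel_measure \<nu>"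
      "nonneg_bounded_symbol (kernel_fourier \<mu> \<nu>) C"
    and D: "D > 3"
    and P: "P > 3 + D / (D - 3) * (sqrt 3 + sqrt (2 * D))\<^sup>2"
    and s: "s \<ge> s\<^sub>0 + 3"
    and E: "E > 0"
    and U0: "bounded_data_family (s + P) E U0"
  shows "\<exists>\<epsilon>\<^sub>0>0. \<epsilon>\<^sub>0 \<le> E \<and> (\<exists>T>0. \<exists>U.
      solution_family (kernel_fourier \<mu> \<nu>) p (s + D) U0 \<epsilon>\<^sub>0 T U \<and>
      (\<forall>U'. solution_family (kernel_fourier \<mu> \<nu>) p (s + D) U0 \<epsilon>\<^sub>0 T U' \<longrightarrow>
         (\<forall>\<epsilon>\<in>{0<..<\<epsilon>\<^sub>0}. \<forall>t\<in>{0..T / \<epsilon> ^ p}. state_eq (U' \<epsilon> t) (U \<epsilon> t))))"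
proof -
  let ?b = "kernel_fourier \<mu> \<nu>"
  interpret symbol "\<lambda>\<xi>. sqrt (Re (?b \<xi>))" "sqrt C" by (rule symbol_sqrt_kernel[OF beta])
  obtain k where k: "p = Suc k" using p by (cases p) auto
  define \<sigma> where "\<sigma> = s + D"
  have \<sigma>: "2 \<le> \<sigma>" using s0 s D by (simp add: \<sigma>_def)
  \<comment> \<open>Strictly above \<sigma> and at most \<open>\<sigma> + 2\<close>, hence covered
    by the regularity of the data.\<close>
  define N where "N = nat \<lceil>\<sigma>\<rceil> + 1"
  have N: "3 \<le> N" "\<sigma> < real N" "real N \<le> s + P"
    using \<sigma> exponent_bound[OF D P] unfolding N_def \<sigma>_def by linarith+
  obtain M0 where M0: "\<And>\<epsilon>. \<epsilon> \<in> {0<..<E} \<Longrightarrow> U0 \<epsilon> \<in> X_space (s + P)" "\<And>\<epsilon>. \<epsilon> \<in> {0<..<E} \<Longrightarrow> X_norm (s + P) (U0 \<epsilon>) \<le> M0"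
    using U0 unfolding bounded_data_family_def by blast
  have P1: "1 \<le> s + P" using N by linarith
  have data: "HN N (cr (fst (U0 \<epsilon>))) M0" "HN N (cr (snd (U0 \<epsilon>))) M0"
    "AE x in lborel. fst (U0 \<epsilon>) x = val (cr (fst (U0 \<epsilon>))) x" "AE x in lborel. snd (U0 \<epsilon>) x = val (cr (snd (U0 \<epsilon>))) x"
    if \<epsilon>: "\<epsilon> \<in> {0<..<E}" for \<epsilon>
  proof -
    have mem: "fst (U0 \<epsilon>) \<in> sobolev (s + P)" "snd (U0 \<epsilon>) \<in> sobolev (s + P)"
      using M0(1)[OF \<epsilon>] by (auto simp: X_space_def mem_Times_iff)
    note u = cr[OF mem(1) P1] and v = cr[OF mem(2) P1]
    have "sobolev_norm (s + P) (fst (U0 \<epsilon>)) \<le> M0" "sobolev_norm (s + P) (snd (U0 \<epsilon>)) \<le> M0"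
      using M0(2)[OF \<epsilon>] sobolev_norm_nonneg[of "s + P" "fst (U0 \<epsilon>)"] sobolev_norm_nonneg[of "s + P" "snd (U0 \<epsilon>)"]
      unfolding X_norm_def by linarith+
    then show "HN N (cr (fst (U0 \<epsilon>))) M0" "HN N (cr (snd (U0 \<epsilon>))) M0"
      using HN_mono[OF sobolev_HN[OF u(3) N(3)]] HN_mono[OF sobolev_HN[OF v(3) N(3)]] u(4) v(4) by simp_all
    show "AE x in lborel. fst (U0 \<epsilon>) x = val (cr (fst (U0 \<epsilon>))) x" "AE x in lborel. snd (U0 \<epsilon>) x = val (cr (snd (U0 \<epsilon>))) x"
      by (rule u(2) v(2))+
  qed
  \<comment> \<open>\<open>size_P_le\<close> bounds the initial size by
    \<open>X0 = 4 * M0\<^sup>2\<close>, and the truncated problem asks for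
    \<open>R\<^sup>2 = 3 * X0 + 2\<close>.\<close>
  define R where "R = sqrt (3 * (4 * M0\<^sup>2) + 2)"
  have R: "R\<^sup>2 = 3 * (4 * M0\<^sup>2) + 2" "0 \<le> R" by (simp_all add: R_def add_nonneg_nonneg)
  define S where "S = sup_const R"
  have S: "0 \<le> S" using R(2) \<kappa>_nonneg by (simp add: S_def sup_const_def)
  define G where "G = growth_const N k R"
  have G: "0 \<le> G" unfolding G_def by (rule growth_const_nonneg[OF R(2)])
  \<comment> \<open>The summand 1 keeps the denominator positive; \<open>2 * G * T \<le> 1\<close>
    limits the energy growth over \<open>{0..T / \<epsilon> ^ p}\<close>. \<open>T\<close> depends
    on the bound of the data but not on \<epsilon>.\<close>
  define T where "T = 1 / (2 * G + 1)"
  have T: "0 < T" "2 * G * T \<le> 1" using G by (simp_all add: T_def)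
  \<comment> \<open>\<open>S + 1\<close> in place of \<open>S\<close> lets the same threshold serve
    existence and the comparison with a competitor at distance at most 1.\<close>
  define Z where "Z = real (k + 2) * (S + 1) ^ (k + 1)"
  have Z: "0 < Z" using S by (simp add: Z_def)
  \<comment> \<open>\<open>\<epsilon> \<le> 1\<close> gives
    \<open>\<epsilon> ^ p \<le> \<epsilon>\<close>, so \<open>\<epsilon> \<le> 1 / (2 * Z)\<close>
    ensures \<open>\<epsilon> ^ p * Z \<le> 1 / 2\<close>.\<close>
  define \<epsilon>\<^sub>0 where "\<epsilon>\<^sub>0 = min E (min 1 (1 / (2 * Z)))"
  have \<epsilon>\<^sub>0: "0 < \<epsilon>\<^sub>0" "\<epsilon>\<^sub>0 \<le> E" using E Z by (auto simp: \<epsilon>\<^sub>0_def)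
  have small: "\<epsilon> ^ Suc k * Z \<le> 1 / 2" if \<epsilon>: "\<epsilon> \<in> {0<..<\<epsilon>\<^sub>0}" for \<epsilon>
  proof -
    have "\<epsilon> ^ Suc k \<le> \<epsilon> ^ 1" using \<epsilon> by (intro power_decreasing) (auto simp: \<epsilon>\<^sub>0_def)
    also have "\<epsilon> ^ 1 \<le> 1 / (2 * Z)" using \<epsilon> by (auto simp: \<epsilon>\<^sub>0_def)
    finally show ?thesis using Z by (simp add: field_simps)
  qed
  obtain L where L: "0 \<le> L" "\<And>\<xi>. (1 + \<xi>\<^sup>2) powr (\<sigma> / 2) \<le> L + 1 * \<bar>\<xi>\<bar> ^ N"
    by (rule interpolation_weight[of \<sigma> N 1]) (use \<sigma> N in auto)
  define Y where "Y = 2 * (3 * L * (3 * R) + 1 * (3 * R))"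
  \<comment> \<open>Gathers all properties of one solution, so that a single choice over \<epsilon>
    produces the family, with the bound \<open>Y\<close> common to all \<epsilon>.\<close>
  define Q where "Q \<epsilon> V \<longleftrightarrow> (\<forall>t\<in>{0..T / \<epsilon> ^ p}. \<forall>x. \<bar>val (cr (fst (V t))) x\<bar> \<le> S) \<and> X_continuous_on \<sigma> {0..T / \<epsilon> ^ p} V \<and>
      (\<forall>t\<in>{0..T / \<epsilon> ^ p}. X_norm \<sigma> (V t) \<le> Y) \<and> solves_system ?b p \<epsilon> \<sigma> {0..T / \<epsilon> ^ p} V \<and> state_eq (V 0) (U0 \<epsilon>)" for \<epsilon> V
  have "\<exists>V. Q \<epsilon> V"
    if \<epsilon>: "\<epsilon> \<in> {0<..<\<epsilon>\<^sub>0}" for \<epsilon>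
  proof -
    have \<epsilon>E: "\<epsilon> \<in> {0<..<E}" and \<epsilon>0: "0 < \<epsilon>" using \<epsilon> \<epsilon>\<^sub>0(2) by auto
    note d = data[OF \<epsilon>E]
    have "real (k + 2) * sup_const R ^ (k + 1) \<le> Z"
      unfolding Z_def S_def[symmetric] using S by (intro mult_left_mono power_mono) auto
    then have "\<epsilon> ^ Suc k * (real (k + 2) * sup_const R ^ (k + 1)) \<le> \<epsilon> ^ Suc k * Z"
      using \<epsilon>0 by (intro mult_left_mono) auto
    then have sm: "\<epsilon> ^ Suc k * (real (k + 2) * sup_const R ^ (k + 1)) \<le> 1 / 2" using small[OF \<epsilon>] by linarith
    obtain u v where uv: "u 0 = cr (fst (U0 \<epsilon>))" "v 0 = cr (snd (U0 \<epsilon>))"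
      "\<And>t x. t \<in> {0..T / \<epsilon> ^ Suc k} \<Longrightarrow> \<bar>val (u t) x\<bar> \<le> sup_const R"
      "X_continuous_on \<sigma> {0..T / \<epsilon> ^ Suc k} (\<lambda>t. (val (u t), val (v t)))"
      "\<And>t. t \<in> {0..T / \<epsilon> ^ Suc k} \<Longrightarrow> X_norm \<sigma> (val (u t), val (v t)) \<le> 2 * (3 * L * (3 * R) + 1 * (3 * R))"
      "solves_system ?b (Suc k) \<epsilon> \<sigma> {0..T / \<epsilon> ^ Suc k} (\<lambda>t. (val (u t), val (v t)))"
      by (rule existence[OF refl N(1) d(1,2) R \<epsilon>0 sm less_imp_le[OF T(1)] T(2)[unfolded G_def] \<sigma> N(2) L(1) zero_le_one L(2)]) blast
    have cru: "cr (val (u t)) = u t" if "t \<in> {0..T / \<epsilon> ^ Suc k}" for t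
      by (rule cr_val[of _ \<sigma>]) (use uv(4) that \<sigma> in \<open>auto simp: X_continuous_on_def X_space_def\<close>)
    have "state_eq (val (u 0), val (v 0)) (U0 \<epsilon>)"
      unfolding state_eq_def uv(1,2) using d(3,4) by eventually_elim simp
    moreover have "\<bar>val (cr (val (u t))) x\<bar> \<le> S" if "t \<in> {0..T / \<epsilon> ^ Suc k}" for t x
      unfolding S_def cru[OF that] by (rule uv(3)[OF that])
    ultimately have "Q \<epsilon> (\<lambda>t. (val (u t), val (v t)))"
      unfolding Q_def k fst_conv Y_def using uv(4-6) by blast
    then show ?thesis by (rule exI[of "Q \<epsilon>"])
  qed
  then have "\<forall>\<epsilon>\<in>{0<..<\<epsilon>\<^sub>0}. \<exists>V. Q \<epsilon> V" by (rule ballI)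
  from bchoice[OF this] obtain U where UU: "\<And>\<epsilon>. \<epsilon> \<in> {0<..<\<epsilon>\<^sub>0} \<Longrightarrow> Q \<epsilon> (U \<epsilon>)" by blast
  note UU = UU[unfolded Q_def]
  note U = UU[THEN conjunct1, rule_format] UU[THEN conjunct2, THEN conjunct1]
    UU[THEN conjunct2, THEN conjunct2, THEN conjunct1, rule_format]
    UU[THEN conjunct2, THEN conjunct2, THEN conjunct2, THEN conjunct1]
    UU[THEN conjunct2, THEN conjunct2, THEN conjunct2, THEN conjunct2]
  have sol: "solution_family ?b p \<sigma> U0 \<epsilon>\<^sub>0 T U"
    unfolding solution_family_def bounded_curve_family_def
    by (intro conjI ballI exI[of _ Y] U)
  \<comment> \<open>A competing family brings its own bound \<open>Y'\<close>; since
    \<open>uniqueness\<close> takes one bound for both solutions, the maximum with \<open>Y\<close>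
    is used.\<close>
  have "state_eq (U' \<epsilon> t) (U \<epsilon> t)"
    if sol': "solution_family ?b p \<sigma> U0 \<epsilon>\<^sub>0 T U'" and \<epsilon>: "\<epsilon> \<in> {0<..<\<epsilon>\<^sub>0}" and t: "t \<in> {0..T / \<epsilon> ^ p}" for U' \<epsilon> t
  proof -
    obtain Y' where Y': "\<And>t. t \<in> {0..T / \<epsilon> ^ p} \<Longrightarrow> X_norm \<sigma> (U' \<epsilon> t) \<le> Y'"
      using sol' \<epsilon> unfolding solution_family_def bounded_curve_family_def by blast
    have cont': "X_continuous_on \<sigma> {0..T / \<epsilon> ^ p} (U' \<epsilon>)" and sys': "solves_system ?b p \<epsilon> \<sigma> {0..T / \<epsilon> ^ p} (U' \<epsilon>)"
      and init': "state_eq (U' \<epsilon> 0) (U0 \<epsilon>)"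
      using sol' \<epsilon> unfolding solution_family_def bounded_curve_family_def by blast+
    have init: "state_eq (U' \<epsilon> 0) (U \<epsilon> 0)"
      using init' U(5)[OF \<epsilon>] unfolding state_eq_def by eventually_elim simp
    have \<epsilon>0: "0 < \<epsilon>" using \<epsilon> by simp
    show ?thesis
    proof (rule uniqueness[OF refl \<sigma> \<epsilon>0 _ small[OF \<epsilon>, unfolded Z_def], of "T / \<epsilon> ^ p" "U \<epsilon>" "max Y Y'" "U' \<epsilon>" t])
      show "0 \<le> T / \<epsilon> ^ p" using T \<epsilon>0 by simp
      show "solves_system ?b (Suc k) \<epsilon> \<sigma> {0..T / \<epsilon> ^ p} (U \<epsilon>)" "solves_system ?b (Suc k) \<epsilon> \<sigma> {0..T / \<epsilon> ^ p} (U' \<epsilon>)"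
        using U(4)[OF \<epsilon>] sys' unfolding k .
      show "U \<epsilon> t \<in> X_space \<sigma>" "U' \<epsilon> t \<in> X_space \<sigma>" if "t \<in> {0..T / \<epsilon> ^ p}" for t
        using U(2)[OF \<epsilon>] cont' that unfolding X_continuous_on_def by blast+
      show "X_norm \<sigma> (U \<epsilon> t) \<le> max Y Y'" "X_norm \<sigma> (U' \<epsilon> t) \<le> max Y Y'" if "t \<in> {0..T / \<epsilon> ^ p}" for t
        using U(3)[OF \<epsilon> that] Y'[OF that] by auto
    qed (use U(1)[OF \<epsilon>] init t in auto)
  qed
  then show ?thesis using \<epsilon>\<^sub>0 T(1) sol unfolding \<sigma>_def by blast
qed

end
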